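(* Let $K$ be a field of characteristic zero, $n\ge1$, and $\mathcal O=\mathcal O_1\times\cdots\times\mathcal O_n\in K^n/\mathbb Z^n$ an orbit. Then $$\mathrm{GW}(\mathbb I_n,\mathcal O)=\bigoplus_{\mathcal D_{\mathcal O}\subseteq\mathbb D_{\mathcal O}}\mathrm{GW}(\mathbb I_n,\mathcal D_{\mathcal O}),$$ where the sum is over all subsets $\mathcal D_{\mathcal O}$ of $\mathbb D_{\mathcal O}=\{i:\mathcal O_i=\mathbb Z\}$.
   Context: $\otimes=\otimes_K$. $P_n=K[x_1,\dots,x_n]$. $\mathbb I_n$ is the $K$-subalgebra of $\mathrm{End}_K(P_n)$ generated by the multiplications by $x_i$, the partial derivatives $\partial_i$, and the integrations $\int_i$ ($K$-linear, $x^\alpha\mapsto x_ix^\alpha/(\alpha_i+1)$), $i=1,\dots,n$; $\mathbb I_n=\mathbb I_1(1)\otimes\cdots\otimes\mathbb I_1(n)$ with $\mathbb I_1(i)=K\langle x_i,\partial_i,\int_i\rangle\simeq\mathbb I_1$. $H_i=\partial_ix_i$ and $D_n=K[H_1,\dots,H_n]\subset\mathbb I_n$ is a polynomial algebra. For $\lambda\in K^n$, $\mathfrak m_\lambda=(H_1-\lambda_1,\dots,H_n-\lambda_n)\subset D_n$. For a left $\mathbb I_n$-module $M$, $M^\lambda=\{v:\mathfrak m_\lambda^iv=0\text{ for some }i\}$; $M$ is generalized weight if $M=\bigoplus_{\lambda\in K^n}M^\lambda$, and $\mathrm{Supp}(M)=\{\lambda:M^\lambda\neq0\}$. $\mathbb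 Z^n$ acts on $K^n$ by translations; an orbit $\mathcal O=\lambda+\mathbb Z^n$ is a product $\mathcal O_1\times\cdots\times\mathcal O_n$ with $\mathcal O_i\in K/\mathbb Z$. $\mathrm{GW}(\mathbb I_n,\mathcal O)$ is the full subcategory of $\mathbb I_n$-modules that are generalized weight with $\mathrm{Supp}(M)\subseteq\mathcal O$. $\mathbb I_1$ (with $x,\partial,\int,H$) has a unique proper nonzero ideal $F$, spanned by $\int^s\partial^t-\int^{s+1}\partial^{t+1}$ ($s,t\geq0$); $B_1=\mathbb I_1/F$ is the skew Laurent polynomial algebra $K[H][\partial^{\pm1}]$ with $\partial H=(H+1)\partial$, $\int\mapsto\partial^{-1}$. For $\lambda\in K$, $M(1,\lambda)=B_1/B_1(H-\lambda)$, an $\mathbb I_1$-module. Choose $\lambda_{\mathcal O_i}\in\mathcal O_i$ (with $\lambda_{\mathbb Z}=0$). For a subset $\mathcal D_{\mathcal O}\subseteq\mathbb D_{\mathcal O}$ let $M(\mathcal D_{\mathcal O})=\bigotimes_{i=1}^nM_i$ with $M_i=K[x_i]$ (the natural $\mathbb I_1(i)$-module) if $i\in\mathcal D_{\mathcal O}$ and $M_i=M(1,\lambda_{\mathcal O_i})$ otherwise; it is a simple weight $\mathbb I_n$-module. $\mathrm{GW}(\mathbb I_n,\mathcal D_{\mathcal O})$ is the full subcategory of $\mathrm{GW}(\mathbb I_n,\mathcal O)$ generated by $M(\mathcal D_{\mathcal O})$, i.e. consisting of the modules all of whose simple subquotients are isomorphic to $M(\mathcal D_{\mathcal O})$. A category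 of modules is a direct sum of full subcategories $\mathcal C_j$ if each of its objects is a direct sum of submodules $M_j\in\mathcal C_j$ and $\mathrm{Hom}(X,Y)=0$ for $X\in\mathcal C_j$, $Y\in\mathcal C_k$, $j\ne k$. *)

theory Defs
  imports "HOL-Algebra.Algebra" "HOL-Library.Poly_Mapping"
begin

section \<open>Left modules over a not necessarily commutative ring\<close>

text \<open>
  The locale for modules in HOL-Algebra asks for a commutative ring of scalars; its record of
  modules and its notion of submodule do not, and are reused. The multiplicative fields of the
  module record play no role.
\<close>

locale left_module = R?: ring R + M?: abelian_group M
  for R :: "('a, 'r) ring_scheme" (structure) and M :: "('a, 'm, 's) module_scheme" (structure) +
  assumes smult_closed:
      "\<lbrakk>a \<in> carrier R; v \<in> carrier M\<rbrakk> \<Longrightarrow> a \<odot>\<^bsub>M\<^esub> v \<in> carrier M"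
    and smult_l_distr:
      "\<lbrakk>a \<in> carrier R; b \<in> carrier R; v \<in> carrier M\<rbrakk> \<Longrightarrow>
        (a \<oplus>\<^bsub>R\<^esub> b) \<odot>\<^bsub>M\<^esub> v = a \<odot>\<^bsub>M\<^esub> v \<oplus>\<^bsub>M\<^esub> b \<odot>\<^bsub>M\<^esub> v"
    and smult_r_distr:
      "\<lbrakk>a \<in> carrier R; v \<in> carrier M; w \<in> carrier M\<rbrakk> \<Longrightarrow>
        a \<odot>\<^bsub>M\<^esub> (v \<oplus>\<^bsub>M\<^esub> w) = a \<odot>\<^bsub>M\<^esub> v \<oplus>\<^bsub>M\<^esub> a \<odot>\<^bsub>M\<^esub> w"
    and smult_assoc:
      "\<lbrakk>a \<in> carrier R; b \<in> carrier R; v \<in> carrier M\<rbrakk> \<Longrightarrow>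
        (a \<otimes>\<^bsub>R\<^esub> b) \<odot>\<^bsub>M\<^esub> v = a \<odot>\<^bsub>M\<^esub> (b \<odot>\<^bsub>M\<^esub> v)"
    and smult_one:
      "v \<in> carrier M \<Longrightarrow> \<one>\<^bsub>R\<^esub> \<odot>\<^bsub>M\<^esub> v = v"

definition module_hom_set ::
    "('a, 'r) ring_scheme \<Rightarrow> ('a, 'm) module \<Rightarrow> ('a, 'l) module \<Rightarrow> ('m \<Rightarrow> 'l) set"
  where "module_hom_set R M N =
    {f. f \<in> carrier M \<rightarrow> carrier N \<and>
        (\<forall>v\<in>carrier M. \<forall>w\<in>carrier M. f (v \<oplus>\<^bsub>M\<^esub> w) = f v \<oplus>\<^bsub>N\<^esub> f w) \<and>
        (\<forall>a\<in>carrier R. \<forall>v\<in>carrier M. f (a \<odot>\<^bsub>M\<^esub> v) = a \<odot>\<^bsub>N\<^esub> f v)}"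

definition module_isomorphic ::
    "('a, 'r) ring_scheme \<Rightarrow> ('a, 'm) module \<Rightarrow> ('a, 'l) module \<Rightarrow> bool"
  where "module_isomorphic R M N \<longleftrightarrow>
    (\<exists>f\<in>module_hom_set R M N. bij_betw f (carrier M) (carrier N))"

definition quotient_module :: "('a, 'm) module \<Rightarrow> 'm set \<Rightarrow> ('a, 'm set) module"
  where "quotient_module M N =
    \<lparr>carrier = a_rcosets\<^bsub>M\<^esub> N, monoid.mult = undefined, monoid.one = undefined, ring.zero = N, ring.add = set_add M,
     smult = (\<lambda>a C. \<Union>v\<in>C. N +>\<^bsub>M\<^esub> (a \<odot>\<^bsub>M\<^esub> v))\<rparr>"

definition simple_left_module :: "('a, 'r) ring_scheme \<Rightarrow> ('a, 'm) module \<Rightarrow> bool"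
  where "simple_left_module R M \<longleftrightarrow>
    left_module R M \<and> carrier M \<noteq> {\<zero>\<^bsub>M\<^esub>} \<and>
    (\<forall>N. submodule N R M \<longrightarrow> N = {\<zero>\<^bsub>M\<^esub>} \<or> N = carrier M)"

text \<open>Internal direct sum of a possibly infinite family of additive subgroups.\<close>

definition internal_direct_sum :: "('a, 'm) module \<Rightarrow> 'i set \<Rightarrow> ('i \<Rightarrow> 'm set) \<Rightarrow> bool"
  where "internal_direct_sum M I A \<longleftrightarrow>
    (\<forall>i\<in>I. subgroup (A i) (add_monoid M)) \<and>
    (\<forall>v\<in>carrier M. \<exists>!f. f \<in> (\<Pi>\<^sub>E i\<in>I. A i) \<and> finite {i\<in>I. f i \<noteq> \<zero>\<^bsub>M\<^esub>} \<and>
       v = finsum M f {i\<in>I. f i \<noteq> \<zero>\<^bsub>M\<^esub>})"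

text \<open>
  Full subcategories of the category of left \<open>R\<close>-modules are given by the predicate singling out
  their objects. All objects have carriers in one type \<open>'m\<close>, which is arbitrary.
\<close>

definition direct_sum_of_subcategories ::
    "('a, 'r) ring_scheme \<Rightarrow> (('a, 'm) module \<Rightarrow> bool) \<Rightarrow> 'j set \<Rightarrow>
     ('j \<Rightarrow> ('a, 'm) module \<Rightarrow> bool) \<Rightarrow> bool"
  where "direct_sum_of_subcategories R C J Cs \<longleftrightarrow>
    (\<forall>j\<in>J. \<forall>M. Cs j M \<longrightarrow> C M) \<and>
    (\<forall>M. C M \<longrightarrow>
       (\<exists>N. (\<forall>j\<in>J. submodule (N j) R M \<and> Cs j (M\<lparr>carrier := N j\<rparr>)) \<and>
            internal_direct_sum M J N)) \<and>
    (\<forall>j\<in>J. \<forall>k\<in>J. j \<noteq> k \<longrightarrow>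
       (\<forall>M N. Cs j M \<longrightarrow> Cs k N \<longrightarrow>
          (\<forall>f\<in>module_hom_set R M N. \<forall>v\<in>carrier M. f v = \<zero>\<^bsub>N\<^esub>)))"

section \<open>Polynomials and the algebras of integro-differential operators\<close>

text \<open>
  The variables are indexed by a finite type \<open>'n\<close>, so that \<open>n = CARD('n)\<close>, and the monomial
  \<open>x\<^sup>\<alpha>\<close> is \<^term>\<open>Poly_Mapping.single \<alpha> 1\<close>.
\<close>

type_synonym ('n, 'k) pol = "('n \<Rightarrow>\<^sub>0 nat) \<Rightarrow>\<^sub>0 'k"
type_synonym ('n, 'k) opr = "('n, 'k) pol \<Rightarrow> ('n, 'k) pol"

definition scl :: "'k::field_char_0 \<Rightarrow> ('b \<Rightarrow>\<^sub>0 'k) \<Rightarrow> ('b \<Rightarrow>\<^sub>0 'k)"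
  where "scl c p = Poly_Mapping.map ((*) c) p"

definition End_P :: "('n, 'k::field_char_0) opr ring"
  where "End_P =
    \<lparr>carrier = {f. Vector_Spaces.linear scl scl f}, monoid.mult = (\<circ>), monoid.one = id,
     ring.zero = (\<lambda>p. 0), ring.add = (\<lambda>f g p. f p + g p)\<rparr>"

definition linear_extension ::
    "(('n \<Rightarrow>\<^sub>0 nat) \<Rightarrow> ('n, 'k::field_char_0) pol) \<Rightarrow> ('n, 'k) opr"
  where "linear_extension g p =
    (\<Sum>\<alpha>\<in>Poly_Mapping.keys p. scl (Poly_Mapping.lookup p \<alpha>) (g \<alpha>))"

definition mult_x :: "'n \<Rightarrow> ('n, 'k::field_char_0) opr"
  where "mult_x i p = Poly_Mapping.single (Poly_Mapping.single i 1) 1 * p"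

text \<open>For \<open>\<alpha>\<^sub>i = 0\<close> the subtraction of exponents is truncated, but the coefficient vanishes.\<close>

definition partial_x :: "'n \<Rightarrow> ('n, 'k::field_char_0) opr"
  where "partial_x i = linear_extension
    (\<lambda>\<alpha>. Poly_Mapping.single (\<alpha> - Poly_Mapping.single i 1) (of_nat (Poly_Mapping.lookup \<alpha> i)))"

definition int_x :: "'n \<Rightarrow> ('n, 'k::field_char_0) opr"
  where "int_x i = linear_extension
    (\<lambda>\<alpha>. Poly_Mapping.single (\<alpha> + Poly_Mapping.single i 1)
            (1 / (of_nat (Poly_Mapping.lookup \<alpha> i) + 1)))"

definition H_op :: "'n \<Rightarrow> ('n, 'k::field_char_0) opr"
  where "H_op i = partial_x i \<circ> mult_x i"

text \<open>
  The \<open>K\<close>-subalgebra generated by \<open>S\<close> is the subring generated by \<open>S\<close> and the scalar operators.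
\<close>

definition subalgebra_generated :: "('n, 'k::field_char_0) opr set \<Rightarrow> ('n, 'k) opr ring"
  where "subalgebra_generated S = End_P\<lparr>carrier := generate_ring End_P (Set.range scl \<union> S)\<rparr>"

definition I_n :: "('n::finite, 'k::field_char_0) opr ring"
  where "I_n = subalgebra_generated (\<Union>i. {mult_x i, partial_x i, int_x i})"

definition I_1 :: "'n \<Rightarrow> ('n::finite, 'k::field_char_0) opr ring"
  where "I_1 i = subalgebra_generated {mult_x i, partial_x i, int_x i}"

definition D_n :: "('n::finite, 'k::field_char_0) opr ring"
  where "D_n = subalgebra_generated (Set.range H_op)"

section \<open>Generalized weight modules\<close>

definition max_ideal :: "('n \<Rightarrow> 'k) \<Rightarrow> ('n::finite, 'k::field_char_0) opr set"
  where "max_ideal \<nu> = Idl\<^bsub>D_n\<^esub> (Set.range (\<lambda>i p. H_op i p - scl (\<nu> i) p))"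

definition max_ideal_power :: "('n \<Rightarrow> 'k) \<Rightarrow> nat \<Rightarrow> ('n::finite, 'k::field_char_0) opr set"
  where "max_ideal_power \<nu> k = (ideal_prod D_n (max_ideal \<nu>) ^^ k) (carrier D_n)"

definition weight_space ::
    "(('n::finite, 'k::field_char_0) opr, 'm) module \<Rightarrow> ('n \<Rightarrow> 'k) \<Rightarrow> 'm set"
  where "weight_space M \<nu> =
    {v \<in> carrier M. \<exists>k. \<forall>a\<in>max_ideal_power \<nu> k. a \<odot>\<^bsub>M\<^esub> v = \<zero>\<^bsub>M\<^esub>}"

definition generalized_weight :: "(('n::finite, 'k::field_char_0) opr, 'm) module \<Rightarrow> bool"
  where "generalized_weight M \<longleftrightarrow> internal_direct_sum M UNIV (weight_space M)"

definition Supp :: "(('n::finite, 'k::field_char_0) opr, 'm) module \<Rightarrow> ('n \<Rightarrow> 'k) set"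
  where "Supp M = {\<nu>. weight_space M \<nu> \<noteq> {\<zero>\<^bsub>M\<^esub>}}"

definition translation_orbits :: "('n::finite \<Rightarrow> 'k::field_char_0) set set"
  where "translation_orbits = {{\<mu>. \<exists>z :: 'n \<Rightarrow> int. \<forall>i. \<mu> i = \<nu> i + of_int (z i)} |\<nu>. True}"

definition orbit_component :: "('n \<Rightarrow> 'k) set \<Rightarrow> 'n \<Rightarrow> 'k set"
  where "orbit_component \<O> i = (\<lambda>\<mu>. \<mu> i) ` \<O>"

definition integral_indices :: "('n \<Rightarrow> 'k::field_char_0) set \<Rightarrow> 'n set"
  where "integral_indices \<O> = {i. orbit_component \<O> i = \<int>}"

definition GW ::
    "('n \<Rightarrow> 'k) set \<Rightarrow> (('n::finite, 'k::field_char_0) opr, 'm) module \<Rightarrow> bool"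
  where "GW \<O> M \<longleftrightarrow> left_module I_n M \<and> generalized_weight M \<and> Supp M \<subseteq> \<O>"

section \<open>The tensor factors\<close>

definition e_op :: "'n \<Rightarrow> nat \<Rightarrow> nat \<Rightarrow> ('n, 'k::field_char_0) opr"
  where "e_op i s t p =
    (int_x i ^^ s) ((partial_x i ^^ t) p) - (int_x i ^^ Suc s) ((partial_x i ^^ Suc t) p)"

definition F_ideal :: "'n \<Rightarrow> ('n, 'k::field_char_0) opr set"
  where "F_ideal i =
    {(\<lambda>p. \<Sum>(s, t)\<in>S. scl (c s t) (e_op i s t p)) |S c. finite S}"

definition B_1 :: "'n \<Rightarrow> ('n::finite, 'k::field_char_0) opr set ring"
  where "B_1 i = I_1 i Quot F_ideal i"

definition B_1_module :: "'n \<Rightarrow> (('n::finite, 'k::field_char_0) opr, ('n, 'k) opr set) module"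
  where "B_1_module i =
    \<lparr>carrier = carrier (B_1 i), monoid.mult = monoid.mult (B_1 i), monoid.one = monoid.one (B_1 i),
     ring.zero = ring.zero (B_1 i), ring.add = ring.add (B_1 i),
     smult = (\<lambda>a b. (F_ideal i +>\<^bsub>I_1 i\<^esub> a) \<otimes>\<^bsub>B_1 i\<^esub> b)\<rparr>"

text \<open>\<open>M(1,c) = B\<^sub>1 / B\<^sub>1(H - c)\<close> for the \<open>i\<close>-th copy of \<open>B\<^sub>1\<close>.\<close>

definition M_1 ::
    "'n \<Rightarrow> 'k \<Rightarrow> (('n::finite, 'k::field_char_0) opr, ('n, 'k) opr set set) module"
  where "M_1 i c = quotient_module (B_1_module i)
    {b \<otimes>\<^bsub>B_1 i\<^esub> (F_ideal i +>\<^bsub>I_1 i\<^esub> (\<lambda>p. H_op i p - scl c p)) |b. b \<in> carrier (B_1 i)}"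

definition K_x :: "'n \<Rightarrow> (('n::finite, 'k::field_char_0) opr, ('n, 'k) pol) module"
  where "K_x i =
    \<lparr>carrier = {p. \<forall>\<alpha>\<in>Poly_Mapping.keys p. Poly_Mapping.keys \<alpha> \<subseteq> {i}},
     monoid.mult = (*), monoid.one = 1, ring.zero = 0, ring.add = (+), smult = (\<lambda>a p. a p)\<rparr>"

text \<open>
  The factors of the tensor product live in different types, so they are first copied into a
  sum type; \<open>f\<close> is meant to be injective.
\<close>

definition module_copy :: "('m \<Rightarrow> 'l) \<Rightarrow> ('a, 'm) module \<Rightarrow> ('a, 'l) module"
  where "module_copy f M =
    \<lparr>carrier = f ` carrier M, monoid.mult = undefined, monoid.one = undefined, ring.zero = f \<zero>\<^bsub>M\<^esub>,
     ring.add = (\<lambda>u v. f (inv_into UNIV f u \<oplus>\<^bsub>M\<^esub> inv_into UNIV f v)),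
     smult = (\<lambda>a u. f (a \<odot>\<^bsub>M\<^esub> inv_into UNIV f u))\<rparr>"

definition tensor_factor ::
    "('k set \<Rightarrow> 'k) \<Rightarrow> ('n \<Rightarrow> 'k) set \<Rightarrow> 'n set \<Rightarrow> 'n \<Rightarrow>
     (('n::finite, 'k::field_char_0) opr, ('n, 'k) pol + ('n, 'k) opr set set) module"
  where "tensor_factor rep \<O> \<D> i =
    (if i \<in> \<D> then module_copy Inl (K_x i)
     else module_copy Inr (M_1 i (rep (orbit_component \<O> i))))"

section \<open>Tensor products\<close>

text \<open>
  The tensor product over \<open>K\<close> of a family of vector spaces indexed by \<open>'n\<close>: the vector space
  freely generated by the families of elements, modulo the multilinearity relations. On each
  factor, \<open>c \<in> K\<close> acts through the operator \<^term>\<open>scl c\<close>.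
\<close>

definition families :: "('n \<Rightarrow> ('a, 'm) module) \<Rightarrow> ('n \<Rightarrow> 'm) set"
  where "families M = {m. \<forall>i. m i \<in> carrier (M i)}"

definition free_space ::
    "('n \<Rightarrow> ('a, 'm) module) \<Rightarrow> ('k::field_char_0, ('n \<Rightarrow> 'm) \<Rightarrow>\<^sub>0 'k) module"
  where "free_space M =
    \<lparr>carrier = {z. Poly_Mapping.keys z \<subseteq> families M}, monoid.mult = undefined, monoid.one = undefined,
     ring.zero = 0, ring.add = (+), smult = scl\<rparr>"

definition multilinearity_relations ::
    "('n \<Rightarrow> (('n, 'k::field_char_0) opr, 'm) module) \<Rightarrow> (('n \<Rightarrow> 'm) \<Rightarrow>\<^sub>0 'k) set"
  where "multilinearity_relations M = Modules.module.span scl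
    ({Poly_Mapping.single (m(i := u \<oplus>\<^bsub>M i\<^esub> v)) 1
        - Poly_Mapping.single (m(i := u)) 1 - Poly_Mapping.single (m(i := v)) 1
      |m i u v. m \<in> families M \<and> u \<in> carrier (M i) \<and> v \<in> carrier (M i)} \<union>
     {Poly_Mapping.single (m(i := scl c \<odot>\<^bsub>M i\<^esub> u)) 1 - scl c (Poly_Mapping.single (m(i := u)) 1)
      |m i c u. m \<in> families M \<and> u \<in> carrier (M i)})"

definition tensor_space ::
    "('n \<Rightarrow> (('n, 'k::field_char_0) opr, 'm) module) \<Rightarrow> ('k, (('n \<Rightarrow> 'm) \<Rightarrow>\<^sub>0 'k) set) module"
  where "tensor_space M = quotient_module (free_space M) (multilinearity_relations M)"

definition pure_tensor ::
    "('n \<Rightarrow> (('n, 'k::field_char_0) opr, 'm) module) \<Rightarrow> ('n \<Rightarrow> 'm) \<Rightarrow> (('n \<Rightarrow> 'm) \<Rightarrow>\<^sub>0 'k) set"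
  where "pure_tensor M m =
    multilinearity_relations M +>\<^bsub>free_space M :: ('k, ('n \<Rightarrow> 'm) \<Rightarrow>\<^sub>0 'k) module\<^esub>
      Poly_Mapping.single m 1"

definition with_action :: "('b, 'm) module \<Rightarrow> ('a \<Rightarrow> 'm \<Rightarrow> 'm) \<Rightarrow> ('a, 'm) module"
  where "with_action T \<rho> =
    \<lparr>carrier = carrier T, monoid.mult = monoid.mult T, monoid.one = monoid.one T,
     ring.zero = ring.zero T, ring.add = ring.add T, smult = \<rho>\<rparr>"

text \<open>
  Given \<open>\<I>\<^sub>1(i)\<close>-modules \<open>M\<^sub>i\<close>, their tensor product is a module over
  \<open>\<I>\<^sub>n = \<I>\<^sub>1(1) \<otimes> \<dots> \<otimes> \<I>\<^sub>1(n)\<close>, with \<open>\<I>\<^sub>1(i)\<close> acting on the \<open>i\<close>-th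
  factor. As the subalgebras \<open>\<I>\<^sub>1(i)\<close> generate \<open>\<I>\<^sub>n\<close>, this determines the action of the
  elements of \<open>\<I>\<^sub>n\<close> on the carrier, so the choice below is only about irrelevant arguments.
\<close>

definition tensor_module ::
    "('n::finite \<Rightarrow> (('n, 'k::field_char_0) opr, 'm) module) \<Rightarrow>
     (('n, 'k) opr, (('n \<Rightarrow> 'm) \<Rightarrow>\<^sub>0 'k) set) module"
  where "tensor_module M = with_action (tensor_space M)
    (SOME \<rho>. left_module I_n (with_action (tensor_space M) \<rho>) \<and>
       (\<forall>i. \<forall>a\<in>carrier (I_1 i). \<forall>m\<in>families M.
          \<rho> a (pure_tensor M m) = pure_tensor M (m(i := a \<odot>\<^bsub>M i\<^esub> m i))))"

text \<open>The function \<open>rep\<close> chooses representatives of the elements of \<open>K/\<int>\<close>.\<close>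

definition M_D ::
    "('k set \<Rightarrow> 'k) \<Rightarrow> ('n \<Rightarrow> 'k) set \<Rightarrow> 'n set \<Rightarrow>
     (('n::finite, 'k::field_char_0) opr,
      (('n \<Rightarrow> ('n, 'k) pol + ('n, 'k) opr set set) \<Rightarrow>\<^sub>0 'k) set) module"
  where "M_D rep \<O> \<D> = tensor_module (tensor_factor rep \<O> \<D>)"

definition GW_D ::
    "('k set \<Rightarrow> 'k) \<Rightarrow> ('n \<Rightarrow> 'k) set \<Rightarrow> 'n set \<Rightarrow>
     (('n::finite, 'k::field_char_0) opr, 'm) module \<Rightarrow> bool"
  where "GW_D rep \<O> \<D> M \<longleftrightarrow> GW \<O> M \<and>
    (\<forall>N L. submodule N I_n M \<longrightarrow> submodule L I_n M \<longrightarrow> L \<subseteq> N \<longrightarrow>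
       simple_left_module I_n (quotient_module (M\<lparr>carrier := N\<rparr>) L) \<longrightarrow>
       module_isomorphic I_n (quotient_module (M\<lparr>carrier := N\<rparr>) L) (M_D rep \<O> \<D>))"

end

theory Submission
  imports Defs "HOL-Computational_Algebra.Polynomial"
begin

text \<open>
  In a generalized weight module every vector \<open>v\<close> satisfies \<open>(1 - \<integral>\<^sub>i \<partial>\<^sub>i) \<partial>\<^sub>i\<^sup>t v = 0\<close> for large \<open>t\<close>, so
  \<open>v = (v - \<integral>\<^sub>i\<^sup>t \<partial>\<^sub>i\<^sup>t v) + \<integral>\<^sub>i\<^sup>t \<partial>\<^sub>i\<^sup>t v\<close> splits the module into the part on which \<open>\<partial>\<^sub>i\<close> is locally nilpotent
  and the part on which \<open>\<partial>\<^sub>i\<close> is invertible with inverse \<open>\<integral>\<^sub>i\<close>. The first part vanishes unless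
  \<open>\<O>\<^sub>i = \<int>\<close>. These splittings are compatible and yield a direct sum over the subsets \<open>D\<close> of indices,
  without homomorphisms between different summands.

  A simple module in which \<open>\<partial>\<^sub>i\<close> is locally nilpotent for \<open>i \<in> D\<close> and invertible for \<open>i \<notin> D\<close> contains a
  vector killed by \<open>\<partial>\<^sub>i\<close> for \<open>i \<in> D\<close> and by \<open>H\<^sub>i - \<lambda>\<^sub>i\<close> for \<open>i \<notin> D\<close>. Hence it is the image of an explicit
  module with basis \<open>{z \<in> \<int>\<^sup>n. z\<^sub>i \<ge> 0 for i \<in> D}\<close>, which is simple and also isomorphic to \<open>M(D)\<close>.

  As \<open>\<I>\<^sub>n\<close> is an algebra of operators on polynomials and not given by relations, it has to be shown that
  it acts on the explicit module. This starts from the polynomials, \<open>D = {1,\<dots>,n}\<close>; indices are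
  removed from \<open>D\<close> one at a time by observing that far out in direction \<open>i\<close>, at distance \<open>t\<close>, the
  operators act by matrices with entries polynomial in \<open>t\<close>, in which \<open>t\<close> may be replaced by any scalar.
\<close>

section \<open>Linear maps on finitely supported functions\<close>

text \<open>The vanishing for large \<open>t\<close> has a numerical reason:
  \<open>\<partial>\<^sub>i\<^sup>t\<close> lowers the eigenvalue of \<open>H\<^sub>i\<close> by
  \<open>t\<close>, while \<open>1 - \<integral>\<^sub>i \<partial>\<^sub>i\<close> sees only the
  eigenvalue 1, so on a vector of weight \<nu> only \<open>t = \<nu>\<^sub>i - 1\<close> can
  survive. The two components of \<open>v\<close> are images of \<open>v\<close> under elements of
  the algebra and so stay in every submodule; hence the splittings for different indices are
  compatible. Membership in a block is defined through all simple subquotients, whereas the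
  splitting gives conditions on single vectors. One direction is the classification of simple
  modules with these conditions; for the other, Zorn's lemma finds a simple subquotient in the
  submodule generated by an offending vector. The lack of relations also affects
  \<open>M(D)\<close>: the action on the tensor product is a chosen one, so its existence is
  transported from the explicit module, and the explicit module shows that \<open>M(1,c)\<close>
  does not collapse. For \<open>i \<in> D\<close> the base eigenvalue is 1 because
  \<open>H\<^sub>i = \<partial>\<^sub>i x\<^sub>i\<close> fixes the constant 1. At distance
  \<open>t\<close> the eigenvalue \<open>1 + z\<^sub>i\<close> becomes
  \<open>1 + z\<^sub>i + t\<close>, and \<open>t = c - 1\<close> turns this into
  \<open>c + z\<^sub>i\<close>.\<close>

lemma lookup_scl [simp]: "Poly_Mapping.lookup (scl c p) a = c * Poly_Mapping.lookup p a"
  by (simp add: scl_def Poly_Mapping.map.rep_eq when_def)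

interpretation scl: vector_space "scl :: 'k::field_char_0 \<Rightarrow> ('b \<Rightarrow>\<^sub>0 'k) \<Rightarrow> ('b \<Rightarrow>\<^sub>0 'k)"
  by standard (auto intro!: poly_mapping_eqI simp: lookup_add algebra_simps)

lemma scl_single [simp]: "scl c (Poly_Mapping.single a b) = Poly_Mapping.single a (c * b)"
  by (auto intro!: poly_mapping_eqI simp: lookup_single when_def)

abbreviation lin :: "(('a \<Rightarrow>\<^sub>0 'k::field_char_0) \<Rightarrow> ('b \<Rightarrow>\<^sub>0 'k)) \<Rightarrow> bool"
  where "lin \<equiv> Vector_Spaces.linear scl scl"

lemma lin_iff: "lin f \<longleftrightarrow> (\<forall>p q. f (p + q) = f p + f q) \<and> (\<forall>c p. f (scl c p) = scl c (f p))"
  by (simp add: Vector_Spaces.linear_iff scl.vector_space_axioms)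

lemma lin_add: "lin f \<Longrightarrow> f (p + q) = f p + f q"
  and lin_scl: "lin f \<Longrightarrow> f (scl c p) = scl c (f p)"
  by (simp_all add: lin_iff)

lemma lin_zero: "lin f \<Longrightarrow> f 0 = 0"
  by (metis lin_add add_cancel_right_right)

lemma lin_diff: "lin f \<Longrightarrow> f (p - q) = f p - f q"
  using lin_add[of f "p - q" q] by simp

text \<open>The explicit modules consist of functions supported in a cone, and the action is known
  only on them. Both summands in the addition step therefore come with their supports.\<close>

lemma poly_mapping_induct_keys [consumes 1, case_names zero single add]:
  assumes "Poly_Mapping.keys p \<subseteq> A" and "P 0"
    and "\<And>a c. a \<in> A \<Longrightarrow> P (Poly_Mapping.single a c)"
    and "\<And>p q. P p \<Longrightarrow> P q \<Longrightarrow> Poly_Mapping.keys p \<subseteq> A \<Longrightarrow> Poly_Mapping.keys q \<subseteq> A \<Longrightarrow> P (p + q)"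
  shows "P (p :: 'a \<Rightarrow>\<^sub>0 'b::comm_monoid_add)"
proof -
  have "Poly_Mapping.keys p \<subseteq> A \<longrightarrow> P p"
  proof (induction p rule: update_induct)
    case const
    then show ?case using assms(2) by simp
  next
    case (update f a b)
    have eq: "Poly_Mapping.update a b f = f + Poly_Mapping.single a b"
      using update(1) by (auto intro!: poly_mapping_eqI simp: lookup_update lookup_add lookup_single when_def not_in_keys_iff_lookup_eq_zero)
    show ?case
    proof
      assume "Poly_Mapping.keys (Poly_Mapping.update a b f) \<subseteq> A"
      then have "a \<in> A" "Poly_Mapping.keys f \<subseteq> A" using update(1,2) by (auto simp: keys_update)
      then show "P (Poly_Mapping.update a b f)"
        unfolding eq by (intro assms(4) assms(3)) (use update(3) in auto)
    qed
  qed
  then show ?thesis using assms(1) by simp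
qed

lemma poly_mapping_induct [case_names single add]:
  assumes "\<And>a c. P (Poly_Mapping.single a c)" and "\<And>p q. P p \<Longrightarrow> P q \<Longrightarrow> P (p + q)"
  shows "P (p :: 'a \<Rightarrow>\<^sub>0 'b::comm_monoid_add)"
  by (rule poly_mapping_induct_keys[of p UNIV]) (use assms assms(1)[of _ 0] in auto)

text \<open>The formula of \<open>linear_extension\<close> for arbitrary index types: it also serves
  functions on integer lattices and formal combinations of families of vectors.\<close>

definition lext :: "('a \<Rightarrow> ('b \<Rightarrow>\<^sub>0 'k::field_char_0)) \<Rightarrow> ('a \<Rightarrow>\<^sub>0 'k) \<Rightarrow> ('b \<Rightarrow>\<^sub>0 'k)"
  where "lext g p = (\<Sum>a\<in>Poly_Mapping.keys p. scl (Poly_Mapping.lookup p a) (g a))"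

lemma linear_extension_eq: "linear_extension = lext"
  by (intro ext) (simp add: linear_extension_def lext_def)

lemma lext_superset:
  assumes "finite A" "Poly_Mapping.keys p \<subseteq> A"
  shows "lext g p = (\<Sum>a\<in>A. scl (Poly_Mapping.lookup p a) (g a))"
  unfolding lext_def
  by (rule sum.mono_neutral_left) (use assms in \<open>auto simp: in_keys_iff\<close>)

lemma lin_lext: "lin (lext g)"
  unfolding lin_iff
proof (intro conjI allI)
  fix p q :: "'b \<Rightarrow>\<^sub>0 'a" and c
  let ?A = "Poly_Mapping.keys p \<union> Poly_Mapping.keys q"
  have "Poly_Mapping.keys (p + q) \<subseteq> ?A" by (rule keys_add)
  then show "lext g (p + q) = lext g p + lext g q"
    by (simp add: lext_superset[of ?A] lookup_add scl.scale_left_distrib sum.distrib)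
  have "Poly_Mapping.keys (scl c p) \<subseteq> Poly_Mapping.keys p" by (auto simp: in_keys_iff)
  then show "lext g (scl c p) = scl c (lext g p)"
    by (simp add: lext_superset[of "Poly_Mapping.keys p"] scl.scale_sum_right)
qed

lemma lext_single [simp]: "lext g (Poly_Mapping.single a c) = scl c (g a)"
  by (simp add: lext_superset[of "{a}"])

section \<open>Relations between the generators\<close>

lemma lin_partial_x: "lin (partial_x i)" and lin_int_x: "lin (int_x i)"
  by (simp_all add: partial_x_def int_x_def linear_extension_eq lin_lext)

lemma scl_conv_mult: "scl c p = Poly_Mapping.single 0 c * p" for p :: "('n, 'k::field_char_0) pol"
  by (simp add: scl_def mult_map_scale_conv_mult)

lemma lin_mult_x: "lin (mult_x i)"
  unfolding lin_iff mult_x_def by (simp add: scl_conv_mult algebra_simps)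

lemma lin_scl_op: "lin (scl c)"
  unfolding lin_iff by (simp add: scl.scale_right_distrib mult.commute)

lemma lin_comp: "lin f \<Longrightarrow> lin g \<Longrightarrow> lin (f \<circ> g)"
  by (simp add: lin_iff)

lemma lin_H_op: "lin (H_op i)"
  unfolding H_op_def by (intro lin_comp lin_partial_x lin_mult_x)

lemmas gen_add [simp] = lin_add[OF lin_mult_x] lin_add[OF lin_partial_x] lin_add[OF lin_int_x] lin_add[OF lin_H_op]
lemmas gen_scl [simp] = lin_scl[OF lin_mult_x] lin_scl[OF lin_partial_x] lin_scl[OF lin_int_x] lin_scl[OF lin_H_op]
lemmas gen_diff [simp] = lin_diff[OF lin_mult_x] lin_diff[OF lin_partial_x] lin_diff[OF lin_int_x] lin_diff[OF lin_H_op]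
lemmas gen_zero [simp] = lin_zero[OF lin_mult_x] lin_zero[OF lin_partial_x] lin_zero[OF lin_int_x] lin_zero[OF lin_H_op]

abbreviation ex :: "'n \<Rightarrow> ('n \<Rightarrow>\<^sub>0 nat)" where "ex i \<equiv> Poly_Mapping.single i (1::nat)"

lemma mult_x_single: "mult_x i (Poly_Mapping.single \<alpha> c) = Poly_Mapping.single (\<alpha> + ex i) c"
  by (simp add: mult_x_def mult_single add.commute)

lemma partial_x_single:
  "partial_x i (Poly_Mapping.single \<alpha> c) = Poly_Mapping.single (\<alpha> - ex i) (c * of_nat (Poly_Mapping.lookup \<alpha> i))"
  by (simp add: partial_x_def linear_extension_eq)

lemma int_x_single:
  "int_x i (Poly_Mapping.single \<alpha> c) = Poly_Mapping.single (\<alpha> + ex i) (c / (of_nat (Poly_Mapping.lookup \<alpha> i) + 1))"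
  by (simp add: int_x_def linear_extension_eq)

lemma H_op_single:
  "H_op i (Poly_Mapping.single \<alpha> c) = Poly_Mapping.single \<alpha> (c * (of_nat (Poly_Mapping.lookup \<alpha> i) + 1))"
  by (simp add: H_op_def mult_x_single partial_x_single lookup_add add.commute)

lemmas gen_single = mult_x_single partial_x_single int_x_single H_op_single

lemma nat_nonzero [simp]: "(of_nat n + 1 :: 'k::field_char_0) \<noteq> 0" "(1 + of_nat n :: 'k) \<noteq> 0"
  by (metis of_nat_Suc add.commute of_nat_eq_0_iff nat.distinct(1))+

lemma diff_add_ex:
  "Poly_Mapping.lookup \<alpha> i \<noteq> 0 \<Longrightarrow> \<alpha> - ex i + ex i = \<alpha>"
  by (rule poly_mapping_eqI) (auto simp: lookup_add lookup_minus lookup_single when_def)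

lemma partial_int [simp]: "partial_x i (int_x i p) = p"
  by (induction p rule: poly_mapping_induct) (simp_all add: gen_single lookup_add add.commute)

text \<open>The eigenvalue \<open>\<alpha>\<^sub>i + 1\<close> of \<open>H_op i\<close> cancels the
  denominator of the integration. Multiplication by a variable can thus be replaced by
  \<open>int_x i\<close> and \<open>H_op i\<close>, whose commutation rules with the derivative are
  simpler.\<close>

lemma mult_x_eq: "mult_x i p = int_x i (H_op i p)"
  by (induction p rule: poly_mapping_induct) (simp_all add: gen_single)

lemma H_partial: "H_op i (partial_x i p) = partial_x i (H_op i p) - partial_x i p"
proof (induction p rule: poly_mapping_induct)
  case (single \<alpha> c)
  show ?case
    by (cases "Poly_Mapping.lookup \<alpha> i")
       (auto simp: gen_single lookup_minus simp flip: single_diff intro!: arg_cong[where f="Poly_Mapping.single _"] simp: algebra_simps)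
qed (simp add: algebra_simps)

lemma H_int: "H_op i (int_x i p) = int_x i (H_op i p) + int_x i p"
proof (induction p rule: poly_mapping_induct)
  case (single \<alpha> c)
  show ?case
    by (auto simp: gen_single lookup_add simp flip: single_add intro!: arg_cong[where f="Poly_Mapping.single _"] simp: divide_simps) (simp_all add: algebra_simps)?
qed (simp add: algebra_simps)

text \<open>This is the element \<open>e_op i 0 0\<close> of the ideal F: it fixes the monomials
  free of \<open>x\<^sub>i\<close>, kills all others, and measures how far \<open>int_x i\<close> is
  from being a left inverse of \<open>partial_x i\<close>.\<close>

definition proj_op :: "'n \<Rightarrow> ('n, 'k::field_char_0) opr"
  where "proj_op i p = p - int_x i (partial_x i p)"

lemma proj_op_single: "proj_op i (Poly_Mapping.single \<alpha> c) =
  (if Poly_Mapping.lookup \<alpha> i = 0 then Poly_Mapping.single \<alpha> c else 0)"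
proof (cases "Poly_Mapping.lookup \<alpha> i")
  case (Suc m)
  then show ?thesis
    using diff_add_ex[of \<alpha> i]
    by (simp add: proj_op_def gen_single lookup_minus del: of_nat_Suc) (simp add: add.commute)
qed (simp add: proj_op_def gen_single)

lemma lin_proj_op: "lin (proj_op i)"
  by (simp add: lin_iff proj_op_def algebra_simps scl.scale_right_diff_distrib)

lemmas proj_op_lin [simp] = lin_add[OF lin_proj_op] lin_scl[OF lin_proj_op] lin_zero[OF lin_proj_op] lin_diff[OF lin_proj_op]

lemma proj_H [simp]: "proj_op i (H_op i p) = proj_op i p"
  and H_proj: "H_op i (proj_op i p) = proj_op i p"
  by (induction p rule: poly_mapping_induct; simp add: gen_single proj_op_single)+

lemma proj_int [simp]: "proj_op i (int_x i p) = 0"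
  by (simp add: proj_op_def)

lemma partial_proj [simp]: "partial_x i (proj_op i p) = 0"
  by (simp add: proj_op_def)

lemma ex_comm: fixes \<alpha> :: "'n \<Rightarrow>\<^sub>0 nat" shows "i \<noteq> j \<Longrightarrow> \<alpha> - ex i + ex j = \<alpha> + ex j - ex i"
  "\<alpha> - ex i - ex j = \<alpha> - ex j - ex i" "\<alpha> + ex i + ex j = \<alpha> + ex j + ex i"
  by (rule poly_mapping_eqI; auto simp: lookup_add lookup_minus lookup_single when_def)+

lemma gen_commute:
  assumes "i \<noteq> j"
  shows "partial_x i (partial_x j p) = partial_x j (partial_x i p)"
    and "int_x i (partial_x j p) = partial_x j (int_x i p)"
    and "int_x i (int_x j p) = int_x j (int_x i p)"
    and "H_op i (partial_x j p) = partial_x j (H_op i p)"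
    and "H_op i (int_x j p) = int_x j (H_op i p)"
    and "mult_x i (partial_x j p) = partial_x j (mult_x i p)"
    and "mult_x i (int_x j p) = int_x j (mult_x i p)"
    and "mult_x i (mult_x j p) = mult_x j (mult_x i p)"
  using assms ex_comm(1)[where i=i and j=j] ex_comm(1)[where i=j and j=i]
    ex_comm(2,3)[where i=i and j=j]
  by (induction p rule: poly_mapping_induct;
      simp add: gen_single lookup_add lookup_minus lookup_single when_def mult_ac)+

lemma H_commute: "H_op i (H_op j p) = H_op j (H_op i p)"
  by (induction p rule: poly_mapping_induct; simp add: gen_single mult_ac)

section \<open>The algebra of integro-differential operators\<close>

lemma End_P_simps [simp]:
  "carrier End_P = {f. lin f}" "monoid.mult End_P = (\<circ>)" "monoid.one End_P = id"
  "ring.zero End_P = (\<lambda>p. 0)" "ring.add End_P = (\<lambda>f g p. f p + g p)"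
  by (simp_all add: End_P_def)

lemma lin_plus: "lin f \<Longrightarrow> lin g \<Longrightarrow> lin (\<lambda>p. f p + g p)"
  and lin_minus: "lin f \<Longrightarrow> lin g \<Longrightarrow> lin (\<lambda>p. f p - g p)"
  and lin_neg: "lin f \<Longrightarrow> lin (\<lambda>p. - f p)"
  and lin_0: "lin (\<lambda>p. 0)"
  and lin_id: "lin id"
  by (simp_all add: lin_iff algebra_simps scl.scale_right_distrib scl.scale_right_diff_distrib)

lemma ring_End_P: "ring End_P"
proof (rule ringI)
  show "abelian_group End_P"
  proof (rule abelian_groupI)
    fix f assume "f \<in> carrier End_P"
    then show "\<exists>g\<in>carrier End_P. g \<oplus>\<^bsub>End_P\<^esub> f = \<zero>\<^bsub>End_P\<^esub>"
      by (intro bexI[of _ "\<lambda>p. - f p"]) (auto simp: lin_neg)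
  qed (auto simp: lin_plus lin_0 fun_eq_iff add_ac)
  show "Group.monoid End_P"
    by (rule monoidI) (auto simp: lin_comp lin_id)
qed (auto simp: fun_eq_iff lin_add)

lemma End_P_minus: "lin f \<Longrightarrow> \<ominus>\<^bsub>End_P\<^esub> f = (\<lambda>p. - f p)"
proof -
  assume f: "lin f"
  interpret ring End_P by (rule ring_End_P)
  show ?thesis
    by (rule minus_equality) (use f lin_neg[OF f] in \<open>auto simp: fun_eq_iff\<close>)
qed

definition alg :: "('n, 'k::field_char_0) opr set \<Rightarrow> ('n, 'k) opr set"
  where "alg S = generate_ring End_P (Set.range scl \<union> S)"

lemma subalgebra_generated_simps [simp]:
  "carrier (subalgebra_generated S) = alg S" "monoid.mult (subalgebra_generated S) = (\<circ>)"
  "monoid.one (subalgebra_generated S) = id"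
  "ring.zero (subalgebra_generated S) = (\<lambda>p. 0)"
  "ring.add (subalgebra_generated S) = (\<lambda>f g p. f p + g p)"
  by (simp_all add: subalgebra_generated_def alg_def)

lemma ring_subalgebra: "S \<subseteq> {f. lin f} \<Longrightarrow> ring (subalgebra_generated S)"
  unfolding subalgebra_generated_def
  by (rule ring.generate_ring_is_ring[OF ring_End_P]) (auto simp: lin_scl_op)

lemma range_scl_lin: "Set.range scl \<subseteq> {f. lin f}"
  using lin_scl_op by auto

lemma alg_lin: "S \<subseteq> {f. lin f} \<Longrightarrow> a \<in> alg S \<Longrightarrow> lin a"
  using ring.generate_ring_in_carrier[OF ring_End_P, of "Set.range scl \<union> S" a] range_scl_lin
  by (simp add: alg_def)

lemma alg_gen: "a \<in> S \<Longrightarrow> a \<in> alg S"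
  and alg_scl: "scl c \<in> alg S"
  and alg_id: "id \<in> alg S"
  and alg_comp: "a \<in> alg S \<Longrightarrow> b \<in> alg S \<Longrightarrow> a \<circ> b \<in> alg S"
  and alg_add: "a \<in> alg S \<Longrightarrow> b \<in> alg S \<Longrightarrow> (\<lambda>p. a p + b p) \<in> alg S"
  unfolding alg_def
  using generate_ring.incl[of _ "Set.range scl \<union> S" End_P] generate_ring.one[of End_P "Set.range scl \<union> S"]
    generate_ring.eng_mult[of a End_P "Set.range scl \<union> S" b] generate_ring.eng_add[of a End_P "Set.range scl \<union> S" b]
  by auto

lemma alg_zero: "(\<lambda>p. 0) \<in> alg S"
proof -
  have "scl 0 = (\<lambda>p. 0 :: ('a \<Rightarrow>\<^sub>0 nat) \<Rightarrow>\<^sub>0 'b)" by (auto simp: fun_eq_iff)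
  then show ?thesis using alg_scl[of 0 S] by simp
qed

lemma alg_neg:
  assumes "a \<in> alg S" shows "(\<lambda>p. - a p) \<in> alg S"
  using alg_comp[OF alg_scl[of "-1" S] assms] by (simp add: comp_def)

lemma alg_diff: "a \<in> alg S \<Longrightarrow> b \<in> alg S \<Longrightarrow> (\<lambda>p. a p - b p) \<in> alg S"
  using alg_add[OF _ alg_neg, of a S b] by simp

lemma alg_pow: "a \<in> alg S \<Longrightarrow> a ^^ k \<in> alg S"
  by (induction k) (auto simp: alg_id alg_comp)

text \<open>The identity and the negatives have no cases of their own: they are \<open>scl 1\<close>
  and a composition with \<open>scl (-1)\<close>.\<close>

lemma alg_induct [consumes 2, case_names scl gen comp add]:
  assumes "a \<in> alg S" and S: "S \<subseteq> {f. lin f}"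
    and scl: "\<And>c. P (scl c)" and gen: "\<And>a. a \<in> S \<Longrightarrow> P a"
    and comp: "\<And>a b. a \<in> alg S \<Longrightarrow> b \<in> alg S \<Longrightarrow> P a \<Longrightarrow> P b \<Longrightarrow> P (a \<circ> b)"
    and add: "\<And>a b. a \<in> alg S \<Longrightarrow> b \<in> alg S \<Longrightarrow> P a \<Longrightarrow> P b \<Longrightarrow> P (\<lambda>p. a p + b p)"
  shows "P a"
  using assms(1) unfolding alg_def
proof (induction a rule: generate_ring.induct)
  case one
  have "scl 1 = (id :: ('a, 'b) opr)" by (auto simp: fun_eq_iff)
  then show ?case using scl[of 1] by (simp add: id_def)
next
  case (incl h)
  then show ?case using scl gen by auto
next
  case (a_inv h)
  then have h: "h \<in> alg S" by (simp add: alg_def)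
  then have "\<ominus>\<^bsub>End_P\<^esub> h = scl (-1) \<circ> h"
    by (simp add: End_P_minus[OF alg_lin[OF S h]] comp_def)
  then show ?case using comp[OF alg_scl[of "-1" S] h scl a_inv(2)] by metis
next
  case (eng_add a b)
  then show ?case using add[of a b] by (simp add: alg_def)
next
  case (eng_mult a b)
  then show ?case using comp[of a b] by (simp only: alg_def End_P_simps)
qed

abbreviation gens :: "'n \<Rightarrow> ('n, 'k::field_char_0) opr set"
  where "gens i \<equiv> {mult_x i, partial_x i, int_x i}"

lemma gens_lin: "gens i \<subseteq> {f. lin f}" and all_gens_lin: "(\<Union>i. gens i) \<subseteq> {f. lin f}"
  by (auto simp: lin_mult_x lin_partial_x lin_int_x)

lemma alg_mono: "S \<subseteq> T \<Longrightarrow> S \<subseteq> {f. lin f} \<Longrightarrow> a \<in> alg S \<Longrightarrow> a \<in> alg T"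
  by (erule alg_induct) (blast intro: alg_scl alg_gen alg_add alg_comp)+

lemma carrier_I_n: "carrier I_n = alg (\<Union>i. gens i)"
  by (simp add: I_n_def)

lemma carrier_I_1: "carrier (I_1 i) = alg (gens i)"
  by (simp add: I_1_def)

lemma I_n_simps [simp]:
  "monoid.mult I_n = (\<circ>)" "monoid.one I_n = id"
  "ring.zero I_n = (\<lambda>p. 0)" "ring.add I_n = (\<lambda>f g p. f p + g p)"
  by (simp_all add: I_n_def)

lemma I_1_simps [simp]:
  "monoid.mult (I_1 i) = (\<circ>)" "monoid.one (I_1 i) = id"
  "ring.zero (I_1 i) = (\<lambda>p. 0)" "ring.add (I_1 i) = (\<lambda>f g p. f p + g p)"
  by (simp_all add: I_1_def)

lemma ring_I_n: "ring I_n" and ring_I_1: "ring (I_1 i)"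
  unfolding I_n_def I_1_def by (intro ring_subalgebra gens_lin all_gens_lin)+

lemma I_1_le_I_n: "a \<in> carrier (I_1 i) \<Longrightarrow> a \<in> carrier I_n"
  unfolding carrier_I_n carrier_I_1 by (erule alg_mono[rotated 2]) (auto simp: lin_mult_x lin_partial_x lin_int_x)

lemma proj_op_eq: "proj_op i = (\<lambda>p. id p - (int_x i \<circ> partial_x i) p)"
  by (simp add: proj_op_def fun_eq_iff)

lemma gens_in_I_1 [simp]:
  "mult_x i \<in> carrier (I_1 i)" "partial_x i \<in> carrier (I_1 i)" "int_x i \<in> carrier (I_1 i)"
  "H_op i \<in> carrier (I_1 i)" "proj_op i \<in> carrier (I_1 i)" "scl c \<in> carrier (I_1 i)" "id \<in> carrier (I_1 i)"
  unfolding carrier_I_1 H_op_def proj_op_eq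
  by (intro alg_diff alg_comp alg_id alg_gen alg_scl; simp)+

lemmas gens_in_I_n [simp] = gens_in_I_1[THEN I_1_le_I_n]

lemma I_n_closed [simp]:
  "scl c \<in> carrier I_n" "id \<in> carrier I_n" "(\<lambda>p. 0) \<in> carrier I_n"
  "a \<in> carrier I_n \<Longrightarrow> b \<in> carrier I_n \<Longrightarrow> a \<circ> b \<in> carrier I_n"
  "a \<in> carrier I_n \<Longrightarrow> b \<in> carrier I_n \<Longrightarrow> (\<lambda>p. a p + b p) \<in> carrier I_n"
  "a \<in> carrier I_n \<Longrightarrow> b \<in> carrier I_n \<Longrightarrow> (\<lambda>p. a p - b p) \<in> carrier I_n"
  "a \<in> carrier I_n \<Longrightarrow> a ^^ k \<in> carrier I_n"
  unfolding carrier_I_n by (simp_all add: alg_scl alg_id alg_zero alg_comp alg_add alg_diff alg_pow)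

lemma I_1_closed [simp]:
  "scl c \<in> carrier (I_1 i)" "id \<in> carrier (I_1 i)" "(\<lambda>p. 0) \<in> carrier (I_1 i)"
  "a \<in> carrier (I_1 i) \<Longrightarrow> b \<in> carrier (I_1 i) \<Longrightarrow> a \<circ> b \<in> carrier (I_1 i)"
  "a \<in> carrier (I_1 i) \<Longrightarrow> b \<in> carrier (I_1 i) \<Longrightarrow> (\<lambda>p. a p + b p) \<in> carrier (I_1 i)"
  "a \<in> carrier (I_1 i) \<Longrightarrow> b \<in> carrier (I_1 i) \<Longrightarrow> (\<lambda>p. a p - b p) \<in> carrier (I_1 i)"
  "a \<in> carrier (I_1 i) \<Longrightarrow> a ^^ k \<in> carrier (I_1 i)"
  unfolding carrier_I_1 by (simp_all add: alg_scl alg_id alg_zero alg_comp alg_add alg_diff alg_pow)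

lemma lin_I_n: "a \<in> carrier I_n \<Longrightarrow> lin a"
  unfolding carrier_I_n by (rule alg_lin[OF all_gens_lin])

lemma I_n_induct [consumes 1, case_names scl mult_x partial_x int_x comp add]:
  assumes "a \<in> carrier I_n"
    and "\<And>c. P (scl c)" "\<And>i. P (mult_x i)" "\<And>i. P (partial_x i)" "\<And>i. P (int_x i)"
    and "\<And>a b. a \<in> carrier I_n \<Longrightarrow> b \<in> carrier I_n \<Longrightarrow> P a \<Longrightarrow> P b \<Longrightarrow> P (a \<circ> b)"
    and "\<And>a b. a \<in> carrier I_n \<Longrightarrow> b \<in> carrier I_n \<Longrightarrow> P a \<Longrightarrow> P b \<Longrightarrow> P (\<lambda>p. a p + b p)"
  shows "P a"
  using assms(1)[unfolded carrier_I_n] all_gens_lin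
  by (induction rule: alg_induct) (use assms in \<open>auto simp only: carrier_I_n\<close>)

lemma I_1_induct [consumes 1, case_names scl mult_x partial_x int_x comp add]:
  assumes "a \<in> carrier (I_1 i)"
    and "\<And>c. P (scl c)" "P (mult_x i)" "P (partial_x i)" "P (int_x i)"
    and "\<And>a b. a \<in> carrier (I_1 i) \<Longrightarrow> b \<in> carrier (I_1 i) \<Longrightarrow> P a \<Longrightarrow> P b \<Longrightarrow> P (a \<circ> b)"
    and "\<And>a b. a \<in> carrier (I_1 i) \<Longrightarrow> b \<in> carrier (I_1 i) \<Longrightarrow> P a \<Longrightarrow> P b \<Longrightarrow> P (\<lambda>p. a p + b p)"
  shows "P a"
  using assms(1)[unfolded carrier_I_1] gens_lin
  by (induction rule: alg_induct) (use assms in \<open>auto simp only: carrier_I_1\<close>)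

section \<open>Left modules\<close>

context left_module
begin

lemma smult_r_zero: "a \<in> carrier R \<Longrightarrow> a \<odot>\<^bsub>M\<^esub> \<zero>\<^bsub>M\<^esub> = \<zero>\<^bsub>M\<^esub>"
  using smult_r_distr[of a "\<zero>\<^bsub>M\<^esub>" "\<zero>\<^bsub>M\<^esub>"] smult_closed[of a "\<zero>\<^bsub>M\<^esub>"]
  by (metis M.add.r_cancel_one' M.zero_closed M.l_zero)

lemma smult_l_zero: "v \<in> carrier M \<Longrightarrow> \<zero>\<^bsub>R\<^esub> \<odot>\<^bsub>M\<^esub> v = \<zero>\<^bsub>M\<^esub>"
  using smult_l_distr[of "\<zero>\<^bsub>R\<^esub>" "\<zero>\<^bsub>R\<^esub>" v] smult_closed[of "\<zero>\<^bsub>R\<^esub>" v]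
  by (metis M.add.r_cancel_one' R.zero_closed R.l_zero)

lemma smult_l_minus:
  assumes "a \<in> carrier R" "v \<in> carrier M"
  shows "(\<ominus>\<^bsub>R\<^esub> a) \<odot>\<^bsub>M\<^esub> v = \<ominus>\<^bsub>M\<^esub> (a \<odot>\<^bsub>M\<^esub> v)"
  using assms smult_l_distr[of "\<ominus>\<^bsub>R\<^esub> a" a v]
  by (intro M.minus_equality[symmetric]) (auto simp: smult_closed smult_l_zero R.l_neg)

lemma smult_finsum:
  assumes "a \<in> carrier R" "f \<in> A \<rightarrow> carrier M"
  shows "a \<odot>\<^bsub>M\<^esub> finsum M f A = finsum M (\<lambda>i. a \<odot>\<^bsub>M\<^esub> f i) A"
  using assms(2)
proof (induction A rule: infinite_finite_induct)
  case (insert i A)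
  then show ?case
    using assms(1) by (simp add: M.finsum_insert smult_closed smult_r_distr Pi_def)
qed (simp_all add: assms(1) smult_r_zero)

lemma left_submoduleI:
  assumes "H \<subseteq> carrier M" "\<zero>\<^bsub>M\<^esub> \<in> H"
    and "\<And>v w. v \<in> H \<Longrightarrow> w \<in> H \<Longrightarrow> v \<oplus>\<^bsub>M\<^esub> w \<in> H"
    and "\<And>a v. a \<in> carrier R \<Longrightarrow> v \<in> H \<Longrightarrow> a \<odot>\<^bsub>M\<^esub> v \<in> H"
  shows "submodule H R M"
proof (unfold_locales)
  fix x assume x: "x \<in> H"
  have "(\<ominus>\<^bsub>R\<^esub> \<one>\<^bsub>R\<^esub>) \<odot>\<^bsub>M\<^esub> x = \<ominus>\<^bsub>M\<^esub> x"
    using x assms(1) by (subst smult_l_minus) (auto simp: smult_one)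
  then show "inv\<^bsub>add_monoid M\<^esub> x \<in> H"
    using assms(4)[OF _ x, of "\<ominus>\<^bsub>R\<^esub> \<one>\<^bsub>R\<^esub>"] by (simp add: a_inv_def)
qed (use assms in auto)

lemma submodule_zero: "submodule {\<zero>\<^bsub>M\<^esub>} R M"
  by (rule left_submoduleI) (auto simp: smult_r_zero)

lemma submodule_cyclic:
  assumes "u \<in> carrier M"
  shows "submodule ((\<lambda>a. a \<odot>\<^bsub>M\<^esub> u) ` carrier R) R M"
proof (rule left_submoduleI)
  show "\<zero>\<^bsub>M\<^esub> \<in> (\<lambda>a. a \<odot>\<^bsub>M\<^esub> u) ` carrier R"
    using assms by (intro image_eqI[of _ _ "\<zero>\<^bsub>R\<^esub>"]) (auto simp: smult_l_zero)
next
  fix v w assume "v \<in> (\<lambda>a. a \<odot>\<^bsub>M\<^esub> u) ` carrier R" "w \<in> (\<lambda>a. a \<odot>\<^bsub>M\<^esub> u) ` carrier R"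
  then obtain a b where "a \<in> carrier R" "b \<in> carrier R" "v = a \<odot>\<^bsub>M\<^esub> u" "w = b \<odot>\<^bsub>M\<^esub> u" by auto
  then show "v \<oplus>\<^bsub>M\<^esub> w \<in> (\<lambda>a. a \<odot>\<^bsub>M\<^esub> u) ` carrier R"
    using assms by (intro image_eqI[of _ _ "a \<oplus>\<^bsub>R\<^esub> b"]) (auto simp: smult_l_distr)
next
  fix c v assume "c \<in> carrier R" "v \<in> (\<lambda>a. a \<odot>\<^bsub>M\<^esub> u) ` carrier R"
  then obtain a where "a \<in> carrier R" "v = a \<odot>\<^bsub>M\<^esub> u" by auto
  then show "c \<odot>\<^bsub>M\<^esub> v \<in> (\<lambda>a. a \<odot>\<^bsub>M\<^esub> u) ` carrier R"
    using assms \<open>c \<in> carrier R\<close> by (intro image_eqI[of _ _ "c \<otimes>\<^bsub>R\<^esub> a"]) (auto simp: smult_assoc)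
qed (use assms smult_closed in auto)

end

lemma submoduleD:
  assumes "submodule H R M"
  shows "H \<subseteq> carrier M" "\<zero>\<^bsub>M\<^esub> \<in> H" "\<And>v w. v \<in> H \<Longrightarrow> w \<in> H \<Longrightarrow> v \<oplus>\<^bsub>M\<^esub> w \<in> H"
    "\<And>a v. a \<in> carrier R \<Longrightarrow> v \<in> H \<Longrightarrow> a \<odot>\<^bsub>M\<^esub> v \<in> H" "\<And>v. v \<in> H \<Longrightarrow> \<ominus>\<^bsub>M\<^esub> v \<in> H"
    "\<And>v w. v \<in> H \<Longrightarrow> w \<in> H \<Longrightarrow> v \<ominus>\<^bsub>M\<^esub> w \<in> H" "subgroup H (add_monoid M)"
proof -
  interpret submodule H R M by fact
  interpret additive_subgroup H M by (rule additive_subgroupI) unfold_locales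
  show "H \<subseteq> carrier M" "\<zero>\<^bsub>M\<^esub> \<in> H" by (auto simp: a_subset)
  show *: "\<And>v w. v \<in> H \<Longrightarrow> w \<in> H \<Longrightarrow> v \<oplus>\<^bsub>M\<^esub> w \<in> H" "\<And>v. v \<in> H \<Longrightarrow> \<ominus>\<^bsub>M\<^esub> v \<in> H" by auto
  show "\<And>v w. v \<in> H \<Longrightarrow> w \<in> H \<Longrightarrow> v \<ominus>\<^bsub>M\<^esub> w \<in> H" by (simp add: a_minus_def *)
  show "\<And>a v. a \<in> carrier R \<Longrightarrow> v \<in> H \<Longrightarrow> a \<odot>\<^bsub>M\<^esub> v \<in> H" by simp
  show "subgroup H (add_monoid M)" by unfold_locales
qed

lemma left_moduleI:
  assumes "ring R" "abelian_group M"
    and "\<And>a v. a \<in> carrier R \<Longrightarrow> v \<in> carrier M \<Longrightarrow> a \<odot>\<^bsub>M\<^esub> v \<in> carrier M"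
    and "\<And>a b v. a \<in> carrier R \<Longrightarrow> b \<in> carrier R \<Longrightarrow> v \<in> carrier M \<Longrightarrow>
      (a \<oplus>\<^bsub>R\<^esub> b) \<odot>\<^bsub>M\<^esub> v = a \<odot>\<^bsub>M\<^esub> v \<oplus>\<^bsub>M\<^esub> b \<odot>\<^bsub>M\<^esub> v"
    and "\<And>a v w. a \<in> carrier R \<Longrightarrow> v \<in> carrier M \<Longrightarrow> w \<in> carrier M \<Longrightarrow>
      a \<odot>\<^bsub>M\<^esub> (v \<oplus>\<^bsub>M\<^esub> w) = a \<odot>\<^bsub>M\<^esub> v \<oplus>\<^bsub>M\<^esub> a \<odot>\<^bsub>M\<^esub> w"
    and "\<And>a b v. a \<in> carrier R \<Longrightarrow> b \<in> carrier R \<Longrightarrow> v \<in> carrier M \<Longrightarrow>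
      (a \<otimes>\<^bsub>R\<^esub> b) \<odot>\<^bsub>M\<^esub> v = a \<odot>\<^bsub>M\<^esub> (b \<odot>\<^bsub>M\<^esub> v)"
    and "\<And>v. v \<in> carrier M \<Longrightarrow> \<one>\<^bsub>R\<^esub> \<odot>\<^bsub>M\<^esub> v = v"
  shows "left_module R M"
  using assms by (simp add: left_module_def left_module_axioms_def)

lemma left_module_submodule:
  fixes M :: "('a, 'm) module"
  assumes "left_module R M" "submodule N R M"
  shows "left_module R (M\<lparr>carrier := N\<rparr>)"
proof -
  interpret left_module R M by fact
  note N = submoduleD[OF assms(2)]
  have sub: "v \<in> carrier M" if "v \<in> N" for v using N(1) that by auto
  show ?thesis
  proof (rule left_moduleI)
    show "abelian_group (M\<lparr>carrier := N\<rparr>)"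
    proof (rule abelian_groupI)
      fix v assume "v \<in> carrier (M\<lparr>carrier := N\<rparr>)"
      then show "\<exists>w\<in>carrier (M\<lparr>carrier := N\<rparr>). w \<oplus>\<^bsub>M\<lparr>carrier := N\<rparr>\<^esub> v = \<zero>\<^bsub>M\<lparr>carrier := N\<rparr>\<^esub>"
        using N(5) by (intro bexI[of _ "\<ominus>\<^bsub>M\<^esub> v"]) (auto simp: sub M.l_neg)
    qed (auto simp: N sub M.a_ac)
  qed (auto simp: N sub R.ring_axioms smult_l_distr smult_r_distr smult_assoc smult_one)
qed

lemma submodule_of_submodule:
  fixes M :: "('a, 'm) module"
  assumes "left_module R M" "submodule N R M" "submodule L R M" "L \<subseteq> N"
  shows "submodule L R (M\<lparr>carrier := N\<rparr>)"
  by (rule left_module.left_submoduleI[OF left_module_submodule[OF assms(1,2)]])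
     (use submoduleD[OF assms(3)] assms(4) in auto)

text \<open>The module axioms are equations, closure conditions and the existence of negatives, all
  of which pass to an image that respects the operations. Quotients, copies of modules,
  \<open>B_1\<close> as a module and the tensor product get their module structure from
  here.\<close>

lemma left_module_surj:
  assumes M: "left_module R M" and c: "carrier N = g ` carrier M" and z: "\<zero>\<^bsub>N\<^esub> = g \<zero>\<^bsub>M\<^esub>"
    and a: "\<And>u v. u \<in> carrier M \<Longrightarrow> v \<in> carrier M \<Longrightarrow> g u \<oplus>\<^bsub>N\<^esub> g v = g (u \<oplus>\<^bsub>M\<^esub> v)"
    and s: "\<And>x u. x \<in> carrier R \<Longrightarrow> u \<in> carrier M \<Longrightarrow> x \<odot>\<^bsub>N\<^esub> g u = g (x \<odot>\<^bsub>M\<^esub> u)"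
  shows "left_module R N"
proof -
  interpret left_module R M by fact
  have "abelian_group N"
  proof (rule abelian_groupI; unfold c z)
    fix x assume "x \<in> g ` carrier M"
    then obtain u where u: "u \<in> carrier M" "x = g u" by blast
    show "\<exists>y\<in>g ` carrier M. y \<oplus>\<^bsub>N\<^esub> x = g \<zero>\<^bsub>M\<^esub>"
      by (rule bexI[of _ "g (\<ominus>\<^bsub>M\<^esub> u)"]) (simp_all add: u a M.l_neg)
    show "g \<zero>\<^bsub>M\<^esub> \<oplus>\<^bsub>N\<^esub> x = x" by (simp add: u a)
    fix y assume "y \<in> g ` carrier M"
    then obtain v where v: "v \<in> carrier M" "y = g v" by blast
    show "x \<oplus>\<^bsub>N\<^esub> y \<in> g ` carrier M" "x \<oplus>\<^bsub>N\<^esub> y = y \<oplus>\<^bsub>N\<^esub> x"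
      using u(1) v(1) by (simp_all add: u(2) v(2) a M.a_comm)
    fix z assume "z \<in> g ` carrier M"
    then obtain w where w: "w \<in> carrier M" "z = g w" by blast
    show "x \<oplus>\<^bsub>N\<^esub> y \<oplus>\<^bsub>N\<^esub> z = x \<oplus>\<^bsub>N\<^esub> (y \<oplus>\<^bsub>N\<^esub> z)"
      using u(1) v(1) w(1) by (simp add: u(2) v(2) w(2) a M.a_assoc)
  qed simp
  then show ?thesis
  proof (rule left_moduleI[OF R.ring_axioms]; unfold c)
    fix r x assume r: "r \<in> carrier R" and "x \<in> g ` carrier M"
    then obtain u where u: "u \<in> carrier M" "x = g u" by blast
    show "r \<odot>\<^bsub>N\<^esub> x \<in> g ` carrier M" using smult_closed[OF r u(1)] by (simp add: u s r)
    fix q assume q: "q \<in> carrier R"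
    show "(r \<oplus>\<^bsub>R\<^esub> q) \<odot>\<^bsub>N\<^esub> x = r \<odot>\<^bsub>N\<^esub> x \<oplus>\<^bsub>N\<^esub> q \<odot>\<^bsub>N\<^esub> x"
      using smult_l_distr[OF r q u(1)] by (simp add: u s r q a smult_closed)
    show "(r \<otimes>\<^bsub>R\<^esub> q) \<odot>\<^bsub>N\<^esub> x = r \<odot>\<^bsub>N\<^esub> (q \<odot>\<^bsub>N\<^esub> x)"
      using smult_assoc[OF r q u(1)] by (simp add: u s r q smult_closed)
  next
    fix r x y assume r: "r \<in> carrier R" and "x \<in> g ` carrier M" "y \<in> g ` carrier M"
    then obtain u v where u: "u \<in> carrier M" "x = g u" and v: "v \<in> carrier M" "y = g v" by blast
    show "r \<odot>\<^bsub>N\<^esub> (x \<oplus>\<^bsub>N\<^esub> y) = r \<odot>\<^bsub>N\<^esub> x \<oplus>\<^bsub>N\<^esub> r \<odot>\<^bsub>N\<^esub> y"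
      using smult_r_distr[OF r u(1) v(1)] by (simp add: u v s r a smult_closed)
  next
    fix x assume "x \<in> g ` carrier M"
    then obtain u where u: "u \<in> carrier M" "x = g u" by blast
    show "\<one>\<^bsub>R\<^esub> \<odot>\<^bsub>N\<^esub> x = x" using smult_one[OF u(1)] by (simp add: u s)
  qed
qed

section \<open>Quotient modules and simple subquotients\<close>

lemma quotient_module_simps:
  "carrier (quotient_module M L) = (\<lambda>v. L +>\<^bsub>M\<^esub> v) ` carrier M"
  "\<zero>\<^bsub>quotient_module M L\<^esub> = L"
  "ring.add (quotient_module M L) = set_add M"
  by (auto simp: quotient_module_def A_RCOSETS_def')

lemma
  fixes M :: "('a, 'm) module"
  assumes "left_module R M" "submodule L R M"
  shows quotient_add: "v \<in> carrier M \<Longrightarrow> w \<in> carrier M \<Longrightarrow>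
      (L +>\<^bsub>M\<^esub> v) \<oplus>\<^bsub>quotient_module M L\<^esub> (L +>\<^bsub>M\<^esub> w) = L +>\<^bsub>M\<^esub> (v \<oplus>\<^bsub>M\<^esub> w)"
    and quotient_smult: "a \<in> carrier R \<Longrightarrow> v \<in> carrier M \<Longrightarrow>
      a \<odot>\<^bsub>quotient_module M L\<^esub> (L +>\<^bsub>M\<^esub> v) = L +>\<^bsub>M\<^esub> (a \<odot>\<^bsub>M\<^esub> v)"
    and quotient_eq_iff: "v \<in> carrier M \<Longrightarrow> w \<in> carrier M \<Longrightarrow>
      L +>\<^bsub>M\<^esub> v = L +>\<^bsub>M\<^esub> w \<longleftrightarrow> v \<ominus>\<^bsub>M\<^esub> w \<in> L"
    and quotient_zero_iff: "v \<in> carrier M \<Longrightarrow> L +>\<^bsub>M\<^esub> v = L \<longleftrightarrow> v \<in> L"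
    and left_module_quotient: "left_module R (quotient_module M L)"
proof -
  interpret left_module R M by fact
  note L = submoduleD[OF assms(2)]
  interpret abelian_subgroup L M
    by (rule abelian_subgroupI3) (simp_all add: additive_subgroupI L(7) M.abelian_group_axioms)
  show zi: "L +>\<^bsub>M\<^esub> v = L \<longleftrightarrow> v \<in> L" if "v \<in> carrier M" for v
    using that L(7) M.a_coset_join1 M.a_coset_join2 by blast
  show ei: "L +>\<^bsub>M\<^esub> v = L +>\<^bsub>M\<^esub> w \<longleftrightarrow> v \<ominus>\<^bsub>M\<^esub> w \<in> L" if "v \<in> carrier M" "w \<in> carrier M" for v w
    using that zi[of "v \<ominus>\<^bsub>M\<^esub> w"] M.a_coset_add_inv1[of L v w] M.a_coset_add_inv2[of L v w] L(1)
    by (auto simp: a_minus_def)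
  show qa: "(L +>\<^bsub>M\<^esub> v) \<oplus>\<^bsub>quotient_module M L\<^esub> (L +>\<^bsub>M\<^esub> w) = L +>\<^bsub>M\<^esub> (v \<oplus>\<^bsub>M\<^esub> w)"
    if "v \<in> carrier M" "w \<in> carrier M" for v w
    using that by (simp add: quotient_module_simps a_rcos_sum)
  show qs: "a \<odot>\<^bsub>quotient_module M L\<^esub> (L +>\<^bsub>M\<^esub> v) = L +>\<^bsub>M\<^esub> (a \<odot>\<^bsub>M\<^esub> v)"
    if "a \<in> carrier R" "v \<in> carrier M" for a v
  proof -
    \<comment> \<open>The action on a quotient is defined by a union over all representatives; they
      all give the same coset.\<close>
    have "L +>\<^bsub>M\<^esub> (a \<odot>\<^bsub>M\<^esub> w) = L +>\<^bsub>M\<^esub> (a \<odot>\<^bsub>M\<^esub> v)" if "w \<in> L +>\<^bsub>M\<^esub> v" for w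
    proof -
      obtain l where l: "l \<in> L" "w = l \<oplus>\<^bsub>M\<^esub> v" using \<open>w \<in> L +>\<^bsub>M\<^esub> v\<close> by (auto simp: a_r_coset_def')
      then have lc: "l \<in> carrier M" using L(1) by auto
      have "a \<odot>\<^bsub>M\<^esub> w \<ominus>\<^bsub>M\<^esub> a \<odot>\<^bsub>M\<^esub> v = a \<odot>\<^bsub>M\<^esub> l"
        using l lc \<open>a \<in> carrier R\<close> \<open>v \<in> carrier M\<close>
        by (simp add: smult_r_distr a_minus_def M.a_assoc smult_closed M.r_neg)
      then show ?thesis using ei[of "a \<odot>\<^bsub>M\<^esub> w" "a \<odot>\<^bsub>M\<^esub> v"] L(4)[OF \<open>a \<in> carrier R\<close> l(1)] l lc
          \<open>a \<in> carrier R\<close> \<open>v \<in> carrier M\<close> by (simp add: smult_closed)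
    qed
    then have "(\<Union>w\<in>L +>\<^bsub>M\<^esub> v. L +>\<^bsub>M\<^esub> (a \<odot>\<^bsub>M\<^esub> w)) = L +>\<^bsub>M\<^esub> (a \<odot>\<^bsub>M\<^esub> v)"
      using a_rcos_self[OF that(2)] by blast
    then show ?thesis by (simp only: quotient_module_def module.simps)
  qed
  show "left_module R (quotient_module M L)"
    by (rule left_module_surj[OF assms(1), of _ "\<lambda>v. L +>\<^bsub>M\<^esub> v"])
       (simp_all only: quotient_module_simps(1,2) qa qs zi[OF M.zero_closed, THEN iffD2, OF L(2)])
qed

text \<open>By Zorn's lemma some submodule \<open>L\<close> of the cyclic module \<open>N\<close>
  generated by \<open>u\<close> is maximal among those avoiding \<open>u\<close>. A larger submodule
  of \<open>N\<close> contains the generator, hence is \<open>N\<close>. The shape of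
  \<open>N\<close> belongs to the conclusion because properties of \<open>u\<close> are later
  propagated to all of \<open>N\<close>.\<close>

lemma simple_subquotient_exists:
  fixes M :: "('a, 'm) module"
  assumes M: "left_module R M" and u: "u \<in> carrier M" "u \<noteq> \<zero>\<^bsub>M\<^esub>"
  obtains N L where "submodule N R M" "submodule L R M" "L \<subseteq> N"
    "N = (\<lambda>a. a \<odot>\<^bsub>M\<^esub> u) ` carrier R" "simple_left_module R (quotient_module (M\<lparr>carrier := N\<rparr>) L)"
proof -
  interpret left_module R M by fact
  define N where "N = (\<lambda>a. a \<odot>\<^bsub>M\<^esub> u) ` carrier R"
  have N: "submodule N R M" unfolding N_def by (rule submodule_cyclic) fact
  have uN: "u \<in> N" unfolding N_def by (rule image_eqI[of _ _ "\<one>\<^bsub>R\<^esub>"]) (use u in \<open>auto simp: smult_one\<close>)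
  define A where "A = {L. submodule L R M \<and> L \<subseteq> N \<and> u \<notin> L}"
  have "\<exists>L\<in>A. (\<forall>S\<in>A. L \<subseteq> S \<longrightarrow> S = L)"
  proof (rule subset_Zorn_nonempty)
    show "A \<noteq> {}" using submodule_zero u submoduleD(2)[OF N] by (auto simp: A_def)
  next
    fix C assume C: "C \<noteq> {}" "subset.chain A C"
    then have CA: "\<And>L. L \<in> C \<Longrightarrow> submodule L R M \<and> L \<subseteq> N \<and> u \<notin> L"
      and lin: "\<And>L L'. L \<in> C \<Longrightarrow> L' \<in> C \<Longrightarrow> L \<subseteq> L' \<or> L' \<subseteq> L"
      by (auto simp: subset_chain_def A_def)
    have "submodule (\<Union>C) R M"
    proof (rule left_submoduleI)
      show "\<Union>C \<subseteq> carrier M" using CA submoduleD(1)[OF N] by blast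
      show "\<zero>\<^bsub>M\<^esub> \<in> \<Union>C"
      proof -
        obtain L where "L \<in> C" using C(1) by blast
        then show ?thesis using CA[of L] submoduleD(2)[of L R M] by blast
      qed
      show "v \<oplus>\<^bsub>M\<^esub> w \<in> \<Union>C" if vw: "v \<in> \<Union>C" "w \<in> \<Union>C" for v w
      proof -
        obtain L L' where L: "L \<in> C" "L' \<in> C" "v \<in> L" "w \<in> L'" using vw by blast
        then have "v \<in> L' \<or> w \<in> L" using lin[of L L'] by blast
        then show ?thesis
        proof
          assume "v \<in> L'"
          then show ?thesis using L CA[of L'] submoduleD(3)[of L' R M v w] by blast
        next
          assume "w \<in> L"
          then show ?thesis using L CA[of L] submoduleD(3)[of L R M v w] by blast
        qed
      qed
      show "a \<odot>\<^bsub>M\<^esub> v \<in> \<Union>C" if av: "a \<in> carrier R" "v \<in> \<Union>C" for a v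
      proof -
        obtain L where "L \<in> C" "v \<in> L" using av(2) by blast
        then show ?thesis using CA[of L] submoduleD(4)[of L R M a v] av(1) by blast
      qed
    qed
    then show "\<Union>C \<in> A" using CA by (auto simp: A_def)
  qed
  then obtain L where L: "submodule L R M" "L \<subseteq> N" "u \<notin> L"
    and max: "\<And>S. submodule S R M \<Longrightarrow> S \<subseteq> N \<Longrightarrow> u \<notin> S \<Longrightarrow> L \<subseteq> S \<Longrightarrow> S = L" by (auto simp: A_def)
  let ?N = "M\<lparr>carrier := N\<rparr>"
  let ?Q = "quotient_module ?N L"
  have mN: "left_module R ?N" by (rule left_module_submodule[OF M N])
  have sL: "submodule L R ?N" by (rule submodule_of_submodule[OF M N L(1,2)])
  note q = quotient_add[OF mN sL] quotient_smult[OF mN sL] quotient_zero_iff[OF mN sL]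
  have "simple_left_module R ?Q"
    unfolding simple_left_module_def
  proof (intro conjI allI impI)
    show mQ: "left_module R ?Q" by (rule left_module_quotient[OF mN sL])
    show "carrier ?Q \<noteq> {\<zero>\<^bsub>?Q\<^esub>}"
      using q(3)[of u] uN L(3) by (auto simp: quotient_module_simps)
    fix S assume S: "submodule S R ?Q"
    \<comment> \<open>The preimage of \<open>S\<close>: if it contains \<open>u\<close> it is all of
      \<open>N\<close>, otherwise the maximality of \<open>L\<close> forces it to be
      \<open>L\<close>.\<close>
    define Y where "Y = {v \<in> N. L +>\<^bsub>?N\<^esub> v \<in> S}"
    have Y: "submodule Y R M"
    proof (rule left_submoduleI)
      show "Y \<subseteq> carrier M" using submoduleD(1)[OF N] by (auto simp: Y_def)
      show "\<zero>\<^bsub>M\<^esub> \<in> Y" using submoduleD(2)[OF N] submoduleD(2)[OF S] q(3)[of "\<zero>\<^bsub>M\<^esub>"] submoduleD(2)[OF L(1)]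
        by (auto simp: Y_def quotient_module_simps)
      show "v \<oplus>\<^bsub>M\<^esub> w \<in> Y" if "v \<in> Y" "w \<in> Y" for v w
        using that submoduleD(3)[OF N] submoduleD(3)[OF S, of "L +>\<^bsub>?N\<^esub> v" "L +>\<^bsub>?N\<^esub> w"] q(1)[of v w]
        by (auto simp: Y_def)
      show "a \<odot>\<^bsub>M\<^esub> v \<in> Y" if "a \<in> carrier R" "v \<in> Y" for a v
        using that submoduleD(4)[OF N] submoduleD(4)[OF S, of a "L +>\<^bsub>?N\<^esub> v"] q(2)[of a v]
        by (auto simp: Y_def)
    qed
    have LY: "L \<subseteq> Y"
    proof
      fix v assume "v \<in> L"
      then have "v \<in> N" "L +>\<^bsub>?N\<^esub> v = L" using q(3)[of v] L(2) by auto
      then show "v \<in> Y" using submoduleD(2)[OF S] by (simp add: Y_def quotient_module_simps)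
    qed
    have XY: "S = (\<lambda>v. L +>\<^bsub>?N\<^esub> v) ` Y"
      using submoduleD(1)[OF S] by (auto simp: Y_def quotient_module_simps)
    show "S = {\<zero>\<^bsub>?Q\<^esub>} \<or> S = carrier ?Q"
    proof (cases "u \<in> Y")
      case True
      then have "N \<subseteq> Y" using submoduleD(4)[OF Y] by (auto simp: N_def)
      then have "Y = N" unfolding Y_def by blast
      then have "S = carrier ?Q" unfolding quotient_module_simps using XY by simp
      then show ?thesis ..
    next
      case False
      have YN: "Y \<subseteq> N" by (auto simp: Y_def)
      have "Y = L" by (rule max[OF Y YN False LY])
      then have "S = (\<lambda>v. L +>\<^bsub>?N\<^esub> v) ` L" using XY by simp
      also have "\<dots> = (\<lambda>v. L) ` L" using q(3) L(2) by (intro image_cong) auto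
      also have "\<dots> = {L}" using submoduleD(2)[OF L(1)] by auto
      finally show ?thesis unfolding quotient_module_simps by (rule disjI1)
    qed
  qed
  then show thesis using that N L N_def by blast
qed

section \<open>Homomorphisms and isomorphisms of modules\<close>

lemma module_hom_setD:
  assumes "f \<in> module_hom_set R M N"
  shows "v \<in> carrier M \<Longrightarrow> f v \<in> carrier N"
    "v \<in> carrier M \<Longrightarrow> w \<in> carrier M \<Longrightarrow> f (v \<oplus>\<^bsub>M\<^esub> w) = f v \<oplus>\<^bsub>N\<^esub> f w"
    "a \<in> carrier R \<Longrightarrow> v \<in> carrier M \<Longrightarrow> f (a \<odot>\<^bsub>M\<^esub> v) = a \<odot>\<^bsub>N\<^esub> f v"
  using assms by (auto simp: module_hom_set_def)

lemma module_hom_zero: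
  assumes "left_module R M" "left_module R N" "f \<in> module_hom_set R M N"
  shows "f \<zero>\<^bsub>M\<^esub> = \<zero>\<^bsub>N\<^esub>"
proof -
  interpret M: left_module R M by fact
  interpret N: left_module R N by fact
  have "f (\<zero>\<^bsub>R\<^esub> \<odot>\<^bsub>M\<^esub> \<zero>\<^bsub>M\<^esub>) = \<zero>\<^bsub>R\<^esub> \<odot>\<^bsub>N\<^esub> f \<zero>\<^bsub>M\<^esub>"
    using module_hom_setD(3)[OF assms(3), of "\<zero>\<^bsub>R\<^esub>" "\<zero>\<^bsub>M\<^esub>"] by simp
  then show ?thesis using module_hom_setD(1)[OF assms(3), of "\<zero>\<^bsub>M\<^esub>"]
    by (simp add: M.smult_l_zero N.smult_l_zero)
qed

lemma module_hom_inv: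
  assumes f: "f \<in> module_hom_set R M N" "bij_betw f (carrier M) (carrier N)" and M: "left_module R M"
  shows "inv_into (carrier M) f \<in> module_hom_set R N M"
    "bij_betw (inv_into (carrier M) f) (carrier N) (carrier M)"
proof -
  interpret left_module R M by fact
  let ?g = "inv_into (carrier M) f"
  show bg: "bij_betw ?g (carrier N) (carrier M)" by (rule bij_betw_inv_into[OF f(2)])
  have gc: "?g v \<in> carrier M" and fg: "f (?g v) = v" if "v \<in> carrier N" for v
    using that bg f(2) by (auto simp: bij_betw_def f_inv_into_f inv_into_into)
  have gf: "?g (f v) = v" if "v \<in> carrier M" for v
    using that f(2) by (simp add: bij_betw_def)
  have "?g (v \<oplus>\<^bsub>N\<^esub> w) = ?g v \<oplus>\<^bsub>M\<^esub> ?g w" if "v \<in> carrier N" "w \<in> carrier N" for v w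
    using module_hom_setD(2)[OF f(1), of "?g v" "?g w"] gf[of "?g v \<oplus>\<^bsub>M\<^esub> ?g w"] that by (simp add: gc fg)
  moreover have "?g (a \<odot>\<^bsub>N\<^esub> v) = a \<odot>\<^bsub>M\<^esub> ?g v" if "a \<in> carrier R" "v \<in> carrier N" for a v
    using module_hom_setD(3)[OF f(1), of a "?g v"] gf[of "a \<odot>\<^bsub>M\<^esub> ?g v"] that by (simp add: gc fg smult_closed)
  ultimately show "?g \<in> module_hom_set R N M" by (simp add: module_hom_set_def gc)
qed

lemma module_isomorphic_sym:
  "left_module R M \<Longrightarrow> module_isomorphic R M N \<Longrightarrow> module_isomorphic R N M"
  unfolding module_isomorphic_def using module_hom_inv by blast

lemma module_isomorphic_trans:
  assumes "module_isomorphic R M N" "module_isomorphic R N P"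
  shows "module_isomorphic R M P"
proof -
  obtain f g where fg: "f \<in> module_hom_set R M N" "bij_betw f (carrier M) (carrier N)"
    "g \<in> module_hom_set R N P" "bij_betw g (carrier N) (carrier P)"
    using assms by (auto simp: module_isomorphic_def)
  then have "g \<circ> f \<in> module_hom_set R M P" by (auto simp: module_hom_set_def Pi_def)
  moreover have "bij_betw (g \<circ> f) (carrier M) (carrier P)" using fg by (blast intro: bij_betw_trans)
  ultimately show ?thesis by (auto simp: module_isomorphic_def)
qed

section \<open>Locally d_nilpotentotent and torsion-free parts\<close>

definition shift_H :: "'n \<Rightarrow> 'k \<Rightarrow> ('n, 'k::field_char_0) opr"
  where "shift_H i c p = H_op i p - scl c p"

lemma shift_H_eq: "shift_H i c = (\<lambda>p. H_op i p - scl c p)"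
  by (simp add: shift_H_def fun_eq_iff)

lemma shift_H_in_I_n [simp]: "shift_H i c \<in> carrier I_n"
  and shift_H_in_I_1 [simp]: "shift_H i c \<in> carrier (I_1 i)"
  by (simp_all add: shift_H_eq)

lemma shift_H_partial: "shift_H i c (partial_x i p) = partial_x i (shift_H i (c + 1) p)"
  by (simp add: shift_H_def H_partial scl.scale_left_distrib algebra_simps)

text \<open>From \<open>H \<partial> = \<partial> (H - 1)\<close>: each derivative lowers the
  eigenvalues of \<open>H\<close> by one.\<close>

lemma shift_H_partial_pow:
  "(shift_H i c ^^ k) ((partial_x i ^^ t) p) = (partial_x i ^^ t) ((shift_H i (c + of_nat t) ^^ k) p)"
proof -
  have *: "(shift_H i c ^^ k) (partial_x i p) = partial_x i ((shift_H i (c + 1) ^^ k) p)" for c p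
    by (induction k) (simp_all add: shift_H_partial)
  show ?thesis by (induction t arbitrary: c) (simp_all add: * add_ac)
qed

lemma shift_H_int: "shift_H i c (int_x i p) = int_x i (shift_H i (c - 1) p)"
  by (simp add: shift_H_def H_int scl.scale_left_diff_distrib algebra_simps)

lemma proj_shift_H: "proj_op i ((shift_H i c ^^ k) p) = scl ((1 - c) ^ k) (proj_op i p)"
proof (induction k)
  case (Suc k)
  have "proj_op i (shift_H i c q) = scl (1 - c) (proj_op i q)" for q
    by (simp add: shift_H_def scl.scale_left_diff_distrib)
  then show ?case using Suc by simp
qed simp

text \<open>Crossing \<open>\<partial>\<^sup>t\<close> shifts the eigenvalue by \<open>t\<close>,
  and to the right of \<open>proj_op i\<close> the operator \<open>H\<close> counts as 1. The scalar
  \<open>1 - c + t\<close> vanishes for at most one natural number \<open>t\<close>; the eventual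
  vanishing in weight modules and the treatment of non-integral orbits both rest on this.\<close>

lemma proj_partial_shift_H:
  "proj_op i ((partial_x i ^^ t) ((shift_H i c ^^ k) p)) = scl ((1 - c + of_nat t) ^ k) (proj_op i ((partial_x i ^^ t) p))"
  using shift_H_partial_pow[of k i "c - of_nat t" t p] proj_shift_H[of i k "c - of_nat t" "(partial_x i ^^ t) p"]
  by (simp add: algebra_simps)

lemma H_partial_pow: "(partial_x i ^^ t) (H_op i p) = H_op i ((partial_x i ^^ t) p) + scl (of_nat t) ((partial_x i ^^ t) p)"
  by (induction t) (simp_all add: H_partial scl.scale_left_distrib)

lemma I_1_commute:
  assumes "i \<noteq> j" "a \<in> carrier (I_1 i)" "b \<in> carrier (I_1 j)"
  shows "a \<circ> b = b \<circ> a"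
proof -
  \<comment> \<open>The element \<open>a\<close> is moved past single generators of the other
    subalgebra; the later induction over \<open>b\<close> then only uses the linearity of
    \<open>a\<close>.\<close>
  have *: "a (b p) = b (a p)" if "b \<in> gens j \<union> Set.range scl" for b p
    using assms(2)
  proof (induction a arbitrary: p rule: I_1_induct)
    case (scl c)
    then show ?case using that by (auto simp: mult.commute)
  next
    case mult_x
    from that consider "b = mult_x j" | "b = partial_x j" | "b = int_x j" | c where "b = scl c" by auto
    then show ?case by cases (simp_all add: gen_commute(6,7,8)[OF assms(1)])
  next
    case partial_x
    from that consider "b = mult_x j" | "b = partial_x j" | "b = int_x j" | c where "b = scl c" by auto
    then show ?case by cases (simp_all add: gen_commute(1)[OF assms(1)] gen_commute(2,6)[OF assms(1)[symmetric]])
  next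
    case int_x
    from that consider "b = mult_x j" | "b = partial_x j" | "b = int_x j" | c where "b = scl c" by auto
    then show ?case by cases (simp_all add: gen_commute(2,3)[OF assms(1)] gen_commute(7)[OF assms(1)[symmetric]])
  next
    case (comp a b)
    then show ?case by simp
  next
    case (add a b)
    then show ?case using that by (auto simp: scl.scale_right_distrib)
  qed
  have la: "lin a" using assms(2) by (intro lin_I_n I_1_le_I_n)
  have "a (b p) = b (a p)" for p
    using assms(3)
    by (induction b arbitrary: p rule: I_1_induct) (auto simp: * lin_add[OF la])
  then show ?thesis by (simp add: fun_eq_iff)
qed

locale In_module = left_module "I_n :: ('n::finite, 'k::field_char_0) opr ring" M
  for M :: "(('n::finite, 'k::field_char_0) opr, 'm) module"
begin

abbreviation act :: "('n, 'k) opr \<Rightarrow> 'm \<Rightarrow> 'm" (infixr "\<star>" 75)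
  where "a \<star> v \<equiv> a \<odot>\<^bsub>M\<^esub> v"

abbreviation V where "V \<equiv> carrier M"

lemma act_closed [simp]: "a \<in> carrier I_n \<Longrightarrow> v \<in> V \<Longrightarrow> a \<star> v \<in> V"
  by (rule smult_closed)

lemma act_comp: "a \<in> carrier I_n \<Longrightarrow> b \<in> carrier I_n \<Longrightarrow> v \<in> V \<Longrightarrow> a \<star> b \<star> v = (a \<circ> b) \<star> v"
  using smult_assoc[of a b v] by simp

lemma act_id [simp]: "v \<in> V \<Longrightarrow> id \<star> v = v"
  using smult_one by simp

lemma act_add: "a \<in> carrier I_n \<Longrightarrow> b \<in> carrier I_n \<Longrightarrow> v \<in> V \<Longrightarrow> (\<lambda>p. a p + b p) \<star> v = a \<star> v \<oplus>\<^bsub>M\<^esub> b \<star> v"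
  using smult_l_distr[of a b v] by simp

lemma act_0 [simp]: "v \<in> V \<Longrightarrow> (\<lambda>p. 0) \<star> v = \<zero>\<^bsub>M\<^esub>"
  using smult_l_zero[of v] by simp

lemma act_zero [simp]: "a \<in> carrier I_n \<Longrightarrow> a \<star> \<zero>\<^bsub>M\<^esub> = \<zero>\<^bsub>M\<^esub>"
  by (rule smult_r_zero)

lemma act_diff:
  assumes "a \<in> carrier I_n" "b \<in> carrier I_n" "v \<in> V"
  shows "(\<lambda>p. a p - b p) \<star> v = a \<star> v \<ominus>\<^bsub>M\<^esub> b \<star> v"
proof -
  have "a \<star> v = (\<lambda>p. a p - b p) \<star> v \<oplus>\<^bsub>M\<^esub> b \<star> v"
    using act_add[of "\<lambda>p. a p - b p" b v] assms by simp
  then show ?thesis using assms by (simp add: a_minus_def M.a_assoc M.r_neg)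
qed

lemma act_commute:
  assumes "a \<circ> b = c \<circ> d" "a \<in> carrier I_n" "b \<in> carrier I_n" "c \<in> carrier I_n" "d \<in> carrier I_n" "v \<in> V"
  shows "a \<star> b \<star> v = c \<star> d \<star> v"
  using assms by (simp add: act_comp)

lemma act_scl_zero:
  assumes "scl c \<star> v = \<zero>\<^bsub>M\<^esub>" "c \<noteq> 0" "v \<in> V"
  shows "v = \<zero>\<^bsub>M\<^esub>"
proof -
  have "scl (1 / c) \<circ> scl c = (id :: ('n, 'k) opr)" using assms(2) by (auto simp: fun_eq_iff)
  then have "scl (1 / c) \<star> scl c \<star> v = v" using assms(3) by (simp add: act_comp)
  then show ?thesis using assms(1) by simp
qed

lemma act_pow_zero_mono:
  assumes "(a ^^ k) \<star> v = \<zero>\<^bsub>M\<^esub>" "k \<le> m" "a \<in> carrier I_n" "v \<in> V"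
  shows "(a ^^ m) \<star> v = \<zero>\<^bsub>M\<^esub>"
proof -
  have "a ^^ m = (a ^^ (m - k)) \<circ> (a ^^ k)" using assms(2) by (simp add: funpow_add[symmetric])
  then have "(a ^^ m) \<star> v = (a ^^ (m - k)) \<star> (a ^^ k) \<star> v" using assms(3,4) by (simp add: act_comp)
  then show ?thesis using assms by simp
qed

end

section \<open>Vectors nilpotent under a derivative and vectors killed by F\<close>

definition d_nilpotent :: "(('n::finite, 'k::field_char_0) opr, 'm) module \<Rightarrow> 'n \<Rightarrow> 'm \<Rightarrow> bool"
  where "d_nilpotent M i v \<longleftrightarrow> (\<exists>k. (partial_x i ^^ k) \<odot>\<^bsub>M\<^esub> v = \<zero>\<^bsub>M\<^esub>)"

text \<open>\<open>F_killed M i v\<close> says that the ideal \<open>F\<close> of \<open>\<I>\<^sub>1(i)\<close>, which is spanned by the operators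
  \<open>\<integral>\<^sup>s (1 - \<integral> \<partial>) \<partial>\<^sup>t\<close>, annihilates \<open>v\<close>.\<close>

definition F_killed :: "(('n::finite, 'k::field_char_0) opr, 'm) module \<Rightarrow> 'n \<Rightarrow> 'm \<Rightarrow> bool"
  where "F_killed M i v \<longleftrightarrow> (\<forall>t. (proj_op i \<circ> (partial_x i ^^ t)) \<odot>\<^bsub>M\<^esub> v = \<zero>\<^bsub>M\<^esub>)"

context In_module
begin

lemma minus_zero_iff: "v \<in> V \<Longrightarrow> w \<in> V \<Longrightarrow> v \<ominus>\<^bsub>M\<^esub> w = \<zero>\<^bsub>M\<^esub> \<longleftrightarrow> v = w"
  by (metis M.minus_eq M.a_inv_closed M.minus_equality M.minus_minus M.r_neg)

lemma d_nilpotent_zero [simp]: "d_nilpotent M i \<zero>\<^bsub>M\<^esub>" and F_killed_zero [simp]: "F_killed M i \<zero>\<^bsub>M\<^esub>"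
  by (auto simp: d_nilpotent_def F_killed_def)

lemma d_nilpotent_add:
  assumes "d_nilpotent M i v" "d_nilpotent M i w" "v \<in> V" "w \<in> V"
  shows "d_nilpotent M i (v \<oplus>\<^bsub>M\<^esub> w)"
proof -
  obtain k l where "(partial_x i ^^ k) \<star> v = \<zero>\<^bsub>M\<^esub>" "(partial_x i ^^ l) \<star> w = \<zero>\<^bsub>M\<^esub>"
    using assms by (auto simp: d_nilpotent_def)
  then have "(partial_x i ^^ max k l) \<star> v = \<zero>\<^bsub>M\<^esub>" "(partial_x i ^^ max k l) \<star> w = \<zero>\<^bsub>M\<^esub>"
    using assms(3,4) by (auto elim!: act_pow_zero_mono)
  then have "(partial_x i ^^ max k l) \<star> (v \<oplus>\<^bsub>M\<^esub> w) = \<zero>\<^bsub>M\<^esub>"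
    using assms(3,4) by (simp add: smult_r_distr)
  then show ?thesis by (auto simp: d_nilpotent_def)
qed

lemma F_killed_add:
  assumes "F_killed M i v" "F_killed M i w" "v \<in> V" "w \<in> V"
  shows "F_killed M i (v \<oplus>\<^bsub>M\<^esub> w)"
  using assms by (simp add: F_killed_def smult_r_distr)

text \<open>The slack \<open>m\<close> is there for the integration, which uses up one derivative:
  \<open>\<partial>\<^sup>k\<^sup>+\<^sup>1 \<integral> = \<partial>\<^sup>k\<close>. The factor
  \<open>b k\<close> depends on \<open>k\<close> because \<open>H\<close> turns into
  \<open>H + k\<close> on crossing \<open>\<partial>\<^sup>k\<close>.\<close>

lemma d_nilpotent_act_commuting:
  assumes "d_nilpotent M i v" "v \<in> V" "a \<in> carrier I_n"
    and "\<And>k. (partial_x i ^^ (k + m)) \<circ> a = (b k) \<circ> (partial_x i ^^ k)" "\<And>k. b k \<in> carrier I_n"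
  shows "d_nilpotent M i (a \<star> v)"
proof -
  obtain k where k: "(partial_x i ^^ k) \<star> v = \<zero>\<^bsub>M\<^esub>" using assms(1) by (auto simp: d_nilpotent_def)
  have "(partial_x i ^^ (k + m)) \<star> a \<star> v = b k \<star> (partial_x i ^^ k) \<star> v"
    by (rule act_commute) (use assms in auto)
  then show ?thesis using k assms(5)[of k] unfolding d_nilpotent_def by auto
qed

lemma d_nilpotent_H: "d_nilpotent M i v \<Longrightarrow> v \<in> V \<Longrightarrow> d_nilpotent M i (H_op i \<star> v)"
  by (rule d_nilpotent_act_commuting[where m=0 and b="\<lambda>k p. H_op i p + scl (of_nat k) p" and a="H_op i"])
     (auto simp: fun_eq_iff H_partial_pow)

lemma d_nilpotent_int: "d_nilpotent M i v \<Longrightarrow> v \<in> V \<Longrightarrow> d_nilpotent M i (int_x i \<star> v)"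
  by (rule d_nilpotent_act_commuting[where m=1 and b="\<lambda>k. id" and a="int_x i"])
     (auto simp: fun_eq_iff funpow_Suc_right simp del: funpow.simps)

lemma d_nilpotent_other:
  assumes "i \<noteq> j" "a \<in> carrier (I_1 j)" "d_nilpotent M i v" "v \<in> V"
  shows "d_nilpotent M i (a \<star> v)"
  by (rule d_nilpotent_act_commuting[where m=0 and b="\<lambda>k. a" and a=a])
     (use assms I_1_commute[OF assms(1) _ assms(2)] in \<open>auto intro: I_1_le_I_n\<close>)

lemma d_nilpotent_partial: "d_nilpotent M i v \<Longrightarrow> v \<in> V \<Longrightarrow> d_nilpotent M i (partial_x i \<star> v)"
  by (rule d_nilpotent_act_commuting[where m=0 and b="\<lambda>k. partial_x i" and a="partial_x i"])
     (auto simp: fun_eq_iff funpow_swap1)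

lemma d_nilpotent_act:
  assumes "a \<in> carrier I_n" "d_nilpotent M i v" "v \<in> V"
  shows "d_nilpotent M i (a \<star> v)"
  using assms
proof (induction a arbitrary: v rule: I_n_induct)
  case (scl c)
  have "(partial_x i ^^ k) \<circ> scl c = scl c \<circ> (partial_x i ^^ k)" for k
    by (induction k) (auto simp: fun_eq_iff)
  then show ?case
    by (intro d_nilpotent_act_commuting[where m=0 and b="\<lambda>k. scl c" and a="scl c"]) (use scl in auto)
next
  case (mult_x j)
  have "mult_x j = (int_x j \<circ> H_op j :: ('n, 'k) opr)" by (auto simp: fun_eq_iff mult_x_eq)
  then have "mult_x j \<star> v = int_x j \<star> H_op j \<star> v" using mult_x by (simp add: act_comp)
  then show ?case
    using mult_x by (cases "i = j") (simp_all add: d_nilpotent_H d_nilpotent_int d_nilpotent_other I_1_le_I_n)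
next
  case (partial_x j)
  then show ?case by (cases "i = j") (auto simp: d_nilpotent_partial d_nilpotent_other)
next
  case (int_x j)
  then show ?case by (cases "i = j") (auto simp: d_nilpotent_int d_nilpotent_other)
next
  case (comp a b)
  then show ?case unfolding act_comp[OF comp.hyps comp.prems(2), symmetric] by simp
next
  case (add a b)
  then show ?case by (simp add: act_add d_nilpotent_add)
qed

text \<open>This is the two-sidedness of F:
  \<open>(1 - \<integral> \<partial>) \<partial>\<^sup>t\<close> times a generator is a left
  multiple of some \<open>(1 - \<integral> \<partial>) \<partial>\<^sup>s\<close>. As
  \<open>s\<close> may differ from \<open>t\<close>, the condition \<open>F_killed\<close> has to
  range over all \<open>t\<close> at once.\<close>

lemma F_killed_act_commuting:
  assumes "F_killed M i v" "v \<in> V" "a \<in> carrier I_n"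
    and "\<And>t. \<exists>b\<in>carrier I_n. \<exists>s. proj_op i \<circ> (partial_x i ^^ t) \<circ> a = b \<circ> (proj_op i \<circ> (partial_x i ^^ s))"
  shows "F_killed M i (a \<star> v)"
  unfolding F_killed_def
proof
  fix t
  obtain b s where b: "b \<in> carrier I_n" "proj_op i \<circ> (partial_x i ^^ t) \<circ> a = b \<circ> (proj_op i \<circ> (partial_x i ^^ s))"
    using assms(4) by blast
  have "(proj_op i \<circ> (partial_x i ^^ t)) \<star> a \<star> v = b \<star> (proj_op i \<circ> (partial_x i ^^ s)) \<star> v"
    by (rule act_commute[OF b(2)]) (use assms b in auto)
  then show "(proj_op i \<circ> (partial_x i ^^ t)) \<star> a \<star> v = \<zero>\<^bsub>M\<^esub>"
    using assms(1) b by (simp add: F_killed_def)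
qed

lemma F_killed_act_self:
  assumes "F_killed M i v" "v \<in> V"
  shows "F_killed M i (partial_x i \<star> v)" "F_killed M i (int_x i \<star> v)" "F_killed M i (H_op i \<star> v)"
proof -
  show "F_killed M i (partial_x i \<star> v)"
  proof (rule F_killed_act_commuting[OF assms])
    fix t show "\<exists>b\<in>carrier I_n. \<exists>s. proj_op i \<circ> (partial_x i ^^ t) \<circ> partial_x i = b \<circ> (proj_op i \<circ> (partial_x i ^^ s))"
      by (intro bexI[of _ id] exI[of _ "Suc t"]) (auto simp: fun_eq_iff funpow_swap1)
  qed simp
  show "F_killed M i (int_x i \<star> v)"
  proof (rule F_killed_act_commuting[OF assms])
    fix t show "\<exists>b\<in>carrier I_n. \<exists>s. proj_op i \<circ> (partial_x i ^^ t) \<circ> int_x i = b \<circ> (proj_op i \<circ> (partial_x i ^^ s))"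
    proof (cases t)
      case 0
      \<comment> \<open>Here \<open>(1 - \<integral> \<partial>) \<integral> = 0\<close>, because
        \<open>\<partial> \<integral> = 1\<close>.\<close>
      then show ?thesis by (intro bexI[of _ "\<lambda>p. 0"]) (auto simp: fun_eq_iff)
    next
      case (Suc s)
      then show ?thesis
        by (intro bexI[of _ id] exI[of _ s]) (auto simp: fun_eq_iff funpow_Suc_right simp del: funpow.simps)
    qed
  qed simp
  show "F_killed M i (H_op i \<star> v)"
  proof (rule F_killed_act_commuting[OF assms])
    fix t show "\<exists>b\<in>carrier I_n. \<exists>s. proj_op i \<circ> (partial_x i ^^ t) \<circ> H_op i = b \<circ> (proj_op i \<circ> (partial_x i ^^ s))"
      by (intro bexI[of _ "scl (1 + of_nat t)"] exI[of _ t])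
         (auto simp: fun_eq_iff H_partial_pow scl.scale_left_distrib)
  qed simp
qed

lemma F_killed_other:
  assumes "i \<noteq> j" "a \<in> carrier (I_1 j)" "F_killed M i v" "v \<in> V"
  shows "F_killed M i (a \<star> v)"
proof (rule F_killed_act_commuting[OF assms(3,4)])
  fix t
  have "proj_op i \<circ> (partial_x i ^^ t) \<circ> a = a \<circ> (proj_op i \<circ> (partial_x i ^^ t))"
    by (rule I_1_commute[OF assms(1) _ assms(2)]) simp
  then show "\<exists>b\<in>carrier I_n. \<exists>s. proj_op i \<circ> (partial_x i ^^ t) \<circ> a = b \<circ> (proj_op i \<circ> (partial_x i ^^ s))"
    using I_1_le_I_n[OF assms(2)] by blast
qed (rule I_1_le_I_n[OF assms(2)])

lemma F_killed_act:
  assumes "a \<in> carrier I_n" "F_killed M i v" "v \<in> V"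
  shows "F_killed M i (a \<star> v)"
  using assms
proof (induction a arbitrary: v rule: I_n_induct)
  case (scl c)
  have "(partial_x i ^^ t) (scl c p) = scl c ((partial_x i ^^ t) p)" for t and p :: "('n, 'k) pol"
    by (induction t) auto
  then have "proj_op i \<circ> (partial_x i ^^ t) \<circ> scl c = scl c \<circ> (proj_op i \<circ> (partial_x i ^^ t))" for t
    by (auto simp: fun_eq_iff)
  then show ?case using scl by (intro F_killed_act_commuting) (auto intro!: bexI[of _ "scl c"])
next
  case (mult_x j)
  have "mult_x j = (int_x j \<circ> H_op j :: ('n, 'k) opr)" by (auto simp: fun_eq_iff mult_x_eq)
  then have "mult_x j \<star> v = int_x j \<star> H_op j \<star> v" using mult_x by (simp add: act_comp)
  then show ?case
    using mult_x by (cases "i = j") (simp_all add: F_killed_act_self F_killed_other I_1_le_I_n)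
next
  case (partial_x j)
  then show ?case by (cases "i = j") (auto simp: F_killed_act_self F_killed_other)
next
  case (int_x j)
  then show ?case by (cases "i = j") (auto simp: F_killed_act_self F_killed_other)
next
  case (comp a b)
  then show ?case unfolding act_comp[OF comp.hyps comp.prems(2), symmetric] by simp
next
  case (add a b)
  then show ?case by (simp add: act_add F_killed_add)
qed

lemma int_partial_act:
  assumes "v \<in> V" "(proj_op i) \<star> v = \<zero>\<^bsub>M\<^esub>"
  shows "int_x i \<star> partial_x i \<star> v = v"
proof -
  have "proj_op i \<star> v = v \<ominus>\<^bsub>M\<^esub> (int_x i \<circ> partial_x i) \<star> v"
    using act_diff[of id "int_x i \<circ> partial_x i" v] assms(1) by (simp add: proj_op_eq)
  then have "v \<ominus>\<^bsub>M\<^esub> (int_x i \<circ> partial_x i) \<star> v = \<zero>\<^bsub>M\<^esub>" using assms(2) by simp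
  then have "v = (int_x i \<circ> partial_x i) \<star> v" using assms(1) by (simp add: minus_zero_iff)
  then show ?thesis using assms(1) by (simp add: act_comp)
qed

text \<open>From \<open>(1 - \<integral> \<partial>) \<partial>\<^sup>k v = 0\<close> follows
  \<open>\<partial>\<^sup>k v = \<integral> \<partial>\<^sup>k\<^sup>+\<^sup>1 v\<close>, so the
  vanishing of one power of \<partial> descends step by step to \<open>v\<close> itself. Uniqueness
  of the splitting and the absence of homomorphisms between blocks both come down to this.\<close>

lemma d_nilpotent_F_killed_zero:
  assumes "d_nilpotent M i v" "F_killed M i v" "v \<in> V"
  shows "v = \<zero>\<^bsub>M\<^esub>"
proof -
  obtain k where k: "(partial_x i ^^ k) \<star> v = \<zero>\<^bsub>M\<^esub>" using assms(1) by (auto simp: d_nilpotent_def)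
  then show ?thesis
  proof (induction k)
    case 0
    then show ?case using assms(3) by (simp add: id_def[symmetric])
  next
    case (Suc k)
    let ?w = "(partial_x i ^^ k) \<star> v"
    have "proj_op i \<star> ?w = \<zero>\<^bsub>M\<^esub>" using assms(2,3) by (auto simp: F_killed_def act_comp)
    then have "int_x i \<star> partial_x i \<star> ?w = ?w" using assms(3) by (intro int_partial_act) auto
    moreover have "partial_x i \<star> ?w = (partial_x i ^^ Suc k) \<star> v"
      using assms(3) by (simp only: act_comp gens_in_I_n I_n_closed funpow.simps(2))
    ultimately have "?w = \<zero>\<^bsub>M\<^esub>" unfolding Suc.prems by simp
    then show ?case by (rule Suc.IH)
  qed
qed

text \<open>With \<open>b = \<integral>\<^sup>K \<partial>\<^sup>K\<close> and
  \<open>a = 1 - b\<close>, the relation \<open>\<partial>\<^sup>K \<integral>\<^sup>K = 1\<close>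
  gives \<open>\<partial>\<^sup>K a = 0\<close>. For \<open>t < K\<close> the operator
  \<open>\<partial>\<^sup>t b\<close> begins with an integration, which
  \<open>1 - \<integral> \<partial>\<close> kills; for \<open>t \<ge> K\<close> one has
  \<open>\<partial>\<^sup>t b = \<partial>\<^sup>t\<close> and the hypothesis applies. The
  components are given as images under \<open>a\<close> and \<open>b\<close> so that they stay in
  every submodule containing \<open>v\<close>.\<close>

lemma d_nilpotent_F_killed_decomposition:
  assumes "v \<in> V" "\<And>t. t \<ge> K \<Longrightarrow> (proj_op i \<circ> (partial_x i ^^ t)) \<star> v = \<zero>\<^bsub>M\<^esub>"
  obtains a b where "a \<in> carrier I_n" "b \<in> carrier I_n" "d_nilpotent M i (a \<star> v)" "F_killed M i (b \<star> v)" "v = a \<star> v \<oplus>\<^bsub>M\<^esub> b \<star> v"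
proof
  let ?b = "(int_x i ^^ K) \<circ> (partial_x i ^^ K) :: ('n, 'k) opr"
    and ?a = "\<lambda>p. id p - ((int_x i ^^ K) \<circ> (partial_x i ^^ K) :: ('n, 'k) opr) p"
  have b: "?b \<in> carrier I_n" by simp
  have a: "?a \<in> carrier I_n" by (rule I_n_closed(6)[OF I_n_closed(2) b])
  then show "?a \<in> carrier I_n" .
  show "?b \<in> carrier I_n" by (rule b)
  note ab = a b
  have di: "(partial_x i ^^ m) ((int_x i ^^ m) p) = p" for m and p :: "('n, 'k) pol"
    by (induction m arbitrary: p) (simp_all add: funpow_swap1[of "partial_x i"])
  have ld: "(partial_x i ^^ m) (p - q) = (partial_x i ^^ m) p - (partial_x i ^^ m) q" for m and p q :: "('n, 'k) pol"
    by (induction m) simp_all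
  have "(partial_x i ^^ K) \<circ> ?a = (\<lambda>p. 0)" by (simp add: fun_eq_iff ld di)
  then have "(partial_x i ^^ K) \<star> ?a \<star> v = \<zero>\<^bsub>M\<^esub>" using assms(1) ab by (simp only: act_comp gens_in_I_n I_n_closed act_0)
  then show "d_nilpotent M i (?a \<star> v)" by (auto simp: d_nilpotent_def)
  show "F_killed M i (?b \<star> v)" unfolding F_killed_def
  proof
    fix t
    show "(proj_op i \<circ> (partial_x i ^^ t)) \<star> ?b \<star> v = \<zero>\<^bsub>M\<^esub>"
    proof (cases "t < K")
      case True
      define m where "m = K - t - 1"
      have K: "K = t + Suc m" using True by (simp add: m_def)
      have "(partial_x i ^^ t) ((int_x i ^^ K) p) = int_x i ((int_x i ^^ m) p)" for p :: "('n, 'k) pol"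
        unfolding K by (simp only: funpow_add o_apply di) simp
      then have "proj_op i \<circ> (partial_x i ^^ t) \<circ> ?b = (\<lambda>p. 0)" by (simp add: fun_eq_iff)
      then show ?thesis using assms(1) ab by (simp only: act_comp gens_in_I_n I_n_closed act_0)
    next
      case False
      define m where "m = t - K"
      have t: "t = m + K" using False by (simp add: m_def)
      have "(partial_x i ^^ t) ((int_x i ^^ K) p) = (partial_x i ^^ m) p" for p :: "('n, 'k) pol"
        unfolding t by (simp only: funpow_add o_apply di)
      then have "proj_op i \<circ> (partial_x i ^^ t) \<circ> ?b = proj_op i \<circ> (partial_x i ^^ t)"
        by (simp add: fun_eq_iff t funpow_add)
      then show ?thesis using assms(1) ab assms(2)[of t] False by (simp only: act_comp gens_in_I_n I_n_closed)
    qed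
  qed
  have "(\<lambda>p. ?a p + ?b p) = id" by (simp add: fun_eq_iff)
  then show "v = ?a \<star> v \<oplus>\<^bsub>M\<^esub> ?b \<star> v"
    using act_add[OF ab assms(1)] act_id[OF assms(1)] by argo
qed

end

lemma proj_partial_in_I_n: "proj_op i \<circ> (partial_x i ^^ t) \<in> carrier I_n"
  by (intro I_n_closed gens_in_I_n)

lemma internal_direct_sumD:
  assumes "internal_direct_sum M I A"
  shows "i \<in> I \<Longrightarrow> subgroup (A i) (add_monoid M)"
    "v \<in> carrier M \<Longrightarrow> \<exists>!f. f \<in> (\<Pi>\<^sub>E i\<in>I. A i) \<and> finite {i\<in>I. f i \<noteq> \<zero>\<^bsub>M\<^esub>} \<and>
       v = finsum M f {i\<in>I. f i \<noteq> \<zero>\<^bsub>M\<^esub>}"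
  using assms by (auto simp: internal_direct_sum_def)

lemma (in abelian_group) finsum_in_subgroup:
  assumes "subgroup H (add_monoid G)" "f \<in> A \<rightarrow> H"
  shows "finsum G f A \<in> H"
proof -
  interpret additive_subgroup H G by (rule additive_subgroupI) fact
  have "f \<in> A \<rightarrow> H \<Longrightarrow> finsum G f A \<in> H"
    by (induction A rule: infinite_finite_induct) (auto simp: finsum_insert Pi_def)
  then show ?thesis using assms(2) .
qed

context In_module
begin

text \<open>The direct sum inside a submodule is formed with the sums of the restricted record;
  these agree with the sums of \<open>M\<close>.\<close>

lemma finsum_submodule:
  assumes "submodule N I_n M" "f \<in> A \<rightarrow> N"
  shows "finsum (M\<lparr>carrier := N\<rparr>) f A = finsum M f A"
proof -
  interpret N: left_module I_n "M\<lparr>carrier := N\<rparr>"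
    by (rule left_module_submodule[OF left_module_axioms assms(1)])
  note NM = submoduleD[OF assms(1)]
  show ?thesis using assms(2)
  proof (induction A rule: infinite_finite_induct)
    case (insert i A)
    then have "f \<in> A \<rightarrow> V" "f i \<in> V" using NM(1) by auto
    then show ?case using insert by (subst N.M.finsum_insert) (auto simp: M.finsum_insert)
  qed auto
qed

end

section \<open>Generalized weight modules\<close>

text \<open>The bridge from powers of the maximal ideal to powers of the single operators
  \<open>H\<^sub>i - \<nu>\<^sub>i\<close>, in which all later computations take place. A product of
  ideals contains the products of their elements.\<close>

lemma shift_H_pow_in_max_ideal_power: "(shift_H i (\<nu> i) ^^ k) \<in> max_ideal_power \<nu> k"
proof -
  have S: "Set.range H_op \<subseteq> {f. lin f}" by (auto simp: lin_H_op)
  interpret D: ring D_n unfolding D_n_def by (rule ring_subalgebra[OF S])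
  have c: "carrier D_n = alg (Set.range H_op)" and m: "monoid.mult D_n = (\<circ>)" by (simp_all add: D_n_def)
  have "(\<lambda>p. H_op j p - scl (\<nu> j) p) \<in> carrier D_n" for j
    unfolding c by (intro alg_diff alg_gen alg_scl) auto
  then have "Set.range (\<lambda>j p. H_op j p - scl (\<nu> j) p) \<subseteq> carrier D_n" by blast
  from D.genideal_self[OF this] have *: "shift_H i (\<nu> i) \<in> max_ideal \<nu>"
    unfolding max_ideal_def shift_H_eq by blast
  show ?thesis
  proof (induction k)
    case 0
    then show ?case using alg_id[of "Set.range H_op"] by (simp add: max_ideal_power_def c id_def)
  next
    case (Suc k)
    have 1: "max_ideal_power \<nu> (Suc k) = ideal_prod D_n (max_ideal \<nu>) (max_ideal_power \<nu> k)"
      by (simp add: max_ideal_power_def)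
    have 2: "shift_H i (\<nu> i) ^^ Suc k = shift_H i (\<nu> i) \<otimes>\<^bsub>D_n\<^esub> (shift_H i (\<nu> i) ^^ k)"
      unfolding m by (rule funpow.simps(2))
    show ?case unfolding 1 2 by (rule ideal_prod.prod[OF * Suc])
  qed
qed

text \<open>The coordinatewise form of lying in a weight space; the exponent may depend on the
  coordinate.\<close>

definition weight_vec :: "(('n::finite, 'k::field_char_0) opr, 'm) module \<Rightarrow> ('n \<Rightarrow> 'k) \<Rightarrow> 'm \<Rightarrow> bool"
  where "weight_vec M \<nu> v \<longleftrightarrow> v \<in> carrier M \<and> (\<forall>i. \<exists>k. (shift_H i (\<nu> i) ^^ k) \<odot>\<^bsub>M\<^esub> v = \<zero>\<^bsub>M\<^esub>)"

lemma weight_space_weight_vec: "v \<in> weight_space M \<nu> \<Longrightarrow> weight_vec M \<nu> v"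
  unfolding weight_space_def weight_vec_def using shift_H_pow_in_max_ideal_power by blast

lemma weight_space_submodule:
  "N \<subseteq> carrier M \<Longrightarrow> weight_space (M\<lparr>carrier := N\<rparr>) \<nu> = weight_space M \<nu> \<inter> N"
  by (auto simp: weight_space_def)

text \<open>The weight decomposition in the form in which it is applied: a property closed under
  addition is checked on weight vectors. A nonzero component has its weight in the support, hence in
  the orbit.\<close>

lemma GW_induct [consumes 2, case_names zero weight add]:
  assumes "GW \<O> M" "v \<in> carrier M"
    and zero: "P \<zero>\<^bsub>M\<^esub>"
    and weight: "\<And>v \<nu>. \<nu> \<in> \<O> \<Longrightarrow> weight_vec M \<nu> v \<Longrightarrow> P v"
    and add: "\<And>v w. v \<in> carrier M \<Longrightarrow> w \<in> carrier M \<Longrightarrow> P v \<Longrightarrow> P w \<Longrightarrow> P (v \<oplus>\<^bsub>M\<^esub> w)"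
  shows "P v"
proof -
  have ds: "internal_direct_sum M UNIV (weight_space M)" and sp: "Supp M \<subseteq> \<O>" and lm: "left_module I_n M"
    using assms(1) by (auto simp: GW_def generalized_weight_def)
  interpret left_module I_n M by (rule lm)
  obtain f where f: "f \<in> (\<Pi>\<^sub>E i\<in>UNIV. weight_space M i)" "finite {i\<in>UNIV. f i \<noteq> \<zero>\<^bsub>M\<^esub>}"
    "v = finsum M f {i\<in>UNIV. f i \<noteq> \<zero>\<^bsub>M\<^esub>}"
    using internal_direct_sumD(2)[OF ds assms(2)] by blast
  have Pf: "P (f \<nu>)" and fc: "f \<nu> \<in> carrier M" for \<nu>
  proof -
    have w: "f \<nu> \<in> weight_space M \<nu>" using f(1) by auto
    then show "f \<nu> \<in> carrier M" by (simp add: weight_space_def)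
    show "P (f \<nu>)"
    proof (cases "f \<nu> = \<zero>\<^bsub>M\<^esub>")
      case True
      show ?thesis unfolding True by (rule assms(3))
    next
      case False
      then have "weight_space M \<nu> \<noteq> {\<zero>\<^bsub>M\<^esub>}" using w by auto
      then have "\<nu> \<in> \<O>" using sp by (auto simp: Supp_def)
      then show ?thesis using weight weight_space_weight_vec[OF w] by blast
    qed
  qed
  have "P (finsum M f S)" if "finite S" for S
    using that
  proof (induction S)
    case (insert s S)
    then have "finsum M f (insert s S) = f s \<oplus>\<^bsub>M\<^esub> finsum M f S"
      by (intro M.finsum_insert) (auto simp: fc)
    then show ?case using insert Pf fc by (simp add: add M.finsum_closed Pi_def)
  qed (simp add: assms(3))
  then show ?thesis using f by simp
qed

lemma shift_H_pow_commute: "(shift_H i c ^^ k) \<circ> (shift_H j d ^^ l) = (shift_H j d ^^ l) \<circ> (shift_H i c ^^ k)"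
proof -
  have 1: "shift_H i c (shift_H j d p) = shift_H j d (shift_H i c p)" for p
    by (simp add: shift_H_def scl.scale_right_diff_distrib mult.commute H_commute[of i j])
  have 2: "(shift_H i c ^^ k) (shift_H j d p) = shift_H j d ((shift_H i c ^^ k) p)" for p
    by (induction k arbitrary: p) (simp_all add: 1)
  have "(shift_H i c ^^ k) ((shift_H j d ^^ l) p) = (shift_H j d ^^ l) ((shift_H i c ^^ k) p)" for p
    by (induction l arbitrary: p) (simp_all add: 2)
  then show ?thesis by (simp add: fun_eq_iff)
qed

text \<open>A list of eigenvalues rather than one power, since the components of a sum of weight
  vectors may belong to different eigenvalues of \<open>H\<^sub>i\<close>.\<close>

primrec shift_prod :: "'n \<Rightarrow> 'k list \<Rightarrow> ('n, 'k::field_char_0) opr" where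
  "shift_prod i [] p = p"
| "shift_prod i (c # cs) p = shift_H i c (shift_prod i cs p)"

lemma shift_prod_Nil: "shift_prod i [] = id"
  and shift_prod_Cons: "shift_prod i (c # cs) = shift_H i c \<circ> shift_prod i cs"
  by (simp_all add: fun_eq_iff)

lemma shift_prod_append: "shift_prod i (cs @ ds) = shift_prod i cs \<circ> shift_prod i ds"
proof -
  have "shift_prod i (cs @ ds) p = shift_prod i cs (shift_prod i ds p)" for p by (induction cs) simp_all
  then show ?thesis by (simp add: fun_eq_iff)
qed

lemma shift_prod_in_I_n: "shift_prod i cs \<in> carrier I_n"
  unfolding carrier_I_n[symmetric]
proof (induction cs)
  case Nil
  show ?case unfolding shift_prod_Nil by (rule I_n_closed(2))
next
  case (Cons c cs)
  show ?case unfolding shift_prod_Cons by (rule I_n_closed(4)[OF shift_H_in_I_n Cons])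
qed

lemma shift_prod_shift_H: "shift_prod i cs (shift_H j d p) = shift_H j d (shift_prod i cs p)"
proof -
  have "shift_H i c (shift_H j d p) = shift_H j d (shift_H i c p)" for c p
    by (simp add: shift_H_def scl.scale_right_diff_distrib mult.commute H_commute[of i j])
  then show ?thesis by (induction cs arbitrary: p) simp_all
qed

lemma shift_prod_commute: "shift_prod i cs \<circ> shift_prod j ds = shift_prod j ds \<circ> shift_prod i cs"
proof -
  have "shift_prod i cs (shift_prod j ds p) = shift_prod j ds (shift_prod i cs p)" for p
    by (induction ds arbitrary: p) (simp_all add: shift_prod_shift_H)
  then show ?thesis by (simp add: fun_eq_iff)
qed

context In_module
begin

text \<open>The polynomials \<open>(H - a)\<^sup>m\<close> and \<open>(H - b)\<^sup>k\<close> are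
  coprime. In place of a Bezout identity, induction on \<open>m + k\<close> puts
  \<open>(H - a) v\<close> and \<open>(H - b) v\<close> into \<open>N\<close>; their difference is
  \<open>(b - a) v\<close>.\<close>

lemma coprime_shift_mem:
  assumes N: "submodule N I_n M" and "v \<in> V" "a \<noteq> b"
    and "(shift_H i a ^^ m) \<star> v \<in> N" "(shift_H i b ^^ k) \<star> v \<in> N"
  shows "v \<in> N"
  using assms(2,4,5)
proof (induction "m + k" arbitrary: m k v rule: less_induct)
  case less
  show ?case
  proof (cases "m = 0 \<or> k = 0")
    case True
    have "(f ^^ 0) \<star> v = v" for f :: "('n, 'k) opr"
      unfolding funpow.simps(1) by (rule act_id) (rule less.prems)
    then show ?thesis using True less.prems(2,3) by metis
  next
    case False
    then obtain m' k' where mk: "m = Suc m'" "k = Suc k'" by (metis not0_implies_Suc)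
    have comm: "shift_H i a \<circ> shift_H i b = shift_H i b \<circ> shift_H i a"
      by (auto simp: fun_eq_iff shift_H_def scl.scale_right_diff_distrib mult.commute)
    have commp: "(shift_H i c ^^ l) \<circ> shift_H i d = shift_H i d \<circ> (shift_H i c ^^ l)"
      if "shift_H i c \<circ> shift_H i d = shift_H i d \<circ> shift_H i c" for c d l
    proof (induction l)
      case (Suc l)
      then show ?case using that by (simp add: fun_eq_iff)
    qed auto
    have in_N: "x \<star> w \<in> N" if "w \<in> N" "x \<in> carrier I_n" for x w using submoduleD(4)[OF N] that by blast
    have "shift_H i a \<star> v \<in> N"
    proof (rule less.hyps[of m' k])
      show "(shift_H i a ^^ m') \<star> shift_H i a \<star> v \<in> N"
        using less.prems mk by (simp add: act_comp funpow_Suc_right del: funpow.simps)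
      have "(shift_H i b ^^ k) \<star> shift_H i a \<star> v = shift_H i a \<star> (shift_H i b ^^ k) \<star> v"
        by (rule act_commute[OF commp[OF comm[symmetric]]]) (use less.prems in auto)
      then show "(shift_H i b ^^ k) \<star> shift_H i a \<star> v \<in> N" using in_N less.prems by simp
    qed (use less.prems mk in auto)
    moreover have "shift_H i b \<star> v \<in> N"
    proof (rule less.hyps[of m k'])
      show "(shift_H i b ^^ k') \<star> shift_H i b \<star> v \<in> N"
        using less.prems mk by (simp add: act_comp funpow_Suc_right del: funpow.simps)
      have "(shift_H i a ^^ m) \<star> shift_H i b \<star> v = shift_H i b \<star> (shift_H i a ^^ m) \<star> v"
        by (rule act_commute[OF commp[OF comm]]) (use less.prems in auto)
      then show "(shift_H i a ^^ m) \<star> shift_H i b \<star> v \<in> N" using in_N less.prems by simp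
    qed (use less.prems mk in auto)
    ultimately have "shift_H i a \<star> v \<ominus>\<^bsub>M\<^esub> shift_H i b \<star> v \<in> N" by (rule submoduleD(6)[OF N])
    then have d: "(\<lambda>p. shift_H i a p - shift_H i b p) \<star> v \<in> N" using less.prems by (simp add: act_diff)
    have "(\<lambda>p. shift_H i a p - shift_H i b p) = scl (b - a)"
      by (simp add: fun_eq_iff shift_H_def scl.scale_left_diff_distrib)
    then have d: "scl (b - a) \<star> v \<in> N" using d by simp
    have "scl (1 / (b - a)) \<circ> scl (b - a) = (id :: ('n, 'k) opr)"
      using assms(3) by (auto simp: fun_eq_iff)
    then have "scl (1 / (b - a)) \<star> scl (b - a) \<star> v = v"
      using less.prems by (simp add: act_comp)
    then show ?thesis using in_N[OF d, of "scl (1 / (b - a))"] by simp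
  qed
qed

text \<open>If \<nu> and \<mu> differ at \<open>i\<close>, a power of
  \<open>H\<^sub>i - \<mu>\<^sub>i\<close> removes the component at \<mu> and leaves a shorter sum
  in \<open>N\<close>, to which the induction applies. It alters the component at \<nu>, but that
  one is recovered by coprimality, being killed by a power of
  \<open>H\<^sub>i - \<nu>\<^sub>i\<close>.\<close>

lemma weight_components_mem:
  assumes N: "submodule N I_n M" and "finite S"
    and "\<And>\<nu>. \<nu> \<in> S \<Longrightarrow> weight_vec M \<nu> (g \<nu>)" "finsum M g S \<in> N"
  shows "\<forall>\<nu>\<in>S. g \<nu> \<in> N"
  using assms(2-4)
proof (induction S arbitrary: g rule: finite_induct)
  case (insert \<mu> S)
  have gV: "g \<nu> \<in> V" if "\<nu> \<in> insert \<mu> S" for \<nu> using insert.prems(1)[OF that] by (simp add: weight_vec_def)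
  have S: "g \<nu> \<in> N" if nS: "\<nu> \<in> S" for \<nu>
  proof -
    have "\<nu> \<noteq> \<mu>" using insert.hyps nS by auto
    then obtain i where i: "\<nu> i \<noteq> \<mu> i" by blast
    obtain k where k: "(shift_H i (\<mu> i) ^^ k) \<star> g \<mu> = \<zero>\<^bsub>M\<^esub>" using insert.prems(1)[of \<mu>] by (auto simp: weight_vec_def)
    let ?b = "shift_H i (\<mu> i) ^^ k :: ('n, 'k) opr"
    have bc: "?b \<in> carrier I_n" by simp
    have "?b \<star> finsum M g (insert \<mu> S) = finsum M (\<lambda>\<nu>. ?b \<star> g \<nu>) (insert \<mu> S)"
      by (rule smult_finsum) (use gV in auto)
    also have "\<dots> = ?b \<star> g \<mu> \<oplus>\<^bsub>M\<^esub> finsum M (\<lambda>\<nu>. ?b \<star> g \<nu>) S"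
      by (rule M.finsum_insert) (use insert.hyps gV in auto)
    also have "\<dots> = finsum M (\<lambda>\<nu>. ?b \<star> g \<nu>) S"
      unfolding k by (rule M.l_zero[OF M.finsum_closed]) (use gV in auto)
    finally have "finsum M (\<lambda>\<nu>. ?b \<star> g \<nu>) S \<in> N"
      using submoduleD(4)[OF N bc insert.prems(2)] by simp
    moreover have "weight_vec M \<rho> (?b \<star> g \<rho>)" if r: "\<rho> \<in> S" for \<rho>
      unfolding weight_vec_def
    proof (intro conjI allI)
      show "?b \<star> g \<rho> \<in> V" using gV r by simp
      fix j
      obtain l where l: "(shift_H j (\<rho> j) ^^ l) \<star> g \<rho> = \<zero>\<^bsub>M\<^esub>"
        using insert.prems(1)[of \<rho>] r by (auto simp: weight_vec_def)
      have "(shift_H j (\<rho> j) ^^ l) \<star> ?b \<star> g \<rho> = ?b \<star> (shift_H j (\<rho> j) ^^ l) \<star> g \<rho>"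
        by (rule act_commute[OF shift_H_pow_commute]) (use gV r in auto)
      then show "\<exists>l. (shift_H j (\<rho> j) ^^ l) \<star> ?b \<star> g \<rho> = \<zero>\<^bsub>M\<^esub>" using l by (auto intro: exI[of _ l])
    qed
    ultimately have b: "?b \<star> g \<nu> \<in> N" using insert.IH[of "\<lambda>\<nu>. ?b \<star> g \<nu>"] nS by blast
    obtain l where "(shift_H i (\<nu> i) ^^ l) \<star> g \<nu> = \<zero>\<^bsub>M\<^esub>"
      using insert.prems(1)[of \<nu>] nS by (auto simp: weight_vec_def)
    then have "(shift_H i (\<nu> i) ^^ l) \<star> g \<nu> \<in> N" using submoduleD(2)[OF N] by simp
    then show ?thesis using coprime_shift_mem[OF N gV i _ b] nS by blast
  qed
  have "finsum M g (insert \<mu> S) = g \<mu> \<oplus>\<^bsub>M\<^esub> finsum M g S"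
    by (rule M.finsum_insert) (use insert.hyps gV in auto)
  moreover have sN: "finsum M g S \<in> N"
    by (rule M.finsum_in_subgroup[OF submoduleD(7)[OF N]]) (use S in auto)
  moreover have "g \<mu> = (g \<mu> \<oplus>\<^bsub>M\<^esub> finsum M g S) \<ominus>\<^bsub>M\<^esub> finsum M g S"
  proof -
    have "finsum M g S \<in> V" "g \<mu> \<in> V" using gV sN submoduleD(1)[OF N] by auto
    then show ?thesis by (simp only: M.minus_eq M.a_assoc M.r_neg M.r_zero M.a_inv_closed)
  qed
  ultimately have "g \<mu> \<in> N" using submoduleD(6)[OF N insert.prems(2) sN] by simp
  then show ?case using S by blast
qed simp

text \<open>The weight spaces of \<open>N\<close> are the intersections of \<open>N\<close> with
  those of \<open>M\<close>. The content is that the weight components of a vector of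
  \<open>N\<close> lie in \<open>N\<close>; uniqueness is inherited from \<open>M\<close>.\<close>

lemma GW_submodule:
  assumes GW: "GW \<O> M" and N: "submodule N I_n M"
  shows "GW \<O> (M\<lparr>carrier := N\<rparr>)"
proof -
  let ?N = "M\<lparr>carrier := N\<rparr>"
  have ds: "internal_direct_sum M UNIV (weight_space M)" and sp: "Supp M \<subseteq> \<O>"
    using GW unfolding GW_def generalized_weight_def by blast+
  note Nd = submoduleD[OF N]
  have ws: "weight_space ?N \<nu> = weight_space M \<nu> \<inter> N" for \<nu> by (rule weight_space_submodule[OF Nd(1)])
  have "left_module I_n ?N" by (rule left_module_submodule[OF left_module_axioms N])
  moreover have "internal_direct_sum ?N UNIV (weight_space ?N)"
    unfolding internal_direct_sum_def
  proof (intro conjI ballI)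
    fix \<nu> :: "'n \<Rightarrow> 'k"
    have "subgroup (weight_space M \<nu> \<inter> N) (add_monoid M)"
      by (rule M.a_group[THEN group.subgroups_Inter_pair]) (use internal_direct_sumD(1)[OF ds] Nd(7) in auto)
    then have "subgroup (weight_space M \<nu> \<inter> N) ((add_monoid M)\<lparr>carrier := N\<rparr>)"
      by (rule group.subgroup_incl[OF M.a_group _ Nd(7)]) auto
    then show "subgroup (weight_space ?N \<nu>) (add_monoid ?N)" by (simp add: ws)
  next
    fix v assume "v \<in> carrier ?N"
    then have vN: "v \<in> N" and vV: "v \<in> V" using Nd(1) by auto
    obtain f where f: "f \<in> (\<Pi>\<^sub>E i\<in>UNIV. weight_space M i)" "finite {i\<in>UNIV. f i \<noteq> \<zero>\<^bsub>M\<^esub>}"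
        "v = finsum M f {i\<in>UNIV. f i \<noteq> \<zero>\<^bsub>M\<^esub>}"
      and uniq: "\<And>g. g \<in> (\<Pi>\<^sub>E i\<in>UNIV. weight_space M i) \<Longrightarrow> finite {i\<in>UNIV. g i \<noteq> \<zero>\<^bsub>M\<^esub>} \<Longrightarrow>
        v = finsum M g {i\<in>UNIV. g i \<noteq> \<zero>\<^bsub>M\<^esub>} \<Longrightarrow> g = f"
      using internal_direct_sumD(2)[OF ds vV] by blast
    let ?S = "{i\<in>UNIV. f i \<noteq> \<zero>\<^bsub>M\<^esub>}"
    have "\<forall>\<nu>\<in>?S. f \<nu> \<in> N"
    proof (rule weight_components_mem[OF N f(2)])
      show "weight_vec M \<nu> (f \<nu>)" for \<nu> by (rule weight_space_weight_vec) (use f(1) in auto)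
      show "finsum M f ?S \<in> N" using f(3) vN by simp
    qed
    then have fN: "f \<nu> \<in> N" for \<nu> using Nd(2) by (cases "f \<nu> = \<zero>\<^bsub>M\<^esub>") auto
    show "\<exists>!g. g \<in> (\<Pi>\<^sub>E i\<in>UNIV. weight_space ?N i) \<and> finite {i\<in>UNIV. g i \<noteq> \<zero>\<^bsub>?N\<^esub>} \<and>
       v = finsum ?N g {i\<in>UNIV. g i \<noteq> \<zero>\<^bsub>?N\<^esub>}"
    proof (rule ex1I[of _ f], intro conjI)
      show "f \<in> (\<Pi>\<^sub>E i\<in>UNIV. weight_space ?N i)" unfolding ws using f(1) fN by auto
      show "finite {i\<in>UNIV. f i \<noteq> \<zero>\<^bsub>?N\<^esub>}" using f(2) by simp
      show "v = finsum ?N f {i\<in>UNIV. f i \<noteq> \<zero>\<^bsub>?N\<^esub>}"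
        using finsum_submodule[OF N, of f ?S] fN f(3) by simp
    next
      fix g assume g: "g \<in> (\<Pi>\<^sub>E i\<in>UNIV. weight_space ?N i) \<and> finite {i\<in>UNIV. g i \<noteq> \<zero>\<^bsub>?N\<^esub>} \<and>
       v = finsum ?N g {i\<in>UNIV. g i \<noteq> \<zero>\<^bsub>?N\<^esub>}"
      then have "g \<in> (\<Pi>\<^sub>E i\<in>UNIV. weight_space M i)" "g \<in> {i\<in>UNIV. g i \<noteq> \<zero>\<^bsub>M\<^esub>} \<rightarrow> N"
        unfolding ws by (auto simp: PiE_iff)
      with g show "g = f" using finsum_submodule[OF N] by (intro uniq) auto
    qed
  qed
  moreover have "Supp ?N \<subseteq> \<O>"
  proof
    fix \<nu> assume "\<nu> \<in> Supp ?N"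
    then have "weight_space M \<nu> \<inter> N \<noteq> {\<zero>\<^bsub>M\<^esub>}" by (simp add: Supp_def ws)
    moreover have "\<zero>\<^bsub>M\<^esub> \<in> weight_space M \<nu>"
      using subgroup.one_closed[OF internal_direct_sumD(1)[OF ds, of \<nu>]] by simp
    ultimately have "\<nu> \<in> Supp M" using Nd(2) unfolding Supp_def by blast
    then show "\<nu> \<in> \<O>" using sp by blast
  qed
  ultimately show ?thesis by (simp add: GW_def generalized_weight_def)
qed

text \<open>Moved to the left of \<open>(1 - \<integral> \<partial>) \<partial>\<^sup>t\<close>, the
  power of \<open>H\<^sub>i - \<nu>\<^sub>i\<close> that kills \<open>v\<close> becomes a power of
  the scalar \<open>1 - \<nu>\<^sub>i + t\<close>. The excluded value of
  \<open>\<nu>\<^sub>i\<close> is where this scalar vanishes.\<close>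

lemma weight_vec_proj_zero:
  assumes "weight_vec M \<nu> v" "\<nu> i \<noteq> of_nat t + 1"
  shows "(proj_op i \<circ> (partial_x i ^^ t)) \<star> v = \<zero>\<^bsub>M\<^esub>"
proof -
  have v: "v \<in> V" using assms(1) by (simp add: weight_vec_def)
  obtain k where k: "(shift_H i (\<nu> i) ^^ k) \<star> v = \<zero>\<^bsub>M\<^esub>" using assms(1) by (auto simp: weight_vec_def)
  let ?e = "proj_op i \<circ> (partial_x i ^^ t) :: ('n, 'k) opr"
  let ?c = "(1 - \<nu> i + of_nat t) ^ k"
  have "?e \<circ> (shift_H i (\<nu> i) ^^ k) = scl ?c \<circ> ?e" by (auto simp: fun_eq_iff proj_partial_shift_H)
  then have "?e \<star> (shift_H i (\<nu> i) ^^ k) \<star> v = scl ?c \<star> ?e \<star> v" by (rule act_commute) (simp_all add: v)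
  then have "scl ?c \<star> ?e \<star> v = \<zero>\<^bsub>M\<^esub>" using k by simp
  moreover have "?c \<noteq> 0" using assms(2) by (auto simp: algebra_simps)
  ultimately show ?thesis by (rule act_scl_zero) (simp add: v)
qed

lemma GW_eventually_proj_zero:
  assumes "GW \<O> M" "v \<in> V"
  shows "\<exists>K. \<forall>t\<ge>K. (proj_op i \<circ> (partial_x i ^^ t)) \<star> v = \<zero>\<^bsub>M\<^esub>"
  using assms
proof (induction v rule: GW_induct)
  case zero
  show ?case by (intro exI[of _ 0] allI impI act_zero proj_partial_in_I_n)
next
  case (weight v \<nu>)
  show ?case
  proof (cases "\<exists>t. \<nu> i = of_nat t + 1")
    case True
    then obtain t where "\<nu> i = of_nat t + 1" by blast
    then have "\<nu> i \<noteq> of_nat s + 1" if "s \<ge> Suc t" for s using that by auto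
    then show ?thesis using weight_vec_proj_zero[OF weight(2)] by blast
  next
    case False
    then show ?thesis using weight_vec_proj_zero[OF weight(2)] by blast
  qed
next
  case (add v w)
  obtain K where "\<forall>t\<ge>K. (proj_op i \<circ> (partial_x i ^^ t)) \<star> v = \<zero>\<^bsub>M\<^esub>" using add.IH by blast
  moreover obtain L where "\<forall>t\<ge>L. (proj_op i \<circ> (partial_x i ^^ t)) \<star> w = \<zero>\<^bsub>M\<^esub>" using add.IH by blast
  ultimately have "\<forall>t\<ge>max K L. (proj_op i \<circ> (partial_x i ^^ t)) \<star> (v \<oplus>\<^bsub>M\<^esub> w) = \<zero>\<^bsub>M\<^esub>"
    using add.hyps by (simp add: smult_r_distr)
  then show ?case by blast
qed

lemma GW_F_killed_nonintegral:
  assumes "GW \<O> M" "v \<in> V" "\<And>\<nu>. \<nu> \<in> \<O> \<Longrightarrow> \<nu> i \<notin> \<int>"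
  shows "F_killed M i v"
  using assms(1,2)
proof (induction v rule: GW_induct)
  case (weight v \<nu>)
  have "\<nu> i \<noteq> of_nat t + 1" for t using assms(3)[OF weight(1)] by (metis Ints_of_nat of_nat_Suc add.commute)
  then show ?case unfolding F_killed_def using weight_vec_proj_zero[OF weight(2)] by blast
qed (auto simp: F_killed_add)

lemma act_shift_prod:
  "v \<in> V \<Longrightarrow> shift_prod i [] \<star> v = v"
  "v \<in> V \<Longrightarrow> shift_prod i (c # cs) \<star> v = shift_H i c \<star> shift_prod i cs \<star> v"
  "v \<in> V \<Longrightarrow> shift_prod i (cs @ ds) \<star> v = shift_prod i cs \<star> shift_prod i ds \<star> v"
  unfolding shift_prod_Nil shift_prod_Cons shift_prod_append
  by (rule act_id, assumption, (subst act_comp; simp add: shift_prod_in_I_n)+)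

text \<open>An annihilating product with eigenvalues in the orbit passes at once to subquotients,
  which makes it more convenient than the decomposition into weight spaces. For a sum the two lists
  are concatenated; the factors commute.\<close>

lemma GW_annihilating_product:
  assumes "GW \<O> M" "v \<in> V"
  shows "\<exists>cs. set cs \<subseteq> orbit_component \<O> i \<and> shift_prod i cs \<star> v = \<zero>\<^bsub>M\<^esub>"
  using assms
proof (induction v rule: GW_induct)
  case zero
  have "shift_prod i [] \<star> \<zero>\<^bsub>M\<^esub> = \<zero>\<^bsub>M\<^esub>" by (rule act_shift_prod(1)[OF M.zero_closed])
  then show ?case by (intro exI[of _ "[]"] conjI) (simp_all only: list.set empty_subsetI)
next
  case (weight v \<nu>)
  have v: "v \<in> V" using weight by (simp add: weight_vec_def)
  obtain k where k: "(shift_H i (\<nu> i) ^^ k) \<star> v = \<zero>\<^bsub>M\<^esub>" using weight(2) by (auto simp: weight_vec_def)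
  have "shift_prod i (replicate k (\<nu> i)) p = (shift_H i (\<nu> i) ^^ k) p" for p
    by (induction k) auto
  then have "shift_prod i (replicate k (\<nu> i)) = shift_H i (\<nu> i) ^^ k" by (rule ext)
  then show ?case using k weight(1)
    by (intro exI[of _ "replicate k (\<nu> i)"]) (auto simp: orbit_component_def)
next
  case (add v w)
  obtain cs ds where cs: "set cs \<subseteq> orbit_component \<O> i" "shift_prod i cs \<star> v = \<zero>\<^bsub>M\<^esub>"
    and ds: "set ds \<subseteq> orbit_component \<O> i" "shift_prod i ds \<star> w = \<zero>\<^bsub>M\<^esub>"
    using add.IH by blast
  have "shift_prod i (cs @ ds) = shift_prod i (ds @ cs)"
    unfolding shift_prod_append by (rule shift_prod_commute)
  then have "shift_prod i (cs @ ds) \<star> v = shift_prod i ds \<star> shift_prod i cs \<star> v"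
    using add.hyps by (simp add: act_shift_prod)
  moreover have "shift_prod i (cs @ ds) \<star> w = shift_prod i cs \<star> shift_prod i ds \<star> w"
    using add.hyps by (simp add: act_shift_prod)
  ultimately have "shift_prod i (cs @ ds) \<star> (v \<oplus>\<^bsub>M\<^esub> w) = \<zero>\<^bsub>M\<^esub>"
    using cs ds add.hyps by (simp add: smult_r_distr shift_prod_in_I_n)
  then show ?case using cs ds by (intro exI[of _ "cs @ ds"]) auto
qed

end

section \<open>Decomposition of generalized weight modules\<close>

text \<open>For \<open>A = UNIV\<close> this is the summand belonging to \<open>D\<close>. Smaller
  sets \<open>A\<close> occur in the induction that splits one index at a time.\<close>

definition part_sub :: "(('n::finite, 'k::field_char_0) opr, 'm) module \<Rightarrow> 'n set \<Rightarrow> 'n set \<Rightarrow> 'm set"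
  where "part_sub M A D = {v \<in> carrier M. (\<forall>i\<in>D. d_nilpotent M i v) \<and> (\<forall>i\<in>A - D. F_killed M i v)}"

text \<open>The subsets of \<open>insert i A\<close> come in pairs \<open>D\<close>,
  \<open>insert i D\<close> with \<open>D \<subseteq> A\<close>.\<close>

lemma (in abelian_group) finsum_Pow_insert:
  assumes "finite A" "i \<notin> A" "f \<in> Pow (insert i A) \<rightarrow> carrier G"
  shows "finsum G f (Pow (insert i A)) = finsum G (\<lambda>D. f D \<oplus> f (insert i D)) (Pow A)"
proof -
  have inj: "inj_on (insert i) (Pow A)" using assms(2) by (auto simp: inj_on_def)
  have f1: "f \<in> Pow A \<rightarrow> carrier G" "(\<lambda>D. f (insert i D)) \<in> Pow A \<rightarrow> carrier G" "f \<in> insert i ` Pow A \<rightarrow> carrier G"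
    using assms(3) by (auto simp: Pi_iff)
  have "finsum G f (Pow (insert i A)) = finsum G f (Pow A) \<oplus> finsum G f (insert i ` Pow A)"
    unfolding Pow_insert using assms f1 by (intro finsum_Un_disjoint) auto
  also have "finsum G f (insert i ` Pow A) = finsum G (\<lambda>D. f (insert i D)) (Pow A)"
    by (rule finsum_reindex[OF f1(3) inj])
  also have "finsum G f (Pow A) \<oplus> finsum G (\<lambda>D. f (insert i D)) (Pow A) = finsum G (\<lambda>D. f D \<oplus> f (insert i D)) (Pow A)"
    by (rule finsum_addf[symmetric, OF f1(1,2)])
  finally show ?thesis .
qed

context In_module
begin

lemma submodule_part_sub: "submodule (part_sub M A D) I_n M"
proof (rule left_submoduleI)
  show "part_sub M A D \<subseteq> V" by (auto simp: part_sub_def)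
  show "\<zero>\<^bsub>M\<^esub> \<in> part_sub M A D" by (simp add: part_sub_def)
  show "v \<oplus>\<^bsub>M\<^esub> w \<in> part_sub M A D" if "v \<in> part_sub M A D" "w \<in> part_sub M A D" for v w
    using that by (simp add: part_sub_def d_nilpotent_add F_killed_add)
  show "a \<star> v \<in> part_sub M A D" if "a \<in> carrier I_n" "v \<in> part_sub M A D" for a v
    using that by (simp add: part_sub_def d_nilpotent_act F_killed_act)
qed

text \<open>The element \<open>u - u' = z' - z\<close> is nilpotent under the derivative and killed
  by F at the same time.\<close>

lemma d_nilpotent_F_killed_unique:
  assumes "u \<oplus>\<^bsub>M\<^esub> z = u' \<oplus>\<^bsub>M\<^esub> z'" "u \<in> V" "u' \<in> V" "z \<in> V" "z' \<in> V"
    "d_nilpotent M i u" "d_nilpotent M i u'" "F_killed M i z" "F_killed M i z'"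
  shows "u = u' \<and> z = z'"
proof -
  have S: "submodule (part_sub M {i} {i}) I_n M" "submodule (part_sub M {i} {}) I_n M"
    by (rule submodule_part_sub)+
  have "u \<ominus>\<^bsub>M\<^esub> u' \<in> part_sub M {i} {i}"
    by (rule submoduleD(6)[OF S(1)]) (use assms in \<open>auto simp: part_sub_def\<close>)
  then have n: "d_nilpotent M i (u \<ominus>\<^bsub>M\<^esub> u')" by (auto simp: part_sub_def)
  have "z' \<ominus>\<^bsub>M\<^esub> z \<in> part_sub M {i} {}"
    by (rule submoduleD(6)[OF S(2)]) (use assms in \<open>auto simp: part_sub_def\<close>)
  then have z: "F_killed M i (z' \<ominus>\<^bsub>M\<^esub> z)" by (auto simp: part_sub_def)
  define d where "d = z' \<ominus>\<^bsub>M\<^esub> z"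
  have d: "d \<in> V" using assms by (simp add: d_def)
  have "u = (u \<oplus>\<^bsub>M\<^esub> z) \<ominus>\<^bsub>M\<^esub> z" using assms(2,4) by (simp add: M.minus_eq M.a_assoc M.r_neg)
  also have "\<dots> = d \<oplus>\<^bsub>M\<^esub> u'"
    unfolding assms(1) d_def using assms(3-5) by (simp add: M.minus_eq M.a_ac)
  finally have "u \<ominus>\<^bsub>M\<^esub> u' = d" using d assms(3) by (simp add: M.minus_eq M.a_assoc M.r_neg)
  then have "u \<ominus>\<^bsub>M\<^esub> u' = z' \<ominus>\<^bsub>M\<^esub> z" by (simp add: d_def)
  then have "u \<ominus>\<^bsub>M\<^esub> u' = \<zero>\<^bsub>M\<^esub>" using d_nilpotent_F_killed_zero[OF n] z d d_def by metis
  then have "u = u'" using assms(2,3) minus_zero_iff by blast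
  moreover have "z = z'" using assms(1-5) calculation by (metis M.add.l_cancel)
  ultimately show ?thesis by blast
qed

text \<open>The components of \<open>w\<close> are images under the algebra and
  \<open>part_sub M A D\<close> is a submodule, so the conditions already reached for the indices in
  \<open>A\<close> are kept while index \<open>i\<close> is split.\<close>

lemma part_sub_decomposition:
  assumes ev: "\<And>v i. v \<in> V \<Longrightarrow> \<exists>K. \<forall>t\<ge>K. (proj_op i \<circ> (partial_x i ^^ t)) \<star> v = \<zero>\<^bsub>M\<^esub>"
    and "w \<in> part_sub M A D" "i \<notin> A" "D \<subseteq> A"
  shows "\<exists>u z. u \<in> part_sub M (insert i A) (insert i D) \<and> z \<in> part_sub M (insert i A) D \<and> w = z \<oplus>\<^bsub>M\<^esub> u"
proof -
  have w: "w \<in> V" using assms(2) by (simp add: part_sub_def)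
  obtain K where K: "\<And>t. t \<ge> K \<Longrightarrow> (proj_op i \<circ> (partial_x i ^^ t)) \<star> w = \<zero>\<^bsub>M\<^esub>"
    using ev[OF w, of i] by blast
  obtain a b where ab: "a \<in> carrier I_n" "b \<in> carrier I_n" "d_nilpotent M i (a \<star> w)" "F_killed M i (b \<star> w)"
    "w = a \<star> w \<oplus>\<^bsub>M\<^esub> b \<star> w"
    using d_nilpotent_F_killed_decomposition[OF w K] by blast
  have "a \<star> w \<in> part_sub M A D" "b \<star> w \<in> part_sub M A D"
    using submoduleD(4)[OF submodule_part_sub] ab assms(2) by blast+
  moreover have "w = b \<star> w \<oplus>\<^bsub>M\<^esub> a \<star> w" using ab w M.a_comm[of "a \<star> w" "b \<star> w"] by simp
  ultimately show ?thesis using ab assms(3,4)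
    by (intro exI[of _ "a \<star> w"] exI[of _ "b \<star> w"]) (auto simp: part_sub_def)
qed

lemma part_sub_sum_exists:
  assumes ev: "\<And>v i. v \<in> V \<Longrightarrow> \<exists>K. \<forall>t\<ge>K. (proj_op i \<circ> (partial_x i ^^ t)) \<star> v = \<zero>\<^bsub>M\<^esub>"
    and "finite A" "v \<in> V"
  shows "\<exists>f. (\<forall>D\<in>Pow A. f D \<in> part_sub M A D) \<and> v = finsum M f (Pow A)"
  using assms(2)
proof (induction A rule: finite_induct)
  case empty
  show ?case
    by (intro exI[of _ "\<lambda>_. v"]) (use assms(3) in \<open>simp add: part_sub_def M.finsum_insert\<close>)
next
  case (insert i A)
  then obtain f where f: "\<And>D. D \<in> Pow A \<Longrightarrow> f D \<in> part_sub M A D" "v = finsum M f (Pow A)" by blast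
  have "\<forall>D. \<exists>u z. D \<in> Pow A \<longrightarrow> u \<in> part_sub M (insert i A) (insert i D) \<and> z \<in> part_sub M (insert i A) D \<and> f D = z \<oplus>\<^bsub>M\<^esub> u"
    using part_sub_decomposition[OF ev f(1) insert.hyps(2)] by blast
  then obtain u z where uz: "\<And>D. D \<in> Pow A \<Longrightarrow> u D \<in> part_sub M (insert i A) (insert i D) \<and>
      z D \<in> part_sub M (insert i A) D \<and> f D = z D \<oplus>\<^bsub>M\<^esub> u D"
    by metis
  \<comment> \<open>Each old summand is cut into its two parts at \<open>i\<close>; membership of
    \<open>i\<close> in \<open>E\<close> tells which part is meant.\<close>
  define g where "g E = (if i \<in> E then u (E - {i}) else z E)" for E
  have gE: "g E \<in> part_sub M (insert i A) E" if "E \<in> Pow (insert i A)" for E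
  proof (cases "i \<in> E")
    case True
    then have "E - {i} \<in> Pow A" "insert i (E - {i}) = E" using that by auto
    then show ?thesis using uz[of "E - {i}"] True by (simp add: g_def)
  next
    case False
    then have "E \<in> Pow A" using that by auto
    then show ?thesis using uz[of E] False by (simp add: g_def)
  qed
  have gV: "g \<in> Pow (insert i A) \<rightarrow> V" using gE by (auto simp: part_sub_def)
  have "finsum M g (Pow (insert i A)) = finsum M (\<lambda>D. g D \<oplus>\<^bsub>M\<^esub> g (insert i D)) (Pow A)"
    by (rule M.finsum_Pow_insert) (use insert.hyps gV in auto)
  also have "\<dots> = finsum M f (Pow A)"
  proof (rule M.finsum_cong')
    show "f \<in> Pow A \<rightarrow> V" using f(1) by (auto simp: part_sub_def)
    fix D assume D: "D \<in> Pow A"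
    then have "i \<notin> D" "insert i D - {i} = D" using insert.hyps by auto
    then show "g D \<oplus>\<^bsub>M\<^esub> g (insert i D) = f D" using uz[OF D] by (simp add: g_def)
  qed simp
  finally show ?case using gE f(2) by (intro exI[of _ g]) auto
qed

text \<open>Adding the two members of each pair \<open>D\<close>, \<open>insert i D\<close> gives
  decompositions over \<open>A\<close>, which agree by induction. Inside a pair the uniqueness at
  the single index \<open>i\<close> decides.\<close>

lemma part_sub_sum_unique:
  assumes "finite A" "\<And>D. D \<in> Pow A \<Longrightarrow> f D \<in> part_sub M A D" "\<And>D. D \<in> Pow A \<Longrightarrow> g D \<in> part_sub M A D"
    "finsum M f (Pow A) = finsum M g (Pow A)"
  shows "\<forall>D\<in>Pow A. f D = g D"
  using assms
proof (induction A arbitrary: f g rule: finite_induct)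
  case empty
  then have "f {} \<in> V" "g {} \<in> V" by (auto simp: part_sub_def)
  then show ?case using empty.prems(3) by (simp add: M.finsum_insert)
next
  case (insert i A)
  have fg: "f \<in> Pow (insert i A) \<rightarrow> V" "g \<in> Pow (insert i A) \<rightarrow> V"
    using insert.prems(1,2) by (auto simp: part_sub_def)
  have mem: "h D \<oplus>\<^bsub>M\<^esub> h (insert i D) \<in> part_sub M A D"
    if "D \<in> Pow A" "\<And>E. E \<in> Pow (insert i A) \<Longrightarrow> h E \<in> part_sub M (insert i A) E" for h D
  proof (rule submoduleD(3)[OF submodule_part_sub])
    have "h D \<in> part_sub M (insert i A) D" "h (insert i D) \<in> part_sub M (insert i A) (insert i D)"
      using that(1) by (auto intro!: that(2))
    then show "h D \<in> part_sub M A D" "h (insert i D) \<in> part_sub M A D"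
      using that(1) insert.hyps by (auto simp: part_sub_def)
  qed
  have "finsum M (\<lambda>D. f D \<oplus>\<^bsub>M\<^esub> f (insert i D)) (Pow A) = finsum M (\<lambda>D. g D \<oplus>\<^bsub>M\<^esub> g (insert i D)) (Pow A)"
    using insert.prems(3) M.finsum_Pow_insert[OF insert.hyps fg(1)] M.finsum_Pow_insert[OF insert.hyps fg(2)] by simp
  then have eq: "\<forall>D\<in>Pow A. f D \<oplus>\<^bsub>M\<^esub> f (insert i D) = g D \<oplus>\<^bsub>M\<^esub> g (insert i D)"
    by (intro insert.IH) (use mem insert.prems(1,2) in auto)
  have both: "f D = g D \<and> f (insert i D) = g (insert i D)" if D: "D \<in> Pow A" for D
  proof -
    have in1: "D \<in> Pow (insert i A)" "insert i D \<in> Pow (insert i A)" "i \<notin> D" using D insert.hyps by auto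
    note p = insert.prems(1)[OF in1(1)] insert.prems(1)[OF in1(2)] insert.prems(2)[OF in1(1)] insert.prems(2)[OF in1(2)]
    have "f (insert i D) \<oplus>\<^bsub>M\<^esub> f D = g (insert i D) \<oplus>\<^bsub>M\<^esub> g D"
      using eq D p M.a_comm by (auto simp: part_sub_def)
    then have "f (insert i D) = g (insert i D) \<and> f D = g D"
      by (rule d_nilpotent_F_killed_unique[where i=i]) (use p in1(3) in \<open>auto simp: part_sub_def\<close>)
    then show ?thesis by blast
  qed
  show ?case
  proof
    fix E assume E: "E \<in> Pow (insert i A)"
    show "f E = g E"
    proof (cases "i \<in> E")
      case True
      then have "insert i (E - {i}) = E" "E - {i} \<in> Pow A" using E by auto
      then show ?thesis using both by metis
    next
      case False
      then have "E \<in> Pow A" using E by auto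
      then show ?thesis using both by blast
    qed
  qed
qed

theorem part_sub_direct_sum:
  assumes ev: "\<And>v i. v \<in> V \<Longrightarrow> \<exists>K. \<forall>t\<ge>K. (proj_op i \<circ> (partial_x i ^^ t)) \<star> v = \<zero>\<^bsub>M\<^esub>"
    and J: "\<And>i v. i \<notin> J \<Longrightarrow> v \<in> V \<Longrightarrow> F_killed M i v"
  shows "internal_direct_sum M (Pow J) (part_sub M UNIV)"
  unfolding internal_direct_sum_def
proof (intro conjI ballI)
  fix D show "subgroup (part_sub M UNIV D) (add_monoid M)" by (rule submoduleD(7)[OF submodule_part_sub])
next
  fix v assume v: "v \<in> V"
  have fin: "finite J" "finite (Pow J)" by simp_all
  \<comment> \<open>Outside \<open>J\<close> the F-condition holds for every vector, so imposing it
    there changes nothing.\<close>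
  have pJ: "part_sub M J D = part_sub M UNIV D" for D
    using J unfolding part_sub_def by blast
  let ?S = "\<lambda>f. {D \<in> Pow J. f D \<noteq> \<zero>\<^bsub>M\<^esub>}"
  have supp: "finsum M f (?S f) = finsum M f (Pow J)" if "f \<in> Pow J \<rightarrow> V" for f
    by (rule M.add.finprod_mono_neutral_cong_left) (use fin that in auto)
  obtain f where f: "\<And>D. D \<in> Pow J \<Longrightarrow> f D \<in> part_sub M J D" "v = finsum M f (Pow J)"
    using part_sub_sum_exists[OF ev fin(1) v] by blast
  let ?f = "restrict f (Pow J)"
  have PV: "h \<in> (\<Pi>\<^sub>E D\<in>Pow J. part_sub M UNIV D) \<Longrightarrow> h \<in> Pow J \<rightarrow> V" for h
    unfolding part_sub_def by auto
  have fP: "?f \<in> (\<Pi>\<^sub>E D\<in>Pow J. part_sub M UNIV D)" using f(1) by (auto simp: pJ)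
  have fs: "finsum M ?f (Pow J) = v"
    unfolding f(2) by (rule M.finsum_cong') (use f(1) in \<open>auto simp: part_sub_def\<close>)
  show "\<exists>!f. f \<in> (\<Pi>\<^sub>E D\<in>Pow J. part_sub M UNIV D) \<and> finite (?S f) \<and> v = finsum M f (?S f)"
  proof (rule ex1I[of _ ?f], intro conjI)
    show "?f \<in> (\<Pi>\<^sub>E D\<in>Pow J. part_sub M UNIV D)" by (rule fP)
    show "finite (?S ?f)" using fin by simp
    show "v = finsum M ?f (?S ?f)" using supp[OF PV[OF fP]] fs by simp
  next
    fix g assume g: "g \<in> (\<Pi>\<^sub>E D\<in>Pow J. part_sub M UNIV D) \<and> finite (?S g) \<and> v = finsum M g (?S g)"
    then have gP: "g \<in> (\<Pi>\<^sub>E D\<in>Pow J. part_sub M UNIV D)" and gs: "v = finsum M g (Pow J)"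
      using supp[OF PV] by auto
    have "\<forall>D\<in>Pow J. g D = ?f D"
    proof (rule part_sub_sum_unique[OF fin(1)])
      show "g D \<in> part_sub M J D" "?f D \<in> part_sub M J D" if "D \<in> Pow J" for D
        unfolding pJ by (rule PiE_mem[OF gP that] PiE_mem[OF fP that])+
      show "finsum M g (Pow J) = finsum M ?f (Pow J)" using gs fs by simp
    qed
    then show "g = ?f" by (intro PiE_ext[OF gP fP]) blast
  qed
qed

end

section \<open>Typed modules\<close>

text \<open>Every condition says that some operator kills a given vector, so all of them pass to
  submodules and quotients. The family \<open>\<O>s\<close> bounds the eigenvalues of the
  \<open>H\<^sub>i\<close>, in the role of the orbit.\<close>

definition typed_module ::
    "('n \<Rightarrow> 'k set) \<Rightarrow> 'n set \<Rightarrow> (('n::finite, 'k::field_char_0) opr, 'm) module \<Rightarrow> bool"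
  where "typed_module \<O>s D M \<longleftrightarrow> left_module I_n M \<and>
    (\<forall>v\<in>carrier M. (\<forall>i\<in>D. d_nilpotent M i v) \<and> (\<forall>i\<in>-D. F_killed M i v) \<and>
      (\<forall>i. \<exists>cs. set cs \<subseteq> \<O>s i \<and> shift_prod i cs \<odot>\<^bsub>M\<^esub> v = \<zero>\<^bsub>M\<^esub>))"

lemma typed_module_submodule:
  assumes "typed_module \<O>s D M" "submodule N I_n M"
  shows "typed_module \<O>s D (M\<lparr>carrier := N\<rparr>)"
  using assms left_module_submodule[of I_n M N] submoduleD(1)[OF assms(2)]
  by (auto simp: typed_module_def d_nilpotent_def F_killed_def)

lemma typed_module_quotient:
  fixes M :: "(('n::finite, 'k::field_char_0) opr, 'm) module"
  assumes M: "typed_module \<O>s D M" and L: "submodule L I_n M"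
  shows "typed_module \<O>s D (quotient_module M L)"
proof -
  let ?Q = "quotient_module M L"
  have lm: "left_module I_n M" using M by (simp add: typed_module_def)
  have zero: "a \<odot>\<^bsub>?Q\<^esub> (L +>\<^bsub>M\<^esub> v) = \<zero>\<^bsub>?Q\<^esub>"
    if "a \<in> carrier I_n" "v \<in> carrier M" "a \<odot>\<^bsub>M\<^esub> v = \<zero>\<^bsub>M\<^esub>" for a v
  proof -
    have "a \<odot>\<^bsub>?Q\<^esub> (L +>\<^bsub>M\<^esub> v) = L +>\<^bsub>M\<^esub> \<zero>\<^bsub>M\<^esub>" using quotient_smult[OF lm L that(1,2)] that(3) by simp
    also have "\<dots> = L" using quotient_zero_iff[OF lm L, of "\<zero>\<^bsub>M\<^esub>"] submoduleD(1,2)[OF L] by blast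
    finally show ?thesis by (simp add: quotient_module_simps)
  qed
  show ?thesis unfolding typed_module_def
  proof (intro conjI ballI)
    show "left_module I_n ?Q" by (rule left_module_quotient[OF lm L])
    fix S assume "S \<in> carrier ?Q"
    then obtain v where v: "v \<in> carrier M" "S = L +>\<^bsub>M\<^esub> v" by (auto simp: quotient_module_simps)
    have p: "(\<forall>i\<in>D. d_nilpotent M i v) \<and> (\<forall>i\<in>-D. F_killed M i v) \<and>
      (\<forall>i. \<exists>cs. set cs \<subseteq> \<O>s i \<and> shift_prod i cs \<odot>\<^bsub>M\<^esub> v = \<zero>\<^bsub>M\<^esub>)"
      using M v(1) by (simp add: typed_module_def)
    have pw: "partial_x i ^^ k \<in> carrier I_n" for i :: 'n and k by simp
    show "d_nilpotent ?Q i S" if "i \<in> D" for i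
      using p that zero[OF pw v(1)] unfolding d_nilpotent_def v(2) by blast
    show "F_killed ?Q i S" if "i \<in> -D" for i
      using p that zero[OF proj_partial_in_I_n v(1)] unfolding F_killed_def v(2) by blast
    show "\<forall>i. \<exists>cs. set cs \<subseteq> \<O>s i \<and> shift_prod i cs \<odot>\<^bsub>?Q\<^esub> S = \<zero>\<^bsub>?Q\<^esub>"
      using p zero[OF shift_prod_in_I_n v(1)] unfolding v(2) by blast
  qed
qed

lemma typed_part_sub:
  assumes "GW \<O> M"
  shows "typed_module (orbit_component \<O>) D (M\<lparr>carrier := part_sub M UNIV D\<rparr>)"
proof -
  have lm: "left_module I_n M" using assms unfolding GW_def by blast
  interpret In_module M by (rule In_module.intro[OF lm])
  show ?thesis
    using left_module_submodule[OF lm submodule_part_sub] GW_annihilating_product[OF assms]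
    by (auto simp: typed_module_def d_nilpotent_def F_killed_def part_sub_def)
qed

context In_module
begin

text \<open>The factors are applied to \<open>w\<close> one after the other; the last nonzero result
  is an eigenvector.\<close>

lemma eigenvector_exists:
  assumes "w \<in> V" "w \<noteq> \<zero>\<^bsub>M\<^esub>" "shift_prod i cs \<star> w = \<zero>\<^bsub>M\<^esub>"
  shows "\<exists>ds. \<exists>c\<in>set cs. shift_prod i ds \<star> w \<noteq> \<zero>\<^bsub>M\<^esub> \<and> shift_H i c \<star> shift_prod i ds \<star> w = \<zero>\<^bsub>M\<^esub>"
  using assms(3)
proof (induction cs)
  case Nil
  then show ?case using assms(1,2) act_shift_prod(1)[OF assms(1)] by metis
next
  case (Cons c cs)
  then show ?case using act_shift_prod(2)[OF assms(1), of i c cs] by (metis list.set_intros(1,2))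
qed

text \<open>For \<open>i \<in> D\<close> the last nonzero derivative of \<open>w\<close> is taken.
  Otherwise \<open>w\<close> yields an eigenvector of \<open>H\<^sub>i\<close> whose eigenvalue
  differs from \<open>r i\<close> by an integer, and derivatives lower it or integrations raise it
  to \<open>r i\<close>. The operator is taken from the \<open>i\<close>-th subalgebra, so that
  normalising one index does not disturb another.\<close>

lemma normal_vector_step:
  assumes T: "typed_module \<O>s D M" and r: "\<And>i c. i \<notin> D \<Longrightarrow> c \<in> \<O>s i \<Longrightarrow> c - r i \<in> \<int>"
    and w: "w \<in> V" "w \<noteq> \<zero>\<^bsub>M\<^esub>"
  shows "\<exists>a\<in>carrier (I_1 i). a \<star> w \<noteq> \<zero>\<^bsub>M\<^esub> \<and>
    (if i \<in> D then partial_x i \<star> a \<star> w = \<zero>\<^bsub>M\<^esub> else shift_H i (r i) \<star> a \<star> w = \<zero>\<^bsub>M\<^esub>)"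
proof (cases "i \<in> D")
  case True
  then have "d_nilpotent M i w" using T w by (simp add: typed_module_def)
  then have ex: "\<exists>k. (partial_x i ^^ k) \<star> w = \<zero>\<^bsub>M\<^esub>" by (simp add: d_nilpotent_def)
  define k where "k = (LEAST k. (partial_x i ^^ k) \<star> w = \<zero>\<^bsub>M\<^esub>)"
  have k0: "(partial_x i ^^ k) \<star> w = \<zero>\<^bsub>M\<^esub>" unfolding k_def by (rule LeastI_ex[OF ex])
  have "k \<noteq> 0"
  proof
    assume "k = 0"
    then have "id \<star> w = \<zero>\<^bsub>M\<^esub>" using k0 unfolding \<open>k = 0\<close> funpow.simps(1) by blast
    then show False using w by simp
  qed
  then obtain m where m: "k = Suc m" by (cases k) auto
  have 1: "(partial_x i ^^ m) \<star> w \<noteq> \<zero>\<^bsub>M\<^esub>" using not_less_Least[of m "\<lambda>k. (partial_x i ^^ k) \<star> w = \<zero>\<^bsub>M\<^esub>"] m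
    by (auto simp: k_def)
  have "partial_x i \<star> (partial_x i ^^ m) \<star> w = (partial_x i ^^ Suc m) \<star> w"
    using w(1) by (simp only: act_comp gens_in_I_n I_n_closed funpow.simps(2))
  then have 2: "partial_x i \<star> (partial_x i ^^ m) \<star> w = \<zero>\<^bsub>M\<^esub>" using k0 m by simp
  show ?thesis
    by (rule bexI[of _ "partial_x i ^^ m"]) (use 1 2 True in auto)
next
  case False
  obtain cs where cs: "set cs \<subseteq> \<O>s i" "shift_prod i cs \<star> w = \<zero>\<^bsub>M\<^esub>"
    using T w(1) unfolding typed_module_def by blast
  obtain ds c where ds: "c \<in> set cs" "shift_prod i ds \<star> w \<noteq> \<zero>\<^bsub>M\<^esub>" "shift_H i c \<star> shift_prod i ds \<star> w = \<zero>\<^bsub>M\<^esub>"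
    using eigenvector_exists[OF w cs(2)] by blast
  define u where "u = shift_prod i ds \<star> w"
  have u: "u \<in> V" "u \<noteq> \<zero>\<^bsub>M\<^esub>" "shift_H i c \<star> u = \<zero>\<^bsub>M\<^esub>" using ds w by (simp_all add: u_def shift_prod_in_I_n)
  have F_killed: "F_killed M i v" if "v \<in> V" for v using T False that by (simp add: typed_module_def)
  have "c - r i \<in> \<int>" using r[OF False] ds(1) cs(1) by blast
  then obtain z where "c - r i = of_int z" by (rule Ints_cases)
  then have z: "c = r i + of_int z" by (simp add: algebra_simps)
  have sp: "shift_prod i ds \<in> carrier (I_1 i)"
  proof (induction ds)
    case Nil
    show ?case unfolding shift_prod_Nil by (rule I_1_closed(2))
  next
    case (Cons c cs)
    show ?case unfolding shift_prod_Cons by (rule I_1_closed(4)[OF shift_H_in_I_1 Cons])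
  qed
  show ?thesis
  proof (cases "z \<ge> 0")
    case True
    define m where "m = nat z"
    have c: "c = r i + of_nat m" using z True by (simp add: m_def)
    have "shift_H i (r i) \<circ> (partial_x i ^^ m) = (partial_x i ^^ m) \<circ> shift_H i c"
      using shift_H_partial_pow[of 1 i "r i" m] by (simp add: fun_eq_iff c)
    then have 1: "shift_H i (r i) \<star> (partial_x i ^^ m) \<star> u = (partial_x i ^^ m) \<star> shift_H i c \<star> u"
      by (rule act_commute) (use u in auto)
    \<comment> \<open>Powers of \<partial> are injective here: a vector killed by one of them is
      nilpotent, and every vector is killed by F.\<close>
    have 2: "(partial_x i ^^ l) \<star> v = \<zero>\<^bsub>M\<^esub> \<Longrightarrow> v \<in> V \<Longrightarrow> v = \<zero>\<^bsub>M\<^esub>" for l v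
      by (rule d_nilpotent_F_killed_zero[of i]) (use F_killed in \<open>auto simp: d_nilpotent_def\<close>)
    have 2: "(partial_x i ^^ m) \<star> u \<noteq> \<zero>\<^bsub>M\<^esub>" using 2[of m u] u(1,2) by blast
    have 3: "((partial_x i ^^ m) \<circ> shift_prod i ds) \<star> w = (partial_x i ^^ m) \<star> u"
      unfolding u_def by (subst act_comp) (use w in \<open>simp_all add: shift_prod_in_I_n\<close>)
    show ?thesis
      by (rule bexI[of _ "(partial_x i ^^ m) \<circ> shift_prod i ds"])
         (use 1 2 u False sp in \<open>simp_all add: 3\<close>)
  next
    case zneg: False
    define m where "m = nat (- z)"
    have c: "c = r i - of_nat m" using z zneg by (simp add: m_def)
    have 0: "shift_H i d ((int_x i ^^ m) p) = (int_x i ^^ m) (shift_H i (d - of_nat m) p)" for d and p :: "('n, 'k) pol"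
      by (induction m arbitrary: d) (simp_all add: shift_H_int algebra_simps)
    have "shift_H i (r i) \<circ> (int_x i ^^ m) = (int_x i ^^ m) \<circ> shift_H i c"
      by (simp add: fun_eq_iff c 0)
    then have 1: "shift_H i (r i) \<star> (int_x i ^^ m) \<star> u = (int_x i ^^ m) \<star> shift_H i c \<star> u"
      by (rule act_commute) (use u in auto)
    have "(partial_x i ^^ m) ((int_x i ^^ m) p) = p" for p :: "('n, 'k) pol"
      by (induction m arbitrary: p) (simp_all add: funpow_swap1[of "partial_x i"])
    then have "(partial_x i ^^ m) \<circ> (int_x i ^^ m) = (id :: ('n, 'k) opr)" by (simp add: fun_eq_iff)
    then have "(partial_x i ^^ m) \<star> (int_x i ^^ m) \<star> u = u" using u(1) by (simp add: act_comp)
    then have 2: "(int_x i ^^ m) \<star> u \<noteq> \<zero>\<^bsub>M\<^esub>" using u(2) by auto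
    have 3: "((int_x i ^^ m) \<circ> shift_prod i ds) \<star> w = (int_x i ^^ m) \<star> u"
      unfolding u_def by (subst act_comp) (use w in \<open>simp_all add: shift_prod_in_I_n\<close>)
    show ?thesis
      by (rule bexI[of _ "(int_x i ^^ m) \<circ> shift_prod i ds"])
         (use 1 2 u False sp in \<open>simp_all add: 3\<close>)
  qed
qed

text \<open>The indices are normalised in turn. The operators for \<open>i\<close> commute with
  \<open>partial_x j\<close> and \<open>shift_H j\<close>, so conditions reached at \<open>j\<close>
  survive.\<close>

lemma normal_vector_exists:
  assumes T: "typed_module \<O>s D M" and r: "\<And>i c. i \<notin> D \<Longrightarrow> c \<in> \<O>s i \<Longrightarrow> c - r i \<in> \<int>"
    and w: "w \<in> V" "w \<noteq> \<zero>\<^bsub>M\<^esub>"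
  obtains u where "u \<in> V" "u \<noteq> \<zero>\<^bsub>M\<^esub>" "\<And>i. i \<in> D \<Longrightarrow> partial_x i \<star> u = \<zero>\<^bsub>M\<^esub>"
    "\<And>i. i \<notin> D \<Longrightarrow> shift_H i (r i) \<star> u = \<zero>\<^bsub>M\<^esub>"
proof -
  define nrm where "nrm i u \<longleftrightarrow> (if i \<in> D then partial_x i \<star> u = \<zero>\<^bsub>M\<^esub> else shift_H i (r i) \<star> u = \<zero>\<^bsub>M\<^esub>)" for i u
  have "\<exists>u\<in>V. u \<noteq> \<zero>\<^bsub>M\<^esub> \<and> (\<forall>i\<in>A. nrm i u)" if "finite A" for A
    using that
  proof (induction A rule: finite_induct)
    case empty
    then show ?case using w by blast
  next
    case (insert i A)
    then obtain u where u: "u \<in> V" "u \<noteq> \<zero>\<^bsub>M\<^esub>" "\<And>j. j \<in> A \<Longrightarrow> nrm j u" by blast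
    obtain a where a: "a \<in> carrier (I_1 i)" "a \<star> u \<noteq> \<zero>\<^bsub>M\<^esub>" "nrm i (a \<star> u)"
      using normal_vector_step[where r=r and i=i, OF T _ u(1,2)] r unfolding nrm_def by blast
    have aI: "a \<in> carrier I_n" by (rule I_1_le_I_n[OF a(1)])
    have "nrm j (a \<star> u)" if "j \<in> A" for j
    proof -
      have "j \<noteq> i" using that insert.hyps by auto
      have c: "b \<star> a \<star> u = a \<star> b \<star> u" if "b \<in> carrier (I_1 j)" for b
        by (rule act_commute[OF I_1_commute[OF \<open>j \<noteq> i\<close> that a(1)]]) (use aI that u(1) I_1_le_I_n in auto)
      show ?thesis using u(3)[OF that] c[of "partial_x j"] c[of "shift_H j (r j)"] aI
        by (auto simp: nrm_def)
    qed
    then show ?case using a aI u(1) by (intro bexI[of _ "a \<star> u"]) auto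
  qed
  from this[of UNIV] obtain u where "u \<in> V" "u \<noteq> \<zero>\<^bsub>M\<^esub>" "\<And>i. nrm i u" by auto
  then show thesis using that unfolding nrm_def by metis
qed

end

lemma module_hom_image:
  assumes M: "left_module R M" and N: "left_module R N" and f: "f \<in> module_hom_set R M N"
  shows "submodule (f ` carrier M) R N"
proof -
  interpret M: left_module R M by fact
  interpret N: left_module R N by fact
  note fh = module_hom_setD[OF f]
  show ?thesis
  proof (rule N.left_submoduleI)
    show "f ` carrier M \<subseteq> carrier N" using fh(1) by blast
    show "\<zero>\<^bsub>N\<^esub> \<in> f ` carrier M" using module_hom_zero[OF M N f] M.M.zero_closed by (metis imageI)
  next
    fix v w assume "v \<in> f ` carrier M" "w \<in> f ` carrier M"
    then obtain v' w' where v: "v' \<in> carrier M" "v = f v'" and w: "w' \<in> carrier M" "w = f w'" by blast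
    then show "v \<oplus>\<^bsub>N\<^esub> w \<in> f ` carrier M"
      using fh(2)[OF v(1) w(1)] M.M.add.m_closed[OF v(1) w(1)] by (metis imageI)
  next
    fix a v assume a: "a \<in> carrier R" and "v \<in> f ` carrier M"
    then obtain v' where v: "v' \<in> carrier M" "v = f v'" by blast
    then show "a \<odot>\<^bsub>N\<^esub> v \<in> f ` carrier M"
      using fh(3)[OF a v(1)] M.smult_closed[OF a v(1)] by (metis imageI)
  qed
qed

section \<open>Model modules\<close>

definition lattice_cone :: "'n set \<Rightarrow> ('n \<Rightarrow> int) set"
  where "lattice_cone D = {z. \<forall>i\<in>D. z i \<ge> 0}"

text \<open>The basis is modelled on the divided powers \<open>x\<^sup>\<alpha> / \<alpha>!\<close>,
  in which derivative and integration are shifts without coefficients and only \<open>H\<close>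
  carries numbers. For \<open>i \<in> D\<close> a step out of the cone gives zero.\<close>

definition m_partial :: "'n set \<Rightarrow> 'n \<Rightarrow> (('n \<Rightarrow> int) \<Rightarrow>\<^sub>0 'k::field_char_0) \<Rightarrow> (('n \<Rightarrow> int) \<Rightarrow>\<^sub>0 'k)"
  where "m_partial D i = lext (\<lambda>z. if i \<in> D \<and> z i \<le> 0 then 0 else Poly_Mapping.single (z(i := z i - 1)) 1)"

definition m_int :: "'n \<Rightarrow> (('n \<Rightarrow> int) \<Rightarrow>\<^sub>0 'k::field_char_0) \<Rightarrow> (('n \<Rightarrow> int) \<Rightarrow>\<^sub>0 'k)"
  where "m_int i = lext (\<lambda>z. Poly_Mapping.single (z(i := z i + 1)) 1)"

definition m_H :: "('n \<Rightarrow> 'k) \<Rightarrow> 'n \<Rightarrow> (('n \<Rightarrow> int) \<Rightarrow>\<^sub>0 'k::field_char_0) \<Rightarrow> (('n \<Rightarrow> int) \<Rightarrow>\<^sub>0 'k)"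
  where "m_H r i = lext (\<lambda>z. Poly_Mapping.single z (r i + of_int (z i)))"

lemma lin_m: "lin (m_partial D i)" "lin (m_int i)" "lin (m_H r i)"
  by (simp_all add: m_partial_def m_int_def m_H_def lin_lext)

lemma m_single:
  "m_partial D i (Poly_Mapping.single z c) = (if i \<in> D \<and> z i \<le> 0 then 0 else Poly_Mapping.single (z(i := z i - 1)) c)"
  "m_int i (Poly_Mapping.single z c) = Poly_Mapping.single (z(i := z i + 1)) c"
  "m_H r i (Poly_Mapping.single z c) = Poly_Mapping.single z (c * (r i + of_int (z i)))"
  by (simp_all add: m_partial_def m_int_def m_H_def)

text \<open>The action is a parameter: whether the algebra acts on this space at all is a theorem,
  shown later by constructing a suitable \<open>\<rho>\<close>.\<close>

definition model ::
    "'n set \<Rightarrow> (('n, 'k) opr \<Rightarrow> (('n \<Rightarrow> int) \<Rightarrow>\<^sub>0 'k) \<Rightarrow> (('n \<Rightarrow> int) \<Rightarrow>\<^sub>0 'k)) \<Rightarrow>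
     (('n, 'k::field_char_0) opr, ('n \<Rightarrow> int) \<Rightarrow>\<^sub>0 'k) module"
  where "model D \<rho> = \<lparr>carrier = {p. Poly_Mapping.keys p \<subseteq> lattice_cone D}, monoid.mult = undefined,
    monoid.one = undefined, ring.zero = 0, ring.add = (+), module.smult = \<rho>\<rparr>"

lemma model_simps [simp]:
  "carrier (model D \<rho>) = {p. Poly_Mapping.keys p \<subseteq> lattice_cone D}"
  "ring.zero (model D \<rho>) = 0" "ring.add (model D \<rho>) = (+)" "module.smult (model D \<rho>) = \<rho>"
  by (simp_all add: model_def)

text \<open>The eigenvalue of \<open>H\<^sub>i\<close> on the basis vector of index \<open>z\<close> is \<open>r i + z i\<close>; for \<open>i \<in> D\<close> the
  intended value of \<open>r i\<close> is 1.\<close>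

definition is_model :: "'n::finite set \<Rightarrow> ('n \<Rightarrow> 'k::field_char_0) \<Rightarrow>
    (('n, 'k) opr \<Rightarrow> (('n \<Rightarrow> int) \<Rightarrow>\<^sub>0 'k) \<Rightarrow> (('n \<Rightarrow> int) \<Rightarrow>\<^sub>0 'k)) \<Rightarrow> bool"
  where "is_model D r \<rho> \<longleftrightarrow> left_module I_n (model D \<rho>) \<and>
    (\<forall>p. Poly_Mapping.keys p \<subseteq> lattice_cone D \<longrightarrow>
      (\<forall>c. \<rho> (scl c) p = scl c p) \<and>
      (\<forall>i. \<rho> (partial_x i) p = m_partial D i p \<and> \<rho> (int_x i) p = m_int i p \<and>
        \<rho> (mult_x i) p = m_int i (m_H r i p)))"

section \<open>Shift operators and homomorphisms out of the models\<close>

definition op_s :: "'n \<Rightarrow> int \<Rightarrow> ('n, 'k::field_char_0) opr"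
  where "op_s i k = (if k \<ge> 0 then int_x i ^^ nat k else partial_x i ^^ nat (- k))"

lemma op_s_in_I_1: "op_s i k \<in> carrier (I_1 i)"
  by (simp add: op_s_def)

lemma op_s_in_I_n: "op_s i k \<in> carrier I_n"
  by (rule I_1_le_I_n[OF op_s_in_I_1])

lemma op_s_zero: "op_s i 0 = id"
  unfolding op_s_def by simp

text \<open>The relation \<open>\<partial> \<integral> = 1\<close> makes this hold for every integer
  \<open>k\<close>. Its counterpart \<open>int_op_s\<close> is restricted to
  \<open>k \<ge> 0\<close>, since for negative \<open>k\<close> the difference
  \<open>1 - \<integral> \<partial>\<close> intervenes.\<close>

lemma partial_op_s: "partial_x i \<circ> op_s i k = (op_s i (k - 1) :: ('n, 'k::field_char_0) opr)"
proof (cases "k > 0")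
  case True
  define m where "m = nat (k - 1)"
  have k: "k = int m + 1" using True by (simp add: m_def)
  have "nat (int m + 1) = Suc m" by simp
  then have "op_s i k = (int_x i ^^ Suc m :: ('n, 'k) opr)" unfolding op_s_def k by simp
  moreover have "op_s i (k - 1) = (int_x i ^^ m :: ('n, 'k) opr)" unfolding op_s_def k by simp
  ultimately show ?thesis by (simp add: fun_eq_iff)
next
  case False
  define m where "m = nat (- k)"
  have k: "k = - int m" using False by (simp add: m_def)
  have "op_s i (k - 1) = (partial_x i ^^ Suc m :: ('n, 'k) opr)" unfolding op_s_def k by (simp add: nat_add_distrib)
  moreover have "op_s i k = (partial_x i ^^ m :: ('n, 'k) opr)" unfolding op_s_def k by (cases "m = 0") simp_all
  ultimately show ?thesis by (simp add: fun_eq_iff)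
qed

lemma int_op_s: "k \<ge> 0 \<Longrightarrow> int_x i \<circ> op_s i k = op_s i (k + 1)"
  by (simp add: op_s_def fun_eq_iff nat_add_distrib)

lemma op_s_neg: "op_s i k = partial_x i \<circ> op_s i (k + 1)"
  by (simp add: partial_op_s)

text \<open>Applying \<open>op_s i k\<close> raises the eigenvalue of \<open>H\<close> by
  \<open>k\<close>, whatever the sign of \<open>k\<close>.\<close>

lemma shift_H_op_s: "shift_H i (c + of_int k) \<circ> op_s i k = op_s i k \<circ> shift_H i c"
proof -
  have 0: "shift_H i d ((int_x i ^^ m) p) = (int_x i ^^ m) (shift_H i (d - of_nat m) p)" for d m p
    by (induction m arbitrary: d) (simp_all add: shift_H_int algebra_simps)
  have 1: "shift_H i d ((partial_x i ^^ m) p) = (partial_x i ^^ m) (shift_H i (d + of_nat m) p)" for d m p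
    using shift_H_partial_pow[of 1 i d m p] by simp
  show ?thesis by (auto simp: op_s_def fun_eq_iff 0 1)
qed

text \<open>The product of the shifts \<open>op_s i (z i)\<close> over \<open>i \<in> A\<close>.
  Shifts in different directions commute, which makes the fold independent of the order.\<close>

definition fold_op :: "('n \<Rightarrow> int) \<Rightarrow> 'n::finite set \<Rightarrow> ('n, 'k::field_char_0) opr"
  where "fold_op z A = Finite_Set.fold (\<lambda>i f. op_s i (z i) \<circ> f) id A"

lemma fold_op_empty: "fold_op z {} = id"
  by (simp add: fold_op_def)

lemma fold_op_insert: "i \<notin> A \<Longrightarrow> fold_op z (insert i A) = op_s i (z i) \<circ> fold_op z A"
proof -
  have c: "op_s i (z i) \<circ> (op_s j (z j) \<circ> f) = op_s j (z j) \<circ> (op_s i (z i) \<circ> f)" for i j and f :: "('a, 'b) opr"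
  proof (cases "i = j")
    case False
    then have "op_s i (z i) \<circ> op_s j (z j) = (op_s j (z j) \<circ> op_s i (z i) :: ('a, 'b) opr)"
      by (intro I_1_commute[OF _ op_s_in_I_1 op_s_in_I_1])
    then show ?thesis by (metis comp_assoc)
  qed simp
  interpret comp_fun_commute "\<lambda>i f. op_s i (z i) \<circ> f :: ('a, 'b) opr"
    by standard (simp only: fun_eq_iff[of "_ \<circ> _ :: _ \<Rightarrow> ('a, 'b) opr"] o_apply[of "\<lambda>f. op_s _ _ \<circ> f"] c simp_thms)
  show "i \<notin> A \<Longrightarrow> ?thesis" unfolding fold_op_def by (rule fold_insert) simp_all
qed

lemma fold_op_in_I_n: "fold_op z A \<in> carrier I_n"
proof -
  have "finite A" by simp
  then show ?thesis
  proof (induction A rule: finite_induct)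
    case empty
    show ?case unfolding fold_op_empty by (rule I_n_closed(2))
  next
    case (insert i A)
    show ?case unfolding fold_op_insert[OF insert.hyps(2)] by (rule I_n_closed(4)[OF op_s_in_I_n insert.IH])
  qed
qed

lemma fold_op_commute:
  assumes "b \<in> carrier (I_1 i)" "i \<notin> A"
  shows "b \<circ> fold_op z A = fold_op z A \<circ> b"
proof -
  have "finite A" by simp
  then show ?thesis using assms(2)
  proof (induction A rule: finite_induct)
    case (insert j A)
    then have "b \<circ> op_s j (z j) = op_s j (z j) \<circ> b" by (intro I_1_commute[OF _ assms(1) op_s_in_I_1]) auto
    moreover have "b \<circ> fold_op z A = fold_op z A \<circ> b" using insert.IH insert.prems by blast
    ultimately show ?case unfolding fold_op_insert[OF insert.hyps(2)] by (metis comp_assoc)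
  qed (simp add: fold_op_empty)
qed

lemma fold_op_cong: "(\<And>j. j \<in> A \<Longrightarrow> z j = z' j) \<Longrightarrow> fold_op z A = fold_op z' A"
proof -
  have "finite A" by simp
  then show "(\<And>j. j \<in> A \<Longrightarrow> z j = z' j) \<Longrightarrow> ?thesis"
    by (induction A rule: finite_induct) (simp_all add: fold_op_empty fold_op_insert)
qed

text \<open>The factor in direction \<open>i\<close> is brought to the front, where a generator of
  index \<open>i\<close> meets it.\<close>

lemma fold_op_UNIV: "fold_op (z(i := k)) UNIV = op_s i k \<circ> fold_op z (UNIV - {i})"
proof -
  have U: "insert i (UNIV - {i}) = UNIV" by auto
  have "fold_op (z(i := k)) (insert i (UNIV - {i})) = op_s i ((z(i := k)) i) \<circ> fold_op (z(i := k)) (UNIV - {i})"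
    by (rule fold_op_insert) simp
  then have "fold_op (z(i := k)) UNIV = op_s i k \<circ> fold_op (z(i := k)) (UNIV - {i})"
    unfolding U fun_upd_same .
  also have "fold_op (z(i := k)) (UNIV - {i}) = fold_op z (UNIV - {i})"
    by (rule fold_op_cong) simp
  finally show ?thesis .
qed

lemma fold_op_zero: "fold_op (\<lambda>_. 0) A = id"
proof -
  have "finite A" by simp
  then show ?thesis
    by (induction A rule: finite_induct) (simp_all add: fold_op_empty fold_op_insert op_s_zero)
qed

context In_module
begin

lemma act_scl_commute:
  assumes "a \<in> carrier I_n" "v \<in> V"
  shows "a \<star> scl c \<star> v = scl c \<star> a \<star> v"
  by (rule act_commute) (use assms lin_I_n[OF assms(1)] in \<open>auto simp: fun_eq_iff lin_scl\<close>)

lemma act_scl_add: "v \<in> V \<Longrightarrow> scl (c + d) \<star> v = scl c \<star> v \<oplus>\<^bsub>M\<^esub> scl d \<star> v"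
  using act_add[of "scl c" "scl d" v] by (simp add: scl.scale_left_distrib[symmetric])

lemma act_scl_scl: "v \<in> V \<Longrightarrow> scl c \<star> scl d \<star> v = scl (c * d) \<star> v"
  by (subst act_comp) (auto simp: comp_def)

lemma act_scl_one: "v \<in> V \<Longrightarrow> scl 1 \<star> v = v"
proof -
  have "scl 1 = (id :: ('n, 'k) opr)" by (auto simp: fun_eq_iff)
  then show "v \<in> V \<Longrightarrow> ?thesis" by (metis act_id)
qed

lemma act_scl_0: "v \<in> V \<Longrightarrow> scl 0 \<star> v = \<zero>\<^bsub>M\<^esub>"
proof -
  have "scl 0 = (\<lambda>p. 0 :: ('n, 'k) pol)" by (auto simp: fun_eq_iff)
  then show "v \<in> V \<Longrightarrow> ?thesis" by (metis act_0)
qed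

definition lincomb :: "(('n \<Rightarrow> int) \<Rightarrow> 'm) \<Rightarrow> (('n \<Rightarrow> int) \<Rightarrow>\<^sub>0 'k) \<Rightarrow> 'm"
  where "lincomb W p = finsum M (\<lambda>z. scl (Poly_Mapping.lookup p z) \<star> W z) (Poly_Mapping.keys p)"

lemma lincomb_superset:
  assumes "finite A" "Poly_Mapping.keys p \<subseteq> A" "\<And>z. W z \<in> V"
  shows "lincomb W p = finsum M (\<lambda>z. scl (Poly_Mapping.lookup p z) \<star> W z) A"
  unfolding lincomb_def
  by (rule M.add.finprod_mono_neutral_cong_left)
     (use assms in \<open>auto simp: in_keys_iff act_scl_0\<close>)

lemma lincomb_closed: "(\<And>z. W z \<in> V) \<Longrightarrow> lincomb W p \<in> V"
  unfolding lincomb_def by (rule M.finsum_closed) auto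

lemma lincomb_add:
  assumes "\<And>z. W z \<in> V"
  shows "lincomb W (p + q) = lincomb W p \<oplus>\<^bsub>M\<^esub> lincomb W q"
proof -
  let ?A = "Poly_Mapping.keys p \<union> Poly_Mapping.keys q"
  have "lincomb W (p + q) = finsum M (\<lambda>z. scl (Poly_Mapping.lookup (p + q) z) \<star> W z) ?A"
    by (rule lincomb_superset) (use keys_add[of p q] assms in auto)
  also have "\<dots> = finsum M (\<lambda>z. scl (Poly_Mapping.lookup p z) \<star> W z \<oplus>\<^bsub>M\<^esub> scl (Poly_Mapping.lookup q z) \<star> W z) ?A"
    by (rule M.finsum_cong') (use assms in \<open>auto simp: lookup_add act_scl_add\<close>)
  also have "\<dots> = finsum M (\<lambda>z. scl (Poly_Mapping.lookup p z) \<star> W z) ?A \<oplus>\<^bsub>M\<^esub> finsum M (\<lambda>z. scl (Poly_Mapping.lookup q z) \<star> W z) ?A"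
    by (rule M.finsum_addf) (use assms in auto)
  also have "\<dots> = lincomb W p \<oplus>\<^bsub>M\<^esub> lincomb W q"
    using lincomb_superset[of ?A p W] lincomb_superset[of ?A q W] assms by simp
  finally show ?thesis .
qed

lemma lincomb_single: "(\<And>z. W z \<in> V) \<Longrightarrow> lincomb W (Poly_Mapping.single z c) = scl c \<star> W z"
  by (subst lincomb_superset[of "{z}"]) (auto simp: M.finsum_insert)

lemma lincomb_zero: "lincomb W 0 = \<zero>\<^bsub>M\<^esub>"
  by (simp add: lincomb_def)

text \<open>The basis vector of index \<open>z\<close> is sent to \<open>W z\<close>, the product of
  the shifts \<open>op_s i (z i)\<close> applied to \<open>u\<close>. Its behaviour under the
  generators follows from \<open>\<partial> \<integral> = 1\<close>, from
  \<open>\<integral> \<partial> = 1\<close> outside \<open>D\<close>, and from the conditions on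
  \<open>u\<close>.\<close>

theorem model_hom_exists:
  assumes mdl: "is_model D r \<rho>" and T: "\<And>v i. i \<notin> D \<Longrightarrow> v \<in> V \<Longrightarrow> F_killed M i v"
    and r1: "\<And>i. i \<in> D \<Longrightarrow> r i = 1"
    and u: "u \<in> V" "\<And>i. i \<in> D \<Longrightarrow> partial_x i \<star> u = \<zero>\<^bsub>M\<^esub>"
    "\<And>i. i \<notin> D \<Longrightarrow> shift_H i (r i) \<star> u = \<zero>\<^bsub>M\<^esub>"
  shows "\<exists>f\<in>module_hom_set I_n (model D \<rho>) M. f (Poly_Mapping.single (\<lambda>_. 0) 1) = u"
proof -
  \<comment> \<open>For \<open>i \<in> D\<close>, \<open>\<partial> u = 0\<close> gives
    \<open>u = (1 - \<integral> \<partial>) u\<close>, on which \<open>H\<close> acts as 1. This is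
    where the value \<open>r i = 1\<close> comes from.\<close>
  have uH: "shift_H i (r i) \<star> u = \<zero>\<^bsub>M\<^esub>" for i
  proof (cases "i \<in> D")
    case True
    have "proj_op i \<star> u = u \<ominus>\<^bsub>M\<^esub> (int_x i \<circ> partial_x i) \<star> u"
      unfolding proj_op_eq using act_diff[of id "int_x i \<circ> partial_x i" u] u(1) by (simp only: I_n_closed gens_in_I_n act_id)
    also have "(int_x i \<circ> partial_x i) \<star> u = int_x i \<star> partial_x i \<star> u" using u(1) by (simp add: act_comp)
    finally have e: "proj_op i \<star> u = u" using u True by (simp add: M.minus_eq)
    have "H_op i \<circ> proj_op i = (proj_op i :: ('n, 'k) opr)" by (simp add: fun_eq_iff H_proj)
    then have "H_op i \<star> proj_op i \<star> u = proj_op i \<star> u" using u(1) by (simp add: act_comp)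
    then have "H_op i \<star> u = u" by (simp add: e)
    then have "shift_H i 1 \<star> u = \<zero>\<^bsub>M\<^esub>"
      unfolding shift_H_eq using act_diff[of "H_op i" "scl 1" u] act_scl_one[of u] u(1) minus_zero_iff[of u u]
      by (simp only: gens_in_I_n I_n_closed)
    then show ?thesis using r1[OF True] by simp
  qed (rule u(3))
  define W where "W z = fold_op z UNIV \<star> u" for z
  have WV: "W z \<in> V" for z unfolding W_def by (rule act_closed[OF fold_op_in_I_n u(1)])
  have W0: "W (\<lambda>_. 0) = u" unfolding W_def fold_op_zero using u(1) by (rule act_id)
  \<comment> \<open>The vector \<open>v\<close> is \<open>u\<close> shifted in all directions except
    \<open>i\<close>. It inherits the conditions on \<open>u\<close> at \<open>i\<close>, and along
    the line through \<open>z\<close> in direction \<open>i\<close> the vectors \<open>W\<close> are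
    the shifts of \<open>v\<close>.\<close>
  have W: "\<exists>v\<in>V. (\<forall>k. W (z(i := k)) = op_s i k \<star> v) \<and> shift_H i (r i) \<star> v = \<zero>\<^bsub>M\<^esub> \<and> (i \<in> D \<longrightarrow> partial_x i \<star> v = \<zero>\<^bsub>M\<^esub>)"
    for z i
  proof -
    let ?R = "fold_op z (UNIV - {i}) :: ('n, 'k) opr"
    have c: "b \<star> ?R \<star> u = ?R \<star> b \<star> u" if "b \<in> carrier (I_1 i)" for b
      by (rule act_commute[OF fold_op_commute[OF that]]) (use that I_1_le_I_n u(1) fold_op_in_I_n in auto)
    have "W (z(i := k)) = op_s i k \<star> ?R \<star> u" for k
      unfolding W_def fold_op_UNIV using u(1) by (simp add: act_comp op_s_in_I_n fold_op_in_I_n)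
    moreover have "shift_H i (r i) \<star> ?R \<star> u = \<zero>\<^bsub>M\<^esub>" using c[OF shift_H_in_I_1] uH by (simp add: fold_op_in_I_n)
    moreover have "i \<in> D \<Longrightarrow> partial_x i \<star> ?R \<star> u = \<zero>\<^bsub>M\<^esub>" using c[of "partial_x i"] u(2) by (simp add: fold_op_in_I_n)
    moreover have "?R \<star> u \<in> V" by (rule act_closed[OF fold_op_in_I_n u(1)])
    ultimately show ?thesis by blast
  qed
  have Wp: "partial_x i \<star> W z = (if i \<in> D \<and> z i \<le> 0 then \<zero>\<^bsub>M\<^esub> else W (z(i := z i - 1)))" if z: "z \<in> lattice_cone D" for z i
  proof -
    obtain v where v: "v \<in> V" "\<And>k. W (z(i := k)) = op_s i k \<star> v" "i \<in> D \<Longrightarrow> partial_x i \<star> v = \<zero>\<^bsub>M\<^esub>"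
      using W[of z i] by blast
    have Wz: "W z = op_s i (z i) \<star> v" using v(2)[of "z i"] by simp
    show ?thesis
    proof (cases "i \<in> D \<and> z i \<le> 0")
      case True
      \<comment> \<open>Inside the cone truncation happens only on the wall, and there
        \<open>W z\<close> is \<open>v\<close>, which \<partial> kills.\<close>
      then have "z i = 0" using z by (auto simp: lattice_cone_def)
      then have "W z = op_s i 0 \<star> v" using Wz by simp
      then have "W z = v" unfolding op_s_zero act_id[OF v(1)] .
      then show ?thesis using v(3) True by simp
    next
      case False
      have "partial_x i \<star> W z = (partial_x i \<circ> op_s i (z i)) \<star> v"
        unfolding Wz using v(1) by (simp add: act_comp op_s_in_I_n)
      also have "\<dots> = W (z(i := z i - 1))" unfolding v(2) by (simp only: partial_op_s)
      finally show ?thesis by (simp only: if_not_P[OF False])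
    qed
  qed
  have Wi: "int_x i \<star> W z = W (z(i := z i + 1))" if z: "z \<in> lattice_cone D" for z i
  proof -
    obtain v where v: "v \<in> V" "\<And>k. W (z(i := k)) = op_s i k \<star> v" using W[of z i] by blast
    have Wz: "W z = op_s i (z i) \<star> v" using v(2)[of "z i"] by simp
    show ?thesis
    proof (cases "z i \<ge> 0")
      case True
      have "int_x i \<star> W z = (int_x i \<circ> op_s i (z i)) \<star> v"
        unfolding Wz using v(1) by (simp add: act_comp op_s_in_I_n)
      then show ?thesis unfolding v(2) by (simp only: int_op_s[OF True])
    next
      case False
      \<comment> \<open>A negative coordinate occurs only outside \<open>D\<close>, where F kills
        everything and the integration undoes the last derivative.\<close>
      then have iD: "i \<notin> D" using z by (auto simp: lattice_cone_def)
      let ?v = "op_s i (z i + 1) \<star> v"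
      have vV: "?v \<in> V" by (rule act_closed[OF op_s_in_I_n v(1)])
      have "(proj_op i \<circ> (partial_x i ^^ 0)) \<star> ?v = \<zero>\<^bsub>M\<^esub>" using T[OF iD vV] unfolding F_killed_def by blast
      then have "proj_op i \<star> ?v = \<zero>\<^bsub>M\<^esub>" unfolding funpow.simps(1) comp_id .
      then have "int_x i \<star> partial_x i \<star> ?v = ?v" by (rule int_partial_act[OF vV])
      moreover have "W z = partial_x i \<star> ?v"
        unfolding Wz using False v(1) by (subst op_s_neg) (auto simp: act_comp op_s_in_I_n)
      ultimately show ?thesis unfolding v(2) by simp
    qed
  qed
  have WH: "H_op i \<star> W z = scl (r i + of_int (z i)) \<star> W z" for z i
  proof -
    obtain v where v: "v \<in> V" "\<And>k. W (z(i := k)) = op_s i k \<star> v" "shift_H i (r i) \<star> v = \<zero>\<^bsub>M\<^esub>"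
      using W[of z i] by blast
    have Wz: "W z = op_s i (z i) \<star> v" using v(2)[of "z i"] by simp
    have "shift_H i (r i + of_int (z i)) \<star> op_s i (z i) \<star> v = op_s i (z i) \<star> shift_H i (r i) \<star> v"
      by (rule act_commute[OF shift_H_op_s]) (use v(1) op_s_in_I_n in auto)
    then have "shift_H i (r i + of_int (z i)) \<star> W z = \<zero>\<^bsub>M\<^esub>" unfolding Wz v(3) by (simp add: op_s_in_I_n)
    then have "H_op i \<star> W z \<ominus>\<^bsub>M\<^esub> scl (r i + of_int (z i)) \<star> W z = \<zero>\<^bsub>M\<^esub>"
      unfolding shift_H_eq using act_diff[of "H_op i" _ "W z"] WV by simp
    then show ?thesis using minus_zero_iff WV by simp
  qed
  let ?f = "lincomb W"
  note lc = lincomb_add[OF WV] lincomb_single[OF WV] lincomb_zero lincomb_closed[OF WV]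
  have keysG: "p \<in> carrier (model D \<rho>) \<longleftrightarrow> Poly_Mapping.keys p \<subseteq> lattice_cone D" for p by simp
  have fp: "?f (m_partial D i p) = partial_x i \<star> ?f p" if "Poly_Mapping.keys p \<subseteq> lattice_cone D" for i p
    using that
  proof (induction p rule: poly_mapping_induct_keys)
    case (single z c)
    then show ?case using WV by (simp add: m_single lc act_scl_commute[of "partial_x i"] Wp)
  qed (simp_all add: lin_zero[OF lin_m(1)] lin_add[OF lin_m(1)] lc smult_r_distr)
  have fi: "?f (m_int i p) = int_x i \<star> ?f p" if "Poly_Mapping.keys p \<subseteq> lattice_cone D" for i p
    using that
  proof (induction p rule: poly_mapping_induct_keys)
    case (single z c)
    then show ?case using WV by (simp add: m_single lc act_scl_commute[of "int_x i"] Wi)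
  qed (simp_all add: lin_zero[OF lin_m(2)] lin_add[OF lin_m(2)] lc smult_r_distr)
  have fH: "?f (m_H r i p) = H_op i \<star> ?f p" for i p
  proof (induction p rule: poly_mapping_induct)
    case (single z c)
    then show ?case using WV by (simp add: m_single lc act_scl_commute[of "H_op i"] WH act_scl_scl)
  next
    case (add p q)
    then show ?case by (simp add: lin_add[OF lin_m(3)] lc smult_r_distr)
  qed
  have fs: "?f (scl c p) = scl c \<star> ?f p" for c p
  proof (induction p rule: poly_mapping_induct)
    case (single z d)
    then show ?case using WV by (simp add: lc act_scl_scl)
  next
    case (add p q)
    then show ?case by (simp add: scl.scale_right_distrib lc smult_r_distr)
  qed
  have kH: "Poly_Mapping.keys (m_H r i p) \<subseteq> lattice_cone D" if "Poly_Mapping.keys p \<subseteq> lattice_cone D" for i p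
    using that
  proof (induction p rule: poly_mapping_induct_keys)
    case (add p q)
    then show ?case using keys_add[of "m_H r i p" "m_H r i q"] by (auto simp: lin_add[OF lin_m(3)])
  qed (auto simp: lin_zero[OF lin_m(3)] m_single)
  interpret MD: left_module I_n "model D \<rho>" using mdl by (simp add: is_model_def)
  \<comment> \<open>The predicate \<open>is_model\<close> fixes the action of scalars and
    generators; compatibility spreads to sums and compositions because both sides are
    modules.\<close>
  have hom: "?f (\<rho> a p) = a \<star> ?f p" if "a \<in> carrier I_n" "p \<in> carrier (model D \<rho>)" for a p
    using that
  proof (induction a arbitrary: p rule: I_n_induct)
    case (scl c)
    then show ?case using mdl fs by (simp add: is_model_def)
  next
    case (mult_x i)
    then have "?f (\<rho> (mult_x i) p) = int_x i \<star> H_op i \<star> ?f p"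
      using mdl kH by (simp add: is_model_def fi fH)
    also have "\<dots> = (int_x i \<circ> H_op i) \<star> ?f p" by (simp add: act_comp lc)
    also have "int_x i \<circ> H_op i = (mult_x i :: ('n, 'k) opr)" by (simp add: fun_eq_iff mult_x_eq)
    finally show ?case .
  next
    case (partial_x i)
    then show ?case using mdl fp by (simp add: is_model_def)
  next
    case (int_x i)
    then show ?case using mdl fi by (simp add: is_model_def)
  next
    case (comp a b)
    have "\<rho> (a \<circ> b) p = \<rho> a (\<rho> b p)" using MD.smult_assoc[OF comp.hyps comp.prems] by (simp only: model_simps I_n_simps)
    moreover have "\<rho> b p \<in> carrier (model D \<rho>)" using MD.smult_closed[OF comp.hyps(2) comp.prems] by simp
    moreover have "(a \<circ> b) \<star> ?f p = a \<star> b \<star> ?f p" by (rule act_comp[symmetric]) (use comp.hyps lc in auto)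
    ultimately show ?case using comp.IH comp.prems by metis
  next
    case (add a b)
    have "\<rho> (\<lambda>q. a q + b q) p = \<rho> a p + \<rho> b p" using MD.smult_l_distr[OF add.hyps add.prems] by (simp only: model_simps I_n_simps)
    moreover have "(\<lambda>q. a q + b q) \<star> ?f p = a \<star> ?f p \<oplus>\<^bsub>M\<^esub> b \<star> ?f p"
      by (rule act_add) (use add.hyps lc in auto)
    ultimately show ?case by (simp only: lc(1) add.IH[OF add.prems])
  qed
  have "?f \<in> module_hom_set I_n (model D \<rho>) M"
    unfolding module_hom_set_def mem_Collect_eq
    by (intro conjI funcsetI ballI) (simp_all only: model_simps lc(1,4) hom)
  moreover have "?f (Poly_Mapping.single (\<lambda>_. 0) 1) = u" using u(1) by (simp add: lc W0 act_scl_one)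
  ultimately show ?thesis by blast
qed

end

text \<open>Distinct lattice points have distinct tuples of eigenvalues of the
  \<open>H\<^sub>i\<close>, the characteristic being zero, so a nonzero element can be cut down to a
  single basis vector. The shifts then bring this vector to the origin.\<close>

lemma model_submodule_generator:
  assumes mdl: "is_model D r \<rho>" and K: "submodule K I_n (model D \<rho>)" and p: "p \<in> K" "p \<noteq> 0"
  shows "Poly_Mapping.single (\<lambda>_. 0) 1 \<in> K"
proof -
  interpret MD: In_module "model D \<rho>" using mdl by (simp add: is_model_def In_module_def)
  note Kd = submoduleD[OF K]
  have Kc: "q \<in> K \<Longrightarrow> Poly_Mapping.keys q \<subseteq> lattice_cone D" for q using Kd(1) by auto
  have Kp: "m_partial D i q \<in> K" and Ki: "m_int i q \<in> K" and Ks: "scl c q \<in> K" if "q \<in> K" for q i c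
    using Kd(4)[OF _ that, of "partial_x i"] Kd(4)[OF _ that, of "int_x i"] Kd(4)[OF _ that, of "scl c"]
      mdl Kc[OF that] by (simp_all add: is_model_def)
  have Kdiff: "q - q' \<in> K" if "q \<in> K" "q' \<in> K" for q q'
    using Kd(3)[OF that(1) Ks[OF that(2), of "-1"]] by (simp add: scl.scale_minus_left)
  have KH: "m_H r i q \<in> K" if "q \<in> K" for q i
  proof -
    have kH: "Poly_Mapping.keys (m_H r i p) \<subseteq> lattice_cone D" if "Poly_Mapping.keys p \<subseteq> lattice_cone D" for i p
      using that
    proof (induction p rule: poly_mapping_induct_keys)
      case (add p q)
      then show ?case using keys_add[of "m_H r i p" "m_H r i q"] by (auto simp: lin_add[OF lin_m(3)])
    qed (auto simp: lin_zero[OF lin_m(3)] m_single)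
    \<comment> \<open>Since \<open>is_model\<close> describes \<open>mult_x i\<close> and not
      \<open>H_op i\<close>, the action of \<open>m_H\<close> is recovered by cancelling the
      integration with a derivative.\<close>
    have "m_int i (m_H r i q) \<in> K"
      using Kd(4)[OF _ that, of "mult_x i"] mdl Kc[OF that] by (simp add: is_model_def)
    then have "m_partial D i (m_int i (m_H r i q)) \<in> K" by (rule Kp)
    moreover have "m_partial D i (m_int i q) = q" if "Poly_Mapping.keys q \<subseteq> lattice_cone D" for q :: "('a \<Rightarrow> int) \<Rightarrow>\<^sub>0 'b"
      using that
      by (induction q rule: poly_mapping_induct_keys)
         (auto simp: lin_zero[OF lin_m(1)] lin_zero[OF lin_m(2)] lin_add[OF lin_m(1)] lin_add[OF lin_m(2)] m_single lattice_cone_def)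
    ultimately show ?thesis using kH[OF Kc[OF that]] by simp
  qed
  have lH: "Poly_Mapping.lookup (m_H r i q) z = (r i + of_int (z i)) * Poly_Mapping.lookup q z" for i q z
    by (induction q rule: poly_mapping_induct)
       (auto simp: m_single lin_add[OF lin_m(3)] lookup_add lookup_single when_def algebra_simps)
  have single: "\<exists>z c. c \<noteq> 0 \<and> Poly_Mapping.single z c \<in> K" if "q \<in> K" "q \<noteq> 0" for q
    using that
  proof (induction "card (Poly_Mapping.keys q)" arbitrary: q rule: less_induct)
    case less
    obtain z where z: "z \<in> Poly_Mapping.keys q" using less.prems(2) by (metis keys_eq_empty equals0I)
    show ?case
    proof (cases "Poly_Mapping.keys q = {z}")
      case True
      then have "q = Poly_Mapping.single z (Poly_Mapping.lookup q z)"
        by (intro poly_mapping_eqI) (auto simp: lookup_single when_def in_keys_iff)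
      moreover have "Poly_Mapping.lookup q z \<noteq> 0" using z by (simp add: in_keys_iff)
      ultimately show ?thesis using less.prems(1) by metis
    next
      case False
      then obtain z' where z': "z' \<in> Poly_Mapping.keys q" "z' \<noteq> z" using z by blast
      then obtain i where i: "z' i \<noteq> z i" by blast
      let ?q = "m_H r i q - scl (r i + of_int (z i)) q"
      \<comment> \<open>The factor vanishes at \<open>y = z\<close> but not at
        \<open>y = z'\<close>: the support shrinks without becoming empty.\<close>
      have l: "Poly_Mapping.lookup ?q y = (of_int (y i) - of_int (z i)) * Poly_Mapping.lookup q y" for y
        by (simp only: lookup_minus lH lookup_scl) (simp add: algebra_simps)
      have "Poly_Mapping.keys ?q \<subseteq> Poly_Mapping.keys q - {z}" by (auto simp: in_keys_iff l)
      then have "card (Poly_Mapping.keys ?q) < card (Poly_Mapping.keys q)"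
        using z by (meson card_Diff1_less card_mono finite_Diff finite_keys le_less_trans)
      moreover have "?q \<in> K" using less.prems(1) by (intro Kdiff KH Ks)
      moreover have "?q \<noteq> 0"
      proof
        assume "?q = 0"
        then have "Poly_Mapping.lookup ?q z' = 0" by simp
        then show False using i z' by (simp add: l in_keys_iff)
      qed
      ultimately show ?thesis using less.hyps by blast
    qed
  qed
  obtain z c where zc: "c \<noteq> 0" "Poly_Mapping.single z c \<in> K" using single[OF p] by blast
  have move: "Poly_Mapping.single (y(i := 0)) 1 \<in> K" if y: "Poly_Mapping.single y 1 \<in> K" for y i
  proof -
    \<comment> \<open>Before each step down the coordinate is still positive, so the truncation at
      the wall is never met.\<close>
    have down: "Poly_Mapping.single (y(i := y i - int k)) 1 \<in> K" if "int k \<le> y i" for k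
      using that
    proof (induction k)
      case (Suc k)
      have "m_partial D i (Poly_Mapping.single (y(i := y i - int k)) 1) \<in> K"
        by (rule Kp[OF Suc.IH]) (use Suc.prems in simp)
      moreover have "(y(i := y i - int k))(i := (y(i := y i - int k)) i - 1) = y(i := y i - int (Suc k))"
        by (simp add: fun_eq_iff)
      moreover have "\<not> (i \<in> D \<and> (y(i := y i - int k)) i \<le> 0)" using Suc.prems by simp
      ultimately show ?case unfolding m_single by (simp only: if_False)
    qed (use y in simp)
    have up: "Poly_Mapping.single (y(i := y i + int k)) 1 \<in> K" for k
    proof (induction k)
      case (Suc k)
      have "(y(i := y i + int k))(i := (y(i := y i + int k)) i + 1) = y(i := y i + int (Suc k))"
        by (simp add: fun_eq_iff)
      with Ki[OF Suc, of i] show ?case unfolding m_single by (simp only:)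
    qed (use y in simp)
    show ?thesis using down[of "nat (y i)"] up[of "nat (- y i)"] by (cases "y i \<ge> 0") auto
  qed
  have "\<exists>y. Poly_Mapping.single y 1 \<in> K \<and> (\<forall>i\<in>A. y i = 0)" if "finite A" for A
    using that
  proof (induction A rule: finite_induct)
    case empty
    from Ks[OF zc(2), of "1 / c"] show ?case using zc(1) by auto
  next
    case (insert i A)
    then obtain y where y: "Poly_Mapping.single y 1 \<in> K" "\<forall>j\<in>A. y j = 0" by blast
    have "\<forall>j\<in>insert i A. (y(i := 0)) j = 0" using y(2) by simp
    then show ?case using move[OF y(1), of i] by blast
  qed
  from this[of UNIV] obtain y where "Poly_Mapping.single y 1 \<in> K" "\<forall>i. y i = 0" by auto
  moreover from this(2) have "y = (\<lambda>_. 0)" by (simp add: fun_eq_iff)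
  ultimately show ?thesis by simp
qed

text \<open>A normalised vector of \<open>S\<close> defines a homomorphism from the model. It is
  injective because a nonzero kernel would contain the generator, which goes to a nonzero vector,
  and surjective because \<open>S\<close> is simple.\<close>

theorem simple_typed_isomorphic:
  assumes S: "simple_left_module I_n S" and T: "typed_module \<O>s D S"
    and r: "\<And>i c. i \<notin> D \<Longrightarrow> c \<in> \<O>s i \<Longrightarrow> c - r i \<in> \<int>" and r1: "\<And>i. i \<in> D \<Longrightarrow> r i = 1"
    and mdl: "is_model D r \<rho>"
  shows "module_isomorphic I_n (model D \<rho>) S"
proof -
  have lS: "left_module I_n S" and nz: "carrier S \<noteq> {\<zero>\<^bsub>S\<^esub>}"
    and simple: "\<And>N. submodule N I_n S \<Longrightarrow> N = {\<zero>\<^bsub>S\<^esub>} \<or> N = carrier S"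
    using S unfolding simple_left_module_def by blast+
  interpret S: In_module S by (rule In_module.intro[OF lS])
  have lM: "left_module I_n (model D \<rho>)" using mdl by (simp add: is_model_def)
  interpret MD: In_module "model D \<rho>" by (rule In_module.intro[OF lM])
  obtain w where w: "w \<in> carrier S" "w \<noteq> \<zero>\<^bsub>S\<^esub>" using nz S.M.zero_closed by blast
  obtain u where u: "u \<in> carrier S" "u \<noteq> \<zero>\<^bsub>S\<^esub>" "\<And>i. i \<in> D \<Longrightarrow> partial_x i \<odot>\<^bsub>S\<^esub> u = \<zero>\<^bsub>S\<^esub>"
    "\<And>i. i \<notin> D \<Longrightarrow> shift_H i (r i) \<odot>\<^bsub>S\<^esub> u = \<zero>\<^bsub>S\<^esub>"
    by (rule S.normal_vector_exists[where r=r, OF T _ w]) (use r that in blast)+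
  have z: "\<And>v i. i \<notin> D \<Longrightarrow> v \<in> carrier S \<Longrightarrow> F_killed S i v" using T unfolding typed_module_def by blast
  obtain f where f: "f \<in> module_hom_set I_n (model D \<rho>) S" "f (Poly_Mapping.single (\<lambda>_. 0) 1) = u"
    using S.model_hom_exists[OF mdl z r1 u(1,3,4)] by blast
  note fh = module_hom_setD[OF f(1)]
  have f0: "f 0 = \<zero>\<^bsub>S\<^esub>" using module_hom_zero[OF lM lS f(1)] by simp
  define K where "K = {p \<in> carrier (model D \<rho>). f p = \<zero>\<^bsub>S\<^esub>}"
  have K: "submodule K I_n (model D \<rho>)"
  proof (rule MD.left_submoduleI)
    show "a \<odot>\<^bsub>model D \<rho>\<^esub> v \<in> K" if "a \<in> carrier I_n" "v \<in> K" for a v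
      using that MD.smult_closed[of a v] fh(3)[of a v] by (simp add: K_def)
    show "v \<oplus>\<^bsub>model D \<rho>\<^esub> w \<in> K" if "v \<in> K" "w \<in> K" for v w
      using that MD.M.add.m_closed[of v w] fh(2)[of v w] by (simp add: K_def)
  qed (auto simp: K_def f0)
  have ker: "p = 0" if "p \<in> carrier (model D \<rho>)" "f p = \<zero>\<^bsub>S\<^esub>" for p
  proof (rule ccontr)
    assume "p \<noteq> 0"
    then have "Poly_Mapping.single (\<lambda>_. 0) 1 \<in> K"
      using model_submodule_generator[OF mdl K, of p] that by (simp add: K_def)
    then show False using f(2) u(2) by (simp add: K_def)
  qed
  have inj: "inj_on f (carrier (model D \<rho>))"
  proof (rule inj_onI)
    fix p q assume pq: "p \<in> carrier (model D \<rho>)" "q \<in> carrier (model D \<rho>)" "f p = f q"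
    have k: "Poly_Mapping.keys (p - q) \<subseteq> lattice_cone D" using pq keys_diff[of p q] by auto
    have "f (p - q) \<oplus>\<^bsub>S\<^esub> f q = f p" using fh(2)[of "p - q" q] k pq by simp
    then have "f (p - q) \<oplus>\<^bsub>S\<^esub> f q = \<zero>\<^bsub>S\<^esub> \<oplus>\<^bsub>S\<^esub> f q" using pq fh(1) by simp
    moreover have "f (p - q) \<in> carrier S" "f q \<in> carrier S" using fh(1)[of "p - q"] fh(1)[of q] k pq by auto
    ultimately have "f (p - q) = \<zero>\<^bsub>S\<^esub>" using S.M.add.r_cancel by blast
    then show "p = q" using ker[of "p - q"] k by simp
  qed
  have im: "submodule (f ` carrier (model D \<rho>)) I_n S" by (rule module_hom_image[OF lM lS f(1)])
  have "u \<in> f ` carrier (model D \<rho>)"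
    using f(2) by (intro image_eqI[of _ _ "Poly_Mapping.single (\<lambda>_. 0) 1"]) (auto simp: lattice_cone_def)
  then have "f ` carrier (model D \<rho>) = carrier S" using simple[OF im] u(2) by blast
  then show ?thesis using f(1) inj unfolding module_isomorphic_def bij_betw_def by blast
qed

section \<open>Existence of the model modules\<close>

lemma abelian_group_model: "abelian_group (model D \<rho>)"
proof (rule abelian_groupI)
  fix p assume "p \<in> carrier (model D \<rho>)"
  then show "\<exists>q\<in>carrier (model D \<rho>). q \<oplus>\<^bsub>model D \<rho>\<^esub> p = \<zero>\<^bsub>model D \<rho>\<^esub>"
    by (intro bexI[of _ "- p"]) auto
next
  fix p q assume "p \<in> carrier (model D \<rho>)" "q \<in> carrier (model D \<rho>)"
  then show "p \<oplus>\<^bsub>model D \<rho>\<^esub> q \<in> carrier (model D \<rho>)" using keys_add[of p q] by auto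
qed (auto simp: add_ac)

lemma left_module_modelI:
  assumes "\<And>a p. a \<in> carrier I_n \<Longrightarrow> Poly_Mapping.keys p \<subseteq> lattice_cone D \<Longrightarrow> Poly_Mapping.keys (\<rho> a p) \<subseteq> lattice_cone D"
    and "\<And>a b p. a \<in> carrier I_n \<Longrightarrow> b \<in> carrier I_n \<Longrightarrow> Poly_Mapping.keys p \<subseteq> lattice_cone D \<Longrightarrow>
      \<rho> (\<lambda>q. a q + b q) p = \<rho> a p + \<rho> b p"
    and "\<And>a p q. a \<in> carrier I_n \<Longrightarrow> Poly_Mapping.keys p \<subseteq> lattice_cone D \<Longrightarrow> Poly_Mapping.keys q \<subseteq> lattice_cone D \<Longrightarrow>
      \<rho> a (p + q) = \<rho> a p + \<rho> a q"
    and "\<And>a b p. a \<in> carrier I_n \<Longrightarrow> b \<in> carrier I_n \<Longrightarrow> Poly_Mapping.keys p \<subseteq> lattice_cone D \<Longrightarrow>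
      \<rho> (a \<circ> b) p = \<rho> a (\<rho> b p)"
    and "\<And>p. Poly_Mapping.keys p \<subseteq> lattice_cone D \<Longrightarrow> \<rho> id p = p"
  shows "left_module I_n (model D \<rho>)"
  by (rule left_moduleI[OF ring_I_n abelian_group_model])
     (simp_all only: model_simps mem_Collect_eq I_n_simps assms)

section \<open>The polynomials as the model with all indices in the cone condition\<close>

definition mono_fact :: "('n::finite \<Rightarrow>\<^sub>0 nat) \<Rightarrow> 'k::field_char_0"
  where "mono_fact \<alpha> = (\<Prod>i\<in>UNIV. fact (Poly_Mapping.lookup \<alpha> i))"

lemma mono_fact_nonzero [simp]: "mono_fact \<alpha> \<noteq> 0"
  by (simp add: mono_fact_def)

lemma mono_fact_add: "(mono_fact (\<alpha> + ex i) :: 'k::field_char_0) = (of_nat (Poly_Mapping.lookup \<alpha> i) + 1) * mono_fact \<alpha>"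
proof -
  have "(\<Prod>j\<in>UNIV - {i}. fact (Poly_Mapping.lookup (\<alpha> + ex i) j)) = (\<Prod>j\<in>UNIV - {i}. fact (Poly_Mapping.lookup \<alpha> j) :: 'k)"
    by (rule prod.cong) (auto simp: lookup_add lookup_single when_def)
  then show ?thesis
    by (simp add: mono_fact_def prod.remove[of UNIV i] lookup_add algebra_simps)
qed

text \<open>\<open>x\<^sup>\<alpha> / \<alpha>!\<close> corresponds to the basis vector of index \<open>\<alpha>\<close>.\<close>

definition theta :: "('n::finite, 'k::field_char_0) pol \<Rightarrow> (('n \<Rightarrow> int) \<Rightarrow>\<^sub>0 'k)"
  where "theta = lext (\<lambda>\<alpha>. Poly_Mapping.single (\<lambda>i. int (Poly_Mapping.lookup \<alpha> i)) (mono_fact \<alpha>))"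

definition of_cone :: "('n::finite \<Rightarrow> int) \<Rightarrow> ('n \<Rightarrow>\<^sub>0 nat)"
  where "of_cone z = Abs_poly_mapping (\<lambda>i. nat (z i))"

lemma lookup_of_cone [simp]: "Poly_Mapping.lookup (of_cone z) i = nat (z i)"
  by (simp add: of_cone_def)

definition theta_inv :: "(('n::finite \<Rightarrow> int) \<Rightarrow>\<^sub>0 'k::field_char_0) \<Rightarrow> ('n, 'k) pol"
  where "theta_inv = lext (\<lambda>z. Poly_Mapping.single (of_cone z) (1 / mono_fact (of_cone z)))"

lemma lin_theta: "lin theta" and lin_theta_inv: "lin theta_inv"
  by (simp_all add: theta_def theta_inv_def lin_lext)

lemma theta_single: "theta (Poly_Mapping.single \<alpha> c) = Poly_Mapping.single (\<lambda>i. int (Poly_Mapping.lookup \<alpha> i)) (c * mono_fact \<alpha>)"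
  by (simp add: theta_def)

lemma theta_inv_single: "theta_inv (Poly_Mapping.single z c) = Poly_Mapping.single (of_cone z) (c / mono_fact (of_cone z))"
  by (simp add: theta_inv_def)

lemma of_cone_int: "of_cone (\<lambda>i. int (Poly_Mapping.lookup \<alpha> i)) = \<alpha>"
  by (rule poly_mapping_eqI) simp

lemma theta_inv_theta: "theta_inv (theta p) = p"
  by (induction p rule: poly_mapping_induct)
     (simp_all add: theta_single theta_inv_single of_cone_int lin_add[OF lin_theta] lin_add[OF lin_theta_inv])

lemma theta_theta_inv: "Poly_Mapping.keys p \<subseteq> lattice_cone UNIV \<Longrightarrow> theta (theta_inv p) = p"
proof (induction p rule: poly_mapping_induct_keys)
  case (single z c)
  then have "(\<lambda>i. int (nat (z i))) = z" by (auto simp: lattice_cone_def)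
  then show ?case by (simp add: theta_single theta_inv_single)
qed (simp_all add: lin_zero[OF lin_theta] lin_zero[OF lin_theta_inv] lin_add[OF lin_theta] lin_add[OF lin_theta_inv])

lemma keys_theta: "Poly_Mapping.keys (theta p) \<subseteq> lattice_cone UNIV"
proof (induction p rule: poly_mapping_induct)
  case (add p q)
  then show ?case using keys_add[of "theta p" "theta q"] by (auto simp: lin_add[OF lin_theta])
qed (auto simp: theta_single lattice_cone_def)

lemma theta_partial: "theta (partial_x i p) = m_partial UNIV i (theta p)"
proof (induction p rule: poly_mapping_induct)
  case (single \<alpha> c)
  show ?case
  proof (cases "Poly_Mapping.lookup \<alpha> i")
    case 0
    then show ?thesis by (simp add: partial_x_single theta_single m_single lin_zero[OF lin_theta])
  next
    case (Suc m)
    define \<beta> where "\<beta> = \<alpha> - ex i"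
    have \<alpha>: "\<alpha> = \<beta> + ex i" using diff_add_ex[of \<alpha> i] Suc by (simp add: \<beta>_def)
    have l: "(\<lambda>j. int (Poly_Mapping.lookup \<beta> j)) = (\<lambda>j. int (Poly_Mapping.lookup (\<beta> + ex i) j))(i := int (Poly_Mapping.lookup (\<beta> + ex i) i) - 1)"
      by (auto simp: lookup_add lookup_single when_def)
    have "theta (partial_x i (Poly_Mapping.single \<alpha> c)) =
        Poly_Mapping.single (\<lambda>j. int (Poly_Mapping.lookup \<beta> j)) (c * (of_nat (Poly_Mapping.lookup \<alpha> i) * mono_fact \<beta>))"
      unfolding partial_x_single theta_single \<beta>_def by (simp only: mult.assoc)
    also have "of_nat (Poly_Mapping.lookup \<alpha> i) * mono_fact \<beta> = (mono_fact \<alpha> :: 'b)"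
      unfolding \<alpha> mono_fact_add by (simp add: lookup_add add.commute)
    also have "Poly_Mapping.single (\<lambda>j. int (Poly_Mapping.lookup \<beta> j)) (c * mono_fact \<alpha>) = m_partial UNIV i (theta (Poly_Mapping.single \<alpha> c))"
      unfolding theta_single m_single l \<alpha> by (simp add: lookup_add)
    finally show ?thesis .
  qed
qed (simp add: lin_add[OF lin_theta] lin_add[OF lin_m(1)])

lemma lookup_add_ex_int: "(\<lambda>j. int (Poly_Mapping.lookup (\<alpha> + ex i) j)) =
    (\<lambda>j. int (Poly_Mapping.lookup \<alpha> j))(i := int (Poly_Mapping.lookup \<alpha> i) + 1)"
  by (auto simp: lookup_add lookup_single when_def)

lemma theta_int: "theta (int_x i p) = m_int i (theta p)"
proof (induction p rule: poly_mapping_induct)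
  case (single \<alpha> c)
  show ?case unfolding int_x_single theta_single m_single lookup_add_ex_int mono_fact_add by simp
qed (simp add: lin_add[OF lin_theta] lin_add[OF lin_m(2)])

lemma theta_H: "theta (H_op i p) = m_H (\<lambda>_. 1) i (theta p)"
  by (induction p rule: poly_mapping_induct)
     (simp_all add: H_op_single theta_single m_single lin_add[OF lin_theta] lin_add[OF lin_m(3)] mult_ac add.commute)

lemma theta_scl: "theta (scl c p) = scl c (theta p)"
  by (rule lin_scl[OF lin_theta])

text \<open>Here the action exists by the very definition of the algebra as operators on
  polynomials; it is only rewritten in the basis of divided powers.\<close>

lemma is_model_UNIV: "is_model UNIV (\<lambda>_. 1) (\<lambda>a p. theta (a (theta_inv p)))"
  unfolding is_model_def
proof (intro conjI allI impI)
  show "left_module I_n (model UNIV (\<lambda>a p. theta (a (theta_inv p))))"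
    by (rule left_module_modelI)
       (simp_all add: keys_theta lin_add[OF lin_theta] lin_add[OF lin_theta_inv] lin_add[OF lin_I_n]
          theta_inv_theta theta_theta_inv)
qed (simp_all add: theta_theta_inv theta_partial theta_int mult_x_eq theta_H theta_scl)

section \<open>Coefficients that are polynomials in a parameter\<close>

lemma lookup_pmap: "f 0 = 0 \<Longrightarrow> Poly_Mapping.lookup (Poly_Mapping.map f p) a = f (Poly_Mapping.lookup p a)"
  by (simp add: Poly_Mapping.map.rep_eq when_def)

definition ev :: "'k \<Rightarrow> ('a \<Rightarrow>\<^sub>0 'k::field_char_0 poly) \<Rightarrow> ('a \<Rightarrow>\<^sub>0 'k)"
  where "ev t = Poly_Mapping.map (\<lambda>p. poly p t)"

definition cst :: "('a \<Rightarrow>\<^sub>0 'k::field_char_0) \<Rightarrow> ('a \<Rightarrow>\<^sub>0 'k poly)"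
  where "cst = Poly_Mapping.map (\<lambda>c. [:c:])"

definition pscl :: "'k poly \<Rightarrow> ('a \<Rightarrow>\<^sub>0 'k::field_char_0 poly) \<Rightarrow> ('a \<Rightarrow>\<^sub>0 'k poly)"
  where "pscl c = Poly_Mapping.map ((*) c)"

lemma lookup_ev [simp]: "Poly_Mapping.lookup (ev t q) a = poly (Poly_Mapping.lookup q a) t"
  and lookup_cst [simp]: "Poly_Mapping.lookup (cst p) a = [:Poly_Mapping.lookup p a:]"
  and lookup_pscl [simp]: "Poly_Mapping.lookup (pscl c q) a = c * Poly_Mapping.lookup q a"
  by (simp_all add: ev_def cst_def pscl_def lookup_pmap)

lemma ev_add: "ev t (p + q) = ev t p + ev t q"
  and cst_add: "cst (p' + q') = cst p' + cst q'"
  and ev_cst: "ev t (cst p') = p'"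
  and ev_zero: "ev t 0 = 0"
  and ev_single: "ev t (Poly_Mapping.single a c) = Poly_Mapping.single a (poly c t)"
  and cst_single: "cst (Poly_Mapping.single a d) = Poly_Mapping.single a [:d:]"
  and ev_pscl: "ev t (pscl c q) = scl (poly c t) (ev t q)"
  by (rule poly_mapping_eqI; simp add: lookup_add lookup_single when_def)+

lemma keys_ev: "Poly_Mapping.keys (ev t q) \<subseteq> Poly_Mapping.keys q"
  and keys_cst: "Poly_Mapping.keys (cst p) = Poly_Mapping.keys p"
  and keys_pscl: "Poly_Mapping.keys (pscl c q) \<subseteq> Poly_Mapping.keys q"
  by (auto simp: in_keys_iff)

text \<open>The remainder theorem, coefficient by coefficient. It will show that the value at
  \<open>t\<close> of a result depends only on the value at \<open>t\<close> of the
  argument.\<close>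

lemma ev_division: "\<exists>q'. Poly_Mapping.keys q' \<subseteq> Poly_Mapping.keys q \<and> q = cst (ev t q) + pscl [:-t, 1:] q'"
proof (intro exI conjI)
  let ?q = "Poly_Mapping.map (\<lambda>p. synthetic_div p t) q"
  have l: "Poly_Mapping.lookup ?q a = synthetic_div (Poly_Mapping.lookup q a) t" for a by (simp add: lookup_pmap)
  show "Poly_Mapping.keys ?q \<subseteq> Poly_Mapping.keys q" by (auto simp: in_keys_iff l)
  show "q = cst (ev t q) + pscl [:-t, 1:] ?q"
  proof (rule poly_mapping_eqI)
    fix a
    show "Poly_Mapping.lookup q a = Poly_Mapping.lookup (cst (ev t q) + pscl [:-t, 1:] ?q) a"
      unfolding lookup_add lookup_cst lookup_pscl lookup_ev l
      using synthetic_div_correct'[of t "Poly_Mapping.lookup q a"] by (simp only: add.commute)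
  qed
qed

section \<open>Translation along one direction and behaviour far out\<close>

definition mv :: "'n \<Rightarrow> int \<Rightarrow> (('n \<Rightarrow> int) \<Rightarrow>\<^sub>0 'k::field_char_0) \<Rightarrow> (('n \<Rightarrow> int) \<Rightarrow>\<^sub>0 'k)"
  where "mv i m = lext (\<lambda>z. Poly_Mapping.single (z(i := z i + m)) 1)"

lemma lin_mv: "lin (mv i m)" by (simp add: mv_def lin_lext)

lemma mv_single: "mv i m (Poly_Mapping.single z c) = Poly_Mapping.single (z(i := z i + m)) c"
  by (simp add: mv_def)

lemma mv_inverse: "mv i (- m) (mv i m p) = p"
  by (induction p rule: poly_mapping_induct) (simp_all add: mv_single lin_add[OF lin_mv])

definition Lt :: "'n \<Rightarrow> nat \<Rightarrow> (('n \<Rightarrow> int) \<Rightarrow>\<^sub>0 'k::field_char_0 poly) \<Rightarrow> (('n \<Rightarrow> int) \<Rightarrow>\<^sub>0 'k)"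
  where "Lt i t q = mv i (int t) (ev (of_nat t) q)"

lemma Lt_add: "Lt i t (p + q) = Lt i t p + Lt i t q"
  and Lt_zero: "Lt i t 0 = 0"
  and Lt_single: "Lt i t (Poly_Mapping.single z c) = Poly_Mapping.single (z(i := z i + int t)) (poly c (of_nat t))"
  and Lt_pscl: "Lt i t (pscl d p) = scl (poly d (of_nat t)) (Lt i t p)"
  by (simp_all add: Lt_def ev_add ev_zero ev_single ev_pscl lin_add[OF lin_mv] lin_zero[OF lin_mv] lin_scl[OF lin_mv] mv_single)

text \<open>In characteristic zero the large natural numbers are infinitely many distinct points of
  the field, too many to be roots of a nonzero difference.\<close>

lemma poly_eq_eventually:
  assumes "\<And>t. t \<ge> N \<Longrightarrow> poly p (of_nat t) = poly q (of_nat t :: 'k::field_char_0)"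
  shows "p = q"
proof (rule ccontr)
  assume "p \<noteq> q"
  then have "finite {x. poly (p - q) x = 0}" by (intro poly_roots_finite) simp
  moreover have "of_nat ` {N..} \<subseteq> {x. poly (p - q) x = 0}" using assms by auto
  ultimately have "finite (of_nat ` {N..} :: 'k set)" by (rule finite_subset[rotated])
  then have "finite {N..}" by (rule finite_imageD) (simp add: inj_on_def)
  then show False using infinite_Ici by blast
qed

lemma Lt_eq_eventually:
  assumes "\<And>t. t \<ge> N \<Longrightarrow> Lt i t p = Lt i t q"
  shows "p = q"
proof (rule poly_mapping_eqI)
  fix a
  have "ev (of_nat t) p = ev (of_nat t) q" if "t \<ge> N" for t
    using assms[OF that] mv_inverse[of i "int t"] unfolding Lt_def by metis
  then have "poly (Poly_Mapping.lookup p a) (of_nat t) = poly (Poly_Mapping.lookup q a) (of_nat t)" if "t \<ge> N" for t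
    using that lookup_ev[of "of_nat t" p a] lookup_ev[of "of_nat t" q a] by metis
  then show "Poly_Mapping.lookup p a = Poly_Mapping.lookup q a" by (rule poly_eq_eventually)
qed

text \<open>A finite support is pushed past the wall in direction \<open>i\<close> by a large enough
  translation; the other walls are respected from the start.\<close>

lemma Lt_cone:
  assumes "Poly_Mapping.keys q \<subseteq> lattice_cone (E - {i})"
  shows "\<exists>N. \<forall>t\<ge>N. Poly_Mapping.keys (Lt i t q) \<subseteq> lattice_cone E"
  using assms
proof (induction q rule: poly_mapping_induct_keys)
  case zero
  then show ?case by (simp add: Lt_zero)
next
  case (single z c)
  then show ?case
    by (intro exI[of _ "nat (- z i)"]) (auto simp: Lt_single lattice_cone_def)
next
  case (add p q)
  then obtain N N' where "\<forall>t\<ge>N. Poly_Mapping.keys (Lt i t p) \<subseteq> lattice_cone E"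
    "\<forall>t\<ge>N'. Poly_Mapping.keys (Lt i t q) \<subseteq> lattice_cone E" by blast
  then have "\<forall>t\<ge>max N N'. Poly_Mapping.keys (Lt i t (p + q)) \<subseteq> lattice_cone E"
    unfolding Lt_add using keys_add by (metis (no_types, lifting) Un_least max.bounded_iff subset_trans)
  then show ?case by blast
qed

section \<open>Removing one index from the cone condition\<close>

locale model_step =
  fixes E :: "'n::finite set" and i :: 'n and r :: "'n \<Rightarrow> 'k::field_char_0" and \<rho> and c :: 'k
  assumes model_E: "is_model E r \<rho>" and iE: "i \<in> E" and ri: "r i = 1"
begin

abbreviation D where "D \<equiv> E - {i}"

text \<open>The coefficients of \<open>q\<close> are polynomials in \<open>t\<close>, and \<open>Lt i t q\<close> is \<open>q\<close> at \<open>t\<close>, translated by \<open>t\<close> in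
  direction \<open>i\<close>. For large \<open>t\<close> it lies in the given model, and there every operator acts by
  formulas that are polynomial in \<open>t\<close>. So \<open>s\<close> is determined by \<open>a\<close> and \<open>q\<close> in \<open>Rel a q s\<close>; the new
  model arises at \<open>t = c - 1\<close>.\<close>

definition Rel where "Rel a q s \<longleftrightarrow> Poly_Mapping.keys q \<subseteq> lattice_cone D \<and> Poly_Mapping.keys s \<subseteq> lattice_cone D \<and>
  (\<exists>N. \<forall>t\<ge>N. \<rho> a (Lt i t q) = Lt i t s)"

sublocale ME: left_module I_n "model E \<rho>"
  using model_E by (simp add: is_model_def)

lemma gens_E:
  assumes "Poly_Mapping.keys p \<subseteq> lattice_cone E"
  shows "\<rho> (scl d) p = scl d p" "\<rho> (partial_x j) p = m_partial E j p" "\<rho> (int_x j) p = m_int j p"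
    "\<rho> (mult_x j) p = m_int j (m_H r j p)"
  using model_E assms by (simp_all add: is_model_def)

text \<open>For large \<open>t\<close> the translate lies in the cone \<open>E\<close>, so the
  equation may be checked under this assumption, which the formulas for the generators
  require.\<close>

lemma RelI:
  assumes "Poly_Mapping.keys q \<subseteq> lattice_cone D" "Poly_Mapping.keys s \<subseteq> lattice_cone D"
    and "\<And>t. t \<ge> N \<Longrightarrow> Poly_Mapping.keys (Lt i t q) \<subseteq> lattice_cone E \<Longrightarrow> \<rho> a (Lt i t q) = Lt i t s"
  shows "Rel a q s"
proof -
  obtain N' where "\<forall>t\<ge>N'. Poly_Mapping.keys (Lt i t q) \<subseteq> lattice_cone E" using Lt_cone[OF assms(1)] by blast
  then have "\<forall>t\<ge>max N N'. \<rho> a (Lt i t q) = Lt i t s" using assms(3) by simp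
  then show ?thesis using assms(1,2) unfolding Rel_def by blast
qed

lemma RelE:
  assumes "Rel a q s"
  obtains N where "\<And>t. t \<ge> N \<Longrightarrow> \<rho> a (Lt i t q) = Lt i t s"
    "\<And>t. t \<ge> N \<Longrightarrow> Poly_Mapping.keys (Lt i t q) \<subseteq> lattice_cone E"
    "\<And>t. t \<ge> N \<Longrightarrow> Poly_Mapping.keys (Lt i t s) \<subseteq> lattice_cone E"
proof -
  obtain N N' N'' where "\<forall>t\<ge>N. \<rho> a (Lt i t q) = Lt i t s"
    "\<forall>t\<ge>N'. Poly_Mapping.keys (Lt i t q) \<subseteq> lattice_cone E"
    "\<forall>t\<ge>N''. Poly_Mapping.keys (Lt i t s) \<subseteq> lattice_cone E"
    using assms Lt_cone unfolding Rel_def by meson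
  then show thesis using that[of "max N (max N' N'')"] by simp
qed

lemma Rel_unique:
  assumes "Rel a q s" "Rel a q s'"
  shows "s = s'"
proof -
  obtain N where N: "\<And>t. t \<ge> N \<Longrightarrow> \<rho> a (Lt i t q) = Lt i t s" by (rule RelE[OF assms(1)]) blast
  obtain N' where N': "\<And>t. t \<ge> N' \<Longrightarrow> \<rho> a (Lt i t q) = Lt i t s'" by (rule RelE[OF assms(2)]) blast
  show ?thesis by (rule Lt_eq_eventually[where N="max N N'" and i=i], rule trans[OF N[symmetric] N']) simp_all
qed

lemma Rel_add:
  assumes "Rel a p s" "Rel a q u" "a \<in> carrier I_n"
  shows "Rel a (p + q) (s + u)"
proof -
  obtain N where N: "\<And>t. t \<ge> N \<Longrightarrow> \<rho> a (Lt i t p) = Lt i t s"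
    "\<And>t. t \<ge> N \<Longrightarrow> Poly_Mapping.keys (Lt i t p) \<subseteq> lattice_cone E" by (rule RelE[OF assms(1)]) blast
  obtain N' where N': "\<And>t. t \<ge> N' \<Longrightarrow> \<rho> a (Lt i t q) = Lt i t u"
    "\<And>t. t \<ge> N' \<Longrightarrow> Poly_Mapping.keys (Lt i t q) \<subseteq> lattice_cone E" by (rule RelE[OF assms(2)]) blast
  show ?thesis
  proof (rule RelI[where N = "max N N'"])
    show "Poly_Mapping.keys (p + q) \<subseteq> lattice_cone D" "Poly_Mapping.keys (s + u) \<subseteq> lattice_cone D"
      using assms(1,2) keys_add[of p q] keys_add[of s u] unfolding Rel_def by blast+
    fix t assume "t \<ge> max N N'"
    then have "\<rho> a (Lt i t p + Lt i t q) = \<rho> a (Lt i t p) + \<rho> a (Lt i t q)"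
      using ME.smult_r_distr[OF assms(3), of "Lt i t p" "Lt i t q"] N(2) N'(2) by simp
    then show "\<rho> a (Lt i t (p + q)) = Lt i t (s + u)" using \<open>t \<ge> max N N'\<close> N(1) N'(1) by (simp add: Lt_add)
  qed
qed

lemma Rel_plus:
  assumes "Rel a q s" "Rel b q u" "a \<in> carrier I_n" "b \<in> carrier I_n"
  shows "Rel (\<lambda>p. a p + b p) q (s + u)"
proof -
  obtain N where N: "\<And>t. t \<ge> N \<Longrightarrow> \<rho> a (Lt i t q) = Lt i t s" by (rule RelE[OF assms(1)]) blast
  obtain N' where N': "\<And>t. t \<ge> N' \<Longrightarrow> \<rho> b (Lt i t q) = Lt i t u" by (rule RelE[OF assms(2)]) blast
  show ?thesis
  proof (rule RelI[where N = "max N N'"])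
    show "Poly_Mapping.keys q \<subseteq> lattice_cone D" "Poly_Mapping.keys (s + u) \<subseteq> lattice_cone D"
      using assms(1,2) keys_add[of s u] unfolding Rel_def by blast+
    fix t assume t: "t \<ge> max N N'" "Poly_Mapping.keys (Lt i t q) \<subseteq> lattice_cone E"
    then have "\<rho> (\<lambda>p. a p + b p) (Lt i t q) = \<rho> a (Lt i t q) + \<rho> b (Lt i t q)"
      using ME.smult_l_distr[OF assms(3,4), of "Lt i t q"] by simp
    then show "\<rho> (\<lambda>p. a p + b p) (Lt i t q) = Lt i t (s + u)" using t N N' by (simp add: Lt_add)
  qed
qed

lemma Rel_comp:
  assumes "Rel b q s" "Rel a s u" "a \<in> carrier I_n" "b \<in> carrier I_n"
  shows "Rel (a \<circ> b) q u"
proof -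
  obtain N where N: "\<And>t. t \<ge> N \<Longrightarrow> \<rho> b (Lt i t q) = Lt i t s" by (rule RelE[OF assms(1)]) blast
  obtain N' where N': "\<And>t. t \<ge> N' \<Longrightarrow> \<rho> a (Lt i t s) = Lt i t u" by (rule RelE[OF assms(2)]) blast
  show ?thesis
  proof (rule RelI[where N = "max N N'"])
    show "Poly_Mapping.keys q \<subseteq> lattice_cone D" "Poly_Mapping.keys u \<subseteq> lattice_cone D"
      using assms(1,2) unfolding Rel_def by blast+
    fix t assume t: "t \<ge> max N N'" "Poly_Mapping.keys (Lt i t q) \<subseteq> lattice_cone E"
    then have "\<rho> (a \<circ> b) (Lt i t q) = \<rho> a (\<rho> b (Lt i t q))"
      using ME.smult_assoc[OF assms(3,4), of "Lt i t q"] by simp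
    then show "\<rho> (a \<circ> b) (Lt i t q) = Lt i t u" using t N N' by simp
  qed
qed

text \<open>At a fixed \<open>t\<close> a polynomial coefficient is just a scalar, and operators
  commute with scalars. So the action on families is linear over polynomials in \<open>t\<close>;
  this is what allows specialisation at values that are not large integers.\<close>

lemma Rel_pscl:
  assumes "Rel a q s" "a \<in> carrier I_n"
  shows "Rel a (pscl d q) (pscl d s)"
proof -
  obtain N where N: "\<And>t. t \<ge> N \<Longrightarrow> \<rho> a (Lt i t q) = Lt i t s"
    "\<And>t. t \<ge> N \<Longrightarrow> Poly_Mapping.keys (Lt i t q) \<subseteq> lattice_cone E"
    "\<And>t. t \<ge> N \<Longrightarrow> Poly_Mapping.keys (Lt i t s) \<subseteq> lattice_cone E" by (rule RelE[OF assms(1)]) blast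
  show ?thesis
  proof (rule RelI[where N = N])
    show "Poly_Mapping.keys (pscl d q) \<subseteq> lattice_cone D" "Poly_Mapping.keys (pscl d s) \<subseteq> lattice_cone D"
      using assms(1) keys_pscl[of d q] keys_pscl[of d s] unfolding Rel_def by blast+
    fix t assume t: "t \<ge> N"
    let ?e = "poly d (of_nat t)"
    have c: "a \<circ> scl ?e = scl ?e \<circ> a" using lin_scl[OF lin_I_n[OF assms(2)]] by (simp add: fun_eq_iff)
    have X: "Lt i t q \<in> carrier (model E \<rho>)" using N(2)[OF t] by simp
    have "\<rho> a (\<rho> (scl ?e) (Lt i t q)) = \<rho> (a \<circ> scl ?e) (Lt i t q)"
      using ME.smult_assoc[OF assms(2) I_n_closed(1) X, of ?e] by (simp only: model_simps I_n_simps)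
    also have "\<dots> = \<rho> (scl ?e) (\<rho> a (Lt i t q))"
      unfolding c using ME.smult_assoc[OF I_n_closed(1) assms(2) X, of ?e] by (simp only: model_simps I_n_simps)
    finally show "\<rho> a (Lt i t (pscl d q)) = Lt i t (pscl d s)"
      unfolding Lt_pscl gens_E(1)[OF N(2)[OF t]] N(1)[OF t] gens_E(1)[OF N(3)[OF t]] .
  qed
qed

text \<open>A coefficient depending on \<open>t\<close> arises only from multiplication by the
  variable of index \<open>i\<close>: at distance \<open>t\<close> the eigenvalue of
  \<open>H\<^sub>i\<close> is \<open>1 + z i + t\<close>, the linear polynomial
  \<open>[:1 + of_int (z i), 1:]\<close>. The truncation of the derivative in direction
  \<open>i\<close> is invisible far out.\<close>

lemma Rel_gens:
  assumes "z \<in> lattice_cone D"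
  shows "Rel (partial_x j) (Poly_Mapping.single z p)
      (if j \<in> D \<and> z j \<le> 0 then 0 else Poly_Mapping.single (z(j := z j - 1)) p)"
    and "Rel (int_x j) (Poly_Mapping.single z p) (Poly_Mapping.single (z(j := z j + 1)) p)"
    and "Rel (mult_x j) (Poly_Mapping.single z p)
      (Poly_Mapping.single (z(j := z j + 1)) (p * (if j = i then [:1 + of_int (z i), 1:] else [:r j + of_int (z j):])))"
proof -
  have k: "Poly_Mapping.keys (Poly_Mapping.single z p) \<subseteq> lattice_cone D" using assms by simp
  show "Rel (partial_x j) (Poly_Mapping.single z p)
      (if j \<in> D \<and> z j \<le> 0 then 0 else Poly_Mapping.single (z(j := z j - 1)) p)"
  \<comment> \<open>From this \<open>t\<close> on the translated coordinate \<open>z i + t\<close>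
    is at least 1, so the derivative is not truncated.\<close>
  proof (rule RelI[OF k, where N = "nat (1 - z i)"])
    show "Poly_Mapping.keys (if j \<in> D \<and> z j \<le> 0 then 0 else Poly_Mapping.single (z(j := z j - 1)) p) \<subseteq> lattice_cone D"
      using assms by (auto simp: lattice_cone_def)
    fix t assume t: "t \<ge> nat (1 - z i)" "Poly_Mapping.keys (Lt i t (Poly_Mapping.single z p)) \<subseteq> lattice_cone E"
    show "\<rho> (partial_x j) (Lt i t (Poly_Mapping.single z p)) =
        Lt i t (if j \<in> D \<and> z j \<le> 0 then 0 else Poly_Mapping.single (z(j := z j - 1)) p)"
    proof (cases "j = i")
      case True
      have 1: "(z(i := z i + int t))(i := (z(i := z i + int t)) i - 1) = (z(i := z i - 1))(i := (z(i := z i - 1)) i + int t)" by auto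
      have 2: "\<not> (i \<in> E \<and> (z(i := z i + int t)) i \<le> 0)" using t(1) by auto
      show ?thesis unfolding gens_E(2)[OF t(2)] unfolding True Lt_single m_single if_not_P[OF 2] 1 by (simp add: Lt_single)
    next
      case False
      have 1: "(z(i := z i + int t))(j := (z(i := z i + int t)) j - 1) = (z(j := z j - 1))(i := (z(j := z j - 1)) i + int t)"
        using False by auto
      have 2: "(j \<in> E \<and> (z(i := z i + int t)) j \<le> 0) = (j \<in> D \<and> z j \<le> 0)" using False by auto
      show ?thesis unfolding gens_E(2)[OF t(2)] unfolding Lt_single m_single 1 2 by (simp add: Lt_single Lt_zero)
    qed
  qed
  have 1: "(z(i := z i + int t))(j := (z(i := z i + int t)) j + 1) = (z(j := z j + 1))(i := (z(j := z j + 1)) i + int t)" for t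
    by auto
  have 2: "z(j := z j + 1) \<in> lattice_cone D" using assms by (auto simp: lattice_cone_def)
  show "Rel (int_x j) (Poly_Mapping.single z p) (Poly_Mapping.single (z(j := z j + 1)) p)"
  proof (rule RelI[OF k])
    fix t assume t: "Poly_Mapping.keys (Lt i t (Poly_Mapping.single z p)) \<subseteq> lattice_cone E"
    show "\<rho> (int_x j) (Lt i t (Poly_Mapping.single z p)) = Lt i t (Poly_Mapping.single (z(j := z j + 1)) p)"
      unfolding gens_E(3)[OF t] unfolding Lt_single m_single 1 ..
  qed (use 2 in simp)
  let ?f = "if j = i then [:1 + of_int (z i), 1:] else [:r j + of_int (z j):]"
  show "Rel (mult_x j) (Poly_Mapping.single z p) (Poly_Mapping.single (z(j := z j + 1)) (p * ?f))"
  proof (rule RelI[OF k])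
    fix t assume t: "Poly_Mapping.keys (Lt i t (Poly_Mapping.single z p)) \<subseteq> lattice_cone E"
    have 3: "poly p (of_nat t) * (r j + of_int ((z(i := z i + int t)) j)) = poly (p * ?f) (of_nat t)"
      using ri by auto
    show "\<rho> (mult_x j) (Lt i t (Poly_Mapping.single z p)) = Lt i t (Poly_Mapping.single (z(j := z j + 1)) (p * ?f))"
      unfolding gens_E(4)[OF t] unfolding Lt_single m_single 1 3 ..
  qed (use 2 in simp)
qed

lemma Rel_zero: "a \<in> carrier I_n \<Longrightarrow> Rel a 0 0"
  using ME.smult_r_zero by (intro RelI) (simp_all add: Lt_zero)

lemma Rel_exists_gen:
  assumes "\<And>z p. z \<in> lattice_cone D \<Longrightarrow> \<exists>s. Rel a (Poly_Mapping.single z p) s" "a \<in> carrier I_n"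
    and "Poly_Mapping.keys q \<subseteq> lattice_cone D"
  shows "\<exists>s. Rel a q s"
  using assms(3)
proof (induction q rule: poly_mapping_induct_keys)
  case zero
  then show ?case using Rel_zero[OF assms(2)] by blast
next
  case (single z p)
  then show ?case by (rule assms(1))
next
  case (add p q)
  then show ?case using Rel_add[OF _ _ assms(2)] by blast
qed

lemma Rel_exists:
  assumes "a \<in> carrier I_n" "Poly_Mapping.keys q \<subseteq> lattice_cone D"
  shows "\<exists>s. Rel a q s"
  using assms
proof (induction a arbitrary: q rule: I_n_induct)
  case (scl d)
  have "Rel (scl d) q (pscl [:d:] q)"
    by (rule RelI) (use scl keys_pscl[of "[:d:]" q] in \<open>auto simp: gens_E Lt_pscl\<close>)
  then show ?case by blast
next
  case (mult_x j)
  show ?case by (rule Rel_exists_gen[OF _ _ mult_x]) (use Rel_gens(3) in \<open>blast, simp\<close>)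
next
  case (partial_x j)
  show ?case by (rule Rel_exists_gen[OF _ _ partial_x]) (use Rel_gens(1) in \<open>blast, simp\<close>)
next
  case (int_x j)
  show ?case by (rule Rel_exists_gen[OF _ _ int_x]) (use Rel_gens(2) in \<open>blast, simp\<close>)
next
  case (comp a b)
  obtain s where s: "Rel b q s" using comp.IH(2)[OF comp.prems] by blast
  then have "Poly_Mapping.keys s \<subseteq> lattice_cone D" unfolding Rel_def by blast
  then obtain u where "Rel a s u" using comp.IH(1) by blast
  then show ?case using Rel_comp[OF s _ comp.hyps] by blast
next
  case (add a b)
  then show ?case using Rel_plus[OF _ _ add.hyps] by blast
qed

definition A where "A a q = (THE s. Rel a q s)"

lemma A_eq: "Rel a q s \<Longrightarrow> A a q = s"
  unfolding A_def using Rel_unique by blast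

lemma Rel_A: "a \<in> carrier I_n \<Longrightarrow> Poly_Mapping.keys q \<subseteq> lattice_cone D \<Longrightarrow> Rel a q (A a q)"
  using Rel_exists A_eq by metis

text \<open>At this value of \<open>t\<close> the eigenvalue \<open>1 + z i + t\<close> becomes
  \<open>c + z i\<close>.\<close>

abbreviation \<tau> where "\<tau> \<equiv> c - 1"

definition \<rho>' where "\<rho>' a p = ev \<tau> (A a (cst p))"

text \<open>Up to a multiple of \<open>t - \<tau>\<close> the family \<open>q\<close> is constant
  with value \<open>ev \<tau> q\<close>. By linearity over polynomials the image of that multiple
  again vanishes at \<open>\<tau>\<close>, so specialisation commutes with the action.\<close>

lemma ev_A:
  assumes a: "a \<in> carrier I_n" and q: "Poly_Mapping.keys q \<subseteq> lattice_cone D"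
  shows "ev \<tau> (A a q) = \<rho>' a (ev \<tau> q)"
proof -
  obtain q' where q': "Poly_Mapping.keys q' \<subseteq> Poly_Mapping.keys q" "q = cst (ev \<tau> q) + pscl [:-\<tau>, 1:] q'"
    using ev_division[where q=q and t=\<tau>] by (elim exE conjE)
  have 1: "Rel a q' (A a q')" using Rel_A[OF a, of q'] q q'(1) by blast
  have "Poly_Mapping.keys (cst (ev \<tau> q)) \<subseteq> lattice_cone D" using q keys_ev[of \<tau> q] by (auto simp: keys_cst)
  then have 2: "Rel a (cst (ev \<tau> q)) (A a (cst (ev \<tau> q)))" using Rel_A[OF a] by blast
  have "A a q = A a (cst (ev \<tau> q)) + pscl [:-\<tau>, 1:] (A a q')"
    using A_eq[OF Rel_add[OF 2 Rel_pscl[OF 1 a, where d="[:-\<tau>, 1:]"] a]] unfolding q'(2)[symmetric] .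
  then show ?thesis by (simp add: \<rho>'_def ev_add ev_pscl)
qed

lemma rho'_add:
  assumes "a \<in> carrier I_n" "Poly_Mapping.keys p \<subseteq> lattice_cone D" "Poly_Mapping.keys q \<subseteq> lattice_cone D"
  shows "\<rho>' a (p + q) = \<rho>' a p + \<rho>' a q"
proof -
  have "Rel a (cst p + cst q) (A a (cst p) + A a (cst q))"
    by (rule Rel_add[OF Rel_A[OF assms(1)] Rel_A[OF assms(1)] assms(1)]) (use assms in \<open>simp_all add: keys_cst\<close>)
  from A_eq[OF this] show ?thesis by (simp add: \<rho>'_def cst_add ev_add)
qed

lemma rho'_single:
  assumes "Rel a (Poly_Mapping.single z [:d:]) s"
  shows "\<rho>' a (Poly_Mapping.single z d) = ev \<tau> s"
  unfolding \<rho>'_def cst_single A_eq[OF assms] ..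

lemma rho'_lin:
  assumes "a \<in> carrier I_n" "lin f" "Poly_Mapping.keys p \<subseteq> lattice_cone D"
    and "\<And>z d. z \<in> lattice_cone D \<Longrightarrow> \<rho>' a (Poly_Mapping.single z d) = f (Poly_Mapping.single z d)"
  shows "\<rho>' a p = f p"
  using assms(3)
proof (induction p rule: poly_mapping_induct_keys)
  case zero
  have "cst 0 = (0 :: ('n \<Rightarrow> int) \<Rightarrow>\<^sub>0 'k poly)" by (rule poly_mapping_eqI) simp
  then show ?case unfolding \<rho>'_def using A_eq[OF Rel_zero[OF assms(1)]] by (simp add: ev_zero lin_zero[OF assms(2)])
next
  case (single z d)
  then show ?case by (rule assms(4))
next
  case (add p q)
  then show ?case using rho'_add[OF assms(1)] by (simp add: lin_add[OF assms(2)])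
qed

lemma is_model_D: "is_model D (r(i := c)) \<rho>'"
  unfolding is_model_def
proof (intro conjI allI impI)
  have cone: "Poly_Mapping.keys (cst p) \<subseteq> lattice_cone D" if "Poly_Mapping.keys p \<subseteq> lattice_cone D" for p :: "('n \<Rightarrow> int) \<Rightarrow>\<^sub>0 'k"
    using that by (simp add: keys_cst)
  show "left_module I_n (model D \<rho>')"
  proof (rule left_module_modelI)
    fix a :: "('n, 'k) opr" and p :: "('n \<Rightarrow> int) \<Rightarrow>\<^sub>0 'k" assume a: "a \<in> carrier I_n" and p: "Poly_Mapping.keys p \<subseteq> lattice_cone D"
    have R: "Rel a (cst p) (A a (cst p))" by (rule Rel_A[OF a cone[OF p]])
    then show "Poly_Mapping.keys (\<rho>' a p) \<subseteq> lattice_cone D"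
      unfolding \<rho>'_def Rel_def using keys_ev[of \<tau> "A a (cst p)"] by blast
    show "\<rho>' a (p + q) = \<rho>' a p + \<rho>' a q" if "Poly_Mapping.keys q \<subseteq> lattice_cone D" for q
      by (rule rho'_add[OF a p that])
    fix b :: "('n, 'k) opr" assume b: "b \<in> carrier I_n"
    have Rb: "Rel b (cst p) (A b (cst p))" by (rule Rel_A[OF b cone[OF p]])
    show "\<rho>' (\<lambda>q. a q + b q) p = \<rho>' a p + \<rho>' b p"
      unfolding \<rho>'_def using A_eq[OF Rel_plus[OF R Rb a b]] by (simp add: ev_add)
    have k: "Poly_Mapping.keys (A b (cst p)) \<subseteq> lattice_cone D" using Rb unfolding Rel_def by blast
    \<comment> \<open>In general \<open>A b (cst p)\<close> is no longer constant in
      \<open>t\<close>; \<open>ev_A\<close> is what permits specialising it before \<open>a\<close>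
      is applied.\<close>
    have "A (a \<circ> b) (cst p) = A a (A b (cst p))"
      by (rule A_eq[OF Rel_comp[OF Rb Rel_A[OF a k] a b]])
    then show "\<rho>' (a \<circ> b) p = \<rho>' a (\<rho>' b p)"
      using ev_A[OF a k] unfolding \<rho>'_def by simp
  next
    fix p :: "('n \<Rightarrow> int) \<Rightarrow>\<^sub>0 'k" assume p: "Poly_Mapping.keys p \<subseteq> lattice_cone D"
    have "Rel id (cst p) (cst p)"
    proof (rule RelI[OF cone[OF p] cone[OF p]])
      fix t assume "Poly_Mapping.keys (Lt i t (cst p)) \<subseteq> lattice_cone E"
      then show "\<rho> id (Lt i t (cst p)) = Lt i t (cst p)" using ME.smult_one by simp
    qed
    from A_eq[OF this] show "\<rho>' id p = p" by (simp add: \<rho>'_def ev_cst)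
  qed
  fix p :: "('n \<Rightarrow> int) \<Rightarrow>\<^sub>0 'k" assume p: "Poly_Mapping.keys p \<subseteq> lattice_cone D"
  show "\<rho>' (scl d) p = scl d p" for d
  proof -
    have "Rel (scl d) (cst p) (pscl [:d:] (cst p))"
      by (rule RelI) (use cone[OF p] keys_pscl[of "[:d:]" "cst p"] in \<open>auto simp: gens_E Lt_pscl\<close>)
    from A_eq[OF this] show ?thesis by (simp add: \<rho>'_def ev_pscl ev_cst)
  qed
  fix j
  show "\<rho>' (partial_x j) p = m_partial D j p"
    by (rule rho'_lin[OF _ lin_m(1) p])
       (simp_all only: gens_in_I_n rho'_single[OF Rel_gens(1)] m_single ev_single ev_zero if_distrib[of "ev \<tau>"] poly_pCons poly_0 mult_zero_right add_0_right)
  show "\<rho>' (int_x j) p = m_int j p"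
    by (rule rho'_lin[OF _ lin_m(2) p])
       (simp_all only: gens_in_I_n rho'_single[OF Rel_gens(2)] m_single ev_single poly_pCons poly_0 mult_zero_right add_0_right)
  have l: "lin (\<lambda>p. m_int j (m_H (r(i := c)) j p))"
    using lin_comp[OF lin_m(2)[of j] lin_m(3)[of "r(i := c)" j]] by (simp add: comp_def)
  show "\<rho>' (mult_x j) p = m_int j (m_H (r(i := c)) j p)"
  proof (rule rho'_lin[OF _ l p])
    fix z :: "'n \<Rightarrow> int" and d assume z: "z \<in> lattice_cone D"
    have 1: "poly ([:d:] * (if j = i then [:1 + of_int (z i), 1:] else [:r j + of_int (z j):])) \<tau> =
        d * ((r(i := c)) j + of_int (z j))"
      by (auto simp: algebra_simps)
    show "\<rho>' (mult_x j) (Poly_Mapping.single z d) = m_int j (m_H (r(i := c)) j (Poly_Mapping.single z d))"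
      unfolding rho'_single[OF Rel_gens(3)[OF z]] m_single ev_single 1 ..
  qed simp
qed

end

theorem model_exists:
  fixes r :: "'n::finite \<Rightarrow> 'k::field_char_0"
  assumes "\<And>i. i \<in> D \<Longrightarrow> r i = 1"
  shows "\<exists>\<rho>. is_model D r \<rho>"
proof -
  \<comment> \<open>Indices still in the cone condition carry the base value 1, as
    \<open>model_step\<close> demands of the index that it removes.\<close>
  have "\<exists>\<rho>. is_model (UNIV - A) (\<lambda>i. if i \<in> A then r i else 1) \<rho>" if "finite A" for A
    using that
  proof (induction A rule: finite_induct)
    case empty
    then show ?case using is_model_UNIV by auto
  next
    case (insert i A)
    let ?r = "\<lambda>j. if j \<in> A then r j else 1"
    obtain \<rho> where \<rho>: "is_model (UNIV - A) ?r \<rho>" using insert.IH by blast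
    interpret model_step "UNIV - A" i ?r \<rho> "r i"
      by unfold_locales (use \<rho> insert.hyps in auto)
    have "UNIV - A - {i} = UNIV - insert i A" "?r(i := r i) = (\<lambda>j. if j \<in> insert i A then r j else 1)"
      by auto
    then show ?case using is_model_D by metis
  qed
  from this[of "- D"] obtain \<rho> where "is_model (UNIV - - D) (\<lambda>i. if i \<in> - D then r i else 1) \<rho>" by auto
  moreover have "UNIV - - D = D" "(\<lambda>i. if i \<in> - D then r i else 1) = r" using assms by auto
  ultimately show ?thesis by metis
qed

section \<open>Tensor products with coordinates\<close>

text \<open>With \<open>i1\<close> and \<open>h1\<close>, the one-variable counterparts of
  \<open>m_partial\<close>, \<open>m_int\<close> and \<open>m_H\<close>, for coordinates on a single
  tensor factor. The flag \<open>b\<close> switches the truncation at 0 on.\<close>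

definition d1 :: "bool \<Rightarrow> (int \<Rightarrow>\<^sub>0 'k::field_char_0) \<Rightarrow> (int \<Rightarrow>\<^sub>0 'k)"
  where "d1 b = lext (\<lambda>k. if b \<and> k \<le> 0 then 0 else Poly_Mapping.single (k - 1) 1)"

definition i1 :: "(int \<Rightarrow>\<^sub>0 'k::field_char_0) \<Rightarrow> (int \<Rightarrow>\<^sub>0 'k)"
  where "i1 = lext (\<lambda>k. Poly_Mapping.single (k + 1) 1)"

definition h1 :: "'k \<Rightarrow> (int \<Rightarrow>\<^sub>0 'k::field_char_0) \<Rightarrow> (int \<Rightarrow>\<^sub>0 'k)"
  where "h1 c = lext (\<lambda>k. Poly_Mapping.single k (c + of_int k))"

lemma lin_1: "lin (d1 b)" "lin i1" "lin (h1 c)"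
  by (simp_all add: d1_def i1_def h1_def lin_lext)

lemma single_1:
  "d1 b (Poly_Mapping.single k x) = (if b \<and> k \<le> 0 then 0 else Poly_Mapping.single (k - 1) x)"
  "i1 (Poly_Mapping.single k x) = Poly_Mapping.single (k + 1) x"
  "h1 c (Poly_Mapping.single k x) = Poly_Mapping.single k (x * (c + of_int k))"
  by (simp_all add: d1_def i1_def h1_def)

lemma lookup_1:
  "Poly_Mapping.lookup (d1 b p) k = (if b \<and> k < 0 then 0 else Poly_Mapping.lookup p (k + 1))"
  "Poly_Mapping.lookup (i1 p) k = Poly_Mapping.lookup p (k - 1)"
  "Poly_Mapping.lookup (h1 c p) k = (c + of_int k) * Poly_Mapping.lookup p k"
  by (induction p rule: poly_mapping_induct;
      auto simp: single_1 lin_add[OF lin_1(1)] lin_add[OF lin_1(2)] lin_add[OF lin_1(3)] lookup_add lookup_single when_def algebra_simps)+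

lemma fun_upd_shift: "y(i := y i + m) = z \<longleftrightarrow> y = z(i := z i - (m::int))"
  by (auto simp: fun_eq_iff)

lemma lookup_m:
  "Poly_Mapping.lookup (m_partial D i p) z = (if i \<in> D \<and> z i < 0 then 0 else Poly_Mapping.lookup p (z(i := z i + 1)))"
  "Poly_Mapping.lookup (m_int i p) z = Poly_Mapping.lookup p (z(i := z i - 1))"
  "Poly_Mapping.lookup (m_H r i p) z = (r i + of_int (z i)) * Poly_Mapping.lookup p z"
proof -
  show "Poly_Mapping.lookup (m_partial D i p) z = (if i \<in> D \<and> z i < 0 then 0 else Poly_Mapping.lookup p (z(i := z i + 1)))"
  proof (induction p rule: poly_mapping_induct)
    case (single y c)
    show ?case
    proof (cases "i \<in> D \<and> y i \<le> 0")
      case True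
      then have "i \<in> D \<and> z i < 0 \<or> y \<noteq> z(i := z i + 1)" by auto
      then show ?thesis unfolding m_single if_P[OF True] by (auto simp: lookup_single when_def)
    next
      case False
      have "y(i := y i - 1) = z \<longleftrightarrow> y = z(i := z i + 1)" using fun_upd_shift[of y i "-1" z] by simp
      moreover have "i \<in> D \<and> z i < 0 \<Longrightarrow> y \<noteq> z(i := z i + 1)" using False by auto
      ultimately show ?thesis unfolding m_single if_not_P[OF False] by (auto simp only: lookup_single when_def split: if_splits)
    qed
  next
    case (add p q)
    then show ?case unfolding lin_add[OF lin_m(1)] lookup_add
      by (cases "i \<in> D \<and> z i < 0") (simp_all only: simp_thms if_True if_False add_0_right)
  qed
  show "Poly_Mapping.lookup (m_int i p) z = Poly_Mapping.lookup p (z(i := z i - 1))"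
  proof (induction p rule: poly_mapping_induct)
    case (single y c)
    show ?case unfolding m_single lookup_single when_def fun_upd_shift ..
  qed (simp add: lin_add[OF lin_m(2)] lookup_add)
  show "Poly_Mapping.lookup (m_H r i p) z = (r i + of_int (z i)) * Poly_Mapping.lookup p z"
    by (induction p rule: poly_mapping_induct)
       (auto simp: m_single lin_add[OF lin_m(3)] lookup_add lookup_single when_def algebra_simps)
qed

text \<open>The coordinates of a pure tensor in the product basis. The support is finite, lying in
  the product of the supports of the factors.\<close>

definition tens :: "('n::finite \<Rightarrow> (int \<Rightarrow>\<^sub>0 'k::field_char_0)) \<Rightarrow> (('n \<Rightarrow> int) \<Rightarrow>\<^sub>0 'k)"
  where "tens c = Abs_poly_mapping (\<lambda>z. \<Prod>i\<in>UNIV. Poly_Mapping.lookup (c i) (z i))"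

lemma lookup_tens: "Poly_Mapping.lookup (tens c) z = (\<Prod>i\<in>UNIV. Poly_Mapping.lookup (c i) (z i))"
proof -
  have "{z. (\<Prod>i\<in>UNIV. Poly_Mapping.lookup (c i) (z i)) \<noteq> 0} \<subseteq> (\<Pi>\<^sub>E i\<in>UNIV. Poly_Mapping.keys (c i))"
    by (auto simp: in_keys_iff)
  moreover have "finite (\<Pi>\<^sub>E i\<in>UNIV. Poly_Mapping.keys (c i))" by (rule finite_PiE) auto
  ultimately have "finite {z. (\<Prod>i\<in>UNIV. Poly_Mapping.lookup (c i) (z i)) \<noteq> 0}" by (rule finite_subset)
  then show ?thesis unfolding tens_def by simp
qed

lemma lookup_tens_upd:
  "Poly_Mapping.lookup (tens (c(i := p))) z = Poly_Mapping.lookup p (z i) * (\<Prod>j\<in>UNIV - {i}. Poly_Mapping.lookup (c j) (z j))"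
proof -
  have "(\<Prod>j\<in>UNIV - {i}. Poly_Mapping.lookup ((c(i := p)) j) (z j)) = (\<Prod>j\<in>UNIV - {i}. Poly_Mapping.lookup (c j) (z j))"
    by (rule prod.cong) auto
  then show ?thesis by (simp add: lookup_tens prod.remove[of UNIV i])
qed

lemma tens_add: "tens (c(i := p + q)) = tens (c(i := p)) + tens (c(i := q))"
  and tens_scl: "tens (c(i := scl a p)) = scl a (tens (c(i := p)))"
  by (rule poly_mapping_eqI; simp only: lookup_tens_upd lookup_add lookup_scl distrib_right mult.assoc)+

lemma tens_off: "(\<Prod>j\<in>UNIV - {i}. Poly_Mapping.lookup (c j) ((z(i := k)) j)) = (\<Prod>j\<in>UNIV - {i}. Poly_Mapping.lookup (c j) (z j))"
  by (rule prod.cong) auto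

lemma tens_m:
  "tens (c(i := d1 (i \<in> D) p)) = m_partial D i (tens (c(i := p)))"
  "tens (c(i := i1 p)) = m_int i (tens (c(i := p)))"
  "tens (c(i := h1 (r i) p)) = m_H r i (tens (c(i := p)))"
proof -
  note l = lookup_tens_upd lookup_m lookup_1 tens_off fun_upd_same mult.assoc
  show "tens (c(i := d1 (i \<in> D) p)) = m_partial D i (tens (c(i := p)))"
  proof (rule poly_mapping_eqI)
    fix z show "Poly_Mapping.lookup (tens (c(i := d1 (i \<in> D) p))) z = Poly_Mapping.lookup (m_partial D i (tens (c(i := p)))) z"
      unfolding l by (cases "i \<in> D \<and> z i < 0") (simp_all only: simp_thms if_True if_False mult_zero_left)
  qed
  show "tens (c(i := i1 p)) = m_int i (tens (c(i := p)))"
    by (rule poly_mapping_eqI) (simp only: l)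
  show "tens (c(i := h1 (r i) p)) = m_H r i (tens (c(i := p)))"
    by (rule poly_mapping_eqI) (simp only: l)
qed

lemma tens_single: "tens (\<lambda>i. Poly_Mapping.single (z i) 1) = Poly_Mapping.single z (1 :: 'k::field_char_0)"
proof (rule poly_mapping_eqI)
  fix y
  show "Poly_Mapping.lookup (tens (\<lambda>i. Poly_Mapping.single (z i) 1)) y = Poly_Mapping.lookup (Poly_Mapping.single z (1 :: 'k)) y"
  proof (cases "y = z")
    case False
    then obtain i where "z i \<noteq> y i" unfolding fun_eq_iff by metis
    then have 0: "Poly_Mapping.lookup (Poly_Mapping.single (z i) 1) (y i) = (0 :: 'k)"
      by (simp add: lookup_single_not_eq)
    have "(\<Prod>i\<in>UNIV. Poly_Mapping.lookup (Poly_Mapping.single (z i) 1) (y i)) = (0 :: 'k)"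
      by (rule prod_zero[OF finite], rule bexI[where x=i], rule 0, rule UNIV_I)
    then show ?thesis using False lookup_single_not_eq[of z y "1 :: 'k"] unfolding lookup_tens by simp
  qed (simp add: lookup_tens)
qed

lemma tens_keys:
  assumes "\<And>i. Poly_Mapping.keys (c i) \<subseteq> (if i \<in> D then {0..} else UNIV)"
  shows "Poly_Mapping.keys (tens c) \<subseteq> lattice_cone D"
proof
  fix z assume "z \<in> Poly_Mapping.keys (tens c)"
  then have k: "z i \<in> Poly_Mapping.keys (c i)" for i by (simp add: in_keys_iff lookup_tens)
  have "0 \<le> z i" if "i \<in> D" for i using k[of i] assms[of i] that by auto
  then show "z \<in> lattice_cone D" unfolding lattice_cone_def by blast
qed

section \<open>The tensor product of factors with coordinates is an explicit module\<close>

locale tensor_coords =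
  fixes M :: "'n::finite \<Rightarrow> (('n, 'k::field_char_0) opr, 'm) module"
    and \<kappa> :: "'n \<Rightarrow> 'm \<Rightarrow> (int \<Rightarrow>\<^sub>0 'k)" and D :: "'n set" and r :: "'n \<Rightarrow> 'k" and \<rho>
  assumes mdl: "is_model D r \<rho>"
    and lm: "\<And>i. left_module (I_1 i) (M i)"
    and bij: "\<And>i. bij_betw (\<kappa> i) (carrier (M i)) {p. Poly_Mapping.keys p \<subseteq> (if i \<in> D then {0..} else UNIV)}"
    and \<kappa>_add: "\<And>i u v. u \<in> carrier (M i) \<Longrightarrow> v \<in> carrier (M i) \<Longrightarrow> \<kappa> i (u \<oplus>\<^bsub>M i\<^esub> v) = \<kappa> i u + \<kappa> i v"
    and \<kappa>_scl: "\<And>i c u. u \<in> carrier (M i) \<Longrightarrow> \<kappa> i (scl c \<odot>\<^bsub>M i\<^esub> u) = scl c (\<kappa> i u)"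
    and \<kappa>_gen: "\<And>i u. u \<in> carrier (M i) \<Longrightarrow> \<kappa> i (partial_x i \<odot>\<^bsub>M i\<^esub> u) = d1 (i \<in> D) (\<kappa> i u)"
      "\<And>i u. u \<in> carrier (M i) \<Longrightarrow> \<kappa> i (int_x i \<odot>\<^bsub>M i\<^esub> u) = i1 (\<kappa> i u)"
      "\<And>i u. u \<in> carrier (M i) \<Longrightarrow> \<kappa> i (mult_x i \<odot>\<^bsub>M i\<^esub> u) = i1 (h1 (r i) (\<kappa> i u))"
begin

sublocale ME: left_module I_n "model D \<rho>"
  using mdl by (simp add: is_model_def)

abbreviation Rel where "Rel \<equiv> multilinearity_relations M"

definition \<Phi> :: "('n \<Rightarrow> 'm) \<Rightarrow> (('n \<Rightarrow> int) \<Rightarrow>\<^sub>0 'k)" where "\<Phi> m = tens (\<lambda>i. \<kappa> i (m i))"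

definition \<beta> :: "'n \<Rightarrow> int \<Rightarrow> 'm" where "\<beta> i k = inv_into (carrier (M i)) (\<kappa> i) (Poly_Mapping.single k 1)"

text \<open>The candidate inverse of the linear extension of \<open>\<Phi>\<close>: a lattice point
  goes to the formal generator given by the corresponding family of basis vectors. It is an inverse
  only modulo the multilinearity relations.\<close>

definition \<Psi> :: "(('n \<Rightarrow> int) \<Rightarrow>\<^sub>0 'k) \<Rightarrow> (('n \<Rightarrow> 'm) \<Rightarrow>\<^sub>0 'k)"
  where "\<Psi> = lext (\<lambda>z. Poly_Mapping.single (\<lambda>i. \<beta> i (z i)) 1)"

lemma M_closed:
  "u \<in> carrier (M i) \<Longrightarrow> v \<in> carrier (M i) \<Longrightarrow> u \<oplus>\<^bsub>M i\<^esub> v \<in> carrier (M i)"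
  "a \<in> carrier (I_1 i) \<Longrightarrow> u \<in> carrier (M i) \<Longrightarrow> a \<odot>\<^bsub>M i\<^esub> u \<in> carrier (M i)"
proof -
  interpret left_module "I_1 i" "M i" by (rule lm)
  show "u \<in> carrier (M i) \<Longrightarrow> v \<in> carrier (M i) \<Longrightarrow> u \<oplus>\<^bsub>M i\<^esub> v \<in> carrier (M i)" by (rule M.add.m_closed)
  show "a \<in> carrier (I_1 i) \<Longrightarrow> u \<in> carrier (M i) \<Longrightarrow> a \<odot>\<^bsub>M i\<^esub> u \<in> carrier (M i)" by (rule smult_closed)
qed

lemma fam_upd: "m \<in> families M \<Longrightarrow> u \<in> carrier (M i) \<Longrightarrow> m(i := u) \<in> families M"
  by (simp add: families_def)

lemma \<Phi>_upd: "\<Phi> (m(i := u)) = tens ((\<lambda>i. \<kappa> i (m i))(i := \<kappa> i u))"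
proof -
  have "(\<lambda>j. \<kappa> j ((m(i := u)) j)) = (\<lambda>i. \<kappa> i (m i))(i := \<kappa> i u)" by auto
  then show ?thesis by (simp only: \<Phi>_def)
qed

lemma \<Phi>_add: "u \<in> carrier (M i) \<Longrightarrow> v \<in> carrier (M i) \<Longrightarrow> \<Phi> (m(i := u \<oplus>\<^bsub>M i\<^esub> v)) = \<Phi> (m(i := u)) + \<Phi> (m(i := v))"
  and \<Phi>_scl: "u \<in> carrier (M i) \<Longrightarrow> \<Phi> (m(i := scl c \<odot>\<^bsub>M i\<^esub> u)) = scl c (\<Phi> (m(i := u)))"
  by (simp_all only: \<Phi>_upd \<kappa>_add \<kappa>_scl tens_add tens_scl)

lemma \<Phi>_keys: "m \<in> families M \<Longrightarrow> Poly_Mapping.keys (\<Phi> m) \<subseteq> lattice_cone D"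
  unfolding \<Phi>_def
proof (rule tens_keys)
  fix i assume "m \<in> families M"
  then have "m i \<in> carrier (M i)" by (simp add: families_def)
  then show "Poly_Mapping.keys (\<kappa> i (m i)) \<subseteq> (if i \<in> D then {0..} else UNIV)"
    using bij[of i] unfolding bij_betw_def by blast
qed

lemma \<beta>: "(i \<in> D \<Longrightarrow> k \<ge> 0) \<Longrightarrow> \<beta> i k \<in> carrier (M i) \<and> \<kappa> i (\<beta> i k) = Poly_Mapping.single k 1"
proof -
  assume "i \<in> D \<Longrightarrow> k \<ge> 0"
  then have "Poly_Mapping.single k 1 \<in> \<kappa> i ` carrier (M i)"
    using bij[of i] unfolding bij_betw_def by auto
  then show ?thesis unfolding \<beta>_def by (simp add: inv_into_into f_inv_into_f)
qed

lemma \<beta>_fam: "z \<in> lattice_cone D \<Longrightarrow> (\<lambda>i. \<beta> i (z i)) \<in> families M"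
  using \<beta> by (simp add: families_def lattice_cone_def)

lemma \<Phi>_\<beta>: "z \<in> lattice_cone D \<Longrightarrow> \<Phi> (\<lambda>i. \<beta> i (z i)) = Poly_Mapping.single z 1"
proof -
  assume "z \<in> lattice_cone D"
  then have "(\<lambda>i. \<kappa> i (\<beta> i (z i))) = (\<lambda>i. Poly_Mapping.single (z i) 1)"
    using \<beta> by (auto simp: lattice_cone_def)
  then show ?thesis unfolding \<Phi>_def by (simp only: tens_single)
qed

lemma lin_\<Psi>: "lin \<Psi>" unfolding \<Psi>_def by (rule lin_lext)

lemma \<Psi>_single: "\<Psi> (Poly_Mapping.single z c) = Poly_Mapping.single (\<lambda>i. \<beta> i (z i)) c"
  by (simp add: \<Psi>_def)

lemma Rel_0: "0 \<in> Rel" and Rel_add: "x \<in> Rel \<Longrightarrow> y \<in> Rel \<Longrightarrow> x + y \<in> Rel"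
  and Rel_scl: "x \<in> Rel \<Longrightarrow> scl c x \<in> Rel" and Rel_diff: "x \<in> Rel \<Longrightarrow> y \<in> Rel \<Longrightarrow> x - y \<in> Rel"
  and Rel_neg: "x \<in> Rel \<Longrightarrow> - x \<in> Rel"
  unfolding multilinearity_relations_def
  by (rule scl.span_zero scl.span_add scl.span_scale scl.span_diff scl.span_neg; assumption?)+

lemma Rel_gen_add: "m \<in> families M \<Longrightarrow> u \<in> carrier (M i) \<Longrightarrow> v \<in> carrier (M i) \<Longrightarrow>
    Poly_Mapping.single (m(i := u \<oplus>\<^bsub>M i\<^esub> v)) 1 - Poly_Mapping.single (m(i := u)) 1 - Poly_Mapping.single (m(i := v)) 1 \<in> Rel"
  unfolding multilinearity_relations_def by (rule scl.span_base) blast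

lemma Rel_gen_scl: "m \<in> families M \<Longrightarrow> u \<in> carrier (M i) \<Longrightarrow>
    Poly_Mapping.single (m(i := scl c \<odot>\<^bsub>M i\<^esub> u)) 1 - scl c (Poly_Mapping.single (m(i := u)) 1) \<in> Rel"
  unfolding multilinearity_relations_def by (rule scl.span_base) blast

text \<open>Since \<open>\<Phi>\<close> is multilinear, its linear extension vanishes on the
  relations; this gives the linear independence of the basis tensors.\<close>

lemma lext_\<Phi>_Rel:
  assumes "x \<in> Rel"
  shows "lext \<Phi> x = 0"
  using assms unfolding multilinearity_relations_def
proof (induction x rule: scl.span_induct)
  case base
  show ?case
    by (auto simp: scl.subspace_def lin_add[OF lin_lext] lin_scl[OF lin_lext] lin_zero[OF lin_lext])
next
  case (step x)
  then show ?case
  proof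
    assume "x \<in> {Poly_Mapping.single (m(i := u \<oplus>\<^bsub>M i\<^esub> v)) 1 - Poly_Mapping.single (m(i := u)) 1
        - Poly_Mapping.single (m(i := v)) 1 |m i u v. m \<in> families M \<and> u \<in> carrier (M i) \<and> v \<in> carrier (M i)}"
    then obtain m i u v where x: "x = Poly_Mapping.single (m(i := u \<oplus>\<^bsub>M i\<^esub> v)) 1 - Poly_Mapping.single (m(i := u)) 1
        - Poly_Mapping.single (m(i := v)) 1" "u \<in> carrier (M i)" "v \<in> carrier (M i)" by blast
    show ?thesis unfolding x(1) lin_diff[OF lin_lext] lext_single \<Phi>_add[OF x(2,3)] by simp
  next
    assume "x \<in> {Poly_Mapping.single (m(i := scl c \<odot>\<^bsub>M i\<^esub> u)) 1 - scl c (Poly_Mapping.single (m(i := u)) 1)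
        |m i c u. m \<in> families M \<and> u \<in> carrier (M i)}"
    then obtain m i c u where x: "x = Poly_Mapping.single (m(i := scl c \<odot>\<^bsub>M i\<^esub> u)) 1 - scl c (Poly_Mapping.single (m(i := u)) 1)"
      "u \<in> carrier (M i)" by blast
    show ?thesis unfolding x(1) lin_diff[OF lin_lext] lin_scl[OF lin_lext] lext_single \<Phi>_scl[OF x(2)] by simp
  qed
qed

abbreviation expands where "expands m \<equiv> Poly_Mapping.single m 1 - \<Psi> (\<Phi> m) \<in> Rel"

lemma expands_add:
  assumes "m \<in> families M" "u \<in> carrier (M i)" "v \<in> carrier (M i)" "expands (m(i := u))" "expands (m(i := v))"
  shows "expands (m(i := u \<oplus>\<^bsub>M i\<^esub> v))"
proof -
  have "Poly_Mapping.single (m(i := u \<oplus>\<^bsub>M i\<^esub> v)) 1 - \<Psi> (\<Phi> (m(i := u \<oplus>\<^bsub>M i\<^esub> v))) =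
    (Poly_Mapping.single (m(i := u \<oplus>\<^bsub>M i\<^esub> v)) 1 - Poly_Mapping.single (m(i := u)) 1 - Poly_Mapping.single (m(i := v)) 1)
    + ((Poly_Mapping.single (m(i := u)) 1 - \<Psi> (\<Phi> (m(i := u)))) + (Poly_Mapping.single (m(i := v)) 1 - \<Psi> (\<Phi> (m(i := v)))))"
    unfolding \<Phi>_add[OF assms(2,3)] lin_add[OF lin_\<Psi>] by (simp only: algebra_simps)
  also have "\<dots> \<in> Rel" by (intro Rel_add Rel_gen_add assms)
  finally show ?thesis .
qed

lemma expands_scl:
  assumes "m \<in> families M" "u \<in> carrier (M i)" "expands (m(i := u))"
  shows "expands (m(i := scl c \<odot>\<^bsub>M i\<^esub> u))"
proof -
  have "Poly_Mapping.single (m(i := scl c \<odot>\<^bsub>M i\<^esub> u)) 1 - \<Psi> (\<Phi> (m(i := scl c \<odot>\<^bsub>M i\<^esub> u))) =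
    (Poly_Mapping.single (m(i := scl c \<odot>\<^bsub>M i\<^esub> u)) 1 - scl c (Poly_Mapping.single (m(i := u)) 1))
    + scl c (Poly_Mapping.single (m(i := u)) 1 - \<Psi> (\<Phi> (m(i := u))))"
    unfolding \<Phi>_scl[OF assms(2)] lin_scl[OF lin_\<Psi>] scl.scale_right_diff_distrib by (simp only: diff_add_cancel add_diff_eq)
  also have "\<dots> \<in> Rel" by (intro Rel_add Rel_gen_scl Rel_scl assms)
  finally show ?thesis .
qed

text \<open>The induction is on the set \<open>A\<close> of positions where the family may differ
  from a basis vector. One entry at a time is expanded in its basis, using additivity and
  homogeneity in that entry.\<close>

lemma expands_all:
  assumes "m \<in> families M"
  shows "expands m"
proof -
  have "\<forall>m\<in>families M. (\<forall>i. i \<notin> A \<longrightarrow> (\<exists>k. (i \<in> D \<longrightarrow> k \<ge> 0) \<and> m i = \<beta> i k)) \<longrightarrow> expands m" if "finite A" for A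
    using that
  proof (induction A rule: finite_induct)
    case empty
    show ?case
    proof (intro ballI impI)
      fix m assume "\<forall>i. i \<notin> {} \<longrightarrow> (\<exists>k. (i \<in> D \<longrightarrow> k \<ge> 0) \<and> m i = \<beta> i k)"
      then obtain z where z: "\<And>i. i \<in> D \<longrightarrow> z i \<ge> 0" "\<And>i. m i = \<beta> i (z i)" by (metis empty_iff)
      then have "z \<in> lattice_cone D" "m = (\<lambda>i. \<beta> i (z i))" by (auto simp: lattice_cone_def)
      then show "expands m" using \<Phi>_\<beta> Rel_0 by (simp add: \<Psi>_single)
    qed
  next
    case (insert i A)
    show ?case
    proof (intro ballI impI)
      fix m assume m: "m \<in> families M" "\<forall>j. j \<notin> insert i A \<longrightarrow> (\<exists>k. (j \<in> D \<longrightarrow> k \<ge> 0) \<and> m j = \<beta> j k)"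
      let ?Z = "if i \<in> D then {0..} else UNIV :: int set"
      \<comment> \<open>The entry is rebuilt from its coordinates: \<open>?P p\<close> provides some
        element with coordinates \<open>p\<close> for which the expansion holds, and injectivity of
        \<open>\<kappa> i\<close> later identifies it with \<open>m i\<close>.\<close>
      let ?P = "\<lambda>p. \<exists>u\<in>carrier (M i). \<kappa> i u = p \<and> expands (m(i := u))"
      have basis: "expands (m(i := \<beta> i k))" "\<beta> i k \<in> carrier (M i)" if k: "k \<in> ?Z" for k
      proof -
        have k': "i \<in> D \<longrightarrow> k \<ge> 0" using k by (auto split: if_splits)
        then show c: "\<beta> i k \<in> carrier (M i)" using \<beta>[of i k] by blast
        have "\<forall>j. j \<notin> A \<longrightarrow> (\<exists>k'. (j \<in> D \<longrightarrow> k' \<ge> 0) \<and> (m(i := \<beta> i k)) j = \<beta> j k')"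
          using m(2) k' by auto
        then show "expands (m(i := \<beta> i k))" using insert.IH fam_upd[OF m(1) c] by blast
      qed
      have single: "?P (Poly_Mapping.single k c)" if k: "k \<in> ?Z" for k c
      proof (rule bexI[of _ "scl c \<odot>\<^bsub>M i\<^esub> \<beta> i k"])
        have "\<kappa> i (\<beta> i k) = Poly_Mapping.single k 1" using \<beta>[of i k] k by (auto split: if_splits)
        then show "\<kappa> i (scl c \<odot>\<^bsub>M i\<^esub> \<beta> i k) = Poly_Mapping.single k c \<and> expands (m(i := scl c \<odot>\<^bsub>M i\<^esub> \<beta> i k))"
          using expands_scl[OF m(1) basis(2)[OF k] basis(1)[OF k]] \<kappa>_scl[OF basis(2)[OF k]] by simp
        show "scl c \<odot>\<^bsub>M i\<^esub> \<beta> i k \<in> carrier (M i)" by (rule M_closed(2)[OF gens_in_I_1(6) basis(2)[OF k]])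
      qed
      have all: "?P p" if "Poly_Mapping.keys p \<subseteq> ?Z" for p
        using that
      proof (induction p rule: poly_mapping_induct_keys)
        case zero
        have "0 \<in> ?Z" by simp
        from single[OF this, of 0] show ?case unfolding single_zero .
      next
        case (single k c)
        then show ?case by (rule \<open>\<And>k c. k \<in> ?Z \<Longrightarrow> ?P (Poly_Mapping.single k c)\<close>)
      next
        case (add p q)
        then obtain u v where u: "u \<in> carrier (M i)" "\<kappa> i u = p" "expands (m(i := u))"
          and v: "v \<in> carrier (M i)" "\<kappa> i v = q" "expands (m(i := v))" by blast
        show ?case
          using expands_add[OF m(1) u(1) v(1) u(3) v(3)] \<kappa>_add[OF u(1) v(1)] M_closed(1)[OF u(1) v(1)] u(2) v(2) by metis
      qed
      have mi: "m i \<in> carrier (M i)" using m(1) by (simp add: families_def)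
      then have "Poly_Mapping.keys (\<kappa> i (m i)) \<subseteq> ?Z" using bij[of i] unfolding bij_betw_def by blast
      then obtain u where u: "u \<in> carrier (M i)" "\<kappa> i u = \<kappa> i (m i)" "expands (m(i := u))" using all by blast
      then have "u = m i" using mi bij[of i] unfolding bij_betw_def inj_on_def by blast
      then show "expands m" using u(3) by simp
    qed
  qed
  from this[of UNIV] show ?thesis using assms by simp
qed

lemma expands_free: "Poly_Mapping.keys x \<subseteq> families M \<Longrightarrow> x - \<Psi> (lext \<Phi> x) \<in> Rel"
proof (induction x rule: poly_mapping_induct_keys)
  case zero
  then show ?case by (simp add: lin_zero[OF lin_lext] lin_zero[OF lin_\<Psi>] Rel_0)
next
  case (single m c)
  have "Poly_Mapping.single m c - \<Psi> (lext \<Phi> (Poly_Mapping.single m c)) = scl c (Poly_Mapping.single m 1 - \<Psi> (\<Phi> m))"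
    unfolding lext_single lin_scl[OF lin_\<Psi>] scl.scale_right_diff_distrib by simp
  then show ?case using Rel_scl[OF expands_all[OF single]] by simp
next
  case (add x y)
  have "x + y - \<Psi> (lext \<Phi> (x + y)) = (x - \<Psi> (lext \<Phi> x)) + (y - \<Psi> (lext \<Phi> y))"
    unfolding lin_add[OF lin_lext] lin_add[OF lin_\<Psi>] by (simp only: algebra_simps)
  then show ?case using Rel_add[OF add.IH] by (simp only:)
qed

lemma lext_\<Phi>_\<Psi>: "Poly_Mapping.keys p \<subseteq> lattice_cone D \<Longrightarrow> lext \<Phi> (\<Psi> p) = p"
proof (induction p rule: poly_mapping_induct_keys)
  case (single z c)
  then show ?case unfolding \<Psi>_single lext_single \<Phi>_\<beta>[OF single] by simp
qed (simp_all add: lin_zero[OF lin_lext] lin_zero[OF lin_\<Psi>] lin_add[OF lin_lext] lin_add[OF lin_\<Psi>])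

abbreviation cos where "cos x \<equiv> Rel +>\<^bsub>free_space M :: ('k, ('n \<Rightarrow> 'm) \<Rightarrow>\<^sub>0 'k) module\<^esub> x"

lemma cos_eq: "cos x = (\<lambda>h. h + x) ` Rel"
  by (auto simp: a_r_coset_def' free_space_def)

lemma cos_eq_iff: "cos x = cos y \<longleftrightarrow> x - y \<in> Rel"
proof
  assume "cos x = cos y"
  then have "x \<in> cos y" using Rel_0 unfolding cos_eq by force
  then show "x - y \<in> Rel" unfolding cos_eq by auto
next
  assume r: "x - y \<in> Rel"
  have "h + x \<in> cos y" if "h \<in> Rel" for h
    unfolding cos_eq using Rel_add[OF that r] by (intro image_eqI[of _ _ "h + (x - y)"]) auto
  moreover have "h + y \<in> cos x" if "h \<in> Rel" for h
    unfolding cos_eq using Rel_diff[OF that r] by (intro image_eqI[of _ _ "h - (x - y)"]) auto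
  ultimately show "cos x = cos y" unfolding cos_eq[of x] cos_eq[of y] by auto
qed

lemma T_simps:
  "carrier (tensor_space M) = cos ` {x. Poly_Mapping.keys x \<subseteq> families M}"
  "\<zero>\<^bsub>tensor_space M\<^esub> = Rel"
  by (auto simp: tensor_space_def quotient_module_simps free_space_def)

lemma T_add: "cos x \<oplus>\<^bsub>tensor_space M\<^esub> cos y = cos (x + y)"
proof -
  have a: "ring.add (free_space M :: ('k, ('n \<Rightarrow> 'm) \<Rightarrow>\<^sub>0 'k) module) = (+)" by (simp add: free_space_def)
  have "cos x \<oplus>\<^bsub>tensor_space M\<^esub> cos y = {u + v | u v. u \<in> cos x \<and> v \<in> cos y}"
    unfolding tensor_space_def quotient_module_simps set_add_def' a by blast
  also have "\<dots> = cos (x + y)"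
  proof (intro equalityI subsetI)
    fix w assume "w \<in> {u + v | u v. u \<in> cos x \<and> v \<in> cos y}"
    then obtain h k where "h \<in> Rel" "k \<in> Rel" "w = (h + x) + (k + y)" unfolding cos_eq by blast
    then show "w \<in> cos (x + y)" unfolding cos_eq
      by (intro image_eqI[of _ _ "h + k"]) (simp_all add: Rel_add algebra_simps)
  next
    fix w assume "w \<in> cos (x + y)"
    then obtain h where "h \<in> Rel" "w = (h + x) + (0 + y)" unfolding cos_eq by (auto simp: algebra_simps)
    then show "w \<in> {u + v | u v. u \<in> cos x \<and> v \<in> cos y}" unfolding cos_eq using Rel_0 by blast
  qed
  finally show ?thesis .
qed

definition G :: "(('n \<Rightarrow> int) \<Rightarrow>\<^sub>0 'k) \<Rightarrow> (('n \<Rightarrow> 'm) \<Rightarrow>\<^sub>0 'k) set" where "G p = cos (\<Psi> p)"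

lemma \<Psi>_keys: "Poly_Mapping.keys p \<subseteq> lattice_cone D \<Longrightarrow> Poly_Mapping.keys (\<Psi> p) \<subseteq> families M"
proof (induction p rule: poly_mapping_induct_keys)
  case (single z c)
  then show ?case using \<beta>_fam[OF single] by (simp add: \<Psi>_single)
next
  case (add p q)
  then show ?case using keys_add[of "\<Psi> p" "\<Psi> q"] by (auto simp: lin_add[OF lin_\<Psi>])
qed (simp add: lin_zero[OF lin_\<Psi>])

lemma G_add: "G (p + q) = G p \<oplus>\<^bsub>tensor_space M\<^esub> G q"
  unfolding G_def T_add lin_add[OF lin_\<Psi>] ..

lemma G_\<Phi>: "m \<in> families M \<Longrightarrow> G (\<Phi> m) = pure_tensor M m"
  unfolding G_def pure_tensor_def cos_eq_iff
  using Rel_neg[OF expands_all] by (simp only: minus_diff_eq)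

lemma lext_\<Phi>_keys: "Poly_Mapping.keys x \<subseteq> families M \<Longrightarrow> Poly_Mapping.keys (lext \<Phi> x) \<subseteq> lattice_cone D"
proof (induction x rule: poly_mapping_induct_keys)
  case (single m c)
  have "Poly_Mapping.keys (scl c (\<Phi> m)) \<subseteq> Poly_Mapping.keys (\<Phi> m)" by (auto simp: in_keys_iff)
  then show ?case using \<Phi>_keys[OF single] by simp
next
  case (add x y)
  then show ?case using keys_add[of "lext \<Phi> x" "lext \<Phi> y"] by (auto simp: lin_add[OF lin_lext])
qed (simp add: lin_zero[OF lin_lext])

lemma G_bij: "bij_betw G (carrier (model D \<rho>)) (carrier (tensor_space M))"
  unfolding bij_betw_def
proof
  show "inj_on G (carrier (model D \<rho>))"
  proof (rule inj_onI)
    fix p q assume pq: "p \<in> carrier (model D \<rho>)" "q \<in> carrier (model D \<rho>)" "G p = G q"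
    then have "\<Psi> p - \<Psi> q \<in> Rel" unfolding G_def cos_eq_iff by blast
    then have "lext \<Phi> (\<Psi> p) - lext \<Phi> (\<Psi> q) = 0" using lext_\<Phi>_Rel lin_diff[OF lin_lext] by metis
    then show "p = q" using pq lext_\<Phi>_\<Psi> by simp
  qed
  show "G ` carrier (model D \<rho>) = carrier (tensor_space M)"
  proof (intro equalityI subsetI)
    fix C assume "C \<in> G ` carrier (model D \<rho>)"
    then show "C \<in> carrier (tensor_space M)" unfolding T_simps G_def using \<Psi>_keys by auto
  next
    fix C assume "C \<in> carrier (tensor_space M)"
    then obtain x where x: "Poly_Mapping.keys x \<subseteq> families M" "C = cos x" unfolding T_simps by blast
    have "C = G (lext \<Phi> x)" unfolding x(2) G_def cos_eq_iff by (rule expands_free[OF x(1)])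
    then show "C \<in> G ` carrier (model D \<rho>)" using lext_\<Phi>_keys[OF x(1)] by simp
  qed
qed

lemma \<rho>_gen:
  assumes "m \<in> families M"
  shows "\<rho> (scl c) (\<Phi> m) = scl c (\<Phi> m)" "\<rho> (partial_x i) (\<Phi> m) = m_partial D i (\<Phi> m)"
    "\<rho> (int_x i) (\<Phi> m) = m_int i (\<Phi> m)" "\<rho> (mult_x i) (\<Phi> m) = m_int i (m_H r i (\<Phi> m))"
  using mdl \<Phi>_keys[OF assms] by (simp_all add: is_model_def)

text \<open>In coordinates, the \<open>i\<close>-th subalgebra touches only the \<open>i\<close>-th
  slot, which is the property required of the action on a tensor product. For generators this is
  \<open>tens_m\<close>; sums and compositions follow because the factor and the model are both
  modules.\<close>

lemma \<rho>_\<Phi>: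
  assumes "a \<in> carrier (I_1 i)" "m \<in> families M"
  shows "\<rho> a (\<Phi> m) = \<Phi> (m(i := a \<odot>\<^bsub>M i\<^esub> m i))"
  using assms
proof (induction a arbitrary: m rule: I_1_induct)
  case (scl c)
  then have "m i \<in> carrier (M i)" by (simp add: families_def)
  from \<Phi>_scl[OF this, of m c] show ?case unfolding \<rho>_gen[OF scl] fun_upd_triv by (rule sym)
next
  case mult_x
  then have mi: "m i \<in> carrier (M i)" by (simp add: families_def)
  show ?case unfolding \<rho>_gen[OF mult_x] \<Phi>_upd \<kappa>_gen(3)[OF mi] tens_m
    unfolding \<Phi>_upd[symmetric] fun_upd_triv ..
next
  case partial_x
  then have mi: "m i \<in> carrier (M i)" by (simp add: families_def)
  show ?case unfolding \<rho>_gen[OF partial_x] \<Phi>_upd \<kappa>_gen(1)[OF mi] tens_m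
    unfolding \<Phi>_upd[symmetric] fun_upd_triv ..
next
  case int_x
  then have mi: "m i \<in> carrier (M i)" by (simp add: families_def)
  show ?case unfolding \<rho>_gen[OF int_x] \<Phi>_upd \<kappa>_gen(2)[OF mi] tens_m
    unfolding \<Phi>_upd[symmetric] fun_upd_triv ..
next
  case (comp a b)
  interpret Mi: left_module "I_1 i" "M i" by (rule lm)
  have mi: "m i \<in> carrier (M i)" using comp.prems by (simp add: families_def)
  have f: "m(i := b \<odot>\<^bsub>M i\<^esub> m i) \<in> families M" by (rule fam_upd[OF comp.prems M_closed(2)[OF comp.hyps(2) mi]])
  have pc: "\<Phi> m \<in> carrier (model D \<rho>)" using \<Phi>_keys[OF comp.prems] by simp
  have "\<rho> (a \<circ> b) (\<Phi> m) = \<rho> a (\<rho> b (\<Phi> m))"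
    using ME.smult_assoc[OF comp.hyps[THEN I_1_le_I_n] pc] by (simp only: model_simps I_n_simps)
  also have "\<dots> = \<Phi> (m(i := b \<odot>\<^bsub>M i\<^esub> m i, i := a \<odot>\<^bsub>M i\<^esub> (m(i := b \<odot>\<^bsub>M i\<^esub> m i)) i))"
    unfolding comp.IH(2)[OF comp.prems] by (rule comp.IH(1)[OF f])
  also have "m(i := b \<odot>\<^bsub>M i\<^esub> m i, i := a \<odot>\<^bsub>M i\<^esub> (m(i := b \<odot>\<^bsub>M i\<^esub> m i)) i) = m(i := (a \<circ> b) \<odot>\<^bsub>M i\<^esub> m i)"
    using Mi.smult_assoc[OF comp.hyps mi] by simp
  finally show ?case .
next
  case (add a b)
  interpret Mi: left_module "I_1 i" "M i" by (rule lm)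
  have mi: "m i \<in> carrier (M i)" using add.prems by (simp add: families_def)
  have pc: "\<Phi> m \<in> carrier (model D \<rho>)" using \<Phi>_keys[OF add.prems] by simp
  have "\<rho> (\<lambda>q. a q + b q) (\<Phi> m) = \<rho> a (\<Phi> m) + \<rho> b (\<Phi> m)"
    using ME.smult_l_distr[OF add.hyps[THEN I_1_le_I_n] pc] by (simp only: model_simps I_n_simps)
  also have "\<dots> = \<Phi> (m(i := a \<odot>\<^bsub>M i\<^esub> m i \<oplus>\<^bsub>M i\<^esub> b \<odot>\<^bsub>M i\<^esub> m i))"
    unfolding add.IH[OF add.prems] by (rule \<Phi>_add[symmetric]) (rule M_closed(2)[OF _ mi], fact)+
  also have "a \<odot>\<^bsub>M i\<^esub> m i \<oplus>\<^bsub>M i\<^esub> b \<odot>\<^bsub>M i\<^esub> m i = (\<lambda>q. a q + b q) \<odot>\<^bsub>M i\<^esub> m i"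
    using Mi.smult_l_distr[OF add.hyps mi] by simp
  finally show ?case .
qed

text \<open>The condition under the choice operator in \<open>tensor_module\<close>.\<close>

definition good where "good \<sigma> \<longleftrightarrow> left_module I_n (with_action (tensor_space M) \<sigma>) \<and>
   (\<forall>i. \<forall>a\<in>carrier (I_1 i). \<forall>m\<in>families M. \<sigma> a (pure_tensor M m) = pure_tensor M (m(i := a \<odot>\<^bsub>M i\<^esub> m i)))"

lemma with_action_simps:
  "carrier (with_action T \<sigma>) = carrier T" "\<zero>\<^bsub>with_action T \<sigma>\<^esub> = \<zero>\<^bsub>T\<^esub>"
  "ring.add (with_action T \<sigma>) = ring.add T" "module.smult (with_action T \<sigma>) = \<sigma>"
  by (simp_all add: with_action_def)

lemma good_exists: "\<exists>\<sigma>. good \<sigma>"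
proof -
  let ?C = "carrier (model D \<rho>)"
  let ?g = "inv_into ?C G"
  let ?T = "tensor_space M"
  define \<sigma> where "\<sigma> a x = G (\<rho> a (?g x))" for a x
  have gG: "?g (G p) = p" if "p \<in> ?C" for p using G_bij that by (simp add: bij_betw_def)
  have \<sigma>G: "\<sigma> a (G p) = G (\<rho> a p)" if "p \<in> ?C" for a p by (simp only: \<sigma>_def gG[OF that])
  have T0: "\<zero>\<^bsub>?T\<^esub> = G 0" unfolding T_simps G_def lin_zero[OF lin_\<Psi>] cos_eq by simp
  let ?W = "with_action ?T \<sigma>"
  have "left_module I_n ?W"
    by (rule left_module_surj[OF ME.left_module_axioms, of _ G]; unfold with_action_simps)
       (use G_bij T0 in \<open>simp_all add: bij_betw_def G_add \<sigma>G\<close>)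
  moreover have "\<sigma> a (pure_tensor M m) = pure_tensor M (m(i := a \<odot>\<^bsub>M i\<^esub> m i))"
    if "a \<in> carrier (I_1 i)" "m \<in> families M" for i a m
  proof -
    have "m i \<in> carrier (M i)" using that(2) by (simp add: families_def)
    then have f: "m(i := a \<odot>\<^bsub>M i\<^esub> m i) \<in> families M" by (intro fam_upd that(2) M_closed(2)[OF that(1)])
    have "\<Phi> m \<in> ?C" using \<Phi>_keys[OF that(2)] by simp
    then show ?thesis unfolding G_\<Phi>[OF that(2), symmetric] G_\<Phi>[OF f, symmetric] \<rho>_\<Phi>[OF that, symmetric] by (rule \<sigma>G)
  qed
  ultimately show ?thesis unfolding good_def by blast
qed

text \<open>Pure tensors span the space, on them the subalgebras act through single slots, and these
  subalgebras generate the whole algebra. So every admissible action is the one transported from the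
  model, whichever the choice operator returns.\<close>

lemma good_unique:
  assumes g: "good \<sigma>" and a: "a \<in> carrier I_n" and p: "Poly_Mapping.keys p \<subseteq> lattice_cone D"
  shows "\<sigma> a (G p) = G (\<rho> a p)"
proof -
  let ?C = "carrier (model D \<rho>)"
  interpret W: left_module I_n "with_action (tensor_space M) \<sigma>" using g by (simp add: good_def)
  have GC: "G q \<in> carrier (with_action (tensor_space M) \<sigma>)" if "Poly_Mapping.keys q \<subseteq> lattice_cone D" for q
    using G_bij that unfolding bij_betw_def with_action_simps by auto
  have \<rho>C: "Poly_Mapping.keys (\<rho> a q) \<subseteq> lattice_cone D" if "a \<in> carrier I_n" "Poly_Mapping.keys q \<subseteq> lattice_cone D" for a q
    using ME.smult_closed[OF that(1), of q] that(2) by simp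
  have sadd: "\<sigma> a (G (q + q')) = \<sigma> a (G q) \<oplus>\<^bsub>tensor_space M\<^esub> \<sigma> a (G q')"
    if "a \<in> carrier I_n" "Poly_Mapping.keys q \<subseteq> lattice_cone D" "Poly_Mapping.keys q' \<subseteq> lattice_cone D" for a q q'
    using W.smult_r_distr[OF that(1) GC[OF that(2)] GC[OF that(3)]] unfolding with_action_simps G_add .
  have gen: "\<sigma> a (G q) = G (\<rho> a q)" if ai: "a \<in> carrier (I_1 i)" and q: "Poly_Mapping.keys q \<subseteq> lattice_cone D" for a i q
    using q
  proof (induction q rule: poly_mapping_induct_keys)
    have aI: "a \<in> carrier I_n" by (rule I_1_le_I_n[OF ai])
    {
      case (single z c)
      define m where "m = (\<lambda>j. \<beta> j (z j))"
      have m: "m \<in> families M" "\<Phi> m = Poly_Mapping.single z 1" unfolding m_def using \<beta>_fam[OF single] \<Phi>_\<beta>[OF single] by blast+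
      have mi: "m i \<in> carrier (M i)" using m(1) by (simp add: families_def)
      \<comment> \<open>The scalar is absorbed into entry \<open>i\<close>, so that the whole term
        is the image of one pure tensor, for which \<open>good\<close> prescribes the
        action.\<close>
      define m' where "m' = m(i := scl c \<odot>\<^bsub>M i\<^esub> m i)"
      have m': "m' \<in> families M" unfolding m'_def by (rule fam_upd[OF m(1) M_closed(2)[OF gens_in_I_1(6) mi]])
      have "\<Phi> m' = scl c (\<Phi> (m(i := m i)))" unfolding m'_def by (rule \<Phi>_scl[OF mi])
      then have P: "\<Phi> m' = Poly_Mapping.single z c" by (simp add: m(2))
      have mi': "m' i \<in> carrier (M i)" using m' by (simp add: families_def)
      have f: "m'(i := a \<odot>\<^bsub>M i\<^esub> m' i) \<in> families M" by (rule fam_upd[OF m' M_closed(2)[OF ai mi']])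
      have "\<sigma> a (pure_tensor M m') = pure_tensor M (m'(i := a \<odot>\<^bsub>M i\<^esub> m' i))" using g ai m' unfolding good_def by blast
      then show ?case unfolding P[symmetric] \<rho>_\<Phi>[OF ai m'] G_\<Phi>[OF m'] G_\<Phi>[OF f] .
    next
      case zero
      have "\<sigma> a (G 0) = \<sigma> a (G 0) \<oplus>\<^bsub>tensor_space M\<^esub> \<sigma> a (G 0)" using sadd[OF aI, of 0 0] by simp
      moreover have "\<sigma> a (G 0) \<in> carrier (with_action (tensor_space M) \<sigma>)"
        using W.smult_closed[OF aI GC[of 0]] by (simp add: with_action_simps)
      ultimately have "\<sigma> a (G 0) = \<zero>\<^bsub>tensor_space M\<^esub>"
        using W.M.add.r_cancel_one'[of "\<sigma> a (G 0)" "\<sigma> a (G 0)"] by (simp add: with_action_simps)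
      also have "\<dots> = G 0" unfolding T_simps G_def lin_zero[OF lin_\<Psi>] cos_eq by simp
      finally have "\<sigma> a (G 0) = G 0" .
      moreover have "\<rho> a 0 = 0" using ME.smult_r_zero[OF aI] by simp
      ultimately show ?case by (simp only:)
    next
      case (add p q)
      have "\<rho> a (p + q) = \<rho> a p + \<rho> a q" using ME.smult_r_distr[OF aI, of p q] add.hyps by simp
      then show ?case using sadd[OF aI add.hyps] add.IH G_add by simp
    }
  qed
  show ?thesis using a p
  proof (induction a arbitrary: p rule: I_n_induct)
    case (scl c)
    show ?case by (rule gen[OF gens_in_I_1(6) scl])
  next
    case (mult_x i)
    show ?case by (rule gen[OF gens_in_I_1(1) mult_x])
  next
    case (partial_x i)
    show ?case by (rule gen[OF gens_in_I_1(2) partial_x])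
  next
    case (int_x i)
    show ?case by (rule gen[OF gens_in_I_1(3) int_x])
  next
    case (comp a b)
    have "\<sigma> (a \<circ> b) (G p) = \<sigma> a (\<sigma> b (G p))"
      using W.smult_assoc[OF comp.hyps GC[OF comp.prems]] by (simp only: with_action_simps I_n_simps)
    also have "\<dots> = G (\<rho> a (\<rho> b p))"
      unfolding comp.IH(2)[OF comp.prems] by (rule comp.IH(1)[OF \<rho>C[OF comp.hyps(2) comp.prems]])
    also have "\<rho> a (\<rho> b p) = \<rho> (a \<circ> b) p"
      using ME.smult_assoc[OF comp.hyps, of p] comp.prems by simp
    finally show ?case .
  next
    case (add a b)
    have "\<sigma> (\<lambda>q. a q + b q) (G p) = \<sigma> a (G p) \<oplus>\<^bsub>tensor_space M\<^esub> \<sigma> b (G p)"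
      using W.smult_l_distr[OF add.hyps GC[OF add.prems]] by (simp only: with_action_simps I_n_simps)
    also have "\<dots> = G (\<rho> a p + \<rho> b p)" unfolding add.IH[OF add.prems] G_add ..
    also have "\<rho> a p + \<rho> b p = \<rho> (\<lambda>q. a q + b q) p"
      using ME.smult_l_distr[OF add.hyps, of p] add.prems by simp
    finally show ?case .
  qed
qed

theorem tensor_module_isomorphic: "module_isomorphic I_n (model D \<rho>) (tensor_module M)"
proof -
  define \<sigma> where "\<sigma> = (SOME \<sigma>. good \<sigma>)"
  have g: "good \<sigma>" unfolding \<sigma>_def by (rule someI_ex[OF good_exists])
  have T: "tensor_module M = with_action (tensor_space M) \<sigma>" unfolding tensor_module_def \<sigma>_def good_def ..
  have b: "bij_betw G (carrier (model D \<rho>)) (carrier (tensor_module M))" unfolding T with_action_simps by (rule G_bij)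
  moreover have "G \<in> module_hom_set I_n (model D \<rho>) (tensor_module M)"
    unfolding module_hom_set_def mem_Collect_eq
  proof (intro conjI ballI)
    show "G \<in> carrier (model D \<rho>) \<rightarrow> carrier (tensor_module M)" using b unfolding bij_betw_def by blast
    show "G (v \<oplus>\<^bsub>model D \<rho>\<^esub> w) = G v \<oplus>\<^bsub>tensor_module M\<^esub> G w" for v w
      unfolding T with_action_simps model_simps by (rule G_add)
    show "G (a \<odot>\<^bsub>model D \<rho>\<^esub> v) = a \<odot>\<^bsub>tensor_module M\<^esub> G v" if "a \<in> carrier I_n" "v \<in> carrier (model D \<rho>)" for a v
      unfolding T with_action_simps model_simps using good_unique[OF g that(1), of v] that(2) by simp
  qed
  ultimately show ?thesis unfolding module_isomorphic_def by blast
qed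

end

section \<open>The tensor factors\<close>

text \<open>What \<open>tensor_coords\<close> demands of a single factor; the flag \<open>b\<close>
  stands for \<open>i \<in> D\<close> and \<open>c\<close> for the base eigenvalue
  \<open>r i\<close>.\<close>

definition coords :: "'n \<Rightarrow> bool \<Rightarrow> 'k \<Rightarrow> ('m \<Rightarrow> (int \<Rightarrow>\<^sub>0 'k)) \<Rightarrow> (('n::finite, 'k::field_char_0) opr, 'm) module \<Rightarrow> bool"
  where "coords i b c \<kappa> N \<longleftrightarrow> left_module (I_1 i) N \<and>
    bij_betw \<kappa> (carrier N) {p. Poly_Mapping.keys p \<subseteq> (if b then {0..} else UNIV)} \<and>
    (\<forall>u\<in>carrier N. \<forall>v\<in>carrier N. \<kappa> (u \<oplus>\<^bsub>N\<^esub> v) = \<kappa> u + \<kappa> v) \<and>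
    (\<forall>u\<in>carrier N. (\<forall>d. \<kappa> (scl d \<odot>\<^bsub>N\<^esub> u) = scl d (\<kappa> u)) \<and> \<kappa> (partial_x i \<odot>\<^bsub>N\<^esub> u) = d1 b (\<kappa> u) \<and>
      \<kappa> (int_x i \<odot>\<^bsub>N\<^esub> u) = i1 (\<kappa> u) \<and> \<kappa> (mult_x i \<odot>\<^bsub>N\<^esub> u) = i1 (h1 c (\<kappa> u)))"

lemma module_copy_simps:
  assumes "inj f"
  shows "carrier (module_copy f N) = f ` carrier N" "\<zero>\<^bsub>module_copy f N\<^esub> = f \<zero>\<^bsub>N\<^esub>"
    "f u \<oplus>\<^bsub>module_copy f N\<^esub> f v = f (u \<oplus>\<^bsub>N\<^esub> v)" "a \<odot>\<^bsub>module_copy f N\<^esub> f u = f (a \<odot>\<^bsub>N\<^esub> u)"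
  using assms by (simp_all add: module_copy_def)

lemma left_module_copy:
  assumes "left_module R N" "inj f"
  shows "left_module R (module_copy f N)"
  by (rule left_module_surj[OF assms(1), of _ f]) (simp_all only: module_copy_simps[OF assms(2)])

lemma coords_copy:
  assumes "coords i b c \<kappa> N" "inj f"
  shows "coords i b c (\<kappa> \<circ> inv_into UNIV f) (module_copy f N)"
proof -
  note s = module_copy_simps[OF assms(2)]
  have "bij_betw (inv_into UNIV f) (f ` carrier N) (carrier N)"
    by (rule bij_betw_byWitness[where f'=f]) (use assms(2) in auto)
  moreover have "bij_betw \<kappa> (carrier N) {p. Poly_Mapping.keys p \<subseteq> (if b then {0..} else UNIV)}"
    using assms(1) unfolding coords_def by blast
  ultimately have "bij_betw (\<kappa> \<circ> inv_into UNIV f) (f ` carrier N) {p. Poly_Mapping.keys p \<subseteq> (if b then {0..} else UNIV)}"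
    by (rule bij_betw_trans)
  moreover have "left_module (I_1 i) (module_copy f N)"
    using assms left_module_copy unfolding coords_def by blast
  ultimately show ?thesis using assms unfolding coords_def s(1) by (simp add: s)
qed

text \<open>The push-forward along the projection to coordinate \<open>i\<close>, with
  \<open>axis i\<close> as a section. Together they extract one-variable coordinates from the
  models, which are built over the full lattice.\<close>

definition res :: "'n \<Rightarrow> (('n \<Rightarrow> int) \<Rightarrow>\<^sub>0 'k::field_char_0) \<Rightarrow> (int \<Rightarrow>\<^sub>0 'k)"
  where "res i = lext (\<lambda>z. Poly_Mapping.single (z i) 1)"

definition axis :: "'n \<Rightarrow> (int \<Rightarrow>\<^sub>0 'k::field_char_0) \<Rightarrow> (('n \<Rightarrow> int) \<Rightarrow>\<^sub>0 'k)"
  where "axis i = lext (\<lambda>k. Poly_Mapping.single ((\<lambda>_. 0)(i := k)) 1)"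

lemma lin_res: "lin (res i)" and lin_axis: "lin (axis i)"
  by (simp_all add: res_def axis_def lin_lext)

lemma res_single: "res i (Poly_Mapping.single z c) = Poly_Mapping.single (z i) c"
  and axis_single: "axis i (Poly_Mapping.single k c) = Poly_Mapping.single ((\<lambda>_. 0)(i := k)) c"
  by (simp_all add: res_def axis_def)

lemma res_axis: "res i (axis i q) = q"
proof (induction q rule: poly_mapping_induct)
  case (single k c)
  show ?case unfolding axis_single res_single fun_upd_same ..
qed (simp add: lin_add[OF lin_res] lin_add[OF lin_axis])

lemma res_m:
  "res i (m_partial D i p) = d1 (i \<in> D) (res i p)"
  "res i (m_int i p) = i1 (res i p)"
  "res i (m_H r i p) = h1 (r i) (res i p)"
proof -
  show "res i (m_partial D i p) = d1 (i \<in> D) (res i p)"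
  proof (induction p rule: poly_mapping_induct)
    case (single z c)
    show ?case
      by (cases "i \<in> D \<and> z i \<le> 0")
         (simp_all only: m_single single_1 res_single if_P if_not_P lin_zero[OF lin_res] fun_upd_same simp_thms if_True if_False)
  qed (simp add: lin_add[OF lin_res] lin_add[OF lin_m(1)] lin_add[OF lin_1(1)])
  show "res i (m_int i p) = i1 (res i p)"
  proof (induction p rule: poly_mapping_induct)
    case (single z c)
    show ?case by (simp only: m_single single_1 res_single fun_upd_same)
  qed (simp add: lin_add[OF lin_res] lin_add[OF lin_m(2)] lin_add[OF lin_1(2)])
  show "res i (m_H r i p) = h1 (r i) (res i p)"
  proof (induction p rule: poly_mapping_induct)
    case (single z c)
    show ?case by (simp only: m_single single_1 res_single)
  qed (simp add: lin_add[OF lin_res] lin_add[OF lin_m(3)] lin_add[OF lin_1(3)])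
qed

lemma keys_ex_add: "Poly_Mapping.keys \<alpha> \<subseteq> {i} \<Longrightarrow> Poly_Mapping.keys (\<alpha> + ex i) \<subseteq> {i}"
  and keys_ex_diff: "Poly_Mapping.keys \<alpha> \<subseteq> {i} \<Longrightarrow> Poly_Mapping.keys (\<alpha> - ex i) \<subseteq> {i}"
  by (auto simp: subset_iff in_keys_iff lookup_add lookup_minus lookup_single when_def split: if_splits)

lemma K_x_closed:
  assumes "a \<in> carrier (I_1 i)" "Poly_Mapping.keys p \<subseteq> {\<alpha>. Poly_Mapping.keys \<alpha> \<subseteq> {i}}"
  shows "Poly_Mapping.keys (a p) \<subseteq> {\<alpha>. Poly_Mapping.keys \<alpha> \<subseteq> {i}}"
proof -
  let ?C = "{\<alpha>. Poly_Mapping.keys \<alpha> \<subseteq> {i}}"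
  have gen: "Poly_Mapping.keys (a p) \<subseteq> ?C" if "lin a" "Poly_Mapping.keys p \<subseteq> ?C"
    "\<And>\<alpha> c. \<alpha> \<in> ?C \<Longrightarrow> Poly_Mapping.keys (a (Poly_Mapping.single \<alpha> c)) \<subseteq> ?C" for a :: "('a, 'b) opr" and p
    using that(2)
  proof (induction p rule: poly_mapping_induct_keys)
    case (single \<alpha> c)
    then show ?case by (rule that(3))
  next
    case (add p q)
    then show ?case using keys_add[of "a p" "a q"] unfolding lin_add[OF that(1)] by blast
  qed (simp add: lin_zero[OF that(1)])
  have 1: "Poly_Mapping.keys (Poly_Mapping.single \<beta> c) \<subseteq> ?C" if "\<beta> \<in> ?C" for \<beta> and c :: 'b
    using that by simp
  have 2: "\<alpha> + ex i \<in> ?C" "\<alpha> - ex i \<in> ?C" if "\<alpha> \<in> ?C" for \<alpha>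
    using that keys_ex_add[of \<alpha> i] keys_ex_diff[of \<alpha> i] by blast+
  show ?thesis using assms
  proof (induction a arbitrary: p rule: I_1_induct)
    case (scl c)
    then show ?case using lookup_scl[of c p] by (auto simp: in_keys_iff subset_iff)
  next
    case mult_x
    show ?case by (rule gen[OF lin_mult_x mult_x]) (unfold mult_x_single, rule 1[OF 2(1)])
  next
    case partial_x
    show ?case by (rule gen[OF lin_partial_x partial_x]) (unfold partial_x_single, rule 1[OF 2(2)])
  next
    case int_x
    show ?case by (rule gen[OF lin_int_x int_x]) (unfold int_x_single, rule 1[OF 2(1)])
  next
    case (comp a b)
    show ?case unfolding o_apply by (rule comp.IH(1)[OF comp.IH(2)[OF comp.prems]])
  next
    case (add a b)
    then show ?case using keys_add[of "a p" "b p"] by blast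
  qed
qed

text \<open>Polynomials in \<open>x\<^sub>i\<close> alone correspond under \<open>theta\<close> to
  lattice points on the nonnegative half of the \<open>i\<close>-th axis. The base value 1 is the
  eigenvalue of \<open>H\<^sub>i\<close> on the constant 1.\<close>

lemma coords_K_x:
  fixes i :: "'n::finite"
  shows "coords i True (1 :: 'k::field_char_0) (\<lambda>p. res i (theta p)) (K_x i)"
proof -
  let ?K = "K_x i :: (('n, 'k) opr, ('n, 'k) pol) module"
  let ?C = "{\<alpha>. Poly_Mapping.keys \<alpha> \<subseteq> {i}}"
  have s: "carrier ?K = {p. Poly_Mapping.keys p \<subseteq> ?C}" "\<zero>\<^bsub>?K\<^esub> = 0" "ring.add ?K = (+)"
    "module.smult ?K = (\<lambda>a p. a p)" by (auto simp: K_x_def)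
  have ag: "abelian_group ?K"
  proof (rule abelian_groupI; unfold s)
    fix p :: "('n, 'k) pol" assume p: "p \<in> {p. Poly_Mapping.keys p \<subseteq> ?C}"
    show "\<exists>q\<in>{p. Poly_Mapping.keys p \<subseteq> ?C}. q + p = 0" by (rule bexI[of _ "- p"]) (use p in auto)
    fix q :: "('n, 'k) pol" assume "q \<in> {p. Poly_Mapping.keys p \<subseteq> ?C}"
    then show "p + q \<in> {p. Poly_Mapping.keys p \<subseteq> ?C}" using p keys_add[of p q] by blast
  qed (auto simp: add_ac)
  have lm: "left_module (I_1 i) ?K"
  proof (rule left_moduleI[OF ring_I_1 ag]; unfold s I_1_simps)
    fix a :: "('n, 'k) opr" and p q :: "('n, 'k) pol" assume a: "a \<in> carrier (I_1 i)" and p: "p \<in> {p. Poly_Mapping.keys p \<subseteq> ?C}"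
    show "a p \<in> {p. Poly_Mapping.keys p \<subseteq> ?C}" using K_x_closed[OF a] p by blast
    show "a (p + q) = a p + a q" by (rule lin_add[OF lin_I_n[OF I_1_le_I_n[OF a]]])
  qed simp_all
  have "bij_betw (\<lambda>p. res i (theta p)) (carrier ?K) {q. Poly_Mapping.keys q \<subseteq> (if True then {0..} else UNIV)}"
  proof (rule bij_betw_byWitness[where f'="\<lambda>q. theta_inv (axis i q)"])
    show "\<forall>p\<in>carrier ?K. theta_inv (axis i (res i (theta p))) = p"
    proof
      fix p :: "('n, 'k) pol" assume "p \<in> carrier ?K"
      then have "Poly_Mapping.keys p \<subseteq> ?C" unfolding s(1) by blast
      then show "theta_inv (axis i (res i (theta p))) = p"
      proof (induction p rule: poly_mapping_induct_keys)
        case (single \<alpha> c)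
        have "Poly_Mapping.lookup \<alpha> j = 0" if "j \<noteq> i" for j using single that by (auto simp: in_keys_iff)
        then have "(\<lambda>_. 0)(i := int (Poly_Mapping.lookup \<alpha> i)) = (\<lambda>j. int (Poly_Mapping.lookup \<alpha> j))" by (auto simp: fun_eq_iff)
        then show ?case unfolding theta_single res_single axis_single by (simp only: theta_single[symmetric] theta_inv_theta)
      qed (simp_all add: lin_zero[OF lin_theta] lin_zero[OF lin_res] lin_zero[OF lin_axis] lin_zero[OF lin_theta_inv]
             lin_add[OF lin_theta] lin_add[OF lin_res] lin_add[OF lin_axis] lin_add[OF lin_theta_inv])
    qed
    have ax: "Poly_Mapping.keys (axis i q) \<subseteq> lattice_cone UNIV" if "Poly_Mapping.keys q \<subseteq> {0..}" for q :: "int \<Rightarrow>\<^sub>0 'k"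
      using that
    proof (induction q rule: poly_mapping_induct_keys)
      case (add p q)
      then show ?case using keys_add[of "axis i p" "axis i q"] unfolding lin_add[OF lin_axis] by blast
    qed (auto simp: lin_zero[OF lin_axis] axis_single lattice_cone_def)
    show "\<forall>q\<in>{q :: int \<Rightarrow>\<^sub>0 'k. Poly_Mapping.keys q \<subseteq> (if True then {0..} else UNIV)}. res i (theta (theta_inv (axis i q))) = q"
    proof
      fix q :: "int \<Rightarrow>\<^sub>0 'k" assume "q \<in> {q. Poly_Mapping.keys q \<subseteq> (if True then {0..} else UNIV)}"
      then have "Poly_Mapping.keys q \<subseteq> {0..}" by simp
      from theta_theta_inv[OF ax[OF this]] show "res i (theta (theta_inv (axis i q))) = q" by (simp only: res_axis)
    qed
    show "(\<lambda>p. res i (theta p)) ` carrier ?K \<subseteq> {q. Poly_Mapping.keys q \<subseteq> (if True then {0..} else UNIV)}"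
    proof (rule image_subsetI)
      fix p :: "('n, 'k) pol"
      have "Poly_Mapping.keys (res i t) \<subseteq> {0..}" if "Poly_Mapping.keys t \<subseteq> lattice_cone UNIV" for t :: "('n \<Rightarrow> int) \<Rightarrow>\<^sub>0 'k"
        using that
      proof (induction t rule: poly_mapping_induct_keys)
        case (add p q)
        then show ?case using keys_add[of "res i p" "res i q"] unfolding lin_add[OF lin_res] by blast
      qed (auto simp: lin_zero[OF lin_res] res_single lattice_cone_def)
      then have "Poly_Mapping.keys (res i (theta p)) \<subseteq> {0..}" using keys_theta[of p] by blast
      then show "res i (theta p) \<in> {q. Poly_Mapping.keys q \<subseteq> (if True then {0..} else UNIV)}" by simp
    qed
    show "(\<lambda>q. theta_inv (axis i q)) ` {q :: int \<Rightarrow>\<^sub>0 'k. Poly_Mapping.keys q \<subseteq> (if True then {0..} else UNIV)} \<subseteq> carrier ?K"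
    proof (rule image_subsetI)
      fix q :: "int \<Rightarrow>\<^sub>0 'k"
      have "Poly_Mapping.keys (theta_inv (axis i q)) \<subseteq> ?C"
      proof (induction q rule: poly_mapping_induct)
        case (single k c)
        have "Poly_Mapping.keys (of_cone ((\<lambda>_. 0)(i := k))) \<subseteq> {i}" by (auto simp: in_keys_iff split: if_splits)
        then show ?case unfolding axis_single theta_inv_single by simp
      next
        case (add p q)
        then show ?case using keys_add[of "theta_inv (axis i p)" "theta_inv (axis i q)"]
          unfolding lin_add[OF lin_axis] lin_add[OF lin_theta_inv] by blast
      qed
      then show "theta_inv (axis i q) \<in> carrier ?K" unfolding s(1) by blast
    qed
  qed
  then show ?thesis unfolding coords_def s(3,4)
    using lm res_m(1)[of i UNIV] by (simp add: theta_scl lin_scl[OF lin_res] lin_add[OF lin_theta] lin_add[OF lin_res]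
        theta_partial theta_int mult_x_eq theta_H res_m)
qed

section \<open>The ideal F of the algebra in one variable\<close>

lemma lin_pow:
  fixes f :: "('a \<Rightarrow>\<^sub>0 'k::field_char_0) \<Rightarrow> ('a \<Rightarrow>\<^sub>0 'k)"
  shows "lin f \<Longrightarrow> lin (f ^^ k)"
proof (induction k)
  case 0
  have "f ^^ 0 = id" by simp
  then show ?case by (metis lin_id)
next
  case (Suc k)
  have "f ^^ Suc k = f \<circ> f ^^ k" by simp
  then show ?case using lin_comp[OF Suc.prems Suc.IH[OF Suc.prems]] by (simp only:)
qed

lemma e_op_eq: "e_op i s t p = (int_x i ^^ s) (proj_op i ((partial_x i ^^ t) p))"
  unfolding e_op_def proj_op_def lin_diff[OF lin_pow[OF lin_int_x]] by (simp add: funpow_swap1)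

text \<open>Encoding a finite sum by its coefficient function turns the addition of elements of F
  into the addition of coefficients, without merging index sets.\<close>

lemma F_ideal_iff: "f \<in> F_ideal i \<longleftrightarrow> (\<exists>q. f = (\<lambda>x. lext (\<lambda>(s, t). e_op i s t x) q))"
proof
  assume "f \<in> F_ideal i"
  then obtain S c where f: "finite S" "f = (\<lambda>p. \<Sum>(s, t)\<in>S. scl (c s t) (e_op i s t p))" unfolding F_ideal_def by blast
  define q where "q = Abs_poly_mapping (\<lambda>a. if a \<in> S then c (fst a) (snd a) else 0)"
  have l: "Poly_Mapping.lookup q = (\<lambda>a. if a \<in> S then c (fst a) (snd a) else 0)"
    unfolding q_def by (rule lookup_Abs_poly_mapping) (rule finite_subset[OF _ f(1)], auto)
  have "f = (\<lambda>x. lext (\<lambda>(s, t). e_op i s t x) q)"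
  proof
    fix x
    have "lext (\<lambda>(s, t). e_op i s t x) q = (\<Sum>a\<in>S. scl (Poly_Mapping.lookup q a) ((\<lambda>(s, t). e_op i s t x) a))"
      by (rule lext_superset[OF f(1)]) (auto simp: in_keys_iff l split: if_splits)
    then show "f x = lext (\<lambda>(s, t). e_op i s t x) q" unfolding f(2)
      by (auto simp: l intro!: sum.cong)
  qed
  then show "\<exists>q. f = (\<lambda>x. lext (\<lambda>(s, t). e_op i s t x) q)" by blast
next
  assume "\<exists>q. f = (\<lambda>x. lext (\<lambda>(s, t). e_op i s t x) q)"
  then obtain q where f: "f = (\<lambda>x. lext (\<lambda>(s, t). e_op i s t x) q)" by blast
  have "f = (\<lambda>p. \<Sum>(s, t)\<in>Poly_Mapping.keys q. scl (Poly_Mapping.lookup q (s, t)) (e_op i s t p))"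
    unfolding f lext_def by (auto simp: fun_eq_iff intro!: sum.cong)
  then show "f \<in> F_ideal i" unfolding F_ideal_def
    by (intro CollectI exI[of _ "Poly_Mapping.keys q"] exI[of _ "\<lambda>s t. Poly_Mapping.lookup q (s, t)"]) simp
qed

lemma F_zero: "(\<lambda>x. 0) \<in> F_ideal i"
  unfolding F_ideal_iff by (rule exI[of _ 0]) (simp add: lin_zero[OF lin_lext])

lemma F_add: "f \<in> F_ideal i \<Longrightarrow> g \<in> F_ideal i \<Longrightarrow> (\<lambda>x. f x + g x) \<in> F_ideal i"
  unfolding F_ideal_iff
proof (elim exE)
  fix q q' assume "f = (\<lambda>x. lext (\<lambda>(s, t). e_op i s t x) q)" "g = (\<lambda>x. lext (\<lambda>(s, t). e_op i s t x) q')"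
  then show "\<exists>q. (\<lambda>x. f x + g x) = (\<lambda>x. lext (\<lambda>(s, t). e_op i s t x) q)"
    by (intro exI[of _ "q + q'"]) (simp add: lin_add[OF lin_lext])
qed

lemma F_e: "(\<lambda>x. scl c (e_op i s t x)) \<in> F_ideal i"
  unfolding F_ideal_iff by (rule exI[of _ "Poly_Mapping.single (s, t) c"]) simp

lemma F_induct [consumes 1, case_names zero e add]:
  assumes "f \<in> F_ideal i" and "P (\<lambda>x. 0)" and "\<And>c s t. P (\<lambda>x. scl c (e_op i s t x))"
    and "\<And>f g. f \<in> F_ideal i \<Longrightarrow> g \<in> F_ideal i \<Longrightarrow> P f \<Longrightarrow> P g \<Longrightarrow> P (\<lambda>x. f x + g x)"
  shows "P f"
proof -
  obtain q where f: "f = (\<lambda>x. lext (\<lambda>(s, t). e_op i s t x) q)" using assms(1) unfolding F_ideal_iff by blast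
  have "P (\<lambda>x. lext (\<lambda>(s, t). e_op i s t x) q)"
  proof (induction q rule: poly_mapping_induct)
    case (single a c)
    obtain s t where "a = (s, t)" by (cases a)
    then show ?case using assms(3)[of c s t] by simp
  next
    case (add p q)
    have "(\<lambda>x. lext (\<lambda>(s, t). e_op i s t x) p) \<in> F_ideal i" "(\<lambda>x. lext (\<lambda>(s, t). e_op i s t x) q) \<in> F_ideal i"
      unfolding F_ideal_iff by blast+
    from assms(4)[OF this add] show ?case by (simp only: lin_add[OF lin_lext])
  qed
  then show ?thesis unfolding f .
qed

lemma e_op_in_I_1: "(\<lambda>x. scl c (e_op i s t x)) \<in> carrier (I_1 i)"
proof -
  have "(\<lambda>x. scl c (e_op i s t x)) = scl c \<circ> ((int_x i ^^ s) \<circ> (proj_op i \<circ> (partial_x i ^^ t)))"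
    by (simp add: fun_eq_iff e_op_eq)
  also have "\<dots> \<in> carrier (I_1 i)" by (intro I_1_closed gens_in_I_1)
  finally show ?thesis .
qed

lemma F_in_I_1: "f \<in> F_ideal i \<Longrightarrow> f \<in> carrier (I_1 i)"
proof (induction rule: F_induct)
  case zero
  show ?case by (rule I_1_closed(3))
next
  case (e c s t)
  show ?case by (rule e_op_in_I_1)
next
  case (add f g)
  then show ?case by (intro I_1_closed(5))
qed

lemma lin_I_1: "a \<in> carrier (I_1 i) \<Longrightarrow> lin a"
  by (intro lin_I_n I_1_le_I_n)

lemma H_int_pow: "H_op i ((int_x i ^^ s) y) = (int_x i ^^ s) (H_op i y) + scl (of_nat s) ((int_x i ^^ s) y)"
  by (induction s) (simp_all add: H_int scl.scale_left_distrib)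

lemma int_pow_scl: "(int_x i ^^ s) (scl c y) = scl c ((int_x i ^^ s) y)"
  by (rule lin_scl[OF lin_pow[OF lin_int_x]])

text \<open>In one variable and the basis of divided powers, \<open>e_op i s t\<close> is the matrix
  unit sending the \<open>t\<close>-th basis vector to the \<open>s\<close>-th. Left multiplication
  moves \<open>s\<close>, right multiplication moves \<open>t\<close>, so F is a two-sided
  ideal.\<close>

lemma e_op_left:
  "partial_x i (e_op i s t x) = (if s = 0 then 0 else e_op i (s - 1) t x)"
  "int_x i (e_op i s t x) = e_op i (s + 1) t x"
  "H_op i (e_op i s t x) = scl (of_nat s + 1) (e_op i s t x)"
  "mult_x i (e_op i s t x) = scl (of_nat s + 1) (e_op i (s + 1) t x)"
proof -
  show "partial_x i (e_op i s t x) = (if s = 0 then 0 else e_op i (s - 1) t x)"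
    by (cases s) (simp_all add: e_op_eq)
  show i: "int_x i (e_op i s t x) = e_op i (s + 1) t x" by (simp add: e_op_eq)
  show H: "H_op i (e_op i s t x) = scl (of_nat s + 1) (e_op i s t x)"
    by (simp add: e_op_eq H_int_pow H_proj scl.scale_left_distrib add.commute)
  show "mult_x i (e_op i s t x) = scl (of_nat s + 1) (e_op i (s + 1) t x)"
    by (simp add: mult_x_eq H i)
qed

lemma e_op_right:
  "e_op i s t (partial_x i x) = e_op i s (t + 1) x"
  "e_op i s t (int_x i x) = (if t = 0 then 0 else e_op i s (t - 1) x)"
  "e_op i s t (mult_x i x) = scl (of_nat t) (if t = 0 then 0 else e_op i s (t - 1) x)"
  "e_op i s t (scl c x) = scl c (e_op i s t x)"
proof -
  show "e_op i s t (partial_x i x) = e_op i s (t + 1) x" by (simp add: e_op_eq funpow_swap1)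
  have i: "e_op i s t (int_x i x) = (if t = 0 then 0 else e_op i s (t - 1) x)" for t x
    by (cases t) (simp_all add: e_op_eq lin_zero[OF lin_pow[OF lin_int_x]] funpow_swap1[of "partial_x i"])
  show "e_op i s t (int_x i x) = (if t = 0 then 0 else e_op i s (t - 1) x)" by (rule i)
  have "e_op i s t (H_op i x) = scl (of_nat t + 1) (e_op i s t x)" for t
    by (simp add: e_op_eq H_partial_pow int_pow_scl lin_add[OF lin_pow[OF lin_int_x]] scl.scale_left_distrib add.commute)
  then show "e_op i s t (mult_x i x) = scl (of_nat t) (if t = 0 then 0 else e_op i s (t - 1) x)"
    by (cases t) (simp_all add: mult_x_eq i add.commute)
  show "e_op i s t (scl c x) = scl c (e_op i s t x)"
    by (simp add: e_op_eq int_pow_scl lin_scl[OF lin_pow[OF lin_partial_x]])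
qed

lemma F_scl: "f \<in> F_ideal i \<Longrightarrow> (\<lambda>x. scl c (f x)) \<in> F_ideal i"
proof (induction rule: F_induct)
  case (e d s t)
  show ?case using F_e[of "c * d" i s t] by simp
qed (simp_all add: F_zero F_add scl.scale_right_distrib)

lemma F_left:
  assumes "a \<in> carrier (I_1 i)" "f \<in> F_ideal i"
  shows "a \<circ> f \<in> F_ideal i"
proof -
  have gen: "(\<lambda>x. a (f x)) \<in> F_ideal i" if "lin a" "f \<in> F_ideal i" "\<And>s t. (\<lambda>x. a (e_op i s t x)) \<in> F_ideal i" for a f
    using that(2)
  proof (induction rule: F_induct)
    case (e c s t)
    show ?case unfolding lin_scl[OF that(1)] by (rule F_scl[OF that(3)])
  qed (simp_all add: lin_zero[OF that(1)] lin_add[OF that(1)] F_zero F_add)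
  have e: "(\<lambda>x. e_op i s t x) \<in> F_ideal i" for s t using F_e[of 1 i s t] by simp
  have "(\<lambda>x. a (f x)) \<in> F_ideal i" using assms
  proof (induction a arbitrary: f rule: I_1_induct)
    case (scl c)
    then show ?case by (rule F_scl)
  next
    case mult_x
    show ?case by (rule gen[OF lin_mult_x mult_x]) (unfold e_op_left, rule F_e)
  next
    case partial_x
    show ?case
    proof (rule gen[OF lin_partial_x partial_x])
      show "(\<lambda>x. partial_x i (e_op i s t x)) \<in> F_ideal i" for s t
        unfolding e_op_left by (cases "s = 0") (simp_all only: if_True if_False simp_thms F_zero e)
    qed
  next
    case int_x
    show ?case by (rule gen[OF lin_int_x int_x]) (unfold e_op_left, rule e)
  next
    case (comp a b)
    show ?case unfolding o_apply by (rule comp.IH(1)[OF comp.IH(2)[OF comp.prems]])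
  next
    case (add a b)
    then show ?case by (intro F_add)
  qed
  then show ?thesis by (simp add: comp_def)
qed

lemma F_right:
  assumes "a \<in> carrier (I_1 i)" "f \<in> F_ideal i"
  shows "f \<circ> a \<in> F_ideal i"
proof -
  have gen: "(\<lambda>x. f (a x)) \<in> F_ideal i" if "f \<in> F_ideal i" "\<And>s t. (\<lambda>x. e_op i s t (a x)) \<in> F_ideal i" for a f
    using that(1)
  proof (induction rule: F_induct)
    case (e c s t)
    show ?case by (rule F_scl[OF that(2)])
  qed (simp_all add: F_zero F_add)
  have e: "(\<lambda>x. e_op i s t x) \<in> F_ideal i" for s t using F_e[of 1 i s t] by simp
  have "(\<lambda>x. f (a x)) \<in> F_ideal i" using assms
  proof (induction a arbitrary: f rule: I_1_induct)
    case (scl c)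
    show ?case by (rule gen[OF scl]) (unfold e_op_right, rule F_e)
  next
    case mult_x
    show ?case
    proof (rule gen[OF mult_x])
      show "(\<lambda>x. e_op i s t (mult_x i x)) \<in> F_ideal i" for s t
        unfolding e_op_right by (cases "t = 0") (simp_all only: if_True if_False simp_thms scl.scale_zero_right F_zero F_e)
    qed
  next
    case partial_x
    show ?case by (rule gen[OF partial_x]) (unfold e_op_right, rule e)
  next
    case int_x
    show ?case
    proof (rule gen[OF int_x])
      show "(\<lambda>x. e_op i s t (int_x i x)) \<in> F_ideal i" for s t
        unfolding e_op_right by (cases "t = 0") (simp_all only: if_True if_False simp_thms F_zero e)
    qed
  next
    case (comp a b)
    have "(\<lambda>x. (\<lambda>y. f (a y)) (b x)) \<in> F_ideal i" by (rule comp.IH(2)[OF comp.IH(1)[OF comp.prems]])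
    then show ?case by simp
  next
    case (add a b)
    show ?case unfolding lin_add[OF lin_I_1[OF F_in_I_1[OF add.prems]]]
      by (rule F_add[OF add.IH(1)[OF add.prems] add.IH(2)[OF add.prems]])
  qed
  then show ?thesis by (simp add: comp_def)
qed

lemma F_neg: "f \<in> F_ideal i \<Longrightarrow> (\<lambda>x. - f x) \<in> F_ideal i"
  using F_scl[of f i "- 1"] by simp

lemma I_1_a_inv: "a \<in> carrier (I_1 i) \<Longrightarrow> \<ominus>\<^bsub>I_1 i\<^esub> a = (\<lambda>x. - a x)"
proof -
  assume a: "a \<in> carrier (I_1 i)"
  interpret ring "I_1 i" by (rule ring_I_1)
  have "(\<lambda>x. 0 - a x) \<in> carrier (I_1 i)" by (rule I_1_closed(6)[OF I_1_closed(3) a])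
  then have n: "(\<lambda>x. - a x) \<in> carrier (I_1 i)" by simp
  show ?thesis by (rule minus_equality[OF _ a n]) (simp add: fun_eq_iff)
qed

lemma ideal_F: "ideal (F_ideal i :: ('n::finite, 'k::field_char_0) opr set) (I_1 i)"
proof (rule idealI[OF ring_I_1])
  interpret ring "I_1 i :: ('n, 'k) opr ring" by (rule ring_I_1)
  let ?F = "F_ideal i :: ('n, 'k) opr set"
  show "subgroup ?F (add_monoid (I_1 i))"
  proof (rule group.subgroupI[OF a_group])
    show "?F \<subseteq> carrier (add_monoid (I_1 i))"
      unfolding partial_object.simps by (rule subsetI) (rule F_in_I_1)
    show "?F \<noteq> {}" by (rule notI, drule equals0D, erule notE, rule F_zero)
    show "inv\<^bsub>add_monoid (I_1 i)\<^esub> f \<in> ?F" if "f \<in> ?F" for f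
      unfolding a_inv_def[symmetric] I_1_a_inv[OF F_in_I_1[OF that]] by (rule F_neg[OF that])
    show "f \<otimes>\<^bsub>add_monoid (I_1 i)\<^esub> g \<in> ?F" if "f \<in> ?F" "g \<in> ?F" for f g
      unfolding monoid.simps I_1_simps by (rule F_add[OF that])
  qed
  show "x \<otimes>\<^bsub>I_1 i\<^esub> a \<in> ?F" "a \<otimes>\<^bsub>I_1 i\<^esub> x \<in> ?F" if "a \<in> ?F" "x \<in> carrier (I_1 i)" for a x
    unfolding I_1_simps by (rule F_left[OF that(2,1)], rule F_right[OF that(2,1)])
qed

section \<open>Coordinates on the modules M(1,c)\<close>

definition regular_module :: "('a, 'r) ring_scheme \<Rightarrow> ('a, 'a) module"
  where "regular_module R = \<lparr>carrier = carrier R, monoid.mult = monoid.mult R, monoid.one = monoid.one R,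
    ring.zero = ring.zero R, ring.add = ring.add R, module.smult = monoid.mult R\<rparr>"

lemma regular_module_simps:
  "carrier (regular_module R) = carrier R" "\<zero>\<^bsub>regular_module R\<^esub> = \<zero>\<^bsub>R\<^esub>"
  "ring.add (regular_module R) = ring.add R" "module.smult (regular_module R) = monoid.mult R"
  by (simp_all add: regular_module_def)

lemma left_module_regular:
  fixes R (structure)
  assumes "ring R"
  shows "left_module R (regular_module R)"
proof -
  interpret ring R by fact
  have "abelian_group (regular_module R)"
  proof (rule abelian_groupI; unfold regular_module_simps)
    fix x assume "x \<in> carrier R"
    then show "\<exists>y\<in>carrier R. y \<oplus> x = \<zero>" by (intro bexI[of _ "\<ominus> x"]) (simp_all add: l_neg)
  qed (simp_all add: a_ac)
  then show ?thesis
    by (rule left_moduleI[OF ring_axioms]) (simp_all add: regular_module_simps l_distr r_distr m_assoc)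
qed

lemma m_int_partial:
  assumes "i \<notin> D"
  shows "m_int i (m_partial D i p) = p"
proof (induction p rule: poly_mapping_induct)
  case (single z c)
  show ?case using assms by (simp add: m_single)
qed (simp add: lin_add[OF lin_m(1)] lin_add[OF lin_m(2)])

text \<open>Outside \<open>D\<close> derivative and integration are mutually inverse shifts, so
  \<open>1 - \<integral> \<partial>\<close> acts by zero; in this direction the model is a module
  over the skew Laurent polynomials.\<close>

lemma model_proj:
  fixes D :: "'n::finite set" and r :: "'n \<Rightarrow> 'k::field_char_0"
  assumes mdl: "is_model D r \<rho>" and i: "i \<notin> D" and p: "p \<in> carrier (model D \<rho>)"
  shows "\<rho> (proj_op i) p = 0"
proof -
  interpret In_module "model D \<rho>" using mdl by (simp add: is_model_def In_module_def)
  have gens: "\<rho> (partial_x i) q = m_partial D i q" "\<rho> (int_x i) q = m_int i q" if "q \<in> carrier (model D \<rho>)" for q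
    using mdl that by (simp_all add: is_model_def)
  have pp: "\<rho> (partial_x i) p \<in> carrier (model D \<rho>)"
    using act_closed[OF gens_in_I_n(2) p, of i] by (simp only: model_simps(4))
  have 1: "(int_x i \<circ> partial_x i :: ('n, 'k) opr) \<in> carrier I_n" by (intro I_n_closed gens_in_I_n)
  have "\<rho> (int_x i \<circ> partial_x i) p = \<rho> (int_x i) (\<rho> (partial_x i) p)"
    using act_comp[OF gens_in_I_n(3,2) p, of i i] by (simp only: model_simps(4))
  also have "\<dots> = p" unfolding gens(2)[OF pp] unfolding gens(1)[OF p] by (rule m_int_partial[OF i])
  finally have 2: "\<rho> (int_x i \<circ> partial_x i) p = p" .
  have "\<rho> (proj_op i) p + \<rho> (int_x i \<circ> partial_x i) p = \<rho> (\<lambda>x. proj_op i x + (int_x i \<circ> partial_x i) x) p"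
    using act_add[OF gens_in_I_n(5) 1 p, of i] by (simp only: model_simps)
  also have "(\<lambda>x. proj_op i x + (int_x i \<circ> partial_x i) x) = (id :: ('n, 'k) opr)"
    by (simp add: fun_eq_iff proj_op_def)
  also have "\<rho> id p = p" using act_id[OF p] by (simp only: model_simps)
  finally show ?thesis unfolding 2 by simp
qed

text \<open>A quotient such as \<open>M(1,c)\<close> could a priori be too small. The model in which
  only \<open>i\<close> is freed from the cone condition shows that it is not: evaluating operators
  at the basis vector of index 0 kills F and \<open>H\<^sub>i - c\<close>, hence factors through
  \<open>M(1,c)\<close>, and its values fill the whole \<open>i\<close>-th axis.\<close>

locale M1_context =
  fixes i :: "'n::finite" and c :: "'k::field_char_0" and \<rho>
  assumes mdl: "is_model (UNIV - {i}) ((\<lambda>_. 1)(i := c)) \<rho>"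
begin

abbreviation "D \<equiv> UNIV - {i}"
abbreviation "r \<equiv> (\<lambda>_. 1 :: 'k)(i := c)"
abbreviation "R1 \<equiv> I_1 i :: ('n, 'k) opr ring"
abbreviation "FF \<equiv> F_ideal i :: ('n, 'k) opr set"
abbreviation "B \<equiv> B_1 i :: ('n, 'k) opr set ring"
abbreviation "BM \<equiv> B_1_module i :: (('n, 'k) opr, ('n, 'k) opr set) module"
abbreviation cl0 :: "('n, 'k) opr \<Rightarrow> ('n, 'k) opr set" where "cl0 a \<equiv> FF +>\<^bsub>R1\<^esub> a"

sublocale FI: ideal FF R1 by (rule ideal_F)

sublocale ME: In_module "model D \<rho>"
  using mdl by (simp add: is_model_def In_module_def)

lemma cl0_eq: "cl0 a = (\<lambda>f x. f x + a x) ` FF"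
  unfolding a_r_coset_def' I_1_simps by blast

lemma cl0_eq_iff: "cl0 a = cl0 b \<longleftrightarrow> (\<lambda>x. a x - b x) \<in> FF"
proof
  assume "cl0 a = cl0 b"
  moreover have "a \<in> cl0 a" unfolding cl0_eq by (rule image_eqI[OF _ F_zero]) simp
  ultimately have "a \<in> cl0 b" by simp
  then obtain f where f: "f \<in> FF" "a = (\<lambda>x. f x + b x)" unfolding cl0_eq by blast
  then have "(\<lambda>x. a x - b x) = f" by simp
  then show "(\<lambda>x. a x - b x) \<in> FF" using f(1) by simp
next
  assume d: "(\<lambda>x. a x - b x) \<in> FF"
  have "(\<lambda>x. f x + a x) \<in> cl0 b" if "f \<in> FF" for f
    unfolding cl0_eq by (rule image_eqI[OF _ F_add[OF that d]]) (simp add: fun_eq_iff)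
  moreover have "(\<lambda>x. f x + b x) \<in> cl0 a" if "f \<in> FF" for f
    unfolding cl0_eq by (rule image_eqI[OF _ F_add[OF that F_neg[OF d]]]) (simp add: fun_eq_iff)
  ultimately show "cl0 a = cl0 b" unfolding cl0_eq[of a] cl0_eq[of b] by blast
qed

lemma B_simps:
  "carrier B = cl0 ` carrier R1"
  "\<zero>\<^bsub>B\<^esub> = FF"
  "a \<in> carrier R1 \<Longrightarrow> b \<in> carrier R1 \<Longrightarrow> cl0 a \<otimes>\<^bsub>B\<^esub> cl0 b = cl0 (a \<circ> b)"
  "a \<in> carrier R1 \<Longrightarrow> b \<in> carrier R1 \<Longrightarrow> cl0 a \<oplus>\<^bsub>B\<^esub> cl0 b = cl0 (\<lambda>x. a x + b x)"
proof -
  show "carrier B = cl0 ` carrier R1" unfolding B_1_def FactRing_def partial_object.simps A_RCOSETS_def' by blast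
  show "\<zero>\<^bsub>B\<^esub> = FF" by (simp add: B_1_def FactRing_def)
  show "cl0 a \<otimes>\<^bsub>B\<^esub> cl0 b = cl0 (a \<circ> b)" if "a \<in> carrier R1" "b \<in> carrier R1"
    using FI.rcoset_mult_add[OF that] unfolding B_1_def FactRing_def monoid.simps I_1_simps .
  show "cl0 a \<oplus>\<^bsub>B\<^esub> cl0 b = cl0 (\<lambda>x. a x + b x)" if "a \<in> carrier R1" "b \<in> carrier R1"
    using FI.a_rcos_sum[OF that] unfolding B_1_def FactRing_def ring.simps I_1_simps .
qed

lemma BM_simps:
  "carrier BM = cl0 ` carrier R1" "\<zero>\<^bsub>BM\<^esub> = FF"
  "a \<in> carrier R1 \<Longrightarrow> b \<in> carrier R1 \<Longrightarrow> cl0 a \<oplus>\<^bsub>BM\<^esub> cl0 b = cl0 (\<lambda>x. a x + b x)"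
  "a \<in> carrier R1 \<Longrightarrow> b \<in> carrier R1 \<Longrightarrow> a \<odot>\<^bsub>BM\<^esub> cl0 b = cl0 (a \<circ> b)"
  unfolding B_1_module_def by (simp_all add: B_simps)

lemma cl0_zero: "cl0 (\<lambda>x. 0) = FF"
  unfolding cl0_eq by simp

lemma lm_BM: "left_module R1 BM"
proof (rule left_module_surj[OF left_module_regular[OF ring_I_1], of BM cl0]; unfold regular_module_simps)
  show "\<zero>\<^bsub>BM\<^esub> = cl0 \<zero>\<^bsub>R1\<^esub>" unfolding I_1_simps BM_simps cl0_zero ..
qed (simp_all only: BM_simps I_1_simps)

sublocale BM: left_module R1 BM by (rule lm_BM)

abbreviation "J \<equiv> {b \<otimes>\<^bsub>B\<^esub> (FF +>\<^bsub>R1\<^esub> (\<lambda>p. H_op i p - scl c p)) |b. b \<in> carrier B}"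

lemma J_eq: "J = (\<lambda>b. cl0 (b \<circ> shift_H i c)) ` carrier R1"
proof -
  have "J = (\<lambda>b. b \<otimes>\<^bsub>B\<^esub> cl0 (shift_H i c)) ` (cl0 ` carrier R1)"
    unfolding B_simps(1) shift_H_eq[symmetric] by blast
  also have "\<dots> = (\<lambda>b. cl0 (b \<circ> shift_H i c)) ` carrier R1"
    unfolding image_image by (rule image_cong[OF refl]) (rule B_simps(3)[OF _ shift_H_in_I_1])
  finally show ?thesis .
qed

lemma J_sub: "submodule J R1 BM"
  unfolding J_eq
proof (rule BM.left_submoduleI)
  have cs: "b \<circ> shift_H i c \<in> carrier R1" if "b \<in> carrier R1" for b by (rule I_1_closed(4)[OF that shift_H_in_I_1])
  show "(\<lambda>b. cl0 (b \<circ> shift_H i c)) ` carrier R1 \<subseteq> carrier BM" unfolding BM_simps using cs by blast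
  show "\<zero>\<^bsub>BM\<^esub> \<in> (\<lambda>b. cl0 (b \<circ> shift_H i c)) ` carrier R1"
    by (rule image_eqI[OF _ I_1_closed(3)]) (simp add: BM_simps(2) cl0_zero comp_def)
  fix v assume "v \<in> (\<lambda>b. cl0 (b \<circ> shift_H i c)) ` carrier R1"
  then obtain b where b: "b \<in> carrier R1" "v = cl0 (b \<circ> shift_H i c)" by blast
  show "a \<odot>\<^bsub>BM\<^esub> v \<in> (\<lambda>b. cl0 (b \<circ> shift_H i c)) ` carrier R1" if a: "a \<in> carrier R1" for a
    unfolding b(2) BM_simps(4)[OF a cs[OF b(1)]] comp_assoc[symmetric] by (rule imageI[OF I_1_closed(4)[OF a b(1)]])
  fix w assume "w \<in> (\<lambda>b. cl0 (b \<circ> shift_H i c)) ` carrier R1"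
  then obtain d where d: "d \<in> carrier R1" "w = cl0 (d \<circ> shift_H i c)" by blast
  have "v \<oplus>\<^bsub>BM\<^esub> w = cl0 ((\<lambda>x. b x + d x) \<circ> shift_H i c)"
    unfolding b(2) d(2) BM_simps(3)[OF cs[OF b(1)] cs[OF d(1)]] by (simp add: comp_def)
  then show "v \<oplus>\<^bsub>BM\<^esub> w \<in> (\<lambda>b. cl0 (b \<circ> shift_H i c)) ` carrier R1"
    using imageI[OF I_1_closed(5)[OF b(1) d(1)], of "\<lambda>b. cl0 (b \<circ> shift_H i c)"] by simp
qed

abbreviation "M1 \<equiv> M_1 i c :: (('n, 'k) opr, ('n, 'k) opr set set) module"

definition cl where "cl a = J +>\<^bsub>BM\<^esub> cl0 a"

lemma cl0_BM: "a \<in> carrier R1 \<Longrightarrow> cl0 a \<in> carrier BM"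
  unfolding BM_simps by (rule imageI)

lemma M1_simps:
  "carrier M1 = cl ` carrier R1"
  "a \<in> carrier R1 \<Longrightarrow> b \<in> carrier R1 \<Longrightarrow> cl a \<oplus>\<^bsub>M1\<^esub> cl b = cl (\<lambda>x. a x + b x)"
  "a \<in> carrier R1 \<Longrightarrow> b \<in> carrier R1 \<Longrightarrow> a \<odot>\<^bsub>M1\<^esub> cl b = cl (a \<circ> b)"
proof -
  show "carrier M1 = cl ` carrier R1"
    unfolding M_1_def quotient_module_simps(1) BM_simps(1) image_image cl_def ..
  show "cl a \<oplus>\<^bsub>M1\<^esub> cl b = cl (\<lambda>x. a x + b x)" if "a \<in> carrier R1" "b \<in> carrier R1"
    unfolding M_1_def cl_def quotient_add[OF lm_BM J_sub cl0_BM[OF that(1)] cl0_BM[OF that(2)]] BM_simps(3)[OF that] ..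
  show "a \<odot>\<^bsub>M1\<^esub> cl b = cl (a \<circ> b)" if "a \<in> carrier R1" "b \<in> carrier R1"
    unfolding M_1_def cl_def quotient_smult[OF lm_BM J_sub that(1) cl0_BM[OF that(2)]] BM_simps(4)[OF that] ..
qed

lemma lm_M1: "left_module R1 M1"
  unfolding M_1_def by (rule left_module_quotient[OF lm_BM J_sub])

lemma cl_eq_iff:
  assumes "a \<in> carrier R1" "b \<in> carrier R1"
  shows "cl a = cl b \<longleftrightarrow> (\<exists>d\<in>carrier R1. (\<lambda>x. a x - b x - d (shift_H i c x)) \<in> FF)"
proof -
  have ab: "(\<lambda>x. a x - b x) \<in> carrier R1" by (rule I_1_closed(6)[OF assms])
  have "cl0 (\<lambda>x. a x - b x) \<oplus>\<^bsub>BM\<^esub> cl0 b = cl0 a" unfolding BM_simps(3)[OF ab assms(2)] by simp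
  moreover have "(cl0 (\<lambda>x. a x - b x) \<oplus>\<^bsub>BM\<^esub> cl0 b) \<ominus>\<^bsub>BM\<^esub> cl0 b = cl0 (\<lambda>x. a x - b x)"
    using cl0_BM[OF ab] cl0_BM[OF assms(2)] by (simp only: BM.M.minus_eq BM.M.a_assoc BM.M.r_neg BM.M.r_zero BM.M.a_inv_closed)
  ultimately have "cl0 a \<ominus>\<^bsub>BM\<^esub> cl0 b = cl0 (\<lambda>x. a x - b x)" by (simp only:)
  then have "cl a = cl b \<longleftrightarrow> cl0 (\<lambda>x. a x - b x) \<in> J"
    unfolding cl_def quotient_eq_iff[OF lm_BM J_sub cl0_BM[OF assms(1)] cl0_BM[OF assms(2)]] by (simp only:)
  also have "\<dots> \<longleftrightarrow> (\<exists>d\<in>carrier R1. cl0 (\<lambda>x. a x - b x) = cl0 (d \<circ> shift_H i c))"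
    unfolding J_eq image_iff ..
  also have "\<dots> \<longleftrightarrow> (\<exists>d\<in>carrier R1. (\<lambda>x. a x - b x - d (shift_H i c x)) \<in> FF)"
    unfolding cl0_eq_iff o_apply ..
  finally show ?thesis .
qed

abbreviation "b0 \<equiv> Poly_Mapping.single (\<lambda>_ :: 'n. 0 :: int) (1 :: 'k)"

definition \<phi> where "\<phi> a = \<rho> a b0"

lemma b0_cone: "b0 \<in> carrier (model D \<rho>)" "Poly_Mapping.keys b0 \<subseteq> lattice_cone D"
  by (simp_all add: lattice_cone_def)

lemma model_gens:
  assumes "p \<in> carrier (model D \<rho>)"
  shows "\<rho> (scl d) p = scl d p" "\<rho> (partial_x j) p = m_partial D j p" "\<rho> (int_x j) p = m_int j p"
    "\<rho> (mult_x j) p = m_int j (m_H r j p)"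
  using mdl assms by (simp_all add: is_model_def)

lemma act_R1: "a \<in> carrier R1 \<Longrightarrow> b \<in> carrier R1 \<Longrightarrow> p \<in> carrier (model D \<rho>) \<Longrightarrow> \<rho> (a \<circ> b) p = \<rho> a (\<rho> b p)"
  using ME.act_comp[of a b p] by (simp only: model_simps I_1_le_I_n)

lemma \<phi>_comp: "a \<in> carrier R1 \<Longrightarrow> b \<in> carrier R1 \<Longrightarrow> \<phi> (a \<circ> b) = \<rho> a (\<phi> b)"
  unfolding \<phi>_def by (rule act_R1[OF _ _ b0_cone(1)])

lemma \<phi>_add: "a \<in> carrier R1 \<Longrightarrow> b \<in> carrier R1 \<Longrightarrow> \<phi> (\<lambda>x. a x + b x) = \<phi> a + \<phi> b"
  unfolding \<phi>_def using ME.act_add[OF _ _ b0_cone(1), of a b] by (simp only: model_simps I_1_le_I_n)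

lemma \<phi>_closed: "a \<in> carrier R1 \<Longrightarrow> \<phi> a \<in> carrier (model D \<rho>)"
  unfolding \<phi>_def using ME.act_closed[OF _ b0_cone(1), of a] by (simp only: model_simps(4) I_1_le_I_n)

lemma \<rho>_zero: "a \<in> carrier R1 \<Longrightarrow> \<rho> a 0 = 0"
  using ME.act_zero[of a] by (simp only: model_simps I_1_le_I_n)

lemma m_partial_int: "m_partial D i (m_int i p) = p"
proof (induction p rule: poly_mapping_induct)
  case (single z c)
  have "\<not> (i \<in> D \<and> (z(i := z i + 1)) i \<le> 0)" by simp
  then show ?case unfolding m_single by simp
qed (simp add: lin_add[OF lin_m(1)] lin_add[OF lin_m(2)])

lemma \<phi>_F: "f \<in> FF \<Longrightarrow> \<phi> f = 0"
proof (induction rule: F_induct)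
  case zero
  show ?case unfolding \<phi>_def using ME.act_0[OF b0_cone(1)] by (simp only: model_simps)
next
  case (e d s t)
  have pt: "(partial_x i ^^ t) \<in> carrier R1" "(int_x i ^^ s) \<in> carrier R1" by (intro I_1_closed gens_in_I_1)+
  have e: "(\<lambda>x. scl d (e_op i s t x)) = scl d \<circ> ((int_x i ^^ s) \<circ> (proj_op i \<circ> (partial_x i ^^ t)))"
    by (simp add: fun_eq_iff e_op_eq)
  have "\<phi> (proj_op i \<circ> (partial_x i ^^ t)) = 0"
    unfolding \<phi>_comp[OF gens_in_I_1(5) pt(1)] by (rule model_proj[OF mdl _ \<phi>_closed[OF pt(1)]]) simp
  then show ?case unfolding e
    using \<phi>_comp[OF pt(2) I_1_closed(4)[OF gens_in_I_1(5) pt(1)]] \<rho>_zero[OF pt(2)] \<rho>_zero[OF gens_in_I_1(6), of d]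
      \<phi>_comp[OF gens_in_I_1(6) I_1_closed(4)[OF pt(2) I_1_closed(4)[OF gens_in_I_1(5) pt(1)]], of d] by (simp only:)
next
  case (add f g)
  then show ?case using \<phi>_add[OF F_in_I_1[OF add.hyps(1)] F_in_I_1[OF add.hyps(2)]] by simp
qed

lemma \<phi>_shift: "\<phi> (shift_H i c) = 0"
proof -
  have m: "m_int i (m_H r i b0) = Poly_Mapping.single ((\<lambda>_. 0)(i := 1)) c"
    unfolding m_single fun_upd_same by simp
  have "\<phi> (mult_x i) = m_int i (m_H r i b0)" unfolding \<phi>_def by (rule model_gens(4)[OF b0_cone(1)])
  then have "\<phi> (H_op i) = m_partial D i (m_int i (m_H r i b0))"
    unfolding H_op_def \<phi>_comp[OF gens_in_I_1(2,1)] using model_gens(2)[OF \<phi>_closed[OF gens_in_I_1(1)], of i] by simp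
  also have "\<dots> = m_H r i b0" by (rule m_partial_int)
  also have "\<dots> = scl c b0" unfolding m_single fun_upd_same by simp
  finally have H: "\<phi> (H_op i) = \<phi> (scl c)" unfolding \<phi>_def model_gens(1)[OF b0_cone(1)] .
  have "(\<lambda>x. shift_H i c x + scl c x) = (H_op i :: ('n, 'k) opr)" by (simp add: fun_eq_iff shift_H_def)
  then have "\<phi> (shift_H i c) + \<phi> (scl c) = \<phi> (H_op i)"
    using \<phi>_add[OF shift_H_in_I_1[of i c] gens_in_I_1(6)[of c i]] by (simp only:)
  then show ?thesis unfolding H by simp
qed

lemma \<phi>_cong:
  assumes "a \<in> carrier R1" "b \<in> carrier R1" "cl a = cl b"
  shows "\<phi> a = \<phi> b"
proof -
  obtain d where d: "d \<in> carrier R1" "(\<lambda>x. a x - b x - d (shift_H i c x)) \<in> FF"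
    using assms(3) cl_eq_iff[OF assms(1,2)] by blast
  have ds: "d \<circ> shift_H i c \<in> carrier R1" by (rule I_1_closed(4)[OF d(1) shift_H_in_I_1])
  have "a = (\<lambda>x. (\<lambda>x. a x - b x - d (shift_H i c x)) x + (\<lambda>x. (d \<circ> shift_H i c) x + b x) x)"
    by (simp add: fun_eq_iff)
  then have "\<phi> a = \<phi> (\<lambda>x. a x - b x - d (shift_H i c x)) + (\<phi> (d \<circ> shift_H i c) + \<phi> b)"
    using \<phi>_add[OF F_in_I_1[OF d(2)] I_1_closed(5)[OF ds assms(2)]] \<phi>_add[OF ds assms(2)] by (simp only:)
  also have "\<dots> = \<phi> b"
    unfolding \<phi>_F[OF d(2)] \<phi>_comp[OF d(1) shift_H_in_I_1] \<phi>_shift \<rho>_zero[OF d(1)] by simp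
  finally show ?thesis .
qed

text \<open>The normal forms for classes in \<open>M(1,c)\<close>: combinations of powers of the
  derivative and of the integration, with nothing containing \<open>H\<close> left.\<close>

definition lc :: "(int \<Rightarrow>\<^sub>0 'k) \<Rightarrow> ('n, 'k) opr" where "lc q x = lext (\<lambda>k. op_s i k x) q"

lemma lc_add: "lc (p + q) = (\<lambda>x. lc p x + lc q x)"
  and lc_single: "lc (Poly_Mapping.single k d) = scl d \<circ> op_s i k"
  by (simp_all add: fun_eq_iff lc_def lin_add[OF lin_lext])

lemma lc_in: "lc q \<in> carrier R1"
proof (induction q rule: poly_mapping_induct)
  case (single k d)
  show ?case unfolding lc_single by (rule I_1_closed(4)[OF gens_in_I_1(6) op_s_in_I_1])
next
  case (add p q)
  show ?case unfolding lc_add by (rule I_1_closed(5)[OF add])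
qed

lemma \<phi>_op_s: "\<phi> (op_s i k) = Poly_Mapping.single ((\<lambda>_. 0)(i := k)) 1"
proof -
  have p: "\<phi> (op_s i (- int m)) = Poly_Mapping.single ((\<lambda>_. 0)(i := - int m)) 1" for m
  proof (induction m)
    case 0
    have "(\<lambda>_ :: 'n. 0 :: int)(i := - int 0) = (\<lambda>_. 0)" by (simp add: fun_eq_iff)
    moreover have "\<phi> (op_s i (- int 0)) = b0"
      unfolding \<phi>_def of_nat_0 minus_zero op_s_zero using ME.act_id[OF b0_cone(1)] by (simp only: model_simps)
    ultimately show ?case by (simp only:)
  next
    case (Suc m)
    have "op_s i (- int (Suc m)) = (partial_x i \<circ> op_s i (- int m) :: ('n, 'k) opr)"
      unfolding partial_op_s by (rule arg_cong[where f="op_s i"]) simp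
    then have "\<phi> (op_s i (- int (Suc m))) = m_partial D i (\<phi> (op_s i (- int m)))"
      using \<phi>_comp[OF gens_in_I_1(2) op_s_in_I_1, of "- int m"] model_gens(2)[OF \<phi>_closed[OF op_s_in_I_1], of i "- int m"] by simp
    moreover have "((\<lambda>_ :: 'n. 0 :: int)(i := - int m))(i := ((\<lambda>_. 0)(i := - int m)) i - 1) = (\<lambda>_. 0)(i := - int (Suc m))"
      by (simp add: fun_eq_iff)
    moreover have "\<not> (i \<in> D \<and> ((\<lambda>_ :: 'n. 0 :: int)(i := - int m)) i \<le> 0)" by simp
    ultimately show ?case unfolding Suc m_single by (simp only: if_False)
  qed
  have q: "\<phi> (op_s i (int m)) = Poly_Mapping.single ((\<lambda>_. 0)(i := int m)) 1" for m
  proof (induction m)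
    case 0
    show ?case using p[of 0] unfolding of_nat_0 minus_zero .
  next
    case (Suc m)
    have "op_s i (int (Suc m)) = (int_x i \<circ> op_s i (int m) :: ('n, 'k) opr)"
      unfolding of_nat_Suc add.commute[of 1] by (rule int_op_s[symmetric]) simp
    then have "\<phi> (op_s i (int (Suc m))) = m_int i (\<phi> (op_s i (int m)))"
      using \<phi>_comp[OF gens_in_I_1(3) op_s_in_I_1, of "int m"] model_gens(3)[OF \<phi>_closed[OF op_s_in_I_1], of i "int m"] by simp
    moreover have "((\<lambda>_ :: 'n. 0 :: int)(i := int m))(i := ((\<lambda>_. 0)(i := int m)) i + 1) = (\<lambda>_. 0)(i := int (Suc m))"
      by (simp add: fun_eq_iff)
    ultimately show ?case unfolding Suc m_single by (simp only:)
  qed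
  show ?thesis using p[of "nat (- k)"] q[of "nat k"] by (cases "k \<ge> 0") simp_all
qed

lemma \<phi>_lc: "\<phi> (lc q) = axis i q"
proof (induction q rule: poly_mapping_induct)
  case (single k d)
  show ?case unfolding lc_single \<phi>_comp[OF gens_in_I_1(6) op_s_in_I_1] \<phi>_op_s axis_single
    by (subst model_gens(1)) (simp_all add: lattice_cone_def)
next
  case (add p q)
  then show ?case unfolding lc_add \<phi>_add[OF lc_in lc_in] lin_add[OF lin_axis] by simp
qed

lemma cl_eqI_F: "a \<in> carrier R1 \<Longrightarrow> b \<in> carrier R1 \<Longrightarrow> (\<lambda>x. a x - b x) \<in> FF \<Longrightarrow> cl a = cl b"
  unfolding cl_def using cl0_eq_iff[THEN iffD2] by (simp only:)

lemma cl_eqI_H: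
  assumes "a \<in> carrier R1" "b \<in> carrier R1" "d \<in> carrier R1" "\<And>x. a x = b x + d (shift_H i c x)"
  shows "cl a = cl b"
proof -
  have "(\<lambda>x. a x - b x - d (shift_H i c x)) = (\<lambda>x. 0)" using assms(4) by (simp add: fun_eq_iff)
  then have "(\<lambda>x. a x - b x - d (shift_H i c x)) \<in> FF" by (simp only: F_zero)
  then show ?thesis using cl_eq_iff[OF assms(1,2)] assms(3) by blast
qed

lemma cl_add_comp:
  assumes "a \<in> carrier R1" "cl (a \<circ> lc p) = cl (lc p')" "cl (a \<circ> lc q) = cl (lc q')"
  shows "cl (a \<circ> lc (p + q)) = cl (lc (p' + q'))"
proof -
  have "a \<circ> lc (p + q) = (\<lambda>x. (a \<circ> lc p) x + (a \<circ> lc q) x)"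
    unfolding lc_add using lin_add[OF lin_I_1[OF assms(1)]] by (simp add: fun_eq_iff)
  then have "cl (a \<circ> lc (p + q)) = cl (a \<circ> lc p) \<oplus>\<^bsub>M1\<^esub> cl (a \<circ> lc q)"
    using M1_simps(2)[OF I_1_closed(4)[OF assms(1) lc_in] I_1_closed(4)[OF assms(1) lc_in]] by (simp only:)
  also have "\<dots> = cl (lc (p' + q'))" unfolding assms(2,3) lc_add by (rule M1_simps(2)[OF lc_in lc_in])
  finally show ?thesis .
qed

lemma cl_partial: "cl (partial_x i \<circ> lc q) = cl (lc (d1 False q))"
proof (induction q rule: poly_mapping_induct)
  case (single k d)
  have "partial_x i \<circ> (scl d \<circ> op_s i k) = (scl d \<circ> (partial_x i \<circ> op_s i k) :: ('n, 'k) opr)"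
    by (simp add: fun_eq_iff)
  then have "partial_x i \<circ> lc (Poly_Mapping.single k d) = lc (d1 False (Poly_Mapping.single k d))"
    unfolding lc_single single_1 simp_thms if_False by (simp only: partial_op_s)
  then show ?case by (simp only:)
next
  case (add p q)
  show ?case unfolding lin_add[OF lin_1(1)] by (rule cl_add_comp[OF gens_in_I_1(2) add])
qed

lemma cl_int: "cl (int_x i \<circ> lc q) = cl (lc (i1 q))"
proof (induction q rule: poly_mapping_induct)
  case (single k d)
  have in1: "int_x i \<circ> lc (Poly_Mapping.single k d) \<in> carrier R1" by (rule I_1_closed(4)[OF gens_in_I_1(3) lc_in])
  show ?case
  proof (cases "k \<ge> 0")
    case True
    have "int_x i \<circ> (scl d \<circ> op_s i k) = (scl d \<circ> (int_x i \<circ> op_s i k) :: ('n, 'k) opr)"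
      by (simp add: fun_eq_iff)
    then have "int_x i \<circ> lc (Poly_Mapping.single k d) = lc (i1 (Poly_Mapping.single k d))"
      unfolding lc_single single_1 by (simp only: int_op_s[OF True])
    then show ?thesis by (simp only:)
  next
    case False
    have o: "op_s i k x = partial_x i (op_s i (k + 1) x)" for x :: "('n, 'k) pol"
      using op_s_neg[of i k] by (metis o_apply)
    \<comment> \<open>For negative \<open>k\<close> the integration does not literally cancel a
      derivative. The error is a multiple of \<open>1 - \<integral> \<partial>\<close>, which is
      zero modulo F.\<close>
    have "(\<lambda>x. (int_x i \<circ> lc (Poly_Mapping.single k d)) x - lc (i1 (Poly_Mapping.single k d)) x) =
        (\<lambda>x. scl (- d) (e_op i 0 0 x)) \<circ> op_s i (k + 1)"
      unfolding lc_single single_1 e_op_eq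
      by (simp add: fun_eq_iff o proj_op_def scl.scale_right_diff_distrib scl.scale_minus_left)
    also have "\<dots> \<in> FF" by (rule F_right[OF op_s_in_I_1 F_e])
    finally show ?thesis by (rule cl_eqI_F[OF in1 lc_in])
  qed
next
  case (add p q)
  show ?case unfolding lin_add[OF lin_1(2)] by (rule cl_add_comp[OF gens_in_I_1(3) add])
qed

lemma cl_H: "cl (H_op i \<circ> lc q) = cl (lc (h1 c q))"
proof (induction q rule: poly_mapping_induct)
  case (single k d)
  have sh: "shift_H i (c + of_int k) (op_s i k x) = op_s i k (shift_H i c x)" for x
    using shift_H_op_s[of i c k] by (metis o_apply)
  show ?case
  \<comment> \<open>Passing \<open>H\<close> through \<open>op_s i k\<close> leaves the scalar
    \<open>c + k\<close> and the remainder \<open>op_s i k\<close> composed with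
    \<open>H - c\<close>, which lies in the left ideal that is factored out.\<close>
  proof (rule cl_eqI_H[where d="scl d \<circ> op_s i k"])
    fix x
    have "H_op i (op_s i k x) = op_s i k (shift_H i c x) + scl (c + of_int k) (op_s i k x)"
      using sh[of x] by (simp add: shift_H_def algebra_simps)
    then show "(H_op i \<circ> lc (Poly_Mapping.single k d)) x = lc (h1 c (Poly_Mapping.single k d)) x + (scl d \<circ> op_s i k) (shift_H i c x)"
      unfolding lc_single single_1 o_apply gen_scl
      by (simp only: scl.scale_right_distrib scl.scale_scale add.commute)
  qed (intro I_1_closed gens_in_I_1 lc_in op_s_in_I_1)+
next
  case (add p q)
  show ?case unfolding lin_add[OF lin_1(3)] by (rule cl_add_comp[OF gens_in_I_1(4) add])
qed

text \<open>The classes of the normal forms are stable under the generators, hence under the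
  algebra. As they include the class of 1, they are everything.\<close>

lemma cl_surj:
  assumes "a \<in> carrier R1"
  shows "\<exists>q'. cl (a \<circ> lc q) = cl (lc q')"
  using assms
proof (induction a arbitrary: q rule: I_1_induct)
  case (scl d)
  have "scl d \<circ> lc q = lc (scl d q)" by (simp add: fun_eq_iff lc_def lin_scl[OF lin_lext])
  then show ?case by metis
next
  case mult_x
  have m: "mult_x i = (int_x i \<circ> H_op i :: ('n, 'k) opr)" by (simp add: fun_eq_iff mult_x_eq)
  have "cl (mult_x i \<circ> lc q) = int_x i \<odot>\<^bsub>M1\<^esub> cl (H_op i \<circ> lc q)"
    unfolding m comp_assoc using M1_simps(3)[OF gens_in_I_1(3) I_1_closed(4)[OF gens_in_I_1(4) lc_in]] by simp
  also have "\<dots> = cl (lc (i1 (h1 c q)))"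
    unfolding cl_H M1_simps(3)[OF gens_in_I_1(3) lc_in] cl_int ..
  finally show ?case by blast
next
  case partial_x
  show ?case using cl_partial by blast
next
  case int_x
  show ?case using cl_int by blast
next
  case (comp a b)
  obtain q' where q': "cl (b \<circ> lc q) = cl (lc q')" using comp.IH(2) by blast
  have "cl ((a \<circ> b) \<circ> lc q) = a \<odot>\<^bsub>M1\<^esub> cl (b \<circ> lc q)"
    unfolding comp_assoc M1_simps(3)[OF comp.hyps(1) I_1_closed(4)[OF comp.hyps(2) lc_in]] ..
  also have "\<dots> = cl (a \<circ> lc q')" unfolding q' by (rule M1_simps(3)[OF comp.hyps(1) lc_in])
  finally show ?case using comp.IH(1)[of q'] by metis
next
  case (add a b)
  obtain q1 q2 where q: "cl (a \<circ> lc q) = cl (lc q1)" "cl (b \<circ> lc q) = cl (lc q2)" using add.IH by metis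
  have "(\<lambda>p. a p + b p) \<circ> lc q = (\<lambda>x. (a \<circ> lc q) x + (b \<circ> lc q) x)" by (simp add: fun_eq_iff)
  then have "cl ((\<lambda>p. a p + b p) \<circ> lc q) = cl (a \<circ> lc q) \<oplus>\<^bsub>M1\<^esub> cl (b \<circ> lc q)"
    using M1_simps(2)[OF I_1_closed(4)[OF add.hyps(1) lc_in] I_1_closed(4)[OF add.hyps(2) lc_in]] by (simp only:)
  also have "\<dots> = cl (lc (q1 + q2))" unfolding q lc_add by (rule M1_simps(2)[OF lc_in lc_in])
  finally show ?case by blast
qed

lemma cl_surj_id: "a \<in> carrier R1 \<Longrightarrow> \<exists>q. cl a = cl (lc q)"
proof -
  assume a: "a \<in> carrier R1"
  have "lc (Poly_Mapping.single 0 1) = id" unfolding lc_single op_s_zero by (simp add: fun_eq_iff)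
  then have "a \<circ> lc (Poly_Mapping.single 0 1) = a" by (simp only: comp_id)
  then show ?thesis using cl_surj[OF a, of "Poly_Mapping.single 0 1"] by (simp only:)
qed

text \<open>A representative is chosen; by \<open>\<phi>_cong\<close> the value depends only on the
  class.\<close>

definition \<kappa> where "\<kappa> C = res i (\<phi> (SOME a. a \<in> carrier R1 \<and> cl a = C))"

lemma \<kappa>_cl: "a \<in> carrier R1 \<Longrightarrow> \<kappa> (cl a) = res i (\<phi> a)"
proof -
  assume a: "a \<in> carrier R1"
  define b where "b = (SOME b. b \<in> carrier R1 \<and> cl b = cl a)"
  have "b \<in> carrier R1 \<and> cl b = cl a" unfolding b_def by (rule someI[of _ a]) (simp add: a)
  then have "\<phi> b = \<phi> a" using \<phi>_cong a by blast
  then show ?thesis unfolding \<kappa>_def b_def[symmetric] by simp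
qed

text \<open>The inverse sends \<open>q\<close> to \<open>cl (lc q)\<close>: \<open>\<phi>_lc\<close>
  shows that normal forms are independent, \<open>cl_surj_id\<close> that they exhaust the
  module.\<close>

lemma coords_M_1: "coords i False c \<kappa> M1"
  unfolding coords_def
proof (intro conjI ballI allI)
  show "left_module (I_1 i) M1" by (rule lm_M1)
  have k: "\<kappa> (cl (lc q)) = q" for q unfolding \<kappa>_cl[OF lc_in] \<phi>_lc res_axis ..
  show "bij_betw \<kappa> (carrier M1) {p. Poly_Mapping.keys p \<subseteq> (if False then {0..} else UNIV)}"
  proof (rule bij_betw_byWitness[where f'="\<lambda>q. cl (lc q)"])
    show "\<forall>C\<in>carrier M1. cl (lc (\<kappa> C)) = C"
      unfolding M1_simps(1) ball_simps
    proof
      fix a assume "a \<in> carrier R1"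
      then obtain q where "cl a = cl (lc q)" using cl_surj_id by blast
      then show "cl (lc (\<kappa> (cl a))) = cl a" by (simp only: k)
    qed
    show "(\<lambda>q. cl (lc q)) ` {p. Poly_Mapping.keys p \<subseteq> (if False then {0..} else UNIV)} \<subseteq> carrier M1"
      unfolding M1_simps(1) by (intro image_subsetI imageI lc_in)
  qed (simp_all add: k)
  fix u assume "u \<in> carrier M1"
  then obtain a where a: "a \<in> carrier R1" "u = cl a" unfolding M1_simps(1) by blast
  have g: "\<kappa> (b \<odot>\<^bsub>M1\<^esub> u) = res i (\<rho> b (\<phi> a))" if "b \<in> carrier R1" for b
    unfolding a(2) M1_simps(3)[OF that a(1)] \<kappa>_cl[OF I_1_closed(4)[OF that a(1)]] \<phi>_comp[OF that a(1)] ..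
  have u: "\<kappa> u = res i (\<phi> a)" unfolding a(2) by (rule \<kappa>_cl[OF a(1)])
  have iD: "(i \<in> D) = False" by simp
  note mg = model_gens[OF \<phi>_closed[OF a(1)]]
  show "\<kappa> (scl d \<odot>\<^bsub>M1\<^esub> u) = scl d (\<kappa> u)" for d
    unfolding g[OF gens_in_I_1(6)] mg u by (rule lin_scl[OF lin_res])
  show "\<kappa> (partial_x i \<odot>\<^bsub>M1\<^esub> u) = d1 False (\<kappa> u)"
    unfolding g[OF gens_in_I_1(2)] mg u res_m iD ..
  show "\<kappa> (int_x i \<odot>\<^bsub>M1\<^esub> u) = i1 (\<kappa> u)"
    unfolding g[OF gens_in_I_1(3)] mg u res_m ..
  show "\<kappa> (mult_x i \<odot>\<^bsub>M1\<^esub> u) = i1 (h1 c (\<kappa> u))"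
    unfolding g[OF gens_in_I_1(1)] mg u res_m fun_upd_same ..
  fix v assume "v \<in> carrier M1"
  then obtain b where b: "b \<in> carrier R1" "v = cl b" unfolding M1_simps(1) by blast
  show "\<kappa> (u \<oplus>\<^bsub>M1\<^esub> v) = \<kappa> u + \<kappa> v"
    unfolding a(2) b(2) M1_simps(2)[OF a(1) b(1)] \<kappa>_cl[OF I_1_closed(5)[OF a(1) b(1)]] \<kappa>_cl[OF a(1)] \<kappa>_cl[OF b(1)] \<phi>_add[OF a(1) b(1)]
    by (rule lin_add[OF lin_res])
qed

end

lemma coords_M_1_exists: "\<exists>\<kappa>. coords i False c \<kappa> (M_1 i c)"
proof -
  obtain \<rho> where "is_model (UNIV - {i}) ((\<lambda>_. 1)(i := c)) \<rho>"
    using model_exists[of "UNIV - {i}" "(\<lambda>_. 1)(i := c)"] by auto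
  then interpret M1_context i c \<rho> by unfold_locales
  show ?thesis using coords_M_1 by blast
qed

text \<open>Each factor has coordinates, from \<open>K[x\<^sub>i]\<close> with base 1 for
  \<open>i \<in> D\<close> and from \<open>M(1,c)\<close> with base \<open>c\<close> otherwise;
  injective copying into the sum type preserves them.\<close>

theorem M_D_isomorphic:
  fixes \<O> :: "('n::finite \<Rightarrow> 'k::field_char_0) set"
  assumes mdl: "is_model D (\<lambda>i. if i \<in> D then 1 else rep (orbit_component \<O> i)) \<rho>"
  shows "module_isomorphic I_n (model D \<rho>) (M_D rep \<O> D)"
proof -
  let ?r = "\<lambda>i. if i \<in> D then 1 else rep (orbit_component \<O> i)"
  have "\<forall>i. \<exists>\<kappa>. coords i (i \<in> D) (?r i) \<kappa> (tensor_factor rep \<O> D i)"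
  proof
    fix i
    show "\<exists>\<kappa>. coords i (i \<in> D) (?r i) \<kappa> (tensor_factor rep \<O> D i)"
    proof (cases "i \<in> D")
      case True
      then show ?thesis unfolding tensor_factor_def using coords_copy[OF coords_K_x[of i] inj_Inl] by auto
    next
      case False
      obtain \<kappa> where "coords i False (rep (orbit_component \<O> i)) \<kappa> (M_1 i (rep (orbit_component \<O> i)))"
        using coords_M_1_exists by blast
      from coords_copy[OF this inj_Inr] show ?thesis unfolding tensor_factor_def using False by auto
    qed
  qed
  then obtain \<kappa> where \<kappa>: "\<And>i. coords i (i \<in> D) (?r i) (\<kappa> i) (tensor_factor rep \<O> D i)" by metis
  interpret tensor_coords "tensor_factor rep \<O> D" \<kappa> D ?r \<rho>
    by (rule tensor_coords.intro[OF mdl]) (use \<kappa> in \<open>simp_all add: coords_def\<close>)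
  show ?thesis unfolding M_D_def by (rule tensor_module_isomorphic)
qed

section \<open>The block decomposition\<close>

lemma quotient_hom:
  assumes "left_module R M" "submodule L R M"
  shows "(\<lambda>v. L +>\<^bsub>M\<^esub> v) \<in> module_hom_set R M (quotient_module M L)"
  using quotient_add[OF assms] quotient_smult[OF assms]
  by (simp add: module_hom_set_def quotient_module_simps(1))

lemma d_nilpotent_F_killed_hom:
  assumes "left_module I_n M" "left_module I_n N" "f \<in> module_hom_set I_n M N" "v \<in> carrier M"
  shows "d_nilpotent M i v \<Longrightarrow> d_nilpotent N i (f v)" "F_killed M i v \<Longrightarrow> F_killed N i (f v)"
proof -
  note h = module_hom_setD(3)[OF assms(3) _ assms(4)]
  note z = module_hom_zero[OF assms(1-3)]
  have pw: "partial_x i ^^ k \<in> carrier I_n" for k by simp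
  show "d_nilpotent N i (f v)" if "d_nilpotent M i v" using that h[OF pw] z unfolding d_nilpotent_def by metis
  show "F_killed N i (f v)" if "F_killed M i v"
    using that h[OF proj_partial_in_I_n] z unfolding F_killed_def by metis
qed

lemma orbit_component_eq:
  assumes "\<O> = {\<mu>. \<exists>z :: 'n \<Rightarrow> int. \<forall>i. \<mu> i = \<nu> i + of_int (z i)}"
  shows "orbit_component \<O> i = range (\<lambda>k :: int. \<nu> i + of_int k)"
proof
  show "orbit_component \<O> i \<subseteq> range (\<lambda>k :: int. \<nu> i + of_int k)"
    unfolding orbit_component_def assms by auto
  show "range (\<lambda>k :: int. \<nu> i + of_int k) \<subseteq> orbit_component \<O> i"
  proof (rule image_subsetI)
    fix k :: int
    have "(\<lambda>j. \<nu> j + of_int k) \<in> \<O>" unfolding assms by (rule CollectI, rule exI[of _ "\<lambda>_. k"]) simp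
    then show "\<nu> i + of_int k \<in> orbit_component \<O> i"
      unfolding orbit_component_def by (rule image_eqI[rotated]) simp
  qed
qed

lemma orbit_component_diff:
  fixes \<O> :: "('n::finite \<Rightarrow> 'k::field_char_0) set"
  assumes "\<O> \<in> translation_orbits" "c \<in> orbit_component \<O> i" "d \<in> orbit_component \<O> i"
  shows "c - d \<in> \<int>"
proof -
  obtain \<nu> where "\<O> = {\<mu>. \<exists>z :: 'n \<Rightarrow> int. \<forall>i. \<mu> i = \<nu> i + of_int (z i)}"
    using assms(1) unfolding translation_orbits_def by blast
  from assms(2,3)[unfolded orbit_component_eq[OF this]] obtain k l :: int where "c = \<nu> i + of_int k" "d = \<nu> i + of_int l"
    by blast
  then have "c - d = of_int (k - l)" by simp
  then show ?thesis by (simp only: Ints_of_int)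
qed

text \<open>One integral value in coordinate \<open>i\<close> would make the whole component equal
  to the set of integers.\<close>

lemma orbit_nonintegral:
  fixes \<O> :: "('n::finite \<Rightarrow> 'k::field_char_0) set"
  assumes O: "\<O> \<in> translation_orbits" and i: "i \<notin> integral_indices \<O>" and \<mu>: "\<mu> \<in> \<O>"
  shows "\<mu> i \<notin> \<int>"
proof
  assume m: "\<mu> i \<in> \<int>"
  obtain \<nu> where \<nu>: "\<O> = {\<mu>. \<exists>z :: 'n \<Rightarrow> int. \<forall>i. \<mu> i = \<nu> i + of_int (z i)}"
    using O unfolding translation_orbits_def by blast
  obtain z where "\<mu> i = \<nu> i + of_int z" using \<mu> unfolding \<nu> by blast
  then have "\<nu> i = \<mu> i - of_int z" by simp
  then have "\<nu> i \<in> \<int>" using m by simp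
  then obtain l :: int where l: "\<nu> i = of_int l" by (rule Ints_cases)
  have "orbit_component \<O> i = \<int>"
    unfolding orbit_component_eq[OF \<nu>] l
  proof
    show "range (\<lambda>k. of_int l + of_int k :: 'k) \<subseteq> \<int>" by auto
    show "\<int> \<subseteq> range (\<lambda>k. of_int l + of_int k :: 'k)"
    proof
      fix c :: 'k assume "c \<in> \<int>"
      then obtain k :: int where "c = of_int k" by (rule Ints_cases)
      then have "c = of_int l + of_int (k - l)" by simp
      then show "c \<in> range (\<lambda>k. of_int l + of_int k :: 'k)" by (rule image_eqI) simp
    qed
  qed
  then show False using i unfolding integral_indices_def by simp
qed

text \<open>The orbit representative enters only for \<open>i \<notin> D\<close>. For
  \<open>i \<in> D\<close> the value is the eigenvalue 1 of \<open>H\<^sub>i\<close> on the constant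
  polynomial 1, not the representative 0 of the integers.\<close>

abbreviation "base rep \<O> D \<equiv> (\<lambda>i. if i \<in> D then 1 else rep (orbit_component \<O> i))"

text \<open>A simple subquotient of the summand is again typed, hence isomorphic to the explicit
  module, which is \<open>M(D)\<close>.\<close>

lemma GW_D_part_sub_carrier:
  fixes \<O> :: "('n::finite \<Rightarrow> 'k::field_char_0) set" and M :: "(('n, 'k) opr, 'm) module"
  assumes O: "\<O> \<in> translation_orbits" and rep: "\<And>i. rep (orbit_component \<O> i) \<in> orbit_component \<O> i"
    and GW: "GW \<O> M" and mdl: "is_model D (base rep \<O> D) \<rho>"
  shows "GW_D rep \<O> D (M\<lparr>carrier := part_sub M UNIV D\<rparr>)"
  unfolding GW_D_def
proof (intro conjI allI impI)
  let ?P = "M\<lparr>carrier := part_sub M UNIV D\<rparr>"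
  have lm: "left_module I_n M" using GW unfolding GW_def by blast
  interpret In_module M by (rule In_module.intro[OF lm])
  show "GW \<O> ?P" by (rule GW_submodule[OF GW submodule_part_sub])
  fix N L assume N: "submodule N I_n ?P" and L: "submodule L I_n ?P" "L \<subseteq> N"
    and simple: "simple_left_module I_n (quotient_module (?P\<lparr>carrier := N\<rparr>) L)"
  have lP: "left_module I_n ?P" by (rule left_module_submodule[OF lm submodule_part_sub])
  have T: "typed_module (orbit_component \<O>) D (quotient_module (?P\<lparr>carrier := N\<rparr>) L)"
    by (rule typed_module_quotient[OF typed_module_submodule[OF typed_part_sub[OF GW] N] submodule_of_submodule[OF lP N L]])
  have "module_isomorphic I_n (model D \<rho>) (quotient_module (?P\<lparr>carrier := N\<rparr>) L)"
    by (rule simple_typed_isomorphic[OF simple T _ _ mdl]) (use orbit_component_diff[OF O _ rep] in simp_all)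
  moreover have "left_module I_n (model D \<rho>)" using mdl by (simp add: is_model_def)
  ultimately show "module_isomorphic I_n (quotient_module (?P\<lparr>carrier := N\<rparr>) L) (M_D rep \<O> D)"
    using module_isomorphic_trans[OF module_isomorphic_sym M_D_isomorphic[OF mdl]] by blast
qed

text \<open>A nonzero \<open>u\<close> generates a submodule with a simple subquotient, hence isomorphic to \<open>M_D\<close>,
  on which \<open>\<partial>\<^sub>i\<close> is locally d_nilpotentotent exactly for \<open>i \<in> D\<close>.\<close>

lemma GW_D_zero:
  fixes \<O> :: "('n::finite \<Rightarrow> 'k::field_char_0) set" and M :: "(('n, 'k) opr, 'm) module"
  assumes M: "GW_D rep \<O> D M" and mdl: "is_model D (base rep \<O> D) \<rho>" and u: "u \<in> carrier M"
    and i: "i \<in> D \<and> F_killed M i u \<or> i \<notin> D \<and> d_nilpotent M i u"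
  shows "u = \<zero>\<^bsub>M\<^esub>"
proof (rule ccontr)
  assume u0: "u \<noteq> \<zero>\<^bsub>M\<^esub>"
  have lm: "left_module I_n M" using M unfolding GW_D_def GW_def by blast
  interpret In_module M by (rule In_module.intro[OF lm])
  obtain N L where N: "submodule N I_n M" and L: "submodule L I_n M" "L \<subseteq> N"
    and Nu: "N = (\<lambda>a. a \<odot>\<^bsub>M\<^esub> u) ` carrier I_n"
    and simple: "simple_left_module I_n (quotient_module (M\<lparr>carrier := N\<rparr>) L)"
    by (rule simple_subquotient_exists[OF lm u u0])
  let ?Y = "M\<lparr>carrier := N\<rparr>"
  let ?Q = "quotient_module ?Y L"
  have lY: "left_module I_n ?Y" by (rule left_module_submodule[OF lm N])
  have LY: "submodule L I_n ?Y" by (rule submodule_of_submodule[OF lm N L])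
  have lQ: "left_module I_n ?Q" by (rule left_module_quotient[OF lY LY])
  interpret Q: In_module ?Q by (rule In_module.intro[OF lQ])
  have lD: "left_module I_n (model D \<rho>)" using mdl by (simp add: is_model_def)
  interpret MD: In_module "model D \<rho>" by (rule In_module.intro[OF lD])
  have "module_isomorphic I_n ?Q (M_D rep \<O> D)" using M N L simple unfolding GW_D_def by blast
  from module_isomorphic_sym[OF lQ this]
  have "module_isomorphic I_n (model D \<rho>) ?Q" by (rule module_isomorphic_trans[OF M_D_isomorphic[OF mdl]])
  then obtain f where f: "f \<in> module_hom_set I_n (model D \<rho>) ?Q" "bij_betw f (carrier (model D \<rho>)) (carrier ?Q)"
    unfolding module_isomorphic_def by blast
  let ?b = "Poly_Mapping.single (\<lambda>_ :: 'n. 0 :: int) (1 :: 'k)"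
  have b: "?b \<in> carrier (model D \<rho>)" by (simp add: lattice_cone_def)
  have fb: "f ?b \<in> carrier ?Q" by (rule module_hom_setD(1)[OF f(1) b])
  have fb0: "f ?b \<noteq> \<zero>\<^bsub>?Q\<^esub>"
  proof
    assume "f ?b = \<zero>\<^bsub>?Q\<^esub>"
    also have "\<dots> = f \<zero>\<^bsub>model D \<rho>\<^esub>" by (rule module_hom_zero[OF lD lQ f(1), symmetric])
    finally have "?b = \<zero>\<^bsub>model D \<rho>\<^esub>"
      by (rule inj_onD[OF bij_betw_imp_inj_on[OF f(2)] _ b MD.M.zero_closed])
    then have "Poly_Mapping.lookup ?b (\<lambda>_. 0) = 0" by simp
    then show False by simp
  qed
  from fb obtain w where w: "w \<in> N" "f ?b = L +>\<^bsub>?Y\<^esub> w" unfolding quotient_module_simps(1) by auto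
  obtain a where a: "a \<in> carrier I_n" "w = a \<odot>\<^bsub>M\<^esub> u" using w(1) unfolding Nu by blast
  have wY: "w \<in> carrier ?Y" using w(1) by simp
  \<comment> \<open>The class of \<open>w\<close> inherits one property from \<open>u\<close>, of
    which \<open>w\<close> is a multiple. The other property holds for the basis vector of index 0
    in the model and is carried over by \<open>f\<close>. Together they force the class to
    vanish.\<close>
  have "d_nilpotent ?Q i (f ?b) \<and> F_killed ?Q i (f ?b)"
  proof (cases "i \<in> D")
    case True
    then have "F_killed M i w" using i F_killed_act[OF a(1) _ u] unfolding a(2) by blast
    then have "F_killed ?Y i w" by (simp add: F_killed_def)
    then have "F_killed ?Q i (f ?b)" unfolding w(2) by (rule d_nilpotent_F_killed_hom(2)[OF lY lQ quotient_hom[OF lY LY] wY])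
    moreover have "\<rho> (partial_x i) ?b = 0"
      using mdl b True by (simp add: is_model_def m_single)
    then have "d_nilpotent (model D \<rho>) i ?b" unfolding d_nilpotent_def by (intro exI[of _ 1]) simp
    then have "d_nilpotent ?Q i (f ?b)" by (rule d_nilpotent_F_killed_hom(1)[OF lD lQ f(1) b])
    ultimately show ?thesis by blast
  next
    case False
    then have "d_nilpotent M i w" using i d_nilpotent_act[OF a(1) _ u] unfolding a(2) by blast
    then have "d_nilpotent ?Y i w" by (simp add: d_nilpotent_def)
    then have "d_nilpotent ?Q i (f ?b)" unfolding w(2) by (rule d_nilpotent_F_killed_hom(1)[OF lY lQ quotient_hom[OF lY LY] wY])
    moreover have "F_killed (model D \<rho>) i ?b"
      unfolding F_killed_def
    proof
      fix t
      have pw: "partial_x i ^^ t \<in> carrier (I_n :: ('n, 'k) opr ring)" by simp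
      show "(proj_op i \<circ> (partial_x i ^^ t)) \<odot>\<^bsub>model D \<rho>\<^esub> ?b = \<zero>\<^bsub>model D \<rho>\<^esub>"
        using MD.act_comp[OF gens_in_I_n(5) pw b, of i] model_proj[OF mdl False MD.act_closed[OF pw b]]
        by (simp only: model_simps)
    qed
    then have "F_killed ?Q i (f ?b)" by (rule d_nilpotent_F_killed_hom(2)[OF lD lQ f(1) b])
    ultimately show ?thesis by blast
  qed
  then show False using Q.d_nilpotent_F_killed_zero[OF _ _ fb] fb0 by blast
qed

text \<open>The vector is split at \<open>i\<close>, and the component of the wrong kind vanishes by
  \<open>GW_D_zero\<close>.\<close>

lemma GW_D_d_nilpotent_F_killed:
  fixes \<O> :: "('n::finite \<Rightarrow> 'k::field_char_0) set" and M :: "(('n, 'k) opr, 'm) module"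
  assumes M: "GW_D rep \<O> D M" and mdl: "is_model D (base rep \<O> D) \<rho>" and v: "v \<in> carrier M"
  shows "i \<in> D \<Longrightarrow> d_nilpotent M i v" "i \<notin> D \<Longrightarrow> F_killed M i v"
proof -
  have GW: "GW \<O> M" using M unfolding GW_D_def by blast
  then have lm: "left_module I_n M" unfolding GW_def by blast
  interpret In_module M by (rule In_module.intro[OF lm])
  obtain K where "\<And>t. t \<ge> K \<Longrightarrow> (proj_op i \<circ> (partial_x i ^^ t)) \<odot>\<^bsub>M\<^esub> v = \<zero>\<^bsub>M\<^esub>"
    using GW_eventually_proj_zero[OF GW v, of i] by blast
  then obtain a b where ab: "a \<in> carrier I_n" "b \<in> carrier I_n" "d_nilpotent M i (a \<odot>\<^bsub>M\<^esub> v)" "F_killed M i (b \<odot>\<^bsub>M\<^esub> v)"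
    "v = a \<odot>\<^bsub>M\<^esub> v \<oplus>\<^bsub>M\<^esub> b \<odot>\<^bsub>M\<^esub> v"
    by (rule d_nilpotent_F_killed_decomposition[OF v])
  have avb: "a \<odot>\<^bsub>M\<^esub> v \<in> carrier M" "b \<odot>\<^bsub>M\<^esub> v \<in> carrier M" using ab(1,2) v by simp_all
  show "d_nilpotent M i v" if "i \<in> D"
  proof -
    have "b \<odot>\<^bsub>M\<^esub> v = \<zero>\<^bsub>M\<^esub>" by (rule GW_D_zero[OF M mdl avb(2)]) (use that ab(4) in blast)
    then have "v = a \<odot>\<^bsub>M\<^esub> v" using ab(5) avb(1) by simp
    then show ?thesis using ab(3) by simp
  qed
  show "F_killed M i v" if "i \<notin> D"
  proof -
    have "a \<odot>\<^bsub>M\<^esub> v = \<zero>\<^bsub>M\<^esub>" by (rule GW_D_zero[OF M mdl avb(1)]) (use that ab(3) in blast)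
    then have "v = b \<odot>\<^bsub>M\<^esub> v" using ab(5) avb(2) by simp
    then show ?thesis using ab(4) by simp
  qed
qed

theorem theorem3p2:
  fixes \<O> :: "('n::finite \<Rightarrow> 'k::field_char_0) set"
    and rep :: "'k set \<Rightarrow> 'k"
  assumes "\<O> \<in> translation_orbits"
    and "\<And>i. rep (orbit_component \<O> i) \<in> orbit_component \<O> i"
    and "rep \<int> = 0"
  shows "direct_sum_of_subcategories I_n
           (GW \<O> :: (('n, 'k) opr, 'm) module \<Rightarrow> bool)
           (Pow (integral_indices \<O>))
           (\<lambda>\<D>. GW_D rep \<O> \<D>)"
  unfolding direct_sum_of_subcategories_def
proof (intro conjI ballI allI impI)
  fix D and M :: "(('n, 'k) opr, 'm) module" assume "GW_D rep \<O> D M"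
  then show "GW \<O> M" unfolding GW_D_def by blast
next
  fix M :: "(('n, 'k) opr, 'm) module" assume GW: "GW \<O> M"
  then have lm: "left_module I_n M" unfolding GW_def by blast
  interpret In_module M by (rule In_module.intro[OF lm])
  have "GW_D rep \<O> D (M\<lparr>carrier := part_sub M UNIV D\<rparr>)" for D
  proof -
    obtain \<rho> where "is_model D (base rep \<O> D) \<rho>" using model_exists[of D "base rep \<O> D"] by auto
    then show ?thesis by (rule GW_D_part_sub_carrier[OF assms(1,2) GW])
  qed
  moreover have "F_killed M i v" if "i \<notin> integral_indices \<O>" "v \<in> carrier M" for i v
    by (rule GW_F_killed_nonintegral[OF GW that(2)]) (rule orbit_nonintegral[OF assms(1) that(1)])
  then have "internal_direct_sum M (Pow (integral_indices \<O>)) (part_sub M UNIV)"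
    using GW_eventually_proj_zero[OF GW] by (intro part_sub_direct_sum)
  ultimately show "\<exists>N. (\<forall>D\<in>Pow (integral_indices \<O>). submodule (N D) I_n M \<and> GW_D rep \<O> D (M\<lparr>carrier := N D\<rparr>)) \<and>
      internal_direct_sum M (Pow (integral_indices \<O>)) N"
    using submodule_part_sub by blast
next
  fix D E and M N :: "(('n, 'k) opr, 'm) module" and f v
  assume "D \<noteq> E" and M: "GW_D rep \<O> D M" and N: "GW_D rep \<O> E N"
    and f: "f \<in> module_hom_set I_n M N" and v: "v \<in> carrier M"
  obtain \<rho> \<sigma> where mdl: "is_model D (base rep \<O> D) \<rho>" "is_model E (base rep \<O> E) \<sigma>"
    using model_exists[of D "base rep \<O> D"] model_exists[of E "base rep \<O> E"] by auto
  have lm: "left_module I_n M" "left_module I_n N" using M N unfolding GW_D_def GW_def by blast+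
  \<comment> \<open>At an index where \<open>D\<close> and \<open>E\<close> differ, the image
    \<open>f v\<close> inherits one of the two conditions from \<open>M\<close> and satisfies the
    opposite one as an element of \<open>N\<close>.\<close>
  obtain i where i: "(i \<in> D) \<noteq> (i \<in> E)" using \<open>D \<noteq> E\<close> by blast
  have fv: "f v \<in> carrier N" by (rule module_hom_setD(1)[OF f v])
  have "i \<in> D \<Longrightarrow> d_nilpotent N i (f v)" "i \<notin> D \<Longrightarrow> F_killed N i (f v)"
    using GW_D_d_nilpotent_F_killed[OF M mdl(1) v] d_nilpotent_F_killed_hom[OF lm f v] by blast+
  then show "f v = \<zero>\<^bsub>N\<^esub>"
    using GW_D_d_nilpotent_F_killed[OF N mdl(2) fv, of i] i In_module.d_nilpotent_F_killed_zero[OF In_module.intro[OF lm(2)] _ _ fv, of i] by blast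
qed

end
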